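(* Let $K$ be a field. For every even positive integer $n$ there is a simple graph $G$ such that $\mathrm{depth}(R/J_2(G))=4$ and $\mathrm{ara}(J_2(G))=\mathrm{pd}(R/J_2(G))=n$.
   Context: For a simple graph $G$ with (finite) vertex set $V(G)=\{1,\dots,N\}$ (the number $N$ of vertices need not equal $n$), $R=K[x_{ij}: i\in\{1,2\}, j\in V(G)]$ is the polynomial ring in $2N$ variables over the field $K$, and the binomial edge ideal $J_2(G)\subset R$ is the ideal generated by all $x_{1i}x_{2j}-x_{1j}x_{2i}$ with $\{i,j\}$ an edge of $G$, $i<j$. The arithmetical rank $\mathrm{ara}(I)$ of an ideal $I\subset R$ is the smallest integer $s$ for which there exist $f_1,\dots,f_s\in I$ with $\mathrm{rad}(I)=\mathrm{rad}(f_1,\dots,f_s)$; $\mathrm{pd}$ denotes projective dimension over $R$, and $\mathrm{depth}$ is taken with respect to the homogeneous maximal ideal of $R$. *)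

theory Defs
  imports
    "HOL-Algebra.QuotRing"
    "HOL-Algebra.Module"
    "HOL-Library.Poly_Mapping"
    "HOL-Library.Extended_Nat"
begin

section \<open>Polynomial rings\<close>

type_synonym ('x, 'k) mpoly = "('x \<Rightarrow>\<^sub>0 nat) \<Rightarrow>\<^sub>0 'k"

text \<open>The polynomial ring over \<open>'k\<close> in the variables \<open>X\<close>, for a subset \<open>X\<close> of the type of
  variables, so that the number of variables need not be determined by a type.\<close>

definition mpoly_ring :: "'x set \<Rightarrow> ('x, 'k::comm_ring_1) mpoly ring" where
  "mpoly_ring X =
     \<lparr>carrier = {p. \<forall>m \<in> Poly_Mapping.keys p. Poly_Mapping.keys m \<subseteq> X},
      mult = (*), one = 1, zero = 0, add = (+)\<rparr>"

definition mvar :: "'x \<Rightarrow> ('x, 'k::comm_ring_1) mpoly" where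
  "mvar v = Poly_Mapping.single (Poly_Mapping.single v 1) 1"

definition homogeneous_maximal_ideal :: "'x set \<Rightarrow> ('x, 'k::comm_ring_1) mpoly set" where
  "homogeneous_maximal_ideal X = Idl\<^bsub>mpoly_ring X\<^esub> (mvar ` X)"

lemma mpoly_ring_cring: "cring (mpoly_ring X :: ('x, 'k::comm_ring_1) mpoly ring)"
proof -
  have closed_mult: "p * q \<in> carrier (mpoly_ring X)"
    if "p \<in> carrier (mpoly_ring X)" "q \<in> carrier (mpoly_ring X)" for p q :: "('x, 'k) mpoly"
  proof -
    have "Poly_Mapping.keys m \<subseteq> X" if "m \<in> Poly_Mapping.keys (p * q)" for m
    proof -
      obtain a b where "m = a + b" "a \<in> Poly_Mapping.keys p" "b \<in> Poly_Mapping.keys q"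
        using \<open>m \<in> Poly_Mapping.keys (p * q)\<close> keys_mult[of p q] by blast
      moreover from this that(1) \<open>p \<in> _\<close> \<open>q \<in> _\<close>
      have "Poly_Mapping.keys a \<subseteq> X" "Poly_Mapping.keys b \<subseteq> X"
        by (simp_all add: mpoly_ring_def)
      ultimately show ?thesis
        using Poly_Mapping.keys_add[of a b] by blast
    qed
    then show ?thesis by (simp add: mpoly_ring_def)
  qed
  have closed_add: "p + q \<in> carrier (mpoly_ring X)"
    if "p \<in> carrier (mpoly_ring X)" "q \<in> carrier (mpoly_ring X)" for p q :: "('x, 'k) mpoly"
    using that Poly_Mapping.keys_add[of p q] by (auto simp: mpoly_ring_def)
  have neg: "\<exists>q \<in> carrier (mpoly_ring X). q + p = 0"
    if "p \<in> carrier (mpoly_ring X)" for p :: "('x, 'k) mpoly"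
  proof
    have "Poly_Mapping.keys (- p) = Poly_Mapping.keys p"
      by (auto simp: in_keys_iff)
    with that show "- p \<in> carrier (mpoly_ring X)" by (simp add: mpoly_ring_def)
  qed simp
  have sel: "mult (mpoly_ring X) = ((*) :: ('x, 'k) mpoly \<Rightarrow> _)"
    "add (mpoly_ring X) = ((+) :: ('x, 'k) mpoly \<Rightarrow> _)"
    "one (mpoly_ring X) = (1 :: ('x, 'k) mpoly)" "zero (mpoly_ring X) = (0 :: ('x, 'k) mpoly)"
    by (simp_all add: mpoly_ring_def)
  have closed_const: "(1 :: ('x, 'k) mpoly) \<in> carrier (mpoly_ring X)"
    "(0 :: ('x, 'k) mpoly) \<in> carrier (mpoly_ring X)"
    by (simp_all add: mpoly_ring_def)
  show ?thesis
  proof (rule cringI)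
    show "abelian_group (mpoly_ring X :: ('x, 'k) mpoly ring)"
      by (rule abelian_groupI; unfold sel)
        (erule (1) closed_add, rule closed_const, rule add.assoc, rule add.commute,
          rule add_0_left, erule neg)
    show "comm_monoid (mpoly_ring X :: ('x, 'k) mpoly ring)"
      by (rule comm_monoidI; unfold sel)
        (erule (1) closed_mult, rule closed_const, rule mult.assoc, rule mult_1_left,
          rule mult.commute)
  qed (unfold sel, rule distrib_right)
qed


section \<open>Modules\<close>

definition quotient_module :: "('a, 'b) ring_scheme \<Rightarrow> 'a set \<Rightarrow> ('a, 'a set) module" where
  "quotient_module R I =
     \<lparr>carrier = carrier (R Quot I), mult = mult (R Quot I), one = one (R Quot I),
      zero = zero (R Quot I), add = add (R Quot I),
      smult = (\<lambda>a C. (I +>\<^bsub>R\<^esub> a) \<otimes>\<^bsub>R Quot I\<^esub> C)\<rparr>"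

definition module_hom ::
    "('a, 'b) ring_scheme \<Rightarrow> ('a, 'm, 'c) module_scheme \<Rightarrow> ('a, 'n, 'd) module_scheme
      \<Rightarrow> ('m \<Rightarrow> 'n) set" where
  "module_hom R M N =
     {h \<in> carrier M \<rightarrow> carrier N.
        (\<forall>x \<in> carrier M. \<forall>y \<in> carrier M. h (x \<oplus>\<^bsub>M\<^esub> y) = h x \<oplus>\<^bsub>N\<^esub> h y) \<and>
        (\<forall>a \<in> carrier R. \<forall>x \<in> carrier M. h (a \<odot>\<^bsub>M\<^esub> x) = a \<odot>\<^bsub>N\<^esub> h x)}"

definition module_kernel ::
    "('a, 'm, 'c) module_scheme \<Rightarrow> ('a, 'n, 'd) module_scheme \<Rightarrow> ('m \<Rightarrow> 'n) \<Rightarrow> 'm set" where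
  "module_kernel M N h = {x \<in> carrier M. h x = \<zero>\<^bsub>N\<^esub>}"

lemma quotient_module_module:
  assumes "cring R" "ideal I R"
  shows "Module.module R (quotient_module R I)"
proof -
  interpret ideal I R by fact
  interpret cring R by fact
  interpret Q: ring "R Quot I" by (rule quotient_is_ring)
  interpret h: ring_hom_ring R "R Quot I" "(+>\<^bsub>R\<^esub>) I" by (rule rcos_ring_hom_ring)
  have ag: "abelian_group (quotient_module R I)"
  proof (rule abelian_groupI)
    fix x assume "x \<in> carrier (quotient_module R I)"
    then have "x \<in> carrier (R Quot I)" by (simp add: quotient_module_def)
    then have "\<ominus>\<^bsub>R Quot I\<^esub> x \<in> carrier (R Quot I)"
      "\<ominus>\<^bsub>R Quot I\<^esub> x \<oplus>\<^bsub>R Quot I\<^esub> x = \<zero>\<^bsub>R Quot I\<^esub>"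
      by (fact Q.a_inv_closed, fact Q.l_neg)
    then show "\<exists>y \<in> carrier (quotient_module R I).
        y \<oplus>\<^bsub>quotient_module R I\<^esub> x = \<zero>\<^bsub>quotient_module R I\<^esub>"
      unfolding quotient_module_def by auto
  qed (unfold quotient_module_def module.simps ring.simps monoid.simps partial_object.simps,
       fact Q.a_closed, fact Q.zero_closed, fact Q.a_assoc, fact Q.a_comm, fact Q.l_zero)
  show ?thesis
  proof (rule Module.moduleI[OF assms(1) ag])
  qed (simp_all add: quotient_module_def Q.l_distr Q.r_distr Q.m_assoc)
qed


section \<open>Depth\<close>

text \<open>The submodule \<open>S M\<close> generated by all \<open>a x\<close> with \<open>a \<in> S\<close> and \<open>x \<in> M\<close>.\<close>

definition set_smult :: "('a, 'b) ring_scheme \<Rightarrow> 'a set \<Rightarrow> ('a, 'm, 'c) module_scheme \<Rightarrow> 'm set" where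
  "set_smult R S M =
     \<Inter> {H. submodule H R M \<and> (\<forall>a \<in> S. \<forall>x \<in> carrier M. a \<odot>\<^bsub>M\<^esub> x \<in> H)}"

text \<open>For each \<open>i\<close>, the entry \<open>fs ! i\<close> is a non-zero-divisor on the quotient of \<open>M\<close> by the
  submodule generated by the preceding entries, and \<open>M / (fs) M\<close> is nonzero.\<close>

definition regular_sequence ::
    "('a, 'b) ring_scheme \<Rightarrow> ('a, 'm, 'c) module_scheme \<Rightarrow> 'a list \<Rightarrow> bool" where
  "regular_sequence R M fs \<longleftrightarrow>
     set fs \<subseteq> carrier R \<and>
     (\<forall>i < length fs. \<forall>x \<in> carrier M.
        (fs ! i) \<odot>\<^bsub>M\<^esub> x \<in> set_smult R (set (take i fs)) M
          \<longrightarrow> x \<in> set_smult R (set (take i fs)) M) \<and>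
     set_smult R (set fs) M \<noteq> carrier M"

text \<open>The depth of \<open>M\<close> with respect to the ideal \<open>I\<close>, with the usual convention that it is
  infinite if \<open>I M = M\<close>.\<close>

definition depth ::
    "('a, 'b) ring_scheme \<Rightarrow> 'a set \<Rightarrow> ('a, 'm, 'c) module_scheme \<Rightarrow> enat" where
  "depth R I M =
     (if set_smult R I M = carrier M then \<infinity>
      else SUP fs \<in> {fs. set fs \<subseteq> I \<and> regular_sequence R M fs}. enat (length fs))"


section \<open>Projective dimension\<close>

text \<open>The lifting property. A definition cannot quantify over all types, but testing against
  modules \<open>N\<close> over \<open>'p\<close> and \<open>M\<close> over \<open>'p \<Rightarrow> 'a\<close> is no restriction: the latter type accommodates
  the free module on the set \<open>carrier P\<close> (as finitely supported functions), and lifting the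
  identity of \<open>P\<close> along its canonical surjection onto \<open>P\<close> makes \<open>P\<close> a direct summand of it.\<close>

definition projective_module ::
    "('a, 'b) ring_scheme \<Rightarrow> ('a, 'p) module \<Rightarrow> bool" where
  "projective_module R P \<longleftrightarrow>
     Module.module R P \<and>
     (\<forall>(M :: ('a, 'p \<Rightarrow> 'a) module) (N :: ('a, 'p) module) g f.
        Module.module R M \<and> Module.module R N \<and>
        g \<in> module_hom R M N \<and> g ` carrier M = carrier N \<and> f \<in> module_hom R P N
        \<longrightarrow> (\<exists>h \<in> module_hom R P M. \<forall>x \<in> carrier P. g (h x) = f x))"

text \<open>Exactness of \<open>\<dots> \<rightarrow> P 2 \<rightarrow> P 1 \<rightarrow> P 0 \<rightarrow> M \<rightarrow> 0\<close>, where \<open>d i\<close> maps \<open>P (i + 1)\<close> to \<open>P i\<close>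
  and \<open>e\<close> is the augmentation.\<close>

definition projective_resolution ::
    "('a, 'b) ring_scheme \<Rightarrow> ('a, 'm, 'c) module_scheme
      \<Rightarrow> (nat \<Rightarrow> ('a, 'p) module) \<Rightarrow> (nat \<Rightarrow> 'p \<Rightarrow> 'p) \<Rightarrow> ('p \<Rightarrow> 'm) \<Rightarrow> bool" where
  "projective_resolution R M P d e \<longleftrightarrow>
     (\<forall>i. projective_module R (P i)) \<and>
     (\<forall>i. d i \<in> module_hom R (P (Suc i)) (P i)) \<and>
     e \<in> module_hom R (P 0) M \<and>
     e ` carrier (P 0) = carrier M \<and>
     d 0 ` carrier (P 1) = module_kernel (P 0) M e \<and>
     (\<forall>i. d (Suc i) ` carrier (P (Suc (Suc i))) = module_kernel (P (Suc i)) (P i) (d i))"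

text \<open>The terms of the resolutions have elements of type \<open>'m \<times> 'a \<times> nat \<Rightarrow> 'a\<close>. This is no
  restriction: \<open>'m \<times> 'a \<times> nat\<close> is infinite and at least as large as \<open>M\<close> and \<open>R\<close>, so free modules
  on (subsets of) it, being sets of finitely supported functions, suffice to build a free
  resolution of \<open>M\<close>, and the syzygies of that resolution are submodules of them. Hence a shortest
  projective resolution can be found among these modules.\<close>

definition projective_dimension ::
    "('a, 'b) ring_scheme \<Rightarrow> ('a, 'm, 'c) module_scheme \<Rightarrow> enat" where
  "projective_dimension R M =
     (INF n \<in> {n. \<exists>(P :: nat \<Rightarrow> ('a, 'm \<times> 'a \<times> nat \<Rightarrow> 'a) module) d e.
                 projective_resolution R M P d e \<and> (\<forall>i > n. carrier (P i) = {\<zero>\<^bsub>P i\<^esub>})}. enat n)"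


section \<open>Arithmetical rank\<close>

definition radical :: "('a, 'b) ring_scheme \<Rightarrow> 'a set \<Rightarrow> 'a set" where
  "radical R I = {a \<in> carrier R. \<exists>k::nat. a [^]\<^bsub>R\<^esub> k \<in> I}"

definition arithmetical_rank :: "('a, 'b) ring_scheme \<Rightarrow> 'a set \<Rightarrow> enat" where
  "arithmetical_rank R I =
     (INF fs \<in> {fs. set fs \<subseteq> I \<and> radical R I = radical R (Idl\<^bsub>R\<^esub> (set fs))}. enat (length fs))"


section \<open>Binomial edge ideals\<close>

text \<open>Simple graphs with vertex set \<open>{1..N}\<close>, given by their set of edges.\<close>

definition simple_graph :: "nat \<Rightarrow> nat set set \<Rightarrow> bool" where
  "simple_graph N E \<longleftrightarrow> E \<subseteq> {{i, j} | i j. i \<in> {1..N} \<and> j \<in> {1..N} \<and> i \<noteq> j}"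

text \<open>The pair \<open>(i, j)\<close> is the index of the variable \<open>x\<^sub>i\<^sub>j\<close>.\<close>

definition edge_vars :: "nat \<Rightarrow> (nat \<times> nat) set" where
  "edge_vars N = {1, 2} \<times> {1..N}"

definition binomial_edge_ideal :: "nat \<Rightarrow> nat set set \<Rightarrow> (nat \<times> nat, 'k::comm_ring_1) mpoly set" where
  "binomial_edge_ideal N E =
     Idl\<^bsub>mpoly_ring (edge_vars N)\<^esub>
       {mvar (1, i) * mvar (2, j) - mvar (1, j) * mvar (2, i) | i j. {i, j} \<in> E \<and> i < j}"

end

theory Submission
  imports Defs "HOL-Library.Nat_Bijection" "HOL-Library.FuncSet"
begin

text \<open>Let \<open>G\<close> be the complete graph on \<open>N = n / 2 + 2\<close> vertices without the edge \<open>{1, N}\<close>, and let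
  \<open>\<Delta>\<close> be the minor of the missing edge. The set \<open>W\<close> of the \<open>2 N - 4 = n\<close> variables in the columns
  \<open>2, \<dots>, N - 1\<close> annihilates \<open>\<Delta>\<close> modulo \<open>J\<close>. Hence the last term of the Koszul complex on \<open>W\<close> forces
  the projective dimension of \<open>R / J\<close> to be at least \<open>n\<close>. Also \<open>\<Delta> R\<close> modulo \<open>J\<close> is \<open>R / (W)\<close>, of dimension \<open>4\<close>,
  and five algebraically dependent elements cannot be a regular sequence on a module containing it,
  so the depth is at most \<open>4\<close>. Conversely, after a linear change of coordinates \<open>R / J\<close> is free over
  a polynomial ring in four variables: \<open>R / (J, \<Delta>)\<close> is the coordinate ring of the matrices of rank at
  most one, with the basis of monomials of degree at most one in the entries \<open>z\<^sub>2, \<dots>, z\<^sub>N\<close> of the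
  first row, and \<open>\<Delta>\<close> itself is the one additional basis element. This gives depth \<open>4\<close>, and a
  relative Koszul resolution of length \<open>2 N - 4\<close>. The arithmetical rank is at most \<open>2 N - 4\<close> since the
  sums of the minors \<open>[k, l]\<close> with \<open>k + l\<close> fixed generate \<open>J\<close> up to radical; it is at least
  \<open>2 N - 4\<close> since specialising \<open>\<Delta>\<close> to \<open>1\<close> turns generators up to radical into generators of an ideal
  that is primary to the maximal ideal of \<open>K[W]\<close>.\<close>

section \<open>Free modules and projective modules\<close>

text \<open>The bound 2 N - 4 always comes from \<open>W\<close>: it is the length of the Koszul
  complex on \<open>W\<close>, the number of the 2 N variables left over by four parameters, and the
  number of variables of K[W]. The ends of 0 -> R/(W) -> R/J -> R/(J, \<Delta>) -> 0 have dimensions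
  4 and N + 1, so one choice of four parameters has to serve both. It is z_1, t_1 - z_2, t_(N-1) -
  z_N, t_N, where z and t are the two rows. Modulo \<open>W\<close> these become z_1, t_1, - z_N,
  t_N, so R/(W) is free of rank one over them. At the other end they belong to the system z_1, t_i -
  z_(i+1) (i < N), t_N of N + 1 parameters, over which 1, z_2, ..., z_N is a basis; its N elements
  match the degree N of the variety of rank-one matrices. The other N - 3 parameters contribute all
  their monomials, so the basis of R/J over the four is infinite once N > 3. Infinite rank does not
  lengthen the resolution: each of the 2 N - 4 remaining variables acts on the basis by a matrix
  over the parameter ring, and the Koszul complex on the operators "variable minus its matrix"
  resolves R/J.\<close>

definition free_module :: "('a, 'b) ring_scheme \<Rightarrow> 'i set \<Rightarrow> ('a, 'i \<Rightarrow> 'a) module" where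
  "free_module R I =
     \<lparr>carrier = {f. (\<forall>i. f i \<in> carrier R) \<and> {i. f i \<noteq> \<zero>\<^bsub>R\<^esub>} \<subseteq> I \<and> finite {i. f i \<noteq> \<zero>\<^bsub>R\<^esub>}},
      mult = (\<lambda>f g. f), one = (\<lambda>i. \<zero>\<^bsub>R\<^esub>), zero = (\<lambda>i. \<zero>\<^bsub>R\<^esub>),
      add = (\<lambda>f g i. f i \<oplus>\<^bsub>R\<^esub> g i), smult = (\<lambda>a f i. a \<otimes>\<^bsub>R\<^esub> f i)\<rparr>"

definition unit_vector :: "('a, 'b) ring_scheme \<Rightarrow> 'i \<Rightarrow> 'i \<Rightarrow> 'a" where
  "unit_vector R i = (\<lambda>j. if j = i then \<one>\<^bsub>R\<^esub> else \<zero>\<^bsub>R\<^esub>)"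

definition linear_comb ::
    "('a, 'b) ring_scheme \<Rightarrow> ('a, 'n, 'd) module_scheme \<Rightarrow> ('i \<Rightarrow> 'n) \<Rightarrow> ('i \<Rightarrow> 'a) \<Rightarrow> 'n" where
  "linear_comb R N v f = finsum N (\<lambda>i. f i \<odot>\<^bsub>N\<^esub> v i) {i. f i \<noteq> \<zero>\<^bsub>R\<^esub>}"

lemma free_module_sel [simp]:
  "f \<in> carrier (free_module R I) \<longleftrightarrow>
     (\<forall>i. f i \<in> carrier R) \<and> {i. f i \<noteq> \<zero>\<^bsub>R\<^esub>} \<subseteq> I \<and> finite {i. f i \<noteq> \<zero>\<^bsub>R\<^esub>}"
  "zero (free_module R I) = (\<lambda>i. \<zero>\<^bsub>R\<^esub>)"
  "add (free_module R I) = (\<lambda>f g i. f i \<oplus>\<^bsub>R\<^esub> g i)"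
  "smult (free_module R I) = (\<lambda>a f i. a \<otimes>\<^bsub>R\<^esub> f i)"
  by (simp_all add: free_module_def)

lemma
  assumes "h \<in> module_hom R M N"
  shows module_hom_closed: "x \<in> carrier M \<Longrightarrow> h x \<in> carrier N"
    and module_hom_add: "x \<in> carrier M \<Longrightarrow> y \<in> carrier M \<Longrightarrow> h (x \<oplus>\<^bsub>M\<^esub> y) = h x \<oplus>\<^bsub>N\<^esub> h y"
    and module_hom_smult: "a \<in> carrier R \<Longrightarrow> x \<in> carrier M \<Longrightarrow> h (a \<odot>\<^bsub>M\<^esub> x) = a \<odot>\<^bsub>N\<^esub> h x"
  using assms unfolding module_hom_def by auto

lemma module_homI:
  assumes "\<And>x. x \<in> carrier M \<Longrightarrow> h x \<in> carrier N"
    and "\<And>x y. x \<in> carrier M \<Longrightarrow> y \<in> carrier M \<Longrightarrow> h (x \<oplus>\<^bsub>M\<^esub> y) = h x \<oplus>\<^bsub>N\<^esub> h y"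
    and "\<And>a x. a \<in> carrier R \<Longrightarrow> x \<in> carrier M \<Longrightarrow> h (a \<odot>\<^bsub>M\<^esub> x) = a \<odot>\<^bsub>N\<^esub> h x"
  shows "h \<in> module_hom R M N"
  using assms unfolding module_hom_def by auto

context cring
begin

lemma free_module_add_closed:
  assumes "f \<in> carrier (free_module R I)" "g \<in> carrier (free_module R I)"
  shows "(\<lambda>i. f i \<oplus> g i) \<in> carrier (free_module R I)"
proof -
  have "{i. f i \<oplus> g i \<noteq> \<zero>} \<subseteq> {i. f i \<noteq> \<zero>} \<union> {i. g i \<noteq> \<zero>}"
    using assms by auto
  with assms show ?thesis
    by (auto intro: finite_subset)
qed

lemma free_module_smult_closed:
  assumes "a \<in> carrier R" "f \<in> carrier (free_module R I)"
  shows "(\<lambda>i. a \<otimes> f i) \<in> carrier (free_module R I)"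
proof -
  have "{i. a \<otimes> f i \<noteq> \<zero>} \<subseteq> {i. f i \<noteq> \<zero>}"
    using assms by auto
  with assms show ?thesis
    by (auto intro: finite_subset)
qed

lemma free_module_module: "Module.module R (free_module R I)"
proof (rule Module.moduleI)
  show "abelian_group (free_module R I)"
  proof (rule abelian_groupI)
    fix f g assume "f \<in> carrier (free_module R I)" "g \<in> carrier (free_module R I)"
    from free_module_add_closed[OF this]
    show "f \<oplus>\<^bsub>free_module R I\<^esub> g \<in> carrier (free_module R I)" by simp
  next
    fix f assume f: "f \<in> carrier (free_module R I)"
    have "(\<lambda>i. (\<ominus> \<one>) \<otimes> f i) \<in> carrier (free_module R I)"
      by (rule free_module_smult_closed[OF _ f]) simp
    moreover have "(\<lambda>i. ((\<ominus> \<one>) \<otimes> f i) \<oplus> f i) = (\<lambda>i. \<zero>)"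
      using f by (auto simp: l_minus l_neg)
    ultimately show "\<exists>g\<in>carrier (free_module R I). g \<oplus>\<^bsub>free_module R I\<^esub> f = \<zero>\<^bsub>free_module R I\<^esub>"
      by (intro bexI[of _ "\<lambda>i. (\<ominus> \<one>) \<otimes> f i"]) simp_all
  qed (auto simp: a_ac)
next
  fix a f assume "a \<in> carrier R" "f \<in> carrier (free_module R I)"
  from free_module_smult_closed[OF this]
  show "a \<odot>\<^bsub>free_module R I\<^esub> f \<in> carrier (free_module R I)" by simp
qed (auto simp: l_distr r_distr m_assoc intro: is_cring)

lemma unit_vector_closed: "i \<in> I \<Longrightarrow> unit_vector R i \<in> carrier (free_module R I)"
proof -
  assume "i \<in> I"
  moreover have "{j. unit_vector R i j \<noteq> \<zero>} \<subseteq> {i}" by (auto simp: unit_vector_def)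
  ultimately show ?thesis
    by (auto simp: unit_vector_def intro: finite_subset)
qed

lemma free_module_induct [consumes 1, case_names zero add]:
  assumes f: "f \<in> carrier (free_module R I)"
  assumes zero: "Q (\<lambda>i. \<zero>)"
  assumes add: "\<And>a i g. a \<in> carrier R \<Longrightarrow> i \<in> I \<Longrightarrow> g \<in> carrier (free_module R I) \<Longrightarrow> Q g \<Longrightarrow>
     Q (\<lambda>j. a \<otimes> unit_vector R i j \<oplus> g j)"
  shows "Q f"
proof -
  have "finite U \<Longrightarrow> (\<And>f. f \<in> carrier (free_module R I) \<Longrightarrow> {i. f i \<noteq> \<zero>} \<subseteq> U \<Longrightarrow> Q f)" for U
  proof (induction U rule: finite_induct)
    case empty
    then have "f = (\<lambda>i. \<zero>)" by auto
    with zero show ?case by simp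
  next
    case (insert i U)
    show ?case
    proof (cases "f i = \<zero>")
      case True
      with insert show ?thesis by blast
    next
      case False
      with insert have i: "i \<in> I" by auto
      define g where "g = (\<lambda>j. if j = i then \<zero> else f j)"
      have s: "{i. g i \<noteq> \<zero>} \<subseteq> {i. f i \<noteq> \<zero>}" by (auto simp: g_def)
      have g: "g \<in> carrier (free_module R I)"
        using insert.prems s by (auto intro: finite_subset simp: g_def)
      have "Q g" by (rule insert.IH[OF g]) (use insert.prems in \<open>auto simp: g_def\<close>)
      then have "Q (\<lambda>j. f i \<otimes> unit_vector R i j \<oplus> g j)"
        using insert.prems i g by (intro add) auto
      moreover have "(\<lambda>j. f i \<otimes> unit_vector R i j \<oplus> g j) = f"
        using insert.prems by (auto simp: g_def unit_vector_def)
      ultimately show ?thesis by simp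
    qed
  qed
  from this[of "{i. f i \<noteq> \<zero>}"] f show ?thesis by auto
qed

lemma module_hom_zero:
  assumes M: "Module.module R M" and N: "Module.module R N" and h: "h \<in> module_hom R M N"
  shows "h \<zero>\<^bsub>M\<^esub> = \<zero>\<^bsub>N\<^esub>"
proof -
  interpret M: Module.module R M by fact
  interpret N: Module.module R N by fact
  have "h (\<zero> \<odot>\<^bsub>M\<^esub> \<zero>\<^bsub>M\<^esub>) = \<zero> \<odot>\<^bsub>N\<^esub> h \<zero>\<^bsub>M\<^esub>"
    by (rule module_hom_smult[OF h]) simp_all
  moreover have "h \<zero>\<^bsub>M\<^esub> \<in> carrier N" by (rule module_hom_closed[OF h]) simp
  ultimately show ?thesis by simp
qed

lemma free_module_hom_ext:
  assumes N: "Module.module R N"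
    and h: "h \<in> module_hom R (free_module R I) N" and h': "h' \<in> module_hom R (free_module R I) N"
    and eq: "\<And>i. i \<in> I \<Longrightarrow> h (unit_vector R i) = h' (unit_vector R i)"
    and f: "f \<in> carrier (free_module R I)"
  shows "h f = h' f"
  using f
proof (induction f rule: free_module_induct)
  case zero
  show ?case
    using module_hom_zero[OF free_module_module N h] module_hom_zero[OF free_module_module N h']
    by simp
next
  case (add a i g)
  have sm: "a \<odot>\<^bsub>free_module R I\<^esub> unit_vector R i \<in> carrier (free_module R I)"
    using free_module_smult_closed[OF add.hyps(1) unit_vector_closed[OF add.hyps(2)]] by simp
  have *: "k (\<lambda>j. a \<otimes> unit_vector R i j \<oplus> g j) = a \<odot>\<^bsub>N\<^esub> k (unit_vector R i) \<oplus>\<^bsub>N\<^esub> k g"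
    if "k \<in> module_hom R (free_module R I) N" for k
  proof -
    have "k ((a \<odot>\<^bsub>free_module R I\<^esub> unit_vector R i) \<oplus>\<^bsub>free_module R I\<^esub> g)
        = k (a \<odot>\<^bsub>free_module R I\<^esub> unit_vector R i) \<oplus>\<^bsub>N\<^esub> k g"
      using that sm add.hyps(3) unfolding module_hom_def by blast
    also have "k (a \<odot>\<^bsub>free_module R I\<^esub> unit_vector R i) = a \<odot>\<^bsub>N\<^esub> k (unit_vector R i)"
      using that add.hyps(1) unit_vector_closed[OF add.hyps(2)] unfolding module_hom_def by blast
    finally show ?thesis by simp
  qed
  show ?case by (simp add: *[OF h] *[OF h'] eq add)
qed

lemma linear_comb_eq:
  assumes N: "Module.module R N" and v: "\<And>i. i \<in> I \<Longrightarrow> v i \<in> carrier N"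
    and f: "f \<in> carrier (free_module R I)" and U: "finite U" "{i. f i \<noteq> \<zero>} \<subseteq> U" "U \<subseteq> I"
  shows "linear_comb R N v f = finsum N (\<lambda>i. f i \<odot>\<^bsub>N\<^esub> v i) U"
proof -
  interpret N: Module.module R N by fact
  show ?thesis unfolding linear_comb_def
  proof (rule N.add.finprod_mono_neutral_cong_left)
    show "(\<lambda>i. f i \<odot>\<^bsub>N\<^esub> v i) \<in> U \<rightarrow> carrier N"
      using f v U by auto
  next
    fix i assume "i \<in> U - {i. f i \<noteq> \<zero>}"
    then have "f i = \<zero>" "v i \<in> carrier N" using U v by auto
    then show "f i \<odot>\<^bsub>N\<^esub> v i = \<zero>\<^bsub>N\<^esub>" by simp
  qed (use U in auto)
qed

lemma linear_comb_hom:
  assumes N: "Module.module R N" and v: "\<And>i. i \<in> I \<Longrightarrow> v i \<in> carrier N"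
  shows "linear_comb R N v \<in> module_hom R (free_module R I) N"
proof -
  interpret N: Module.module R N by fact
  have cl: "(\<lambda>i. f i \<odot>\<^bsub>N\<^esub> v i) \<in> U \<rightarrow> carrier N"
    if "f \<in> carrier (free_module R I)" "U \<subseteq> I" for f U
    using that v by auto
  have "linear_comb R N v f \<in> carrier N" if f: "f \<in> carrier (free_module R I)" for f
    unfolding linear_comb_def by (rule N.finsum_closed) (rule cl[OF f], use f in simp)
  moreover have "linear_comb R N v (\<lambda>i. f i \<oplus> g i) = linear_comb R N v f \<oplus>\<^bsub>N\<^esub> linear_comb R N v g"
    if f: "f \<in> carrier (free_module R I)" and g: "g \<in> carrier (free_module R I)" for f g
  proof -
    define U where "U = {i. f i \<noteq> \<zero>} \<union> {i. g i \<noteq> \<zero>}"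
    have U: "finite U" "U \<subseteq> I" "{i. f i \<noteq> \<zero>} \<subseteq> U" "{i. g i \<noteq> \<zero>} \<subseteq> U"
      "{i. f i \<oplus> g i \<noteq> \<zero>} \<subseteq> U"
      using f g by (auto simp: U_def)
    have "linear_comb R N v (\<lambda>i. f i \<oplus> g i) = finsum N (\<lambda>i. (f i \<oplus> g i) \<odot>\<^bsub>N\<^esub> v i) U"
      using U by (intro linear_comb_eq[OF N v free_module_add_closed[OF f g]]) auto
    also have "\<dots> = finsum N (\<lambda>i. f i \<odot>\<^bsub>N\<^esub> v i \<oplus>\<^bsub>N\<^esub> g i \<odot>\<^bsub>N\<^esub> v i) U"
      using f g v U(2) by (intro N.finsum_cong') (auto simp: N.smult_l_distr subset_eq)
    also have "\<dots> = finsum N (\<lambda>i. f i \<odot>\<^bsub>N\<^esub> v i) U \<oplus>\<^bsub>N\<^esub> finsum N (\<lambda>i. g i \<odot>\<^bsub>N\<^esub> v i) U"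
      by (rule N.finsum_addf) (use cl f g U in blast)+
    also have "\<dots> = linear_comb R N v f \<oplus>\<^bsub>N\<^esub> linear_comb R N v g"
      using linear_comb_eq[OF N v f, where U = U] linear_comb_eq[OF N v g, where U = U] U by simp
    finally show ?thesis .
  qed
  moreover have "linear_comb R N v (\<lambda>i. a \<otimes> f i) = a \<odot>\<^bsub>N\<^esub> linear_comb R N v f"
    if a: "a \<in> carrier R" and f: "f \<in> carrier (free_module R I)" for a f
  proof -
    define U where "U = {i. f i \<noteq> \<zero>}"
    have U: "finite U" "U \<subseteq> I" "{i. f i \<noteq> \<zero>} \<subseteq> U" "{i. a \<otimes> f i \<noteq> \<zero>} \<subseteq> U"
      using f a by (auto simp: U_def)
    have "linear_comb R N v (\<lambda>i. a \<otimes> f i) = finsum N (\<lambda>i. (a \<otimes> f i) \<odot>\<^bsub>N\<^esub> v i) U"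
      using U by (intro linear_comb_eq[OF N v free_module_smult_closed[OF a f]]) auto
    also have "\<dots> = finsum N (\<lambda>i. a \<odot>\<^bsub>N\<^esub> (f i \<odot>\<^bsub>N\<^esub> v i)) U"
      using f a v U(2) by (intro N.finsum_cong') (auto simp: N.smult_assoc1 subset_eq)
    also have "\<dots> = a \<odot>\<^bsub>N\<^esub> finsum N (\<lambda>i. f i \<odot>\<^bsub>N\<^esub> v i) U"
      by (rule N.finsum_smult_ldistr[symmetric]) (use cl f a U in blast)+
    also have "\<dots> = a \<odot>\<^bsub>N\<^esub> linear_comb R N v f"
      using linear_comb_eq[OF N v f, where U = U] U by simp
    finally show ?thesis .
  qed
  ultimately show ?thesis
    unfolding module_hom_def by simp
qed

lemma linear_comb_unit_vector:
  assumes N: "Module.module R N" and v: "\<And>i. i \<in> I \<Longrightarrow> v i \<in> carrier N" and i: "i \<in> I"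
  shows "linear_comb R N v (unit_vector R i) = v i"
proof -
  interpret N: Module.module R N by fact
  have "linear_comb R N v (unit_vector R i) = finsum N (\<lambda>j. unit_vector R i j \<odot>\<^bsub>N\<^esub> v j) {i}"
    by (rule linear_comb_eq[OF N v unit_vector_closed[OF i]])
       (use i in \<open>auto simp: unit_vector_def\<close>)
  also have "\<dots> = v i"
    using v[OF i] by (simp add: unit_vector_def)
  finally show ?thesis .
qed

lemma module_hom_compose:
  "h \<in> module_hom R M N \<Longrightarrow> g \<in> module_hom R N L \<Longrightarrow> (\<lambda>x. g (h x)) \<in> module_hom R M L"
  by (rule module_homI) (simp_all add: module_hom_closed module_hom_add module_hom_smult)

lemma free_module_projective: "projective_module R (free_module R I)"
  unfolding projective_module_def
proof (intro conjI allI impI free_module_module)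
  fix M :: "('a, ('i \<Rightarrow> 'a) \<Rightarrow> 'a) module" and N :: "('a, 'i \<Rightarrow> 'a) module" and g f
  assume *: "Module.module R M \<and> Module.module R N \<and> g \<in> module_hom R M N \<and>
    g ` carrier M = carrier N \<and> f \<in> module_hom R (free_module R I) N"
  then have M: "Module.module R M" and N: "Module.module R N" and g: "g \<in> module_hom R M N"
    and f: "f \<in> module_hom R (free_module R I) N" by auto
  have "\<exists>m. m \<in> carrier M \<and> g m = f (unit_vector R i)" if "i \<in> I" for i
  proof -
    have "f (unit_vector R i) \<in> carrier N"
      using f unit_vector_closed[OF that] by (auto simp: module_hom_def)
    with * show ?thesis by (metis imageE)
  qed
  then obtain v where v: "\<And>i. i \<in> I \<Longrightarrow> v i \<in> carrier M" "\<And>i. i \<in> I \<Longrightarrow> g (v i) = f (unit_vector R i)"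
    by metis
  let ?h = "linear_comb R M v"
  have h: "?h \<in> module_hom R (free_module R I) M" by (rule linear_comb_hom[OF M v(1)])
  moreover have "g (?h x) = f x" if "x \<in> carrier (free_module R I)" for x
    by (rule free_module_hom_ext[OF N module_hom_compose[OF h g] f _ that])
       (simp add: linear_comb_unit_vector[OF M v(1)] v(2))
  ultimately show "\<exists>h\<in>module_hom R (free_module R I) M. \<forall>x\<in>carrier (free_module R I). g (h x) = f x"
    by blast
qed

text \<open>Lifts the identity of \<open>P\<close> along the surjection that sends each basis vector
  to the element indexing it. The retraction reduces divisibility questions in \<open>P\<close> to
  the coordinates of a free module.\<close>

lemma projective_retract_of_free:
  fixes P :: "('a, 'p) module"
  assumes P: "projective_module R P"
  obtains h g where "h \<in> module_hom R P (free_module R (carrier P))"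
    "g \<in> module_hom R (free_module R (carrier P)) P" "\<forall>x\<in>carrier P. g (h x) = x"
proof -
  let ?F = "free_module R (carrier P)"
  let ?g = "linear_comb R P (\<lambda>x. x)"
  have M: "Module.module R P" using P by (simp add: projective_module_def)
  have g: "?g \<in> module_hom R ?F P" by (rule linear_comb_hom[OF M]) simp
  have "?g ` carrier ?F = carrier P"
  proof
    show "?g ` carrier ?F \<subseteq> carrier P" using g by (auto simp: module_hom_def)
    show "carrier P \<subseteq> ?g ` carrier ?F"
    proof
      fix x assume x: "x \<in> carrier P"
      then have "?g (unit_vector R x) = x"
        by (intro linear_comb_unit_vector[OF M]) auto
      with unit_vector_closed[OF x] show "x \<in> ?g ` carrier ?F" by (metis imageI)
    qed
  qed
  moreover have "(\<lambda>x. x) \<in> module_hom R P P" by (auto simp: module_hom_def)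
  ultimately obtain h where "h \<in> module_hom R P ?F" "\<forall>x\<in>carrier P. ?g (h x) = x"
    using P M g free_module_module unfolding projective_module_def by meson
  with g that show ?thesis by blast
qed

end

section \<open>Resolutions and weakly regular sequences\<close>

text \<open>The submodule (w_0, ..., w_(r-1)) M, built by adjoining one generator at a time because
  every later induction peels off the last one.\<close>

primrec span_upto :: "('a, 'm, 'c) module_scheme \<Rightarrow> (nat \<Rightarrow> 'a) \<Rightarrow> nat \<Rightarrow> 'm set" where
  "span_upto M w 0 = {\<zero>\<^bsub>M\<^esub>}"
| "span_upto M w (Suc r) = {p \<oplus>\<^bsub>M\<^esub> w r \<odot>\<^bsub>M\<^esub> q | p q. p \<in> span_upto M w r \<and> q \<in> carrier M}"

primrec ideal_upto :: "('a, 'b) ring_scheme \<Rightarrow> (nat \<Rightarrow> 'a) \<Rightarrow> nat \<Rightarrow> 'a set" where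
  "ideal_upto R w 0 = {\<zero>\<^bsub>R\<^esub>}"
| "ideal_upto R w (Suc r) = {p \<oplus>\<^bsub>R\<^esub> w r \<otimes>\<^bsub>R\<^esub> q | p q. p \<in> ideal_upto R w r \<and> q \<in> carrier R}"

context Module.module
begin

lemma span_upto_closed:
  assumes "\<And>i. i < r \<Longrightarrow> w i \<in> carrier R"
  shows "span_upto M w r \<subseteq> carrier M"
  using assms
proof (induction r)
  case (Suc r)
  then have "span_upto M w r \<subseteq> carrier M" "w r \<in> carrier R" by auto
  then show ?case by auto
qed auto

lemma span_upto_zero:
  assumes "\<And>i. i < r \<Longrightarrow> w i \<in> carrier R"
  shows "\<zero>\<^bsub>M\<^esub> \<in> span_upto M w r"
  using assms
proof (induction r)
  case (Suc r)
  then have "\<zero>\<^bsub>M\<^esub> \<in> span_upto M w r" "w r \<in> carrier R" by auto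
  moreover from this have "\<zero>\<^bsub>M\<^esub> = \<zero>\<^bsub>M\<^esub> \<oplus>\<^bsub>M\<^esub> w r \<odot>\<^bsub>M\<^esub> \<zero>\<^bsub>M\<^esub>" by simp
  ultimately show ?case
    unfolding span_upto.simps using M.zero_closed by blast
qed auto

lemma span_upto_Suc_I1:
  assumes "\<And>i. i < Suc r \<Longrightarrow> w i \<in> carrier R" "x \<in> span_upto M w r"
  shows "x \<in> span_upto M w (Suc r)"
proof -
  have "w r \<in> carrier R" "x \<in> carrier M"
    using assms span_upto_closed[of r w] by (auto simp: subset_eq)
  then have "x = x \<oplus>\<^bsub>M\<^esub> w r \<odot>\<^bsub>M\<^esub> \<zero>\<^bsub>M\<^esub>" by simp
  with assms(2) show ?thesis
    unfolding span_upto.simps using M.zero_closed by blast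
qed

lemma span_upto_Suc_I2:
  assumes "\<And>i. i < Suc r \<Longrightarrow> w i \<in> carrier R" "q \<in> carrier M"
  shows "w r \<odot>\<^bsub>M\<^esub> q \<in> span_upto M w (Suc r)"
proof -
  have "w r \<in> carrier R" using assms by auto
  then have "w r \<odot>\<^bsub>M\<^esub> q = \<zero>\<^bsub>M\<^esub> \<oplus>\<^bsub>M\<^esub> w r \<odot>\<^bsub>M\<^esub> q" using assms(2) by simp
  moreover have "\<zero>\<^bsub>M\<^esub> \<in> span_upto M w r" using assms(1) by (intro span_upto_zero) auto
  ultimately show ?thesis
    unfolding span_upto.simps using assms(2) by blast
qed

lemma span_upto_add:
  assumes "\<And>i. i < r \<Longrightarrow> w i \<in> carrier R"
    and "x \<in> span_upto M w r" "y \<in> span_upto M w r"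
  shows "x \<oplus>\<^bsub>M\<^esub> y \<in> span_upto M w r"
  using assms
proof (induction r arbitrary: x y)
  case (Suc r)
  obtain p q where x: "x = p \<oplus>\<^bsub>M\<^esub> w r \<odot>\<^bsub>M\<^esub> q" "p \<in> span_upto M w r" "q \<in> carrier M"
    using Suc.prems(2) by auto
  obtain p' q' where y: "y = p' \<oplus>\<^bsub>M\<^esub> w r \<odot>\<^bsub>M\<^esub> q'" "p' \<in> span_upto M w r" "q' \<in> carrier M"
    using Suc.prems(3) by auto
  have w: "w r \<in> carrier R" and c: "p \<in> carrier M" "p' \<in> carrier M"
    using Suc.prems(1) x y span_upto_closed[of r w] by (auto simp: subset_eq)
  have "x \<oplus>\<^bsub>M\<^esub> y = (p \<oplus>\<^bsub>M\<^esub> p') \<oplus>\<^bsub>M\<^esub> w r \<odot>\<^bsub>M\<^esub> (q \<oplus>\<^bsub>M\<^esub> q')"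
    using x y w c by (simp add: smult_r_distr M.a_ac)
  moreover have "p \<oplus>\<^bsub>M\<^esub> p' \<in> span_upto M w r"
    using Suc.prems(1) x y by (intro Suc.IH) auto
  ultimately show ?case using x y by auto
qed auto

lemma span_upto_smult:
  assumes "\<And>i. i < r \<Longrightarrow> w i \<in> carrier R"
    and "a \<in> carrier R" "x \<in> span_upto M w r"
  shows "a \<odot>\<^bsub>M\<^esub> x \<in> span_upto M w r"
  using assms
proof (induction r arbitrary: x)
  case (Suc r)
  obtain p q where x: "x = p \<oplus>\<^bsub>M\<^esub> w r \<odot>\<^bsub>M\<^esub> q" "p \<in> span_upto M w r" "q \<in> carrier M"
    using Suc.prems(3) by auto
  have w: "w r \<in> carrier R" and c: "p \<in> carrier M"
    using Suc.prems(1) x span_upto_closed[of r w] by (auto simp: subset_eq)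
  have "a \<odot>\<^bsub>M\<^esub> x = a \<odot>\<^bsub>M\<^esub> p \<oplus>\<^bsub>M\<^esub> w r \<odot>\<^bsub>M\<^esub> (a \<odot>\<^bsub>M\<^esub> q)"
    using x w c Suc.prems(2) by (simp add: smult_r_distr smult_assoc1[symmetric] R.m_comm)
  moreover have "a \<odot>\<^bsub>M\<^esub> p \<in> span_upto M w r"
    using Suc.prems x by (intro Suc.IH) auto
  ultimately show ?case using x Suc.prems(2) by auto
qed auto

lemma span_upto_neg:
  assumes "\<And>i. i < r \<Longrightarrow> w i \<in> carrier R" and "x \<in> span_upto M w r"
  shows "\<ominus>\<^bsub>M\<^esub> x \<in> span_upto M w r"
proof -
  have "x \<in> carrier M" using assms span_upto_closed[of r w] by auto
  then have "\<ominus>\<^bsub>M\<^esub> x = (\<ominus> \<one>) \<odot>\<^bsub>M\<^esub> x" by (simp add: smult_l_minus)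
  with span_upto_smult[OF assms(1) _ assms(2), of "\<ominus> \<one>"] show ?thesis by simp
qed

end

lemma span_upto_hom:
  assumes h: "h \<in> module_hom R M N" and M: "Module.module R M" and N: "Module.module R N"
    and w: "\<And>i. i < r \<Longrightarrow> w i \<in> carrier R" and x: "x \<in> span_upto M w r"
  shows "h x \<in> span_upto N w r"
  using w x
proof (induction r arbitrary: x)
  case 0
  interpret M: Module.module R M by fact
  show ?case using 0 M.module_hom_zero[OF M N h] by simp
next
  case (Suc r)
  interpret M: Module.module R M by fact
  obtain p q where x: "x = p \<oplus>\<^bsub>M\<^esub> w r \<odot>\<^bsub>M\<^esub> q" "p \<in> span_upto M w r" "q \<in> carrier M"
    using Suc.prems(2) by auto
  have w: "w r \<in> carrier R" and c: "p \<in> carrier M"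
    using Suc.prems(1) x M.span_upto_closed[of r w] by (auto simp: subset_eq)
  have "h x = h p \<oplus>\<^bsub>N\<^esub> w r \<odot>\<^bsub>N\<^esub> h q"
    using x w c by (simp add: module_hom_add[OF h] module_hom_smult[OF h])
  moreover have "h p \<in> span_upto N w r" using Suc x by auto
  ultimately show ?case using module_hom_closed[OF h x(3)] by auto
qed

context cring
begin

lemma span_upto_free_module:
  assumes w: "\<And>i. i < r \<Longrightarrow> w i \<in> carrier R"
  shows "f \<in> span_upto (free_module R I) w r \<longleftrightarrow>
    f \<in> carrier (free_module R I) \<and> (\<forall>i. f i \<in> ideal_upto R w r)"
  using w
proof (induction r arbitrary: f)
  case 0
  have "(\<lambda>i. \<zero>) \<in> carrier (free_module R I)" by simp
  moreover have "f = (\<lambda>i. \<zero>) \<longleftrightarrow> (\<forall>i. f i = \<zero>)" by (rule fun_eq_iff)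
  ultimately show ?case unfolding span_upto.simps ideal_upto.simps free_module_sel(2) singleton_iff
    by blast
next
  case (Suc r)
  let ?F = "free_module R I"
  interpret F: Module.module R ?F by (rule free_module_module)
  have wr: "w r \<in> carrier R" using Suc.prems by simp
  show ?case
  proof
    assume f: "f \<in> span_upto ?F w (Suc r)"
    then obtain p q where pq: "f = (\<lambda>i. p i \<oplus> w r \<otimes> q i)" "p \<in> span_upto ?F w r" "q \<in> carrier ?F"
      unfolding span_upto.simps free_module_sel by blast
    have "p i \<in> ideal_upto R w r" for i
      using iffD1[OF Suc.IH pq(2)] Suc.prems by simp
    moreover have "q i \<in> carrier R" for i using pq(3) by simp
    moreover have "f \<in> carrier ?F"
      using f F.span_upto_closed[of "Suc r" w] Suc.prems by blast
    ultimately show "f \<in> carrier ?F \<and> (\<forall>i. f i \<in> ideal_upto R w (Suc r))"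
      unfolding ideal_upto.simps pq(1) by blast
  next
    assume f: "f \<in> carrier ?F \<and> (\<forall>i. f i \<in> ideal_upto R w (Suc r))"
    have z: "\<zero> \<in> ideal_upto R w r"
    proof -
      have "(\<lambda>i. \<zero>) \<in> span_upto ?F w r" using F.span_upto_zero[of r w] Suc.prems by simp
      from iffD1[OF Suc.IH this] Suc.prems show ?thesis by simp
    qed
    \<comment> \<open>Where \<open>f i\<close> vanishes the witnesses are forced to be zero, so that
      the assembled families \<open>p\<close> and \<open>q\<close> are again finitely
      supported.\<close>
    have "\<exists>p q. p \<in> ideal_upto R w r \<and> q \<in> carrier R \<and> f i = p \<oplus> w r \<otimes> q \<and>
        (f i = \<zero> \<longrightarrow> p = \<zero> \<and> q = \<zero>)" for i
    proof (cases "f i = \<zero>")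
      case True
      have "\<zero> = \<zero> \<oplus> w r \<otimes> \<zero>" using wr by simp
      with True z show ?thesis using zero_closed by metis
    next
      case False
      have "f i \<in> ideal_upto R w (Suc r)" using f by blast
      then show ?thesis using False unfolding ideal_upto.simps by blast
    qed
    then obtain p q where pq: "\<And>i. p i \<in> ideal_upto R w r" "\<And>i. q i \<in> carrier R"
      "\<And>i. f i = p i \<oplus> w r \<otimes> q i" "\<And>i. f i = \<zero> \<Longrightarrow> p i = \<zero>" "\<And>i. f i = \<zero> \<Longrightarrow> q i = \<zero>"
      by metis
    have pc: "p i \<in> carrier R" for i
    proof -
      have "ideal_upto R w r' \<subseteq> carrier R" if "r' \<le> r" for r'
        using that
      proof (induction r')
        case (Suc r')
        then have "w r' \<in> carrier R" "ideal_upto R w r' \<subseteq> carrier R"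
          using \<open>\<And>i. i < Suc r \<Longrightarrow> w i \<in> carrier R\<close>[of r'] by auto
        then show ?case unfolding ideal_upto.simps by blast
      qed simp
      from this[of r] pq(1) show ?thesis by blast
    qed
    have "{i. p i \<noteq> \<zero>} \<subseteq> {i. f i \<noteq> \<zero>}" "{i. q i \<noteq> \<zero>} \<subseteq> {i. f i \<noteq> \<zero>}"
      using pq(4,5) by blast+
    then have "p \<in> carrier ?F" "q \<in> carrier ?F"
      using f pc pq(2) unfolding free_module_sel by (meson finite_subset subset_trans)+
    moreover from this have "p \<in> span_upto ?F w r"
      by (intro iffD2[OF Suc.IH]) (use Suc.prems pq(1) in auto)
    moreover have "f = p \<oplus>\<^bsub>?F\<^esub> w r \<odot>\<^bsub>?F\<^esub> q" using pq(3) by auto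
    ultimately show "f \<in> span_upto ?F w (Suc r)" unfolding span_upto.simps by blast
  qed
qed

text \<open>A free module inherits weak regularity from the ring coordinate by coordinate; a retract
  of it inherits the property by going up along \<open>h\<close> and coming back along
  \<open>g\<close>.\<close>

lemma projective_weakly_regular:
  fixes P :: "('a, 'p) module"
  assumes P: "projective_module R P"
    and w: "\<And>i. i \<le> r \<Longrightarrow> w i \<in> carrier R"
    and reg: "\<And>x. x \<in> carrier R \<Longrightarrow> w r \<otimes> x \<in> ideal_upto R w r \<Longrightarrow> x \<in> ideal_upto R w r"
    and x: "x \<in> carrier P" "w r \<odot>\<^bsub>P\<^esub> x \<in> span_upto P w r"
  shows "x \<in> span_upto P w r"
proof -
  let ?F = "free_module R (carrier P)"
  have w': "\<And>i. i < r \<Longrightarrow> w i \<in> carrier R" "w r \<in> carrier R" using w by auto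
  have M: "Module.module R P" using P by (simp add: projective_module_def)
  obtain h g where h: "h \<in> module_hom R P ?F" and g: "g \<in> module_hom R ?F P"
    and gh: "\<forall>x\<in>carrier P. g (h x) = x"
    using projective_retract_of_free[OF P] by blast
  have hx: "h x \<in> carrier ?F" using module_hom_closed[OF h x(1)] .
  have "h (w r \<odot>\<^bsub>P\<^esub> x) \<in> span_upto ?F w r"
    by (rule span_upto_hom[OF h M free_module_module w'(1) x(2)])
  also have "h (w r \<odot>\<^bsub>P\<^esub> x) = (\<lambda>i. w r \<otimes> h x i)"
    using module_hom_smult[OF h w'(2) x(1)] by simp
  finally have "\<forall>i. w r \<otimes> h x i \<in> ideal_upto R w r"
    using span_upto_free_module[of r w, OF w'(1), THEN iffD1, THEN conjunct2] by simp
  moreover have "\<forall>i. h x i \<in> carrier R" using hx by simp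
  ultimately have "\<forall>i. h x i \<in> ideal_upto R w r" using reg by blast
  then have "h x \<in> span_upto ?F w r"
    by (intro span_upto_free_module[of r w, OF w'(1), THEN iffD2] conjI hx)
  from span_upto_hom[OF g free_module_module M w'(1) this] gh x(1)
  show ?thesis by simp
qed

end

section \<open>Length of projective resolutions\<close>

lemma resolution_complex:
  assumes "projective_resolution R M P d e"
  shows "x \<in> carrier (P (Suc (Suc i))) \<Longrightarrow> d i (d (Suc i) x) = \<zero>\<^bsub>P i\<^esub>"
    and "x \<in> carrier (P (Suc (Suc i))) \<Longrightarrow> d (Suc i) x \<in> carrier (P (Suc i))"
proof -
  assume "x \<in> carrier (P (Suc (Suc i)))"
  then have "d (Suc i) x \<in> module_kernel (P (Suc i)) (P i) (d i)"
    using assms unfolding projective_resolution_def by blast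
  then show "d i (d (Suc i) x) = \<zero>\<^bsub>P i\<^esub>" "d (Suc i) x \<in> carrier (P (Suc i))"
    by (simp_all add: module_kernel_def)
qed

text \<open>Reduces the resolution modulo \<open>w\<^sub>0, w\<^sub>1, \<dots>\<close> one element at a time. The reduction modulo the first
  \<open>r\<close> elements stays exact in the degrees above \<open>r\<close>, whereas \<open>u\<close> produces a nonzero homology
  class in degree \<open>r\<close> (a chain-level substitute for \<open>Tor\<close> of \<open>M\<close> against \<open>R/(w)\<close>).\<close>

lemma projective_resolution_length:
  fixes P :: "nat \<Rightarrow> ('a, 'p) module"
  assumes R: "cring R" and M: "Module.module R M"
    and res: "projective_resolution R M P d e"
    and w: "\<And>i. i < n \<Longrightarrow> w i \<in> carrier R"
    and reg: "\<And>r x. r < n \<Longrightarrow> x \<in> carrier R \<Longrightarrow> w r \<otimes>\<^bsub>R\<^esub> x \<in> ideal_upto R w r \<Longrightarrow> x \<in> ideal_upto R w r"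
    and u: "u \<in> carrier M" "u \<noteq> \<zero>\<^bsub>M\<^esub>" and wu: "\<And>i. i < n \<Longrightarrow> w i \<odot>\<^bsub>M\<^esub> u = \<zero>\<^bsub>M\<^esub>"
    and zero: "\<And>i. k < i \<Longrightarrow> carrier (P i) = {\<zero>\<^bsub>P i\<^esub>}"
  shows "n \<le> k"
proof -
  interpret R: cring R by fact
  interpret M: Module.module R M by fact
  have P: "projective_module R (P i)" for i using res by (simp add: projective_resolution_def)
  have PM: "Module.module R (P i)" for i using P[of i] by (simp add: projective_module_def)
  interpret P: Module.module R "P i" for i by (rule PM)
  have d: "d i \<in> module_hom R (P (Suc i)) (P i)" for i
    using res by (simp add: projective_resolution_def)
  have e: "e \<in> module_hom R (P 0) M" using res by (simp add: projective_resolution_def)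
  note dc = module_hom_closed[OF d] and da = module_hom_add[OF d] and ds = module_hom_smult[OF d]
  \<comment> \<open>Cycles and boundaries of the complex P / (w_0, ..., w_(r-1)) P are described
    inside P: \<open>W i r\<close> is the submodule divided out in degree i, and
    \<open>B i r\<close> the boundaries plus that submodule.\<close>
  define W where "W i r = span_upto (P i) w r" for i r
  define B where "B i r = {d i y \<oplus>\<^bsub>P i\<^esub> q | y q. y \<in> carrier (P (Suc i)) \<and> q \<in> W i r}" for i r
  have Wc: "x \<in> carrier (P i)" if "x \<in> W i r" "r \<le> n" for x i r
    using that P.span_upto_closed[of r w i] w by (auto simp: W_def)
  have Wd: "d i x \<in> W i r" if "x \<in> W (Suc i) r" "r \<le> n" for i x r
    using that w unfolding W_def by (intro span_upto_hom[OF d PM PM]) auto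
  have Wz: "\<zero>\<^bsub>P i\<^esub> \<in> W i r" if "r \<le> n" for i r
    using that w unfolding W_def by (intro P.span_upto_zero) auto
  have Wa: "x \<oplus>\<^bsub>P i\<^esub> y \<in> W i r" if "x \<in> W i r" "y \<in> W i r" "r \<le> n" for x y i r
    using that w unfolding W_def by (intro P.span_upto_add) auto
  have Wn: "\<ominus>\<^bsub>P i\<^esub> x \<in> W i r" if "x \<in> W i r" "r \<le> n" for x i r
    using that w unfolding W_def by (intro P.span_upto_neg) auto
  have Ws: "a \<odot>\<^bsub>P i\<^esub> x \<in> W i r" if "a \<in> carrier R" "x \<in> W i r" "r \<le> n" for a x i r
    using that w unfolding W_def by (intro P.span_upto_smult) auto
  have W1: "x \<in> W i (Suc r)" if "x \<in> W i r" "Suc r \<le> n" for x i r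
    using that w unfolding W_def by (intro P.span_upto_Suc_I1) auto
  have W2: "w r \<odot>\<^bsub>P i\<^esub> x \<in> W i (Suc r)" if "x \<in> carrier (P i)" "Suc r \<le> n" for x i r
    using that w unfolding W_def by (intro P.span_upto_Suc_I2) auto
  have W3: "\<exists>p q. x = p \<oplus>\<^bsub>P i\<^esub> w r \<odot>\<^bsub>P i\<^esub> q \<and> p \<in> W i r \<and> q \<in> carrier (P i)"
    if "x \<in> W i (Suc r)" for x i r
    using that unfolding W_def span_upto.simps by blast
  have Wr: "x \<in> W i r" if "x \<in> carrier (P i)" "w r \<odot>\<^bsub>P i\<^esub> x \<in> W i r" "r < n" for x i r
    unfolding W_def
  proof (rule R.projective_weakly_regular[OF P _ reg[OF that(3)] that(1)])
    show "w i' \<in> carrier R" if "i' \<le> r" for i' using that \<open>r < n\<close> w by simp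
    show "w r \<odot>\<^bsub>P i\<^esub> x \<in> span_upto (P i) w r" using that(2) by (simp add: W_def)
  qed
  have dn: "d i (\<ominus>\<^bsub>P (Suc i)\<^esub> x) = \<ominus>\<^bsub>P i\<^esub> d i x" if "x \<in> carrier (P (Suc i))" for i x
  proof -
    have "d i ((\<ominus>\<^bsub>R\<^esub> \<one>\<^bsub>R\<^esub>) \<odot>\<^bsub>P (Suc i)\<^esub> x) = (\<ominus>\<^bsub>R\<^esub> \<one>\<^bsub>R\<^esub>) \<odot>\<^bsub>P i\<^esub> d i x"
      using that by (intro ds) auto
    then show ?thesis using that dc[OF that] by (simp add: P.smult_l_minus)
  qed
  have dd: "d i (d (Suc i) x) = \<zero>\<^bsub>P i\<^esub>" if "x \<in> carrier (P (Suc (Suc i)))" for i x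
    by (rule resolution_complex[OF res that])
  \<comment> \<open>\<open>E r\<close> says that the reduced complex is exact in all degrees above
    r. \<open>Z r\<close> says that the cokernel of its differential into degree r has a nonzero
    element killed by the w_j not yet divided out. For r = 0 the cokernel is M and the element is
    u.\<close>
  define E where "E r \<longleftrightarrow> (\<forall>i\<ge>r. \<forall>x \<in> carrier (P (Suc i)). d i x \<in> W i r \<longrightarrow> x \<in> B (Suc i) r)" for r
  define Z where "Z r \<longleftrightarrow> (\<exists>z \<in> carrier (P r). z \<notin> B r r \<and> (\<forall>j. r \<le> j \<and> j < n \<longrightarrow> w j \<odot>\<^bsub>P r\<^esub> z \<in> B r r))" for r
  have BI: "d i y \<oplus>\<^bsub>P i\<^esub> q \<in> B i r" if "y \<in> carrier (P (Suc i))" "q \<in> W i r" for i y q r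
    using that by (auto simp: B_def)
  have E0: "E 0"
    unfolding E_def
  proof (intro allI impI ballI)
    fix i x assume x: "x \<in> carrier (P (Suc i))" "d i x \<in> W i 0"
    then have "x \<in> module_kernel (P (Suc i)) (P i) (d i)" by (simp add: W_def module_kernel_def)
    then obtain y where y: "y \<in> carrier (P (Suc (Suc i)))" "x = d (Suc i) y"
      using res unfolding projective_resolution_def by blast
    then have "x = d (Suc i) y \<oplus>\<^bsub>P (Suc i)\<^esub> \<zero>\<^bsub>P (Suc i)\<^esub>" using x by simp
    then show "x \<in> B (Suc i) 0" using BI[OF y(1) Wz] by auto
  qed
  have Z0: "Z 0"
  proof -
    obtain z where z: "z \<in> carrier (P 0)" "e z = u"
      using u res unfolding projective_resolution_def by (metis imageE)
    have ker: "module_kernel (P 0) M e = d 0 ` carrier (P 1)"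
      using res by (simp add: projective_resolution_def)
    have "z \<notin> B 0 0"
    proof
      assume "z \<in> B 0 0"
      then obtain y where "z = d 0 y \<oplus>\<^bsub>P 0\<^esub> \<zero>\<^bsub>P 0\<^esub>" "y \<in> carrier (P (Suc 0))"
        by (auto simp: B_def W_def)
      then have "z \<in> d 0 ` carrier (P 1)" using dc[of y 0] by auto
      then have "z \<in> module_kernel (P 0) M e" unfolding ker .
      with z u(2) show False by (simp add: module_kernel_def)
    qed
    moreover have "w j \<odot>\<^bsub>P 0\<^esub> z \<in> B 0 0" if "j < n" for j
    proof -
      have "w j \<odot>\<^bsub>P 0\<^esub> z \<in> module_kernel (P 0) M e"
        using z w[OF that] wu[OF that] by (simp add: module_kernel_def module_hom_smult[OF e])
      then obtain y where y: "w j \<odot>\<^bsub>P 0\<^esub> z = d 0 y" "y \<in> carrier (P (Suc 0))"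
        using ker by auto
      then have "w j \<odot>\<^bsub>P 0\<^esub> z = d 0 y \<oplus>\<^bsub>P 0\<^esub> \<zero>\<^bsub>P 0\<^esub>" using dc[of y 0] by simp
      with BI[OF y(2) Wz] show ?thesis by simp
    qed
    ultimately show ?thesis using z unfolding Z_def by blast
  qed
  have ES: "E (Suc r)" if E: "E r" and r: "r < n" for r
    unfolding E_def
  proof (intro allI impI ballI)
    fix i x assume i: "Suc r \<le> i" and x: "x \<in> carrier (P (Suc i))" and dx: "d i x \<in> W i (Suc r)"
    obtain i' where i': "i = Suc i'" "r \<le> i'" using i by (cases i) auto
    obtain q p where qp: "d i x = q \<oplus>\<^bsub>P i\<^esub> w r \<odot>\<^bsub>P i\<^esub> p" "q \<in> W i r" "p \<in> carrier (P i)"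
      using W3[OF dx] by blast
    have wr: "w r \<in> carrier R" using w r by auto
    have qc: "q \<in> carrier (P i)" using Wc[OF qp(2)] r by simp
    \<comment> \<open>Applying the differential to d x = q + w_r p shows that w_r d p lies in the
      submodule for r, hence so does d p by weak regularity. Exactness for r then makes p a boundary
      d p' up to that submodule, and x - w_r p' is a cycle already modulo the first r
      elements.\<close>
    have "d i' (d i x) = d i' q \<oplus>\<^bsub>P i'\<^esub> w r \<odot>\<^bsub>P i'\<^esub> d i' p"
      using qp qc wr unfolding i' by (simp add: da ds)
    moreover have "d i' (d i x) = \<zero>\<^bsub>P i'\<^esub>" using dd x unfolding i' by simp
    ultimately have "w r \<odot>\<^bsub>P i'\<^esub> d i' p = \<ominus>\<^bsub>P i'\<^esub> d i' q"
      using dc[of _ i'] qp(3) qc wr unfolding i'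
      by (metis P.minus_equality P.smult_closed P.a_comm)
    then have "w r \<odot>\<^bsub>P i'\<^esub> d i' p \<in> W i' r"
      using Wn[OF Wd] qp(2) r unfolding i' by simp
    then have "d i' p \<in> W i' r" using Wr dc[of p i'] qp(3) r unfolding i' by simp
    then have "p \<in> B i r" using E qp(3) i' unfolding E_def by simp
    then obtain p' q' where p': "p = d i p' \<oplus>\<^bsub>P i\<^esub> q'" "p' \<in> carrier (P (Suc i))" "q' \<in> W i r"
      unfolding B_def by blast
    have q'c: "q' \<in> carrier (P i)" using Wc[OF p'(3)] r by simp
    define x' where "x' = x \<oplus>\<^bsub>P (Suc i)\<^esub> \<ominus>\<^bsub>P (Suc i)\<^esub> (w r \<odot>\<^bsub>P (Suc i)\<^esub> p')"
    have x'c: "x' \<in> carrier (P (Suc i))" using x wr p'(2) by (simp add: x'_def)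
    have "d i x' = d i x \<oplus>\<^bsub>P i\<^esub> \<ominus>\<^bsub>P i\<^esub> (w r \<odot>\<^bsub>P i\<^esub> d i p')"
      using x wr p'(2) by (simp add: x'_def da dn ds)
    also have "\<dots> = q \<oplus>\<^bsub>P i\<^esub> w r \<odot>\<^bsub>P i\<^esub> q' \<oplus>\<^bsub>P i\<^esub>
        (w r \<odot>\<^bsub>P i\<^esub> d i p' \<oplus>\<^bsub>P i\<^esub> \<ominus>\<^bsub>P i\<^esub> (w r \<odot>\<^bsub>P i\<^esub> d i p'))"
      using qp(1) p' qc q'c wr dc[of p' i] by (simp add: P.smult_r_distr P.a_ac)
    also have "\<dots> = q \<oplus>\<^bsub>P i\<^esub> w r \<odot>\<^bsub>P i\<^esub> q'"
      using qc q'c wr dc[of p' i] p' by (simp add: P.r_neg)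
    finally have "d i x' \<in> W i r" using Wa[OF qp(2) Ws[OF wr p'(3)]] r by simp
    then have "x' \<in> B (Suc i) r" using E x'c i unfolding E_def by simp
    then obtain s t where st: "x' = d (Suc i) s \<oplus>\<^bsub>P (Suc i)\<^esub> t" "s \<in> carrier (P (Suc (Suc i)))" "t \<in> W (Suc i) r"
      unfolding B_def by blast
    have tc: "t \<in> carrier (P (Suc i))" using Wc[OF st(3)] r by simp
    have "x = x' \<oplus>\<^bsub>P (Suc i)\<^esub> w r \<odot>\<^bsub>P (Suc i)\<^esub> p'"
      using x wr p'(2) by (simp add: x'_def P.a_assoc P.l_neg)
    also have "\<dots> = d (Suc i) s \<oplus>\<^bsub>P (Suc i)\<^esub> (t \<oplus>\<^bsub>P (Suc i)\<^esub> w r \<odot>\<^bsub>P (Suc i)\<^esub> p')"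
      using st tc wr p'(2) dc[of s "Suc i"] by (simp add: P.a_assoc)
    finally show "x \<in> B (Suc i) (Suc r)"
      using BI[OF st(2) Wa[OF W1[OF st(3)] W2[OF p'(2)]]] r by simp
  qed
  have ZS: "Z (Suc r)" if E: "E r" and Z: "Z r" and r: "r < n" for r
  proof -
    obtain z where z: "z \<in> carrier (P r)" "z \<notin> B r r" "\<And>j. r \<le> j \<Longrightarrow> j < n \<Longrightarrow> w j \<odot>\<^bsub>P r\<^esub> z \<in> B r r"
      using Z unfolding Z_def by blast
    have wr: "w r \<in> carrier R" using w r by auto
    \<comment> \<open>This is the connecting map for multiplication by w_r: the element for r + 1 is
      a p whose boundary is w_r z modulo the first r elements. If p were a boundary modulo the first
      r + 1 elements, cancelling w_r would make z one modulo the first r.\<close>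
    obtain p q where pq: "w r \<odot>\<^bsub>P r\<^esub> z = d r p \<oplus>\<^bsub>P r\<^esub> q" "p \<in> carrier (P (Suc r))" "q \<in> W r r"
      using z(3)[of r] r unfolding B_def by blast
    have qc: "q \<in> carrier (P r)" using Wc[OF pq(3)] r by simp
    have "p \<notin> B (Suc r) (Suc r)"
    proof
      assume "p \<in> B (Suc r) (Suc r)"
      then obtain s t where st: "p = d (Suc r) s \<oplus>\<^bsub>P (Suc r)\<^esub> t" "s \<in> carrier (P (Suc (Suc r)))" "t \<in> W (Suc r) (Suc r)"
        unfolding B_def by blast
      obtain q' t' where t: "t = q' \<oplus>\<^bsub>P (Suc r)\<^esub> w r \<odot>\<^bsub>P (Suc r)\<^esub> t'" "q' \<in> W (Suc r) r" "t' \<in> carrier (P (Suc r))"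
        using W3[OF st(3)] by blast
      have q'c: "q' \<in> carrier (P (Suc r))" using Wc[OF t(2)] r by simp
      have "d r p = d r q' \<oplus>\<^bsub>P r\<^esub> w r \<odot>\<^bsub>P r\<^esub> d r t'"
        using st(1,2) t q'c wr dc[of s "Suc r"] dc[of q' r] dc[of t' r] by (simp add: da ds dd)
      then have eq: "w r \<odot>\<^bsub>P r\<^esub> z = d r q' \<oplus>\<^bsub>P r\<^esub> w r \<odot>\<^bsub>P r\<^esub> d r t' \<oplus>\<^bsub>P r\<^esub> q" using pq by simp
      have c: "d r q' \<in> carrier (P r)" "d r t' \<in> carrier (P r)" using dc q'c t by auto
      have "w r \<odot>\<^bsub>P r\<^esub> (z \<oplus>\<^bsub>P r\<^esub> \<ominus>\<^bsub>P r\<^esub> d r t') = w r \<odot>\<^bsub>P r\<^esub> z \<oplus>\<^bsub>P r\<^esub> \<ominus>\<^bsub>P r\<^esub> (w r \<odot>\<^bsub>P r\<^esub> d r t')"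
        using c wr z by (simp add: P.smult_r_distr P.smult_r_minus)
      also have "\<dots> = d r q' \<oplus>\<^bsub>P r\<^esub> q \<oplus>\<^bsub>P r\<^esub> (w r \<odot>\<^bsub>P r\<^esub> d r t' \<oplus>\<^bsub>P r\<^esub> \<ominus>\<^bsub>P r\<^esub> (w r \<odot>\<^bsub>P r\<^esub> d r t'))"
        unfolding eq using c wr qc by (simp add: P.a_ac)
      also have "\<dots> = d r q' \<oplus>\<^bsub>P r\<^esub> q" using c wr qc by (simp add: P.r_neg)
      also have "\<dots> \<in> W r r" using Wa Wd t(2) pq(3) r by simp
      finally have "z \<oplus>\<^bsub>P r\<^esub> \<ominus>\<^bsub>P r\<^esub> d r t' \<in> W r r" using Wr z(1) c r by simp
      from BI[OF t(3) this] have "d r t' \<oplus>\<^bsub>P r\<^esub> (z \<oplus>\<^bsub>P r\<^esub> \<ominus>\<^bsub>P r\<^esub> d r t') \<in> B r r" .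
      also have "d r t' \<oplus>\<^bsub>P r\<^esub> (z \<oplus>\<^bsub>P r\<^esub> \<ominus>\<^bsub>P r\<^esub> d r t') = z \<oplus>\<^bsub>P r\<^esub> (d r t' \<oplus>\<^bsub>P r\<^esub> \<ominus>\<^bsub>P r\<^esub> d r t')"
        using c z(1) by (simp add: P.a_ac)
      also have "\<dots> = z" using c z(1) by (simp add: P.r_neg)
      finally show False using z(2) by simp
    qed
    moreover have "w j \<odot>\<^bsub>P (Suc r)\<^esub> p \<in> B (Suc r) (Suc r)" if j: "Suc r \<le> j" "j < n" for j
    proof -
      have wj: "w j \<in> carrier R" using w j by auto
      obtain p' q' where p': "w j \<odot>\<^bsub>P r\<^esub> z = d r p' \<oplus>\<^bsub>P r\<^esub> q'" "p' \<in> carrier (P (Suc r))" "q' \<in> W r r"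
        using z(3)[of j] j unfolding B_def by auto
      have q'c: "q' \<in> carrier (P r)" using Wc[OF p'(3)] r by simp
      have c: "d r p \<in> carrier (P r)" "d r p' \<in> carrier (P r)" using dc pq(2) p'(2) by auto
      \<comment> \<open>Computing w_j w_r z in both orders shows that w_j p - w_r p' is a cycle
        modulo the first r elements, so \<open>E r\<close> turns it into a boundary.\<close>
      have "w j \<odot>\<^bsub>P r\<^esub> (w r \<odot>\<^bsub>P r\<^esub> z) = w r \<odot>\<^bsub>P r\<^esub> (w j \<odot>\<^bsub>P r\<^esub> z)"
        using wr wj z(1) by (simp add: P.smult_assoc1[symmetric] R.m_comm)
      then have eq: "w j \<odot>\<^bsub>P r\<^esub> d r p \<oplus>\<^bsub>P r\<^esub> w j \<odot>\<^bsub>P r\<^esub> q = w r \<odot>\<^bsub>P r\<^esub> d r p' \<oplus>\<^bsub>P r\<^esub> w r \<odot>\<^bsub>P r\<^esub> q'"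
        using wr wj c qc q'c by (simp add: pq(1) p'(1) P.smult_r_distr)
      define y where "y = w j \<odot>\<^bsub>P (Suc r)\<^esub> p \<oplus>\<^bsub>P (Suc r)\<^esub> \<ominus>\<^bsub>P (Suc r)\<^esub> (w r \<odot>\<^bsub>P (Suc r)\<^esub> p')"
      have yc: "y \<in> carrier (P (Suc r))" using wr wj pq(2) p'(2) by (simp add: y_def)
      have "d r y = w j \<odot>\<^bsub>P r\<^esub> d r p \<oplus>\<^bsub>P r\<^esub> \<ominus>\<^bsub>P r\<^esub> (w r \<odot>\<^bsub>P r\<^esub> d r p')"
        using wr wj pq(2) p'(2) by (simp add: y_def da dn ds)
      also have "\<dots> = (w j \<odot>\<^bsub>P r\<^esub> d r p \<oplus>\<^bsub>P r\<^esub> w j \<odot>\<^bsub>P r\<^esub> q) \<oplus>\<^bsub>P r\<^esub>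
          (\<ominus>\<^bsub>P r\<^esub> (w j \<odot>\<^bsub>P r\<^esub> q) \<oplus>\<^bsub>P r\<^esub> \<ominus>\<^bsub>P r\<^esub> (w r \<odot>\<^bsub>P r\<^esub> d r p'))"
        using wr wj c qc by (simp add: P.a_assoc P.r_neg1 P.r_neg2)
      also have "\<dots> = \<ominus>\<^bsub>P r\<^esub> (w j \<odot>\<^bsub>P r\<^esub> q) \<oplus>\<^bsub>P r\<^esub> w r \<odot>\<^bsub>P r\<^esub> q' \<oplus>\<^bsub>P r\<^esub>
          (w r \<odot>\<^bsub>P r\<^esub> d r p' \<oplus>\<^bsub>P r\<^esub> \<ominus>\<^bsub>P r\<^esub> (w r \<odot>\<^bsub>P r\<^esub> d r p'))"
        unfolding eq using wr wj c qc q'c by (simp add: P.a_ac)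
      also have "\<dots> = \<ominus>\<^bsub>P r\<^esub> (w j \<odot>\<^bsub>P r\<^esub> q) \<oplus>\<^bsub>P r\<^esub> w r \<odot>\<^bsub>P r\<^esub> q'"
        using wr wj c qc q'c by (simp add: P.r_neg)
      also have "\<dots> \<in> W r r" using Wa Wn Ws wr wj pq(3) p'(3) r by simp
      finally have "y \<in> B (Suc r) r" using E yc unfolding E_def by simp
      then obtain s t where st: "y = d (Suc r) s \<oplus>\<^bsub>P (Suc r)\<^esub> t" "s \<in> carrier (P (Suc (Suc r)))" "t \<in> W (Suc r) r"
        unfolding B_def by blast
      have tc: "t \<in> carrier (P (Suc r))" using Wc[OF st(3)] r by simp
      have "w j \<odot>\<^bsub>P (Suc r)\<^esub> p = y \<oplus>\<^bsub>P (Suc r)\<^esub> w r \<odot>\<^bsub>P (Suc r)\<^esub> p'"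
        using wr wj pq(2) p'(2) by (simp add: y_def P.a_assoc P.l_neg)
      also have "\<dots> = d (Suc r) s \<oplus>\<^bsub>P (Suc r)\<^esub> (t \<oplus>\<^bsub>P (Suc r)\<^esub> w r \<odot>\<^bsub>P (Suc r)\<^esub> p')"
        using st tc wr p'(2) dc[of s "Suc r"] by (simp add: P.a_assoc)
      finally show ?thesis
        using BI[OF st(2) Wa[OF W1[OF st(3)] W2[OF p'(2)]]] r by simp
    qed
    ultimately show ?thesis using pq(2) unfolding Z_def by blast
  qed
  have EZ: "r \<le> n \<Longrightarrow> E r \<and> Z r" for r
  proof (induction r)
    case 0
    show ?case using E0 Z0 by (rule conjI)
  next
    case (Suc r)
    then have "r < n" "E r" "Z r" by simp_all
    then show ?case using ES ZS by blast
  qed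
  show ?thesis
  proof (rule ccontr)
    assume "\<not> n \<le> k"
    then have "k < n" by simp
    then have "Z (Suc k)" using EZ[of "Suc k"] by simp
    then obtain z where z: "z \<in> carrier (P (Suc k))" "z \<notin> B (Suc k) (Suc k)"
      unfolding Z_def by blast
    have "z \<in> {\<zero>\<^bsub>P (Suc k)\<^esub>}" using z(1) by (simp only: zero[OF lessI])
    then have z0: "z = \<zero>\<^bsub>P (Suc k)\<^esub>" by (rule singletonD)
    have "\<zero>\<^bsub>P (Suc k)\<^esub> \<in> B (Suc k) (Suc k)"
    proof -
      have "d (Suc k) \<zero>\<^bsub>P (Suc (Suc k))\<^esub> = \<zero>\<^bsub>P (Suc k)\<^esub>" by (rule R.module_hom_zero[OF PM PM d])
      moreover have "\<zero>\<^bsub>P (Suc k)\<^esub> \<in> W (Suc k) (Suc k)" using \<open>k < n\<close> by (intro Wz) simp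
      ultimately have "\<zero>\<^bsub>P (Suc k)\<^esub> \<oplus>\<^bsub>P (Suc k)\<^esub> \<zero>\<^bsub>P (Suc k)\<^esub> \<in> B (Suc k) (Suc k)"
        using BI[of "\<zero>\<^bsub>P (Suc (Suc k))\<^esub>" "Suc k" "\<zero>\<^bsub>P (Suc k)\<^esub>" "Suc k"] by simp
      then show ?thesis by simp
    qed
    with z(2) show False unfolding z0 by (rule notE)
  qed
qed

corollary projective_dimension_ge:
  assumes R: "cring R" and M: "Module.module R M"
    and w: "\<And>i. i < n \<Longrightarrow> w i \<in> carrier R"
    and reg: "\<And>r x. r < n \<Longrightarrow> x \<in> carrier R \<Longrightarrow> w r \<otimes>\<^bsub>R\<^esub> x \<in> ideal_upto R w r \<Longrightarrow> x \<in> ideal_upto R w r"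
    and u: "u \<in> carrier M" "u \<noteq> \<zero>\<^bsub>M\<^esub>" and wu: "\<And>i. i < n \<Longrightarrow> w i \<odot>\<^bsub>M\<^esub> u = \<zero>\<^bsub>M\<^esub>"
  shows "enat n \<le> projective_dimension R M"
  unfolding projective_dimension_def
proof (rule INF_greatest)
  fix k assume "k \<in> {n. \<exists>(P :: nat \<Rightarrow> ('a, 'c \<times> 'a \<times> nat \<Rightarrow> 'a) module) d e.
    projective_resolution R M P d e \<and> (\<forall>i > n. carrier (P i) = {\<zero>\<^bsub>P i\<^esub>})}"
  then obtain P :: "nat \<Rightarrow> ('a, 'c \<times> 'a \<times> nat \<Rightarrow> 'a) module" and d e where
    res: "projective_resolution R M P d e" "\<forall>i>k. carrier (P i) = {\<zero>\<^bsub>P i\<^esub>}" by blast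
  have "n \<le> k"
    by (rule projective_resolution_length[OF R M res(1)])
      (assumption | erule w | erule wu | rule u | erule reg | erule res(2)[rule_format])+
  then show "enat n \<le> enat k" by simp
qed

section \<open>The Koszul complex\<close>

text \<open>The maps are arbitrary commuting additive operators, because the ones needed later are
  not multiplications by ring elements: each is a variable minus the matrix by which that variable
  acts on a quotient.\<close>

locale commuting_endomorphisms =
  fixes F :: "'f::ab_group_add set" and \<phi> :: "nat \<Rightarrow> 'f \<Rightarrow> 'f"
  assumes zero_closed: "0 \<in> F"
    and diff_closed: "x \<in> F \<Longrightarrow> y \<in> F \<Longrightarrow> x - y \<in> F"
    and phi_closed: "x \<in> F \<Longrightarrow> \<phi> j x \<in> F"
    and phi_add: "x \<in> F \<Longrightarrow> y \<in> F \<Longrightarrow> \<phi> j (x + y) = \<phi> j x + \<phi> j y"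
    and phi_commute: "x \<in> F \<Longrightarrow> \<phi> i (\<phi> j x) = \<phi> j (\<phi> i x)"
begin

lemma uminus_closed: "x \<in> F \<Longrightarrow> - x \<in> F"
  using diff_closed[OF zero_closed, of x] by simp

lemma add_closed: "x \<in> F \<Longrightarrow> y \<in> F \<Longrightarrow> x + y \<in> F"
  using diff_closed[of x "- y"] uminus_closed[of y] by simp

lemma phi_zero [simp]: "\<phi> j 0 = 0"
  using phi_add[OF zero_closed zero_closed, of j] by simp

lemma phi_uminus: "x \<in> F \<Longrightarrow> \<phi> j (- x) = - \<phi> j x"
  using phi_add[of x "- x" j] uminus_closed[of x] by (simp add: eq_neg_iff_add_eq_0 add.commute)

primrec image_upto :: "nat \<Rightarrow> 'f set" where
  "image_upto 0 = {0}"
| "image_upto (Suc j) = {u + \<phi> j v | u v. u \<in> image_upto j \<and> v \<in> F}"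

text \<open>A chain on j + 1 operators is a pair of chains on j operators, the two summands of a
  mapping cone: \<open>lo\<close> takes the components at sets without j, \<open>hi\<close> those at
  sets with j, and \<open>join\<close> is the inverse.\<close>

definition lo :: "nat \<Rightarrow> (nat set \<Rightarrow> 'f) \<Rightarrow> nat set \<Rightarrow> 'f" where
  "lo j x = (\<lambda>S. if j \<in> S then 0 else x S)"

definition hi :: "nat \<Rightarrow> (nat set \<Rightarrow> 'f) \<Rightarrow> nat set \<Rightarrow> 'f" where
  "hi j x = (\<lambda>S. if j \<in> S then 0 else x (insert j S))"

definition join :: "nat \<Rightarrow> (nat set \<Rightarrow> 'f) \<Rightarrow> (nat set \<Rightarrow> 'f) \<Rightarrow> nat set \<Rightarrow> 'f" where
  "join j p q = (\<lambda>S. if j \<in> S then q (S - {j}) else p S)"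

text \<open>The Koszul complex on \<open>\<phi> 0, \<dots>, \<phi> (j - 1)\<close>, built as an iterated mapping cone; its term of
  degree \<open>i\<close> consists of the functions supported on the \<open>i\<close>-element subsets of \<open>{..<j}\<close>.\<close>

primrec koszul_diff :: "nat \<Rightarrow> (nat set \<Rightarrow> 'f) \<Rightarrow> nat set \<Rightarrow> 'f" where
  "koszul_diff 0 x = (\<lambda>S. 0)"
| "koszul_diff (Suc j) x =
     join j (\<lambda>S. koszul_diff j (lo j x) S + \<phi> j (hi j x S)) (\<lambda>S. - koszul_diff j (hi j x) S)"

definition koszul_term :: "nat \<Rightarrow> nat \<Rightarrow> (nat set \<Rightarrow> 'f) set" where
  "koszul_term j i = {x. (\<forall>S. x S \<in> F) \<and> (\<forall>S. x S \<noteq> 0 \<longrightarrow> S \<subseteq> {..<j} \<and> card S = i)}"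

lemma koszul_term_zero: "(\<lambda>S. 0) \<in> koszul_term j i"
  by (simp add: koszul_term_def zero_closed)

lemma koszul_term_add:
  assumes "x \<in> koszul_term j i" "y \<in> koszul_term j i"
  shows "(\<lambda>S. x S + y S) \<in> koszul_term j i"
  using assms unfolding koszul_term_def
  by (auto simp: add_closed) (metis add_0_left add_0_right subsetD lessThan_iff, metis add_0_left)

lemma koszul_term_uminus: "x \<in> koszul_term j i \<Longrightarrow> (\<lambda>S. - x S) \<in> koszul_term j i"
  unfolding koszul_term_def by (auto simp: uminus_closed)

lemma koszul_term_phi: "x \<in> koszul_term j i \<Longrightarrow> (\<lambda>S. \<phi> k (x S)) \<in> koszul_term j i"
  unfolding koszul_term_def using phi_zero by (auto simp: phi_closed) (metis phi_zero subsetD lessThan_iff, metis phi_zero)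

lemma koszul_termD:
  assumes "x \<in> koszul_term j i"
  shows "x S \<in> F" and "j \<in> S \<Longrightarrow> x S = 0" and "card S \<noteq> i \<Longrightarrow> x S = 0"
  using assms unfolding koszul_term_def by auto

lemma koszul_term_0_eq: "x \<in> koszul_term j 0 \<Longrightarrow> S \<noteq> {} \<Longrightarrow> x S = 0"
  using finite_subset[of S "{..<j}"] unfolding koszul_term_def by (auto simp: card_eq_0_iff)

lemma lo_term: "x \<in> koszul_term (Suc j) i \<Longrightarrow> lo j x \<in> koszul_term j i"
  unfolding koszul_term_def lo_def lessThan_Suc by (auto simp: zero_closed)

lemma hi_term:
  assumes "x \<in> koszul_term (Suc j) (Suc i)"
  shows "hi j x \<in> koszul_term j i"
proof -
  have "S \<subseteq> {..<j} \<and> card S = i" if "j \<notin> S" "x (insert j S) \<noteq> 0" for S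
  proof -
    have *: "insert j S \<subseteq> {..<Suc j}" "card (insert j S) = Suc i"
      using assms that by (auto simp: koszul_term_def)
    then have "finite S" using finite_subset[of "insert j S" "{..<Suc j}"] by simp
    with * that(1) show ?thesis by (auto simp: less_Suc_eq)
  qed
  then show ?thesis using assms by (auto simp: koszul_term_def hi_def zero_closed)
qed

lemma hi_term_0: "x \<in> koszul_term (Suc j) 0 \<Longrightarrow> hi j x = (\<lambda>S. 0)"
  unfolding koszul_term_def hi_def
  by (auto simp: fun_eq_iff) (metis card_0_eq finite_lessThan finite_subset insert_not_empty)

lemma join_term:
  assumes "p \<in> koszul_term j (Suc i)" "q \<in> koszul_term j i"
  shows "join j p q \<in> koszul_term (Suc j) (Suc i)"
proof -
  have "S \<subseteq> {..<Suc j} \<and> card S = Suc i" if "j \<in> S" "q (S - {j}) \<noteq> 0" for S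
  proof -
    have *: "S - {j} \<subseteq> {..<j}" "card (S - {j}) = i" using assms(2) that by (auto simp: koszul_term_def)
    then have "finite S" using finite_subset[of "S - {j}" "{..<j}"] by simp
    then have "Suc (card (S - {j})) = card S" using that(1) by (intro card_Suc_Diff1)
    with * show ?thesis by auto
  qed
  moreover have "S \<subseteq> {..<Suc j} \<and> card S = Suc i" if "p S \<noteq> 0" for S
    using assms(1) that by (force simp: koszul_term_def)
  ultimately show ?thesis using assms by (simp add: koszul_term_def join_def)
qed

lemma lo_join: "p \<in> koszul_term j i \<Longrightarrow> lo j (join j p q) = p"
  by (auto simp: lo_def join_def koszul_termD fun_eq_iff)

lemma hi_join: "q \<in> koszul_term j i \<Longrightarrow> hi j (join j p q) = q"
  by (auto simp: hi_def join_def koszul_termD fun_eq_iff)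

lemma join_lo_hi: "join j (lo j x) (hi j x) = x"
  by (auto simp: lo_def hi_def join_def fun_eq_iff insert_absorb)

lemma lo_add: "lo j (\<lambda>S. x S + y S) = (\<lambda>S. lo j x S + lo j y S)"
  and hi_add: "hi j (\<lambda>S. x S + y S) = (\<lambda>S. hi j x S + hi j y S)"
  and lo_uminus: "lo j (\<lambda>S. - x S) = (\<lambda>S. - lo j x S)"
  and hi_uminus: "hi j (\<lambda>S. - x S) = (\<lambda>S. - hi j x S)"
  and lo_phi: "lo j (\<lambda>S. \<phi> k (x S)) = (\<lambda>S. \<phi> k (lo j x S))"
  and hi_phi: "hi j (\<lambda>S. \<phi> k (x S)) = (\<lambda>S. \<phi> k (hi j x S))"
  and lo_zero: "lo j (\<lambda>S. 0) = (\<lambda>S. 0)" and hi_zero: "hi j (\<lambda>S. 0) = (\<lambda>S. 0)"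
  by (auto simp: lo_def hi_def)

lemma koszul_diff_zero [simp]: "koszul_diff j (\<lambda>S. 0) = (\<lambda>S. 0)"
  by (induction j) (simp_all add: lo_zero hi_zero join_def)

lemma koszul_diff_term_0: "x \<in> koszul_term j 0 \<Longrightarrow> koszul_diff j x = (\<lambda>S. 0)"
proof (induction j arbitrary: x)
  case (Suc j)
  then show ?case using lo_term hi_term_0 by (simp add: join_def)
qed simp

lemma koszul_diff_term: "x \<in> koszul_term j (Suc i) \<Longrightarrow> koszul_diff j x \<in> koszul_term j i"
proof (induction j arbitrary: x i)
  case 0
  show ?case by (simp add: koszul_term_zero)
next
  case (Suc j)
  note lo = lo_term[OF Suc.prems] and hi = hi_term[OF Suc.prems]
  have p: "(\<lambda>S. koszul_diff j (lo j x) S + \<phi> j (hi j x S)) \<in> koszul_term j i"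
    by (intro koszul_term_add koszul_term_phi Suc.IH lo hi)
  show ?case
  proof (cases i)
    case 0
    then have "koszul_diff j (hi j x) = (\<lambda>S. 0)" using hi by (intro koszul_diff_term_0) simp
    moreover have "join j p (\<lambda>S. 0) \<in> koszul_term (Suc j) 0" if "p \<in> koszul_term j 0" for p
      using that zero_closed unfolding koszul_term_def join_def by force
    ultimately show ?thesis using p 0 by simp
  next
    case (Suc i')
    with hi have "(\<lambda>S. - koszul_diff j (hi j x) S) \<in> koszul_term j i'"
      by (intro koszul_term_uminus \<open>\<And>x i. x \<in> koszul_term j (Suc i) \<Longrightarrow> _\<close>) simp
    with p show ?thesis unfolding Suc koszul_diff.simps by (rule join_term)
  qed
qed

lemma koszul_diff_add:
  "x \<in> koszul_term j i \<Longrightarrow> y \<in> koszul_term j i \<Longrightarrow>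
     koszul_diff j (\<lambda>S. x S + y S) = (\<lambda>S. koszul_diff j x S + koszul_diff j y S)"
proof (induction j arbitrary: x y i)
  case (Suc j)
  note lo = lo_term[OF Suc.prems(1)] lo_term[OF Suc.prems(2)]
  show ?case
  proof (cases i)
    case 0
    have "hi j x = (\<lambda>S. 0)" "hi j y = (\<lambda>S. 0)"
      using Suc.prems hi_term_0 unfolding 0 by blast+
    then show ?thesis
      by (simp add: lo_add hi_add Suc.IH[OF lo]) (simp add: join_def fun_eq_iff)
  next
    case (Suc i')
    have hi: "hi j x \<in> koszul_term j i'" "hi j y \<in> koszul_term j i'"
      using Suc.prems hi_term unfolding Suc by auto
    show ?thesis
      using koszul_termD(1)[OF hi(1)] koszul_termD(1)[OF hi(2)]
      by (auto simp: lo_add hi_add Suc.IH[OF lo] Suc.IH[OF hi] join_def fun_eq_iff phi_add algebra_simps)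
  qed
qed simp

lemma koszul_diff_uminus:
  "x \<in> koszul_term j i \<Longrightarrow> koszul_diff j (\<lambda>S. - x S) = (\<lambda>S. - koszul_diff j x S)"
proof -
  assume x: "x \<in> koszul_term j i"
  from koszul_diff_add[OF x koszul_term_uminus[OF x]]
  have "koszul_diff j x S + koszul_diff j (\<lambda>S. - x S) S = 0" for S
    by (simp add: fun_eq_iff)
  then show ?thesis by (auto simp: fun_eq_iff eq_neg_iff_add_eq_0 add.commute)
qed

text \<open>Naturality of the differential. It is applied to the operators \<phi> k themselves and,
  for linearity over the base ring, to multiplication by scalars.\<close>

lemma koszul_diff_map:
  assumes psi_closed: "\<And>x. x \<in> F \<Longrightarrow> \<psi> x \<in> F"
    and psi_add: "\<And>x y. x \<in> F \<Longrightarrow> y \<in> F \<Longrightarrow> \<psi> (x + y) = \<psi> x + \<psi> y"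
    and psi_phi: "\<And>j x. x \<in> F \<Longrightarrow> \<psi> (\<phi> j x) = \<phi> j (\<psi> x)"
    and x: "x \<in> koszul_term j i"
  shows "koszul_diff j (\<lambda>S. \<psi> (x S)) = (\<lambda>S. \<psi> (koszul_diff j x S))"
  proof -
  have psi_zero: "\<psi> 0 = 0"
    using psi_add[OF zero_closed zero_closed] by simp
  have psi_uminus: "\<psi> (- x) = - \<psi> x" if "x \<in> F" for x
    using psi_add[of x "- x"] uminus_closed[of x] that psi_zero by (simp add: eq_neg_iff_add_eq_0 add.commute)
  have lo_psi: "lo j (\<lambda>S. \<psi> (x S)) = (\<lambda>S. \<psi> (lo j x S))"
    and hi_psi: "hi j (\<lambda>S. \<psi> (x S)) = (\<lambda>S. \<psi> (hi j x S))" for j x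
    by (auto simp: lo_def hi_def psi_zero)
  show ?thesis using x
proof (induction j arbitrary: x i)
  case (Suc j)
  note lo = lo_term[OF Suc.prems]
  have lod: "koszul_diff j (lo j x) S \<in> F" for S
  proof (cases i)
    case 0
    then show ?thesis using koszul_diff_term_0 lo zero_closed by simp
  next
    case (Suc i')
    then show ?thesis using koszul_diff_term lo koszul_termD(1) by blast
  qed
  show ?case
  proof (cases i)
    case 0
    have "hi j x = (\<lambda>S. 0)" using Suc.prems unfolding 0 by (rule hi_term_0)
    then show ?thesis
      by (simp add: lo_psi hi_psi Suc.IH[OF lo]) (simp add: join_def fun_eq_iff psi_zero)
  next
    case (Suc i')
    have hi: "hi j x \<in> koszul_term j i'"
      using Suc.prems hi_term unfolding Suc by auto
    have hid: "koszul_diff j (hi j x) S \<in> F" for S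
    proof (cases i')
      case 0
      then show ?thesis using koszul_diff_term_0 hi zero_closed by simp
    next
      case (Suc i'')
      then show ?thesis using koszul_diff_term hi koszul_termD(1) by blast
    qed
    show ?thesis
      using koszul_termD(1)[OF hi] lod hid
      by (auto simp: lo_psi hi_psi Suc.IH[OF lo] Suc.IH[OF hi] join_def fun_eq_iff psi_add psi_uminus phi_closed psi_phi)
  qed
qed (simp add: psi_zero)
qed

lemma koszul_diff_phi:
  "x \<in> koszul_term j i \<Longrightarrow> koszul_diff j (\<lambda>S. \<phi> k (x S)) = (\<lambda>S. \<phi> k (koszul_diff j x S))"
  by (rule koszul_diff_map) (simp_all add: phi_closed phi_add phi_commute)

lemma koszul_diff_koszul_diff:
  "x \<in> koszul_term j i \<Longrightarrow> koszul_diff j (koszul_diff j x) = (\<lambda>S. 0)"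
proof (induction j arbitrary: x i)
  case (Suc j)
  show ?case
  proof (cases i)
    case 0
    with Suc.prems koszul_diff_term_0 show ?thesis by (metis koszul_diff_zero)
  next
    case (Suc i')
    note x = Suc.prems[unfolded Suc]
    note lo = lo_term[OF x] and hi = hi_term[OF x]
    let ?p = "\<lambda>S. koszul_diff j (lo j x) S + \<phi> j (hi j x S)"
    let ?q = "\<lambda>S. - koszul_diff j (hi j x) S"
    have p1: "koszul_diff j (lo j x) \<in> koszul_term j i'" by (rule koszul_diff_term[OF lo])
    have p2: "(\<lambda>S. \<phi> j (hi j x S)) \<in> koszul_term j i'" by (rule koszul_term_phi[OF hi])
    have p: "?p \<in> koszul_term j i'" by (rule koszul_term_add[OF p1 p2])
    have q: "\<exists>i. ?q \<in> koszul_term j i"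
    proof (cases i')
      case 0
      with hi have "koszul_diff j (hi j x) = (\<lambda>S. 0)" using koszul_diff_term_0 by blast
      then show ?thesis using koszul_term_zero by simp
    next
      case (Suc i'')
      then show ?thesis using koszul_term_uminus koszul_diff_term hi by blast
    qed
    then obtain i2 where q: "?q \<in> koszul_term j i2" by blast
    have "koszul_diff j ?p = (\<lambda>S. \<phi> j (koszul_diff j (hi j x) S))"
      unfolding koszul_diff_add[OF p1 p2] Suc.IH[OF lo] koszul_diff_phi[OF hi] by simp
    moreover have q': "koszul_diff j (hi j x) \<in> koszul_term j i2"
      using koszul_term_uminus[OF q] by simp
    moreover have "koszul_diff j ?q = (\<lambda>S. 0)"
      unfolding koszul_diff_uminus[OF q'] Suc.IH[OF hi] by simp
    ultimately show ?thesis
      using koszul_termD(1)[OF q']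
      by (simp add: lo_join[OF p] hi_join[OF q] phi_uminus) (simp add: join_def)
  qed
qed simp

section \<open>Exactness of the Koszul complex\<close>

lemma image_upto_closed: "image_upto j \<subseteq> F"
  by (induction j) (auto simp: zero_closed add_closed phi_closed)

lemma image_upto_add: "x \<in> image_upto j \<Longrightarrow> y \<in> image_upto j \<Longrightarrow> x + y \<in> image_upto j"
proof (induction j arbitrary: x y)
  case (Suc j)
  obtain u v u' v' where *: "x = u + \<phi> j v" "u \<in> image_upto j" "v \<in> F"
    "y = u' + \<phi> j v'" "u' \<in> image_upto j" "v' \<in> F" using Suc.prems by auto
  then have "x + y = (u + u') + \<phi> j (v + v')" by (simp add: phi_add)
  then show ?case using Suc.IH * add_closed unfolding image_upto.simps by blast
qed simp

lemma image_upto_uminus: "x \<in> image_upto j \<Longrightarrow> - x \<in> image_upto j"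
proof (induction j arbitrary: x)
  case (Suc j)
  obtain u v where *: "x = u + \<phi> j v" "u \<in> image_upto j" "v \<in> F" using Suc.prems by auto
  then have "- x = - u + \<phi> j (- v)" by (simp add: phi_uminus)
  then show ?case using Suc.IH * uminus_closed unfolding image_upto.simps by blast
qed simp

lemma image_upto_phi: "x \<in> image_upto j \<Longrightarrow> \<phi> k x \<in> image_upto j"
proof (induction j arbitrary: x)
  case (Suc j)
  obtain u v where *: "x = u + \<phi> j v" "u \<in> image_upto j" "v \<in> F" using Suc.prems by auto
  have "u \<in> F" using * image_upto_closed by blast
  with * have "\<phi> k x = \<phi> k u + \<phi> j (\<phi> k v)"
    by (simp add: phi_add phi_closed phi_commute[of v k j])
  then show ?case using Suc.IH * phi_closed unfolding image_upto.simps by blast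
qed simp

text \<open>Identifies homology in degree zero as \<open>F\<close> modulo
  \<open>image_upto j\<close>. It starts the exactness proof and later describes the kernel of the
  augmentation.\<close>

lemma koszul_diff_image: "koszul_diff j ` koszul_term j (Suc 0) = (\<lambda>v S. if S = {} then v else 0) ` image_upto j"
proof (induction j)
  case 0
  have "(\<lambda>S. 0) \<in> koszul_term 0 (Suc 0)" by (rule koszul_term_zero)
  then show ?case by (auto simp: fun_eq_iff)
next
  case (Suc j)
  show ?case
  proof (intro equalityI subsetI)
    fix z assume "z \<in> koszul_diff (Suc j) ` koszul_term (Suc j) (Suc 0)"
    then obtain x where x: "x \<in> koszul_term (Suc j) (Suc 0)" "z = koszul_diff (Suc j) x" by blast
    note lo = lo_term[OF x(1)] and hi = hi_term[OF x(1)]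
    from lo Suc.IH obtain u where u: "u \<in> image_upto j" "koszul_diff j (lo j x) = (\<lambda>S. if S = {} then u else 0)"
      by blast
    have "z = (\<lambda>S. if S = {} then u + \<phi> j (hi j x {}) else 0)"
      using koszul_diff_term_0[OF hi] koszul_term_0_eq[OF hi]
      by (simp add: x(2) u(2) join_def fun_eq_iff)
    then show "z \<in> (\<lambda>v S. if S = {} then v else 0) ` image_upto (Suc j)"
      using u(1) koszul_termD(1)[OF hi] by auto
  next
    fix z :: "nat set \<Rightarrow> 'f" assume "z \<in> (\<lambda>v S. if S = {} then v else 0) ` image_upto (Suc j)"
    then obtain u v where uv: "u \<in> image_upto j" "v \<in> F" "z = (\<lambda>S. if S = {} then u + \<phi> j v else 0)" by auto
    with Suc.IH have "(\<lambda>S. if S = {} then u else 0) \<in> koszul_diff j ` koszul_term j (Suc 0)" by blast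
    then obtain x0 where x0: "x0 \<in> koszul_term j (Suc 0)" "koszul_diff j x0 = (\<lambda>S. if S = {} then u else 0)"
      by (metis (no_types, lifting) imageE)
    define x1 where "x1 = (\<lambda>S::nat set. if S = {} then v else 0)"
    have x1: "x1 \<in> koszul_term j 0" using uv zero_closed by (auto simp: x1_def koszul_term_def)
    have "koszul_diff (Suc j) (join j x0 x1) = z"
      by (simp add: lo_join[OF x0(1)] hi_join[OF x1] koszul_diff_term_0[OF x1] x0(2))
        (auto simp: x1_def uv(3) join_def)
    with join_term[OF x0(1) x1] show "z \<in> koszul_diff (Suc j) ` koszul_term (Suc j) (Suc 0)" by blast
  qed
qed

text \<open>Induction over mapping cones. For a cycle x the part \<open>hi j x\<close> is a cycle of
  the smaller complex, and \<phi> j of it is a boundary there. In positive degree the hypothesis for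
  j makes it a boundary; in degree zero weak regularity of \<phi> j does, and only there is it used
  for j. If it is the boundary of y1, then \<open>lo j x\<close> + \<phi> j y1 is a cycle of the
  smaller complex, hence a boundary of some y0, and y0 and - y1 join to a preimage of x.\<close>

lemma koszul_exact:
  assumes reg: "\<And>k x. k < j \<Longrightarrow> x \<in> F \<Longrightarrow> \<phi> k x \<in> image_upto k \<Longrightarrow> x \<in> image_upto k"
    and x: "x \<in> koszul_term j (Suc i)" "koszul_diff j x = (\<lambda>S. 0)"
  shows "x \<in> koszul_diff j ` koszul_term j (Suc (Suc i))"
  using assms
proof (induction j arbitrary: x i)
  case 0
  then have "x = (\<lambda>S. 0)" by (auto simp: koszul_term_def fun_eq_iff)
  moreover have "koszul_diff 0 (\<lambda>S. 0) \<in> koszul_diff 0 ` koszul_term 0 (Suc (Suc i))"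
    by (rule imageI) (rule koszul_term_zero)
  ultimately show ?case by simp
next
  case (Suc j)
  note lo = lo_term[OF Suc.prems(2)] and hi = hi_term[OF Suc.prems(2)]
  have hi0: "koszul_diff j (hi j x) S = 0" and lo0: "koszul_diff j (lo j x) S = - \<phi> j (hi j x S)" for S
  proof -
    have p: "(\<lambda>S. koszul_diff j (lo j x) S + \<phi> j (hi j x S)) \<in> koszul_term j i"
      by (intro koszul_term_add koszul_term_phi koszul_diff_term lo hi)
    have "lo j (koszul_diff (Suc j) x) S = 0" by (simp only: Suc.prems(3) lo_zero)
    then show "koszul_diff j (lo j x) S = - \<phi> j (hi j x S)"
      by (simp add: lo_join[OF p] eq_neg_iff_add_eq_0)
    have "koszul_diff (Suc j) x (insert j S) = 0" by (simp only: Suc.prems(3))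
    then have *: "koszul_diff j (hi j x) (S - {j}) = 0" by (simp add: join_def)
    show "koszul_diff j (hi j x) S = 0"
    proof (cases "j \<in> S")
      case True
      show ?thesis
      proof (cases i)
        case 0
        with hi have "koszul_diff j (hi j x) = (\<lambda>S. 0)" using koszul_diff_term_0 by blast
        then show ?thesis by simp
      next
        case (Suc i')
        then show ?thesis using koszul_diff_term hi True koszul_termD(2) by blast
      qed
    qed (use * in simp)
  qed
  have "\<exists>y \<in> koszul_term j (Suc i). koszul_diff j y = hi j x"
  proof (cases i)
    case 0
    have x0: "hi j x S = 0" if "S \<noteq> {}" for S
      using koszul_term_0_eq hi that unfolding 0 by blast
    have "lo j x \<in> koszul_term j (Suc 0)" using lo 0 by simp
    then have "koszul_diff j (lo j x) \<in> (\<lambda>v S. if S = {} then v else 0) ` image_upto j"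
      using koszul_diff_image by blast
    then obtain v where v: "v \<in> image_upto j" "koszul_diff j (lo j x) = (\<lambda>S. if S = {} then v else 0)"
      by blast
    have "koszul_diff j (lo j x) {} = v" by (simp add: v(2))
    with lo0[of "{}"] v(1) have "\<phi> j (hi j x {}) \<in> image_upto j" using image_upto_uminus[of v j] by simp
    then have "hi j x {} \<in> image_upto j"
      using Suc.prems(1)[of j] koszul_termD(1)[OF hi] by blast
    then have "(\<lambda>S. if S = {} then hi j x {} else 0) \<in> koszul_diff j ` koszul_term j (Suc 0)"
      unfolding koszul_diff_image by blast
    moreover have "(\<lambda>S. if S = {} then hi j x {} else 0) = hi j x" using x0 by auto
    ultimately show ?thesis using 0 by auto
  next
    case (Suc i')
    have "hi j x \<in> koszul_diff j ` koszul_term j (Suc (Suc i'))"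
      using Suc.IH[of "hi j x" i'] Suc.prems(1) hi hi0 unfolding Suc by auto
    then show ?thesis unfolding Suc by auto
  qed
  then obtain y1 where y1: "y1 \<in> koszul_term j (Suc i)" "koszul_diff j y1 = hi j x" by blast
  define z where "z = (\<lambda>S. lo j x S + \<phi> j (y1 S))"
  have z: "z \<in> koszul_term j (Suc i)"
    unfolding z_def by (intro koszul_term_add koszul_term_phi lo y1)
  have "koszul_diff j z = (\<lambda>S. 0)"
    unfolding z_def koszul_diff_add[OF lo koszul_term_phi[OF y1(1)]] koszul_diff_phi[OF y1(1)] y1(2) lo0 by simp
  with Suc.IH[OF _ z] Suc.prems(1) obtain y0 where y0: "y0 \<in> koszul_term j (Suc (Suc i))" "z = koszul_diff j y0"
    by auto
  have ny: "(\<lambda>S. - y1 S) \<in> koszul_term j (Suc i)" by (rule koszul_term_uminus[OF y1(1)])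
  have e1: "koszul_diff j (\<lambda>S. - y1 S) = (\<lambda>S. - hi j x S)" using koszul_diff_uminus[OF y1(1)] y1(2) by simp
  have "koszul_diff (Suc j) (join j y0 (\<lambda>S. - y1 S)) = join j (\<lambda>S. z S + \<phi> j (- y1 S)) (\<lambda>S. - (- hi j x S))"
    by (simp add: lo_join[OF y0(1)] hi_join[OF ny] e1 y0(2))
  also have "(\<lambda>S. z S + \<phi> j (- y1 S)) = lo j x"
    using koszul_termD(1)[OF y1(1)] by (simp add: z_def phi_uminus)
  finally have "koszul_diff (Suc j) (join j y0 (\<lambda>S. - y1 S)) = x" by (simp add: join_lo_hi)
  with join_term[OF y0(1) ny] show ?case by blast
qed

text \<open>Successive splittings \<open>G j = G (j + 1) \<oplus> \<phi> j (G j)\<close> with \<open>\<phi> j\<close> injective on \<open>G j\<close> make \<open>\<phi>\<close> a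
  regular sequence on \<open>F = G 0\<close> and identify the final quotient with \<open>G n\<close>.\<close>

lemma tower:
  assumes G0: "G 0 = F" and sub: "\<And>j. j < n \<Longrightarrow> G (Suc j) \<subseteq> G j"
    and diff: "\<And>j x y. x \<in> G j \<Longrightarrow> y \<in> G j \<Longrightarrow> x - y \<in> G j"
    and phi: "\<And>j x. j < n \<Longrightarrow> x \<in> G j \<Longrightarrow> \<phi> j x \<in> G j"
    and split: "\<And>j x. j < n \<Longrightarrow> x \<in> G j \<Longrightarrow> \<exists>g \<in> G (Suc j). \<exists>h \<in> G j. x = g + \<phi> j h"
    and inj: "\<And>j h. j < n \<Longrightarrow> h \<in> G j \<Longrightarrow> \<phi> j h \<in> G (Suc j) \<Longrightarrow> h = 0"
  shows tower_span: "j \<le> n \<Longrightarrow> x \<in> F \<Longrightarrow> \<exists>g \<in> G j. \<exists>i \<in> image_upto j. x = g + i"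
    and tower_indep: "j \<le> n \<Longrightarrow> x \<in> G j \<Longrightarrow> x \<in> image_upto j \<Longrightarrow> x = 0"
    and tower_regular: "j < n \<Longrightarrow> x \<in> F \<Longrightarrow> \<phi> j x \<in> image_upto j \<Longrightarrow> x \<in> image_upto j"
proof -
  have GF: "j \<le> n \<Longrightarrow> G j \<subseteq> F" for j
    by (induction j) (use G0 sub in \<open>auto simp: Suc_le_eq\<close>)
  have span: "j \<le> n \<Longrightarrow> x \<in> F \<Longrightarrow> \<exists>g \<in> G j. \<exists>i \<in> image_upto j. x = g + i" for j x
  proof (induction j)
    case 0
    then show ?case using G0 by auto
  next
    case (Suc j)
    then obtain g i where gi: "g \<in> G j" "i \<in> image_upto j" "x = g + i" by auto
    obtain g' h where g': "g' \<in> G (Suc j)" "h \<in> G j" "g = g' + \<phi> j h" using split[of j g] Suc.prems gi by auto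
    have "i + \<phi> j h \<in> image_upto (Suc j)" using gi g' GF[of j] Suc.prems by auto
    moreover have "x = g' + (i + \<phi> j h)" using gi g' by simp
    ultimately show ?case using g' by blast
  qed
  have indep: "j \<le> n \<Longrightarrow> x \<in> G j \<Longrightarrow> x \<in> image_upto j \<Longrightarrow> x = 0" for j x
  proof (induction j arbitrary: x)
    case (Suc j)
    then obtain u v where uv: "u \<in> image_upto j" "v \<in> F" "x = u + \<phi> j v" by auto
    obtain g i where gi: "g \<in> G j" "i \<in> image_upto j" "v = g + i" using span[of j v] uv Suc.prems by auto
    have c: "g \<in> F" "i \<in> F" using gi GF[of j] Suc.prems image_upto_closed by auto
    \<comment> \<open>Writing v = g + i, the contribution \<phi> j i already lies in
      \<open>image_upto j\<close>. What remains, x - \<phi> j g, lies in G j and in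
      \<open>image_upto j\<close>, so it vanishes by induction, and then x = \<phi> j g is excluded
      by the directness of the splitting.\<close>
    have "x - \<phi> j g = u + \<phi> j i" using uv gi c by (simp add: phi_add)
    moreover have "u + \<phi> j i \<in> image_upto j" using uv gi image_upto_add image_upto_phi by blast
    moreover have "x - \<phi> j g \<in> G j" using diff sub[of j] phi[of j g] gi Suc.prems by (meson Suc_le_lessD subsetD)
    ultimately have "x - \<phi> j g = 0" using Suc.IH[of "x - \<phi> j g"] Suc.prems(1) by simp
    then have x: "x = \<phi> j g" by simp
    then have "g = 0" using inj[of j g] gi Suc.prems by simp
    with x show ?case by simp
  qed simp
  show "j \<le> n \<Longrightarrow> x \<in> F \<Longrightarrow> \<exists>g \<in> G j. \<exists>i \<in> image_upto j. x = g + i" by (rule span)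
  show "j \<le> n \<Longrightarrow> x \<in> G j \<Longrightarrow> x \<in> image_upto j \<Longrightarrow> x = 0" by (rule indep)
  assume j: "j < n" and x: "x \<in> F" "\<phi> j x \<in> image_upto j"
  obtain g i where gi: "g \<in> G j" "i \<in> image_upto j" "x = g + i" using span[of j x] j x by auto
  have c: "g \<in> F" "i \<in> F" using gi GF[of j] j image_upto_closed by auto
  have "\<phi> j g = \<phi> j x + - \<phi> j i" using gi c by (simp add: phi_add)
  also have "\<dots> \<in> image_upto j" using x gi image_upto_add image_upto_uminus image_upto_phi by blast
  finally have "\<phi> j g = 0" using indep[of j "\<phi> j g"] phi[of j g] gi j by simp
  moreover have "0 \<in> G (Suc j)"
  proof -
    obtain g' where "g' \<in> G (Suc j)" using split[OF j gi(1)] by blast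
    from diff[OF this this] show ?thesis by simp
  qed
  ultimately have "g = 0" using inj[of j g] gi j by simp
  with gi show "x \<in> image_upto j" by simp
qed

end

section \<open>Rings whose operations are those of a type class\<close>

text \<open>Connects ideal theory relative to a carrier with type-class arithmetic. The carrier may
  be a proper subring of the type, as for polynomials in a subset of the variables.\<close>

locale typeclass_ring = cring R for R :: "'a::comm_ring_1 ring" (structure) +
  assumes mult_eq [simp]: "mult R = (*)" and add_eq [simp]: "add R = (+)"
    and one_eq [simp]: "one R = 1" and zero_eq [simp]: "zero R = 0"
begin

lemma a_inv_eq: "x \<in> carrier R \<Longrightarrow> \<ominus> x = - x"
  using l_neg[of x] by (simp add: eq_neg_iff_add_eq_0)

lemma a_minus_eq: "x \<in> carrier R \<Longrightarrow> y \<in> carrier R \<Longrightarrow> x \<ominus> y = x - y"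
  by (simp add: a_minus_def a_inv_eq)

lemma closed [simp, intro]:
  "0 \<in> carrier R" "1 \<in> carrier R"
  "x \<in> carrier R \<Longrightarrow> y \<in> carrier R \<Longrightarrow> x + y \<in> carrier R"
  "x \<in> carrier R \<Longrightarrow> y \<in> carrier R \<Longrightarrow> x * y \<in> carrier R"
  "x \<in> carrier R \<Longrightarrow> - x \<in> carrier R"
  "x \<in> carrier R \<Longrightarrow> y \<in> carrier R \<Longrightarrow> x - y \<in> carrier R"
  using zero_closed one_closed a_closed[of x y] m_closed[of x y] a_inv_closed[of x]
    minus_closed[of x y] a_inv_eq[of x] a_minus_eq[of x y]
  by auto

lemma power_closed [simp, intro]: "x \<in> carrier R \<Longrightarrow> x ^ k \<in> carrier R"
  by (induction k) auto

lemma sum_closed: "(\<And>i. i \<in> A \<Longrightarrow> f i \<in> carrier R) \<Longrightarrow> sum f A \<in> carrier R"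
  by (induction A rule: infinite_finite_induct) auto

lemma prod_closed: "(\<And>i. i \<in> A \<Longrightarrow> f i \<in> carrier R) \<Longrightarrow> prod f A \<in> carrier R"
  by (induction A rule: infinite_finite_induct) auto

lemma nat_pow_eq: "x [^] (k::nat) = x ^ k"
  by (induction k) (simp_all add: mult.commute)

lemma ideal_subset_closed:
  assumes "ideal J R"
  shows ideal_carrier: "x \<in> J \<Longrightarrow> x \<in> carrier R"
    and ideal_zero: "0 \<in> J"
    and ideal_add: "x \<in> J \<Longrightarrow> y \<in> J \<Longrightarrow> x + y \<in> J"
    and ideal_uminus: "x \<in> J \<Longrightarrow> - x \<in> J"
    and ideal_diff: "x \<in> J \<Longrightarrow> y \<in> J \<Longrightarrow> x - y \<in> J"
    and ideal_mult: "r \<in> carrier R \<Longrightarrow> x \<in> J \<Longrightarrow> r * x \<in> J"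
proof -
  interpret J: ideal J R by fact
  show *: "x \<in> J \<Longrightarrow> x \<in> carrier R" for x by (rule J.a_Hcarr)
  show "0 \<in> J" using J.zero_closed by simp
  show "x \<in> J \<Longrightarrow> y \<in> J \<Longrightarrow> x + y \<in> J" using J.a_closed[of x y] by simp
  show **: "x \<in> J \<Longrightarrow> - x \<in> J" for x using J.a_inv_closed[of x] a_inv_eq[OF *, of x] by simp
  show "x \<in> J \<Longrightarrow> y \<in> J \<Longrightarrow> x - y \<in> J" using J.a_closed[of x "- y"] **[of y] by simp
  show "r \<in> carrier R \<Longrightarrow> x \<in> J \<Longrightarrow> r * x \<in> J" using J.I_l_closed[of x r] by simp
qed

lemma ideal_sum:
  assumes "ideal J R" and "\<And>i. i \<in> A \<Longrightarrow> f i \<in> J"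
  shows "sum f A \<in> J"
  using assms(2)
  by (induction A rule: infinite_finite_induct) (auto simp: ideal_zero[OF assms(1)] ideal_add[OF assms(1)])

lemma idealI':
  assumes "J \<subseteq> carrier R" "0 \<in> J" "\<And>x y. x \<in> J \<Longrightarrow> y \<in> J \<Longrightarrow> x + y \<in> J"
    and mult: "\<And>r x. r \<in> carrier R \<Longrightarrow> x \<in> J \<Longrightarrow> r * x \<in> J"
  shows "ideal J R"
proof (rule idealI[OF ring_axioms])
  show "subgroup J (add_monoid R)"
  proof (rule add.subgroupI)
    fix a assume a: "a \<in> J"
    with assms(1) have c: "a \<in> carrier R" by auto
    show "\<ominus> a \<in> J" using mult[OF _ a, of "- 1"] by (simp add: a_inv_eq[OF c])
  qed (use assms(1-3) in auto)
next
  fix a x assume "a \<in> J" "x \<in> carrier R"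
  then have "x * a \<in> J" by (intro mult)
  then show "x \<otimes> a \<in> J" "a \<otimes> x \<in> J" by (simp_all add: ac_simps)
qed

lemma quotient_module_simps:
  assumes J: "ideal J R"
  shows carrier_quotient_module: "carrier (quotient_module R J) = (\<lambda>r. J +> r) ` carrier R"
    and coset_eq_iff: "a \<in> carrier R \<Longrightarrow> b \<in> carrier R \<Longrightarrow> J +> a = J +> b \<longleftrightarrow> a - b \<in> J"
    and zero_quotient_module: "zero (quotient_module R J) = J +> 0"
    and add_quotient_module: "a \<in> carrier R \<Longrightarrow> b \<in> carrier R \<Longrightarrow>
      add (quotient_module R J) (J +> a) (J +> b) = J +> (a + b)"
    and smult_quotient_module: "a \<in> carrier R \<Longrightarrow> b \<in> carrier R \<Longrightarrow>
      smult (quotient_module R J) a (J +> b) = J +> (a * b)"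
proof -
  interpret J: ideal J R by fact
  show "carrier (quotient_module R J) = (\<lambda>r. J +> r) ` carrier R"
    by (auto simp: quotient_module_def FactRing_def A_RCOSETS_def')
  show "a \<in> carrier R \<Longrightarrow> b \<in> carrier R \<Longrightarrow> J +> a = J +> b \<longleftrightarrow> a - b \<in> J"
    using quotient_eq_iff_same_a_r_cos[OF J, of a b] by (simp add: a_minus_eq)
  show "zero (quotient_module R J) = J +> 0"
    using a_rcos_zero[OF J, of 0] J.zero_closed by (simp add: quotient_module_def FactRing_def)
  show "a \<in> carrier R \<Longrightarrow> b \<in> carrier R \<Longrightarrow>
      add (quotient_module R J) (J +> a) (J +> b) = J +> (a + b)"
    by (simp add: quotient_module_def FactRing_def J.a_rcos_sum)
  show "a \<in> carrier R \<Longrightarrow> b \<in> carrier R \<Longrightarrow>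
      smult (quotient_module R J) a (J +> b) = J +> (a * b)"
    using ring_hom_mult[OF J.rcos_ring_hom, of a b] by (simp add: quotient_module_def)
qed

end

section \<open>Koszul resolutions relative to a subring\<close>

definition scale :: "'a::comm_ring_1 \<Rightarrow> ('b \<Rightarrow>\<^sub>0 'a) \<Rightarrow> ('b \<Rightarrow>\<^sub>0 'a)" where
  "scale r a = Poly_Mapping.map ((*) r) a"

lemma lookup_scale [simp]: "Poly_Mapping.lookup (scale r a) b = r * Poly_Mapping.lookup a b"
  unfolding scale_def by transfer (simp add: when_def)

lemma scale_simps:
  "scale r (a + b) = scale r a + scale r b" "scale (r + s) a = scale r a + scale s a"
  "scale r (scale s a) = scale (r * s) a" "scale r 0 = 0" "scale 0 a = 0" "scale 1 a = a"
  "scale r (- a) = - scale r a" "scale r (a - b) = scale r a - scale r b"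
  by (rule poly_mapping_eqI; simp add: lookup_add lookup_minus algebra_simps)+

lemma scale_sum: "scale r (sum f A) = (\<Sum>i\<in>A. scale r (f i))"
  by (induction A rule: infinite_finite_induct) (simp_all add: scale_simps)

text \<open>Matrix times vector, for matrices with finitely supported columns \<open>L b\<close>.
  Coordinate vectors are finitely supported maps on a basis that may be infinite;
  \<open>eval_comb\<close> turns them into ring elements.\<close>

definition lin_ext :: "('b \<Rightarrow> 'c \<Rightarrow>\<^sub>0 'a) \<Rightarrow> ('b \<Rightarrow>\<^sub>0 'a::comm_ring_1) \<Rightarrow> ('c \<Rightarrow>\<^sub>0 'a)" where
  "lin_ext L a = (\<Sum>b\<in>Poly_Mapping.keys a. scale (Poly_Mapping.lookup a b) (L b))"

definition eval_comb :: "('b \<Rightarrow> 'a) \<Rightarrow> ('b \<Rightarrow>\<^sub>0 'a::comm_ring_1) \<Rightarrow> 'a" where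
  "eval_comb v a = (\<Sum>b\<in>Poly_Mapping.keys a. Poly_Mapping.lookup a b * v b)"

lemma lin_ext_superset:
  assumes "finite U" "Poly_Mapping.keys a \<subseteq> U"
  shows "lin_ext L a = (\<Sum>b\<in>U. scale (Poly_Mapping.lookup a b) (L b))"
  unfolding lin_ext_def using assms
  by (intro sum.mono_neutral_left) (auto simp: scale_simps in_keys_iff)

lemma eval_comb_superset:
  assumes "finite U" "Poly_Mapping.keys a \<subseteq> U"
  shows "eval_comb v a = (\<Sum>b\<in>U. Poly_Mapping.lookup a b * v b)"
  unfolding eval_comb_def using assms
  by (intro sum.mono_neutral_left) (auto simp: in_keys_iff)

lemma lin_ext_add: "lin_ext L (a + b) = lin_ext L a + lin_ext L b"
proof -
  let ?U = "Poly_Mapping.keys a \<union> Poly_Mapping.keys b"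
  have "lin_ext L (a + b) = (\<Sum>c\<in>?U. scale (Poly_Mapping.lookup (a + b) c) (L c))"
    by (rule lin_ext_superset) (use Poly_Mapping.keys_add[of a b] in auto)
  also have "\<dots> = lin_ext L a + lin_ext L b"
    using lin_ext_superset[of ?U a L] lin_ext_superset[of ?U b L]
    by (simp add: lookup_add scale_simps sum.distrib)
  finally show ?thesis .
qed

lemma eval_comb_add: "eval_comb v (a + b) = eval_comb v a + eval_comb v b"
proof -
  let ?U = "Poly_Mapping.keys a \<union> Poly_Mapping.keys b"
  have "eval_comb v (a + b) = (\<Sum>c\<in>?U. Poly_Mapping.lookup (a + b) c * v c)"
    by (rule eval_comb_superset) (use Poly_Mapping.keys_add[of a b] in auto)
  also have "\<dots> = eval_comb v a + eval_comb v b"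
    using eval_comb_superset[of ?U a v] eval_comb_superset[of ?U b v]
    by (simp add: lookup_add algebra_simps sum.distrib)
  finally show ?thesis .
qed

lemma keys_scale: "Poly_Mapping.keys (scale r a) \<subseteq> Poly_Mapping.keys a"
  by (auto simp: in_keys_iff)

lemma lin_ext_scale: "lin_ext L (scale r a) = scale r (lin_ext L a)"
  using lin_ext_superset[OF finite_keys keys_scale, of L r a]
  by (simp add: lin_ext_def scale_sum scale_simps)

lemma eval_comb_scale: "eval_comb v (scale r a) = r * eval_comb v a"
  using eval_comb_superset[OF finite_keys keys_scale, of v r a]
  by (simp add: eval_comb_def sum_distrib_left mult.assoc)

lemma eval_comb_0 [simp]: "eval_comb v 0 = 0"
  by (simp add: eval_comb_def)

lemma eval_comb_uminus: "eval_comb v (- a) = - eval_comb v a"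
  using eval_comb_add[of v a "- a"] by (simp add: eq_neg_iff_add_eq_0 add.commute)

lemma eval_comb_diff: "eval_comb v (a - b) = eval_comb v a - eval_comb v b"
  using eval_comb_add[of v a "- b"] by (simp add: eval_comb_uminus)

lemma eval_comb_sum: "eval_comb v (sum f A) = (\<Sum>i\<in>A. eval_comb v (f i))"
  by (induction A rule: infinite_finite_induct) (simp_all add: eval_comb_add)

lemma eval_comb_lin_ext: "eval_comb v (lin_ext L a) = (\<Sum>b\<in>Poly_Mapping.keys a. Poly_Mapping.lookup a b * eval_comb v (L b))"
  by (simp add: lin_ext_def eval_comb_sum eval_comb_scale)

lemma eval_comb_single [simp]: "eval_comb v (Poly_Mapping.single b r) = r * v b"
  using eval_comb_superset[of "{b}" "Poly_Mapping.single b r" v] by (simp add: lookup_single)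

definition pm_over :: "'b set \<Rightarrow> 'a set \<Rightarrow> ('b \<Rightarrow>\<^sub>0 'a::zero) set" where
  "pm_over B C = {a. Poly_Mapping.keys a \<subseteq> B \<and> (\<forall>b. Poly_Mapping.lookup a b \<in> C)}"

text \<open>\<open>R\<close> is, along the chain \<open>R = C 0 \<supseteq> \<dots> \<supseteq> C n = A\<close>, an iterated polynomial ring with
  \<open>C j = C (j + 1)[y j]\<close>, and \<open>D j k\<close> are the polynomials of degree at most \<open>k\<close> in \<open>y j\<close>;
  \<open>R / J\<close> is a free \<open>A\<close>-module with basis \<open>v\<close> indexed by \<open>B\<close>.\<close>

locale relative_polynomial_ring = typeclass_ring R for R :: "'a::comm_ring_1 ring" (structure) +
  fixes n :: nat and y :: "nat \<Rightarrow> 'a" and C :: "nat \<Rightarrow> 'a set" and D :: "nat \<Rightarrow> nat \<Rightarrow> 'a set"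
    and J :: "'a set" and B :: "'b set" and v :: "'b \<Rightarrow> 'a"
  assumes y: "y j \<in> carrier R"
    and C0: "C 0 = carrier R" and C_Suc: "j < n \<Longrightarrow> C (Suc j) \<subseteq> C j"
    and C_zero: "0 \<in> C j" and C_diff: "a \<in> C j \<Longrightarrow> b \<in> C j \<Longrightarrow> a - b \<in> C j"
    and C_mult: "a \<in> C j \<Longrightarrow> b \<in> C j \<Longrightarrow> a * b \<in> C j" and C_one: "1 \<in> C n"
    and C_y: "j < n \<Longrightarrow> a \<in> C j \<Longrightarrow> y j * a \<in> C j"
    and D_0: "j < n \<Longrightarrow> D j 0 = C (Suc j)" and D_sub: "D j k \<subseteq> D j (Suc k)"
    and D_C: "j < n \<Longrightarrow> D j k \<subseteq> C j" and C_D: "j < n \<Longrightarrow> a \<in> C j \<Longrightarrow> \<exists>k. a \<in> D j k"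
    and D_diff: "a \<in> D j k \<Longrightarrow> b \<in> D j k \<Longrightarrow> a - b \<in> D j k"
    and D_mult: "j < n \<Longrightarrow> a \<in> C n \<Longrightarrow> b \<in> D j k \<Longrightarrow> a * b \<in> D j k"
    and D_split: "j < n \<Longrightarrow> a \<in> D j (Suc k) \<Longrightarrow> \<exists>b \<in> D j k. \<exists>c \<in> C (Suc j). a = y j * b + c"
    and D_cancel: "j < n \<Longrightarrow> a \<in> C j \<Longrightarrow> y j * a \<in> D j (Suc k) \<Longrightarrow> a \<in> D j k"
    and D_cancel_0: "j < n \<Longrightarrow> a \<in> C j \<Longrightarrow> y j * a \<in> D j 0 \<Longrightarrow> a = 0"
    and J: "ideal J R" and v: "\<beta> \<in> B \<Longrightarrow> v \<beta> \<in> carrier R"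
    and basis_span: "r \<in> carrier R \<Longrightarrow> \<exists>\<alpha> \<in> pm_over B (C n). r - eval_comb v \<alpha> \<in> J"
    and basis_indep: "\<alpha> \<in> pm_over B (C n) \<Longrightarrow> eval_comb v \<alpha> \<in> J \<Longrightarrow> \<alpha> = 0"
begin

abbreviation "F \<equiv> pm_over B (carrier R)"

lemma pm_over_zero: "0 \<in> Z \<Longrightarrow> 0 \<in> pm_over B Z"
  by (simp add: pm_over_def)

lemma pm_over_diff:
  assumes "\<And>a b. a \<in> Z \<Longrightarrow> b \<in> Z \<Longrightarrow> a - b \<in> Z" and "a \<in> pm_over B Z" "b \<in> pm_over B Z"
  shows "a - b \<in> pm_over B (Z :: 'a set)"
proof -
  have "Poly_Mapping.keys (a - b) \<subseteq> Poly_Mapping.keys a \<union> Poly_Mapping.keys b"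
    by (auto simp: in_keys_iff lookup_minus)
  then show ?thesis using assms by (auto simp: pm_over_def lookup_minus)
qed

lemma pm_over_scale:
  assumes "\<And>a. a \<in> Z \<Longrightarrow> r * a \<in> Z'" and "a \<in> pm_over B Z"
  shows "scale r a \<in> pm_over B (Z' :: 'a set)"
  using assms keys_scale[of r a] by (auto simp: pm_over_def)

lemma pm_over_mono: "Z \<subseteq> Z' \<Longrightarrow> pm_over B Z \<subseteq> pm_over B Z'"
  by (auto simp: pm_over_def)

lemma pm_over_lin_ext:
  assumes zero: "0 \<in> Z" and diff: "\<And>a b. a \<in> Z \<Longrightarrow> b \<in> Z \<Longrightarrow> a - b \<in> Z"
    and mult: "\<And>a b. a \<in> Z' \<Longrightarrow> b \<in> C' \<Longrightarrow> a * b \<in> Z"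
    and a: "a \<in> pm_over B Z'" and L: "\<And>b. b \<in> B \<Longrightarrow> L b \<in> pm_over B' C'"
  shows "lin_ext L a \<in> pm_over B' (Z :: 'a set)"
proof -
  have add: "a + b \<in> Z" if "a \<in> Z" "b \<in> Z" for a b
    using diff[OF that(1) diff[OF zero that(2)]] by simp
  have sum: "sum f A \<in> Z" if "\<And>i. i \<in> A \<Longrightarrow> f i \<in> Z" for f and A :: "'b set"
    using that by (induction A rule: infinite_finite_induct) (auto simp: zero add)
  have "Poly_Mapping.lookup (lin_ext L a) c \<in> Z" for c
    unfolding lin_ext_def lookup_sum lookup_scale
    by (rule sum, rule mult) (use a L in \<open>auto simp: pm_over_def\<close>)
  moreover have "Poly_Mapping.keys (lin_ext L a) \<subseteq> B'"
  proof
    fix c assume "c \<in> Poly_Mapping.keys (lin_ext L a)"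
    then have "(\<Sum>b\<in>Poly_Mapping.keys a. Poly_Mapping.lookup a b * Poly_Mapping.lookup (L b) c) \<noteq> 0"
      by (simp add: in_keys_iff lin_ext_def lookup_sum)
    then obtain b where "b \<in> Poly_Mapping.keys a" "Poly_Mapping.lookup (L b) c \<noteq> 0"
      by (metis (no_types, lifting) mult_zero_right sum.not_neutral_contains_not_neutral)
    then have "b \<in> B" "c \<in> Poly_Mapping.keys (L b)" using a by (auto simp: pm_over_def in_keys_iff)
    then show "c \<in> B'" using L[of b] by (auto simp: pm_over_def)
  qed
  ultimately show ?thesis by (simp add: pm_over_def)
qed

lemma C_carrier: "j \<le> n \<Longrightarrow> C j \<subseteq> carrier R"
  by (induction j) (use C0 C_Suc in \<open>auto simp: Suc_le_eq\<close>)

lemma C_antimono: "i \<le> j \<Longrightarrow> j \<le> n \<Longrightarrow> C j \<subseteq> C i"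
  by (induction j rule: dec_induct) (use C_Suc in \<open>auto simp: Suc_le_eq\<close>)

lemma D_mono: "k \<le> l \<Longrightarrow> D j k \<subseteq> D j l"
  by (induction l rule: dec_induct) (use D_sub in auto)

lemma D_zero: "j < n \<Longrightarrow> 0 \<in> D j k"
  using D_mono[of 0 k j] D_0 C_zero by auto

lemma eval_comb_closed: "a \<in> F \<Longrightarrow> eval_comb v a \<in> carrier R"
  unfolding eval_comb_def by (rule sum_closed) (use v in \<open>auto simp: pm_over_def\<close>)

section \<open>The operators "variable minus matrix"\<close>

lemma multiplication_matrix: "\<exists>L. \<forall>b \<in> B. \<forall>j. L j b \<in> pm_over B (C n) \<and> y j * v b - eval_comb v (L j b) \<in> J"
proof -
  have "\<forall>j b. \<exists>a. b \<in> B \<longrightarrow> a \<in> pm_over B (C n) \<and> y j * v b - eval_comb v a \<in> J"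
    using basis_span y v by (metis closed(4))
  then show ?thesis by metis
qed

definition L :: "nat \<Rightarrow> 'b \<Rightarrow> ('b \<Rightarrow>\<^sub>0 'a)" where
  "L = (SOME L. \<forall>b \<in> B. \<forall>j. L j b \<in> pm_over B (C n) \<and> y j * v b - eval_comb v (L j b) \<in> J)"

lemma L: "b \<in> B \<Longrightarrow> L j b \<in> pm_over B (C n)" "b \<in> B \<Longrightarrow> y j * v b - eval_comb v (L j b) \<in> J"
  using someI_ex[OF multiplication_matrix] unfolding L_def by blast+

text \<open>Write A for C n. Then \<open>F\<close> is the tensor product over A of R with R/J, and
  \<phi> j is the difference of the two actions of y j: on the left factor, and on R/J through the
  matrix \<open>L j\<close>. Dividing \<open>F\<close> by the images of all \<phi> j identifies the
  two actions and leaves R/J.\<close>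

definition \<phi> :: "nat \<Rightarrow> ('b \<Rightarrow>\<^sub>0 'a) \<Rightarrow> ('b \<Rightarrow>\<^sub>0 'a)" where
  "\<phi> j a = scale (y j) a - lin_ext (L j) a"

lemma lin_ext_L:
  assumes "0 \<in> Z" "\<And>a b. a \<in> Z \<Longrightarrow> b \<in> Z \<Longrightarrow> a - b \<in> Z" "\<And>a b. a \<in> C n \<Longrightarrow> b \<in> Z \<Longrightarrow> a * b \<in> Z"
    and "a \<in> pm_over B Z"
  shows "lin_ext (L j) a \<in> pm_over B Z"
proof (rule pm_over_lin_ext[OF assms(1,2) _ assms(4) L(1)])
  show "a * b \<in> Z" if "a \<in> Z" "b \<in> C n" for a b
    using assms(3)[OF that(2,1)] by (simp add: mult.commute)
qed

lemma lin_ext_L_F: "a \<in> F \<Longrightarrow> lin_ext (L j) a \<in> F"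
  by (rule lin_ext_L) (use C_carrier[of n] in auto)

lemma eval_lin_ext_L:
  assumes "a \<in> F"
  shows "y j * eval_comb v a - eval_comb v (lin_ext (L j) a) \<in> J"
proof -
  have "y j * eval_comb v a - eval_comb v (lin_ext (L j) a)
    = (\<Sum>b\<in>Poly_Mapping.keys a. Poly_Mapping.lookup a b * (y j * v b - eval_comb v (L j b)))"
    unfolding eval_comb_lin_ext
    by (simp add: eval_comb_def[of v a] sum_distrib_left algebra_simps sum_subtractf)
  also have "\<dots> \<in> J"
    by (rule ideal_sum[OF J], rule ideal_mult[OF J]) (use assms L in \<open>auto simp: pm_over_def\<close>)
  finally show ?thesis .
qed

lemma eval_phi: "a \<in> F \<Longrightarrow> eval_comb v (\<phi> j a) \<in> J"
  using eval_lin_ext_L by (simp add: \<phi>_def eval_comb_diff eval_comb_scale)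

lemma pm_over_F: "j \<le> n \<Longrightarrow> a \<in> pm_over B (C j) \<Longrightarrow> a \<in> F"
  using C_carrier[of j] pm_over_mono[of "C j" "carrier R"] by auto

text \<open>Both composites are coordinate vectors of y i * y j * v b modulo J, and coordinates over
  the subring C n are unique.\<close>

lemma lin_ext_L_commute_basis:
  assumes "b \<in> B"
  shows "lin_ext (L i) (L j b) = lin_ext (L j) (L i b)"
proof -
  have c: "lin_ext (L i) (L j b) \<in> pm_over B (C n)" for i j
    by (rule lin_ext_L) (use C_zero C_diff C_mult L assms in auto)
  have e: "y i * (y j * v b) - eval_comb v (lin_ext (L i) (L j b)) \<in> J" for i j
  proof -
    have "y i * (y j * v b - eval_comb v (L j b)) \<in> J"
      by (rule ideal_mult[OF J y L(2)[OF assms]])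
    from ideal_add[OF J this eval_lin_ext_L[OF pm_over_F[OF order_refl L(1)[OF assms]], of i j]]
    show ?thesis by (simp add: algebra_simps)
  qed
  have "eval_comb v (lin_ext (L i) (L j b) - lin_ext (L j) (L i b)) \<in> J"
    using ideal_diff[OF J e[of j i] e[of i j]] by (simp add: eval_comb_diff algebra_simps)
  moreover have "lin_ext (L i) (L j b) - lin_ext (L j) (L i b) \<in> pm_over B (C n)"
    using c C_diff by (intro pm_over_diff) auto
  ultimately have "lin_ext (L i) (L j b) - lin_ext (L j) (L i b) = 0" using basis_indep by blast
  then show ?thesis by simp
qed

lemma lin_ext_0: "lin_ext K 0 = 0"
  by (simp add: lin_ext_def)

lemma lin_ext_sum: "lin_ext K (sum f A) = (\<Sum>i\<in>A. lin_ext K (f i))"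
  by (induction A rule: infinite_finite_induct) (simp_all add: lin_ext_add lin_ext_0)

lemma lin_ext_uminus: "lin_ext K (- a) = - lin_ext K a"
  using lin_ext_add[of K a "- a"] by (simp add: eq_neg_iff_add_eq_0 add.commute lin_ext_0)

lemma lin_ext_diff: "lin_ext K (a - b) = lin_ext K a - lin_ext K b"
  using lin_ext_add[of K a "- b"] by (simp add: lin_ext_uminus)

lemma lin_ext_L_commute:
  assumes "a \<in> F"
  shows "lin_ext (L i) (lin_ext (L j) a) = lin_ext (L j) (lin_ext (L i) a)"
  using assms unfolding lin_ext_def[of _ a] lin_ext_sum lin_ext_scale
  by (intro sum.cong refl) (auto simp: lin_ext_L_commute_basis pm_over_def)

lemma phi_scale: "\<phi> j (scale r a) = scale r (\<phi> j a)"
  by (simp add: \<phi>_def lin_ext_scale scale_simps mult.commute)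

sublocale K: commuting_endomorphisms F \<phi>
proof
  show "0 \<in> F" by (rule pm_over_zero) simp
  show "x - y \<in> F" if "x \<in> F" "y \<in> F" for x y
    using that by (intro pm_over_diff) auto
  show "\<phi> j x \<in> F" if "x \<in> F" for j x
    unfolding \<phi>_def
    by (rule pm_over_diff[OF _ _ lin_ext_L_F[OF that]], simp, rule pm_over_scale[OF _ that]) (use y in auto)
  show "\<phi> j (x + y) = \<phi> j x + \<phi> j y" for x y j
    by (simp add: \<phi>_def lin_ext_add scale_simps)
  show "\<phi> i (\<phi> j x) = \<phi> j (\<phi> i x)" if "x \<in> F" for i j x
    using lin_ext_L_commute[OF that, of i j]
    by (simp add: \<phi>_def lin_ext_diff lin_ext_scale scale_simps mult.commute)
qed

lemma phi_preserves: "j < n \<Longrightarrow> a \<in> pm_over B (C j) \<Longrightarrow> \<phi> j a \<in> pm_over B (C j)"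
  unfolding \<phi>_def
  by (rule pm_over_diff[OF C_diff], assumption+, rule pm_over_scale[OF C_y], assumption+, rule lin_ext_L)
     (use C_zero C_diff C_mult C_antimono[of j n] in auto)

lemma lin_ext_L_D: "j < n \<Longrightarrow> a \<in> pm_over B (D j k) \<Longrightarrow> lin_ext (L j) a \<in> pm_over B (D j k)"
  by (rule lin_ext_L) (use D_zero D_diff D_mult in auto)

lemma pm_over_add:
  assumes "0 \<in> Z" "\<And>a b. a \<in> Z \<Longrightarrow> b \<in> Z \<Longrightarrow> a - b \<in> Z" "a \<in> pm_over B Z" "b \<in> pm_over B Z"
  shows "a + b \<in> pm_over B (Z :: 'a set)"
  using pm_over_diff[OF assms(2) assms(3) pm_over_diff[OF assms(2) pm_over_zero[OF assms(1)] assms(4)]] by simp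

lemma pm_over_D:
  assumes "j < n" "a \<in> pm_over B (C j)"
  shows "\<exists>k. a \<in> pm_over B (D j k)"
proof -
  have "\<exists>k. \<forall>b\<in>U. Poly_Mapping.lookup a b \<in> D j k" if "finite U" for U
    using that
  proof (induction U rule: finite_induct)
    case (insert b U)
    then obtain k where "\<forall>b\<in>U. Poly_Mapping.lookup a b \<in> D j k" by blast
    moreover obtain l where "Poly_Mapping.lookup a b \<in> D j l"
      using C_D[OF assms(1), of "Poly_Mapping.lookup a b"] assms(2) by (auto simp: pm_over_def)
    ultimately have "\<forall>b\<in>insert b U. Poly_Mapping.lookup a b \<in> D j (max k l)"
      using D_mono[of k "max k l" j] D_mono[of l "max k l" j] by auto
    then show ?case by blast
  qed auto
  from this[OF finite_keys] obtain k where k: "\<forall>b\<in>Poly_Mapping.keys a. Poly_Mapping.lookup a b \<in> D j k" by blast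
  then have "Poly_Mapping.lookup a b \<in> D j k" for b
    using D_zero[OF assms(1)] by (cases "b \<in> Poly_Mapping.keys a") (auto simp: in_keys_iff)
  then show ?thesis using assms(2) by (auto simp: pm_over_def)
qed

lemma pm_over_D_split:
  assumes j: "j < n" and a: "a \<in> pm_over B (D j (Suc k))"
  shows "\<exists>b \<in> pm_over B (D j k). \<exists>c \<in> pm_over B (C (Suc j)). a = scale (y j) b + c"
proof -
  \<comment> \<open>Outside the support of \<open>a\<close> both parts of the splitting are chosen
    to be zero, so that they define finitely supported vectors.\<close>
  have "\<exists>r s. r \<in> D j k \<and> s \<in> C (Suc j) \<and> Poly_Mapping.lookup a b = y j * r + s \<and>
      (b \<notin> Poly_Mapping.keys a \<longrightarrow> r = 0 \<and> s = 0)" for b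
  proof (cases "b \<in> Poly_Mapping.keys a")
    case True
    have "Poly_Mapping.lookup a b \<in> D j (Suc k)" using a by (simp add: pm_over_def)
    from D_split[OF j this] True show ?thesis by blast
  next
    case False
    then show ?thesis using D_zero[OF j] C_zero by (intro exI[of _ 0]) (auto simp: in_keys_iff)
  qed
  then obtain r s where rs: "\<And>b. r b \<in> D j k" "\<And>b. s b \<in> C (Suc j)"
    "\<And>b. Poly_Mapping.lookup a b = y j * r b + s b"
    "\<And>b. b \<notin> Poly_Mapping.keys a \<Longrightarrow> r b = 0" "\<And>b. b \<notin> Poly_Mapping.keys a \<Longrightarrow> s b = 0"
    by metis
  have "finite {b. r b \<noteq> 0}" "finite {b. s b \<noteq> 0}"
    by (rule finite_subset[OF _ finite_keys[of a]]; use rs(4,5) in blast)+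
  then have l: "Poly_Mapping.lookup (Abs_poly_mapping r) = r" "Poly_Mapping.lookup (Abs_poly_mapping s) = s"
    by simp_all
  have "Poly_Mapping.keys (Abs_poly_mapping r) \<subseteq> B" "Poly_Mapping.keys (Abs_poly_mapping s) \<subseteq> B"
  proof -
    have "x \<in> Poly_Mapping.keys a" if "r x \<noteq> 0 \<or> s x \<noteq> 0" for x using rs(4,5)[of x] that by blast
    then show "Poly_Mapping.keys (Abs_poly_mapping r) \<subseteq> B" "Poly_Mapping.keys (Abs_poly_mapping s) \<subseteq> B"
      using a by (auto simp: pm_over_def in_keys_iff[of _ "Abs_poly_mapping _"] l)
  qed
  then have "Abs_poly_mapping r \<in> pm_over B (D j k)" "Abs_poly_mapping s \<in> pm_over B (C (Suc j))"
    using rs(1,2) by (auto simp: pm_over_def l)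
  moreover have "a = scale (y j) (Abs_poly_mapping r) + Abs_poly_mapping s"
    by (rule poly_mapping_eqI) (simp add: lookup_add l rs(3))
  ultimately show ?thesis by blast
qed

text \<open>Division with remainder by an operator that is monic in y j. The entries of
  \<open>L j\<close> do not involve y j, so replacing y j * b by \<open>lin_ext (L j) b\<close>
  costs \<phi> j b and lowers the degree in y j by one.\<close>

lemma phi_split:
  assumes "j < n" "a \<in> pm_over B (C j)"
  shows "\<exists>g \<in> pm_over B (C (Suc j)). \<exists>h \<in> pm_over B (C j). a = g + \<phi> j h"
proof -
  have "a \<in> pm_over B (D j k) \<Longrightarrow> \<exists>g \<in> pm_over B (C (Suc j)). \<exists>h \<in> pm_over B (C j). a = g + \<phi> j h" for k a
  proof (induction k arbitrary: a)
    case 0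
    then show ?case
      using D_0[OF assms(1)] pm_over_zero[OF C_zero, of j] K.phi_zero[of j] by (metis add.right_neutral)
  next
    case (Suc k)
    obtain b c where bc: "b \<in> pm_over B (D j k)" "c \<in> pm_over B (C (Suc j))" "a = scale (y j) b + c"
      using pm_over_D_split[OF assms(1) Suc.prems] by blast
    have c': "c \<in> pm_over B (D j k)"
      using bc(2) D_mono[of 0 k j] D_0[OF assms(1)] pm_over_mono[of "C (Suc j)" "D j k"] by auto
    have "lin_ext (L j) b + c \<in> pm_over B (D j k)"
      by (rule pm_over_add[OF D_zero[OF assms(1)] D_diff lin_ext_L_D[OF assms(1) bc(1)] c'])
    from Suc.IH[OF this] obtain g h where gh: "g \<in> pm_over B (C (Suc j))" "h \<in> pm_over B (C j)"
      "lin_ext (L j) b + c = g + \<phi> j h" by blast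
    have b: "b \<in> pm_over B (C j)" using bc(1) pm_over_mono[OF D_C[OF assms(1)]] by blast
    have "a = g + \<phi> j (h + b)"
      using gh(3) pm_over_F[OF less_imp_le[OF assms(1)]] gh(2) b
      by (simp add: bc(3) K.phi_add) (simp add: \<phi>_def algebra_simps)
    moreover have "h + b \<in> pm_over B (C j)" by (rule pm_over_add[OF C_zero C_diff gh(2) b])
    ultimately show ?case using gh(1) by blast
  qed
  with pm_over_D[OF assms] show ?thesis by blast
qed

text \<open>If \<phi> j h is free of y j, then y j * h has no larger degree in y j than h, because
  the matrix part does not raise it. Hence the degree bound of h can be lowered repeatedly until h
  vanishes.\<close>

lemma phi_inj:
  assumes j: "j < n" and h: "h \<in> pm_over B (C j)" and p: "\<phi> j h \<in> pm_over B (C (Suc j))"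
  shows "h = 0"
proof -
  have hC: "Poly_Mapping.lookup h b \<in> C j" for b using h by (simp add: pm_over_def)
  have yl: "y j * Poly_Mapping.lookup h b \<in> D j k" if "h \<in> pm_over B (D j k)" for b k
  proof -
    have "Poly_Mapping.lookup (lin_ext (L j) h) b \<in> D j k"
      using lin_ext_L_D[OF j that] by (simp add: pm_over_def)
    moreover have "Poly_Mapping.lookup (\<phi> j h) b \<in> D j k"
      using p D_mono[of 0 k j] D_0[OF j] by (auto simp: pm_over_def)
    moreover have "y j * Poly_Mapping.lookup h b =
        Poly_Mapping.lookup (\<phi> j h) b - (0 - Poly_Mapping.lookup (lin_ext (L j) h) b)"
      by (simp add: \<phi>_def lookup_minus)
    ultimately show ?thesis using D_diff D_zero[OF j] by presburger
  qed
  have "h \<in> pm_over B (D j k) \<Longrightarrow> h = 0" for k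
  proof (induction k)
    case 0
    then have "Poly_Mapping.lookup h b = 0" for b using yl D_cancel_0[OF j hC] by blast
    then show ?case by (intro poly_mapping_eqI) simp
  next
    case (Suc k)
    then have "Poly_Mapping.lookup h b \<in> D j k" for b using yl D_cancel[OF j hC] by blast
    then have "h \<in> pm_over B (D j k)" using h by (simp add: pm_over_def)
    then show ?case by (rule Suc.IH)
  qed
  with pm_over_D[OF j h] show ?thesis by blast
qed

lemma koszul_tower:
  shows phi_regular: "j < n \<Longrightarrow> x \<in> F \<Longrightarrow> \<phi> j x \<in> K.image_upto j \<Longrightarrow> x \<in> K.image_upto j"
    and F_span: "x \<in> F \<Longrightarrow> \<exists>g \<in> pm_over B (C n). \<exists>i \<in> K.image_upto n. x = g + i"
proof -
  have G0: "pm_over B (C 0) = F" by (simp add: C0)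
  have sub: "\<And>j. j < n \<Longrightarrow> pm_over B (C (Suc j)) \<subseteq> pm_over B (C j)"
    by (intro pm_over_mono C_Suc)
  have diff: "\<And>j x y. x \<in> pm_over B (C j) \<Longrightarrow> y \<in> pm_over B (C j) \<Longrightarrow> x - y \<in> pm_over B (C j)"
    by (rule pm_over_diff[OF C_diff])
  note T = K.tower[where G = "\<lambda>j. pm_over B (C j)" and n = n, OF G0 sub diff phi_preserves phi_split phi_inj]
  show "j < n \<Longrightarrow> x \<in> F \<Longrightarrow> \<phi> j x \<in> K.image_upto j \<Longrightarrow> x \<in> K.image_upto j" by (rule T(3))
  show "x \<in> F \<Longrightarrow> \<exists>g \<in> pm_over B (C n). \<exists>i \<in> K.image_upto n. x = g + i" by (rule T(1)) simp_all
qed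

lemma eval_image_upto: "x \<in> K.image_upto j \<Longrightarrow> eval_comb v x \<in> J"
  by (induction j arbitrary: x) (auto simp: eval_comb_add ideal_zero[OF J] intro!: ideal_add[OF J] eval_phi)

text \<open>Modulo the image of the operators every vector has coordinates in C n, and on those
  evaluation in R/J is injective. So the Koszul complex is augmented exactly by R/J.\<close>

lemma eval_kernel:
  assumes "x \<in> F" "eval_comb v x \<in> J"
  shows "x \<in> K.image_upto n"
proof -
  obtain g i where gi: "g \<in> pm_over B (C n)" "i \<in> K.image_upto n" "x = g + i" using F_span[OF assms(1)] by blast
  have "eval_comb v g = eval_comb v x - eval_comb v i" by (simp add: gi(3) eval_comb_add)
  also have "\<dots> \<in> J" by (rule ideal_diff[OF J assms(2) eval_image_upto[OF gi(2)]])
  finally have "g = 0" using basis_indep gi(1) by blast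
  with gi show ?thesis by simp
qed

section \<open>The Koszul complex as a resolution over the prescribed element type\<close>

context
  fixes enc :: "'b \<Rightarrow> 'a" and z :: 'c
  assumes inj: "inj_on enc B"
begin

text \<open>The definition of projective dimension prescribes elements that are functions on
  \<open>'c \<times> 'a \<times> nat\<close>. A basis element b and a finite set S of operator
  indices are therefore coded as a triple with constant first entry z, with b injected into the ring
  by \<open>enc\<close> and S turned into a number.\<close>

definition code_index :: "nat \<Rightarrow> ('c \<times> 'a \<times> nat) set" where
  "code_index i = (\<lambda>(b, S). (z, enc b, set_encode S)) ` (B \<times> {S. S \<subseteq> {..<n} \<and> card S = i})"

definition code :: "(nat set \<Rightarrow> 'b \<Rightarrow>\<^sub>0 'a) \<Rightarrow> 'c \<times> 'a \<times> nat \<Rightarrow> 'a" where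
  "code x = (\<lambda>(c, a, s). if c = z \<and> a \<in> enc ` B
     then Poly_Mapping.lookup (x (set_decode s)) (inv_into B enc a) else 0)"

definition decode :: "('c \<times> 'a \<times> nat \<Rightarrow> 'a) \<Rightarrow> nat set \<Rightarrow> 'b \<Rightarrow>\<^sub>0 'a" where
  "decode f = (\<lambda>S. if finite S
     then Abs_poly_mapping (\<lambda>b. if b \<in> B then f (z, enc b, set_encode S) else 0) else 0)"

lemma code_add: "code (\<lambda>S. x S + x' S) = (\<lambda>i. code x i + code x' i)"
  and code_scale: "code (\<lambda>S. scale r (x S)) = (\<lambda>i. r * code x i)"
  by (auto simp: code_def lookup_add fun_eq_iff)

lemma finite_indices: "finite {S. S \<subseteq> {..<n} \<and> card S = i}"
  by (rule finite_subset[of _ "Pow {..<n}"]) auto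

lemma code_closed:
  assumes "x \<in> K.koszul_term n i"
  shows "code x \<in> carrier (free_module R (code_index i))"
proof -
  have x: "x S \<in> F" "x S \<noteq> 0 \<Longrightarrow> S \<subseteq> {..<n} \<and> card S = i" for S
    using assms by (auto simp: K.koszul_term_def)
  have "code x j \<in> carrier R" for j
    using x(1) by (auto simp: code_def pm_over_def split: prod.splits)
  moreover define W where "W = (\<lambda>(b, S). (z, enc b, set_encode S)) `
    (SIGMA b : (\<Union>S\<in>{S. S \<subseteq> {..<n} \<and> card S = i}. Poly_Mapping.keys (x S)). {S. S \<subseteq> {..<n} \<and> card S = i})"
  have "finite W"
    unfolding W_def by (intro finite_imageI finite_SigmaI finite_UN_I finite_indices finite_keys)
  moreover have "{j. code x j \<noteq> 0} \<subseteq> W"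
  proof
    fix j assume "j \<in> {j. code x j \<noteq> 0}"
    then obtain b s where b: "b \<in> B" "j = (z, enc b, s)" "Poly_Mapping.lookup (x (set_decode s)) b \<noteq> 0"
      using inj by (auto simp: code_def split: prod.splits if_splits)
    then have "x (set_decode s) \<noteq> 0" by auto
    from x(2)[OF this] b show "j \<in> W"
      unfolding W_def by (intro image_eqI[of _ _ "(b, set_decode s)"]) (auto simp: in_keys_iff)
  qed
  moreover have "W \<subseteq> code_index i"
    using x(1) by (fastforce simp: W_def code_index_def pm_over_def)
  ultimately show ?thesis
    by (auto intro: finite_subset)
qed

lemma decode_code:
  assumes "x \<in> K.koszul_term n i"
  shows "decode (code x) = x"
proof
  fix S
  have x: "x S \<in> F" "x S \<noteq> 0 \<Longrightarrow> S \<subseteq> {..<n} \<and> card S = i"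
    using assms by (auto simp: K.koszul_term_def)
  show "decode (code x) S = x S"
  proof (cases "finite S")
    case True
    have "(\<lambda>b. if b \<in> B then code x (z, enc b, set_encode S) else 0) = Poly_Mapping.lookup (x S)"
      using x(1) True inj by (auto simp: code_def pm_over_def fun_eq_iff in_keys_iff)
    with True show ?thesis by (simp add: decode_def)
  next
    case False
    with x(2) have "x S = 0" using finite_subset[of S "{..<n}"] by blast
    with False show ?thesis by (simp add: decode_def)
  qed
qed

lemma decode_closed:
  assumes "f \<in> carrier (free_module R (code_index i))"
  shows "decode f \<in> K.koszul_term n i" and "code (decode f) = f"
proof -
  have f: "f j \<in> carrier R" "f j \<noteq> 0 \<Longrightarrow> j \<in> code_index i" "finite {j. f j \<noteq> 0}" for j
    using assms unfolding free_module_sel zero_eq by blast+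
  have l: "Poly_Mapping.lookup (decode f S) b = (if b \<in> B \<and> finite S then f (z, enc b, set_encode S) else 0)" for S b
  proof (cases "finite S")
    case True
    have "inj_on (\<lambda>b. (z, enc b, set_encode S)) B" using inj by (auto simp: inj_on_def)
    then have "finite {b \<in> B. f (z, enc b, set_encode S) \<noteq> 0}"
      using finite_vimage_IntI[OF f(3), of "\<lambda>b. (z, enc b, set_encode S)" B]
      by (rule_tac finite_subset[rotated]) auto
    then have "finite {b. (if b \<in> B then f (z, enc b, set_encode S) else 0) \<noteq> 0}"
      by (rule rev_finite_subset) auto
    with True show ?thesis by (simp add: decode_def)
  qed (simp add: decode_def)
  show "decode f \<in> K.koszul_term n i"
    unfolding K.koszul_term_def
  proof (intro CollectI conjI allI impI)
    show "decode f S \<in> F" for S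
      using f(1) by (auto simp: pm_over_def l in_keys_iff split: if_splits)
    fix S assume "decode f S \<noteq> 0"
    then obtain b where b: "Poly_Mapping.lookup (decode f S) b \<noteq> 0" by (metis lookup_zero poly_mapping_eqI)
    then have "finite S" "(z, enc b, set_encode S) \<in> code_index i" using f(2) by (auto simp: l split: if_splits)
    then obtain S' where "S' \<subseteq> {..<n}" "card S' = i" "set_encode S = set_encode S'"
      by (auto simp: code_index_def)
    moreover from this \<open>finite S\<close> have "S = S'"
      using finite_subset[of S' "{..<n}"] set_encode_inverse by (metis finite_lessThan)
    ultimately show "S \<subseteq> {..<n}" "card S = i" by auto
  qed
  show "code (decode f) = f"
  proof
    fix j :: "'c \<times> 'a \<times> nat"
    obtain c a s where j: "j = (c, a, s)" by (cases j)
    show "code (decode f) j = f j"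
    proof (cases "c = z \<and> a \<in> enc ` B")
      case True
      then show ?thesis using inj by (auto simp: code_def j l)
    next
      case False
      then have "j \<notin> code_index i" by (auto simp: code_index_def j)
      with f(2) have "f j = 0" by blast
      with False show ?thesis unfolding code_def j by auto
    qed
  qed
qed

definition res_term :: "nat \<Rightarrow> ('a, 'c \<times> 'a \<times> nat \<Rightarrow> 'a) module" where
  "res_term i = free_module R (code_index i)"

definition res_diff :: "nat \<Rightarrow> ('c \<times> 'a \<times> nat \<Rightarrow> 'a) \<Rightarrow> 'c \<times> 'a \<times> nat \<Rightarrow> 'a" where
  "res_diff i f = code (K.koszul_diff n (decode f))"

definition res_aug :: "('c \<times> 'a \<times> nat \<Rightarrow> 'a) \<Rightarrow> 'a set" where
  "res_aug f = J +> eval_comb v (decode f {})"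

lemma res_term_carrier: "carrier (res_term i) = code ` K.koszul_term n i"
  unfolding res_term_def using code_closed decode_closed by (auto simp del: free_module_sel) (metis imageI)

lemma res_term_ops:
  assumes "x \<in> K.koszul_term n i" "x' \<in> K.koszul_term n i" "r \<in> carrier R"
  shows "code x \<oplus>\<^bsub>res_term i\<^esub> code x' = code (\<lambda>S. x S + x' S)"
    and "r \<odot>\<^bsub>res_term i\<^esub> code x = code (\<lambda>S. scale r (x S))"
    and "\<zero>\<^bsub>res_term i\<^esub> = code (\<lambda>S. 0)"
  by (simp_all add: res_term_def code_add code_scale) (simp add: code_def fun_eq_iff)

lemma scale_F: "r \<in> carrier R \<Longrightarrow> x \<in> F \<Longrightarrow> scale r x \<in> F"
  by (rule pm_over_scale) auto

lemma koszul_term_scale: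
  "r \<in> carrier R \<Longrightarrow> x \<in> K.koszul_term n i \<Longrightarrow> (\<lambda>S. scale r (x S)) \<in> K.koszul_term n i"
  unfolding K.koszul_term_def using scale_F by (auto simp: scale_simps) (metis scale_simps(4) subsetD lessThan_iff, metis scale_simps(4))

lemma res_diff_code: "x \<in> K.koszul_term n j \<Longrightarrow> res_diff i (code x) = code (K.koszul_diff n x)"
  by (simp add: res_diff_def decode_code)

lemma res_diff_hom: "res_diff i \<in> module_hom R (res_term (Suc i)) (res_term i)"
proof (rule module_homI)
  fix f assume "f \<in> carrier (res_term (Suc i))"
  then show "res_diff i f \<in> carrier (res_term i)"
    unfolding res_term_carrier using res_diff_code K.koszul_diff_term by auto
next
  fix f g assume "f \<in> carrier (res_term (Suc i))" "g \<in> carrier (res_term (Suc i))"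
  then obtain x x' where x: "f = code x" "x \<in> K.koszul_term n (Suc i)" and x': "g = code x'" "x' \<in> K.koszul_term n (Suc i)"
    unfolding res_term_carrier by auto
  show "res_diff i (f \<oplus>\<^bsub>res_term (Suc i)\<^esub> g) = res_diff i f \<oplus>\<^bsub>res_term i\<^esub> res_diff i g"
    unfolding x x' res_term_ops(1)[OF x(2) x'(2) closed(1)] res_diff_code[OF K.koszul_term_add[OF x(2) x'(2)]]
      res_diff_code[OF x(2)] res_diff_code[OF x'(2)]
      res_term_ops(1)[OF K.koszul_diff_term[OF x(2)] K.koszul_diff_term[OF x'(2)] closed(1)]
      K.koszul_diff_add[OF x(2) x'(2)] ..
next
  fix r f assume r: "r \<in> carrier R" and "f \<in> carrier (res_term (Suc i))"
  then obtain x where x: "f = code x" "x \<in> K.koszul_term n (Suc i)"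
    unfolding res_term_carrier by auto
  have "K.koszul_diff n (\<lambda>S. scale r (x S)) = (\<lambda>S. scale r (K.koszul_diff n x S))"
    by (rule K.koszul_diff_map[OF _ _ _ x(2)]) (simp_all add: scale_F r scale_simps phi_scale)
  then show "res_diff i (r \<odot>\<^bsub>res_term (Suc i)\<^esub> f) = r \<odot>\<^bsub>res_term i\<^esub> res_diff i f"
    unfolding x res_term_ops(2)[OF x(2) x(2) r] res_diff_code[OF koszul_term_scale[OF r x(2)]]
      res_diff_code[OF x(2)] res_term_ops(2)[OF K.koszul_diff_term[OF x(2)] K.koszul_diff_term[OF x(2)] r]
    by simp
qed

lemma koszul_term_0: "x \<in> K.koszul_term n 0 \<longleftrightarrow> (\<exists>a\<in>F. x = (\<lambda>S. if S = {} then a else 0))"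
proof
  assume "x \<in> K.koszul_term n 0"
  then have "x = (\<lambda>S. if S = {} then x {} else 0)" "x {} \<in> F"
    using K.koszul_term_0_eq K.koszul_termD(1) by (auto simp: fun_eq_iff)
  then show "\<exists>a\<in>F. x = (\<lambda>S. if S = {} then a else 0)" by blast
qed (auto simp: K.koszul_term_def K.zero_closed split: if_splits)

lemma code_inj: "x \<in> K.koszul_term n i \<Longrightarrow> x' \<in> K.koszul_term n j \<Longrightarrow> code x = code x' \<Longrightarrow> x = x'"
  using decode_code by metis

lemma res_aug_code: "x \<in> K.koszul_term n 0 \<Longrightarrow> res_aug (code x) = J +> eval_comb v (x {})"
  by (simp add: res_aug_def decode_code)

lemma res_resolution: "projective_resolution R (quotient_module R J) res_term res_diff res_aug"
  unfolding projective_resolution_def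
proof (intro conjI allI)
  let ?M = "quotient_module R J"
  note qm = quotient_module_simps[OF J]
  note xc = eval_comb_closed[OF K.koszul_termD(1)]
  show "projective_module R (res_term i)" for i unfolding res_term_def by (rule free_module_projective)
  show "res_diff i \<in> module_hom R (res_term (Suc i)) (res_term i)" for i by (rule res_diff_hom)
  show "res_aug \<in> module_hom R (res_term 0) ?M"
  proof (rule module_homI)
    fix f assume "f \<in> carrier (res_term 0)"
    then show "res_aug f \<in> carrier ?M"
      unfolding res_term_carrier qm(1) using res_aug_code xc by auto
  next
    fix f g assume "f \<in> carrier (res_term 0)" "g \<in> carrier (res_term 0)"
    then obtain x x' where x: "f = code x" "x \<in> K.koszul_term n 0" and x': "g = code x'" "x' \<in> K.koszul_term n 0"
      unfolding res_term_carrier by auto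
    show "res_aug (f \<oplus>\<^bsub>res_term 0\<^esub> g) = res_aug f \<oplus>\<^bsub>?M\<^esub> res_aug g"
      unfolding x x' res_term_ops(1)[OF x(2) x'(2) closed(1)] res_aug_code[OF K.koszul_term_add[OF x(2) x'(2)]]
        res_aug_code[OF x(2)] res_aug_code[OF x'(2)] qm(4)[OF xc[OF x(2)] xc[OF x'(2)]] eval_comb_add ..
  next
    fix r f assume r: "r \<in> carrier R" and "f \<in> carrier (res_term 0)"
    then obtain x where x: "f = code x" "x \<in> K.koszul_term n 0"
      unfolding res_term_carrier by auto
    show "res_aug (r \<odot>\<^bsub>res_term 0\<^esub> f) = r \<odot>\<^bsub>?M\<^esub> res_aug f"
      unfolding x res_term_ops(2)[OF x(2) x(2) r] res_aug_code[OF koszul_term_scale[OF r x(2)]]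
        res_aug_code[OF x(2)] qm(5)[OF r xc[OF x(2)]] eval_comb_scale ..
  qed
  show "res_aug ` carrier (res_term 0) = carrier ?M"
  proof (intro equalityI subsetI)
    fix q assume "q \<in> res_aug ` carrier (res_term 0)"
    then show "q \<in> carrier ?M"
      unfolding res_term_carrier qm(1) using res_aug_code xc by auto
  next
    fix q assume "q \<in> carrier ?M"
    then obtain r where r: "r \<in> carrier R" "q = J +> r" unfolding qm(1) by auto
    obtain a where a: "a \<in> pm_over B (C n)" "r - eval_comb v a \<in> J" using basis_span[OF r(1)] by blast
    have aF: "a \<in> F" by (rule pm_over_F[OF order_refl a(1)])
    let ?x = "\<lambda>S. if S = {} then a else 0"
    have x: "?x \<in> K.koszul_term n 0" using aF koszul_term_0 by blast
    have "res_aug (code ?x) = q"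
      unfolding res_aug_code[OF x] r(2) using qm(2)[OF r(1) eval_comb_closed[OF aF]] a(2) by simp
    with x show "q \<in> res_aug ` carrier (res_term 0)" unfolding res_term_carrier by blast
  qed
  show "res_diff 0 ` carrier (res_term 1) = module_kernel (res_term 0) ?M res_aug"
  proof -
    have "res_diff 0 ` carrier (res_term 1) = code ` K.koszul_diff n ` K.koszul_term n (Suc 0)"
      unfolding res_term_carrier One_nat_def image_image by (intro image_cong refl res_diff_code)
    also have "\<dots> = code ` (\<lambda>a S. if S = {} then a else 0) ` K.image_upto n"
      by (simp only: K.koszul_diff_image)
    also have "\<dots> = module_kernel (res_term 0) ?M res_aug"
    proof (intro equalityI subsetI)
      fix f assume "f \<in> code ` (\<lambda>a S. if S = {} then a else 0) ` K.image_upto n"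
      then obtain a where a: "a \<in> K.image_upto n" "f = code (\<lambda>S. if S = {} then a else 0)" by auto
      have x: "(\<lambda>S. if S = {} then a else 0) \<in> K.koszul_term n 0"
        using a K.image_upto_closed koszul_term_0 by blast
      have "eval_comb v a - 0 \<in> J" using eval_image_upto[OF a(1)] by simp
      then have "res_aug f = \<zero>\<^bsub>?M\<^esub>"
        unfolding a(2) res_aug_code[OF x] qm(3)
        using a K.image_upto_closed by (subst qm(2)) (auto intro: eval_comb_closed)
      with x a show "f \<in> module_kernel (res_term 0) ?M res_aug"
        by (simp add: module_kernel_def res_term_carrier)
    next
      fix f assume "f \<in> module_kernel (res_term 0) ?M res_aug"
      then obtain x where x: "x \<in> K.koszul_term n 0" "f = code x" "res_aug f = J +> 0"
        by (auto simp: module_kernel_def res_term_carrier qm(3))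
      then obtain a where a: "a \<in> F" "x = (\<lambda>S. if S = {} then a else 0)" using koszul_term_0 by blast
      have "J +> eval_comb v (x {}) = J +> 0" using x(3) unfolding x(2) res_aug_code[OF x(1)] .
      then have "J +> eval_comb v a = J +> 0" unfolding a(2) by simp
      then have "eval_comb v a \<in> J" using qm(2)[OF eval_comb_closed[OF a(1)] closed(1)] by simp
      with eval_kernel a(1) have "a \<in> K.image_upto n" by blast
      then show "f \<in> code ` (\<lambda>a S. if S = {} then a else 0) ` K.image_upto n"
        unfolding x(2) a(2) by blast
    qed
    finally show ?thesis .
  qed
  show "res_diff (Suc i) ` carrier (res_term (Suc (Suc i))) = module_kernel (res_term (Suc i)) (res_term i) (res_diff i)" for i
  proof (intro equalityI subsetI)
    fix f assume "f \<in> res_diff (Suc i) ` carrier (res_term (Suc (Suc i)))"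
    then obtain x where x: "x \<in> K.koszul_term n (Suc (Suc i))" "f = code (K.koszul_diff n x)"
      unfolding res_term_carrier using res_diff_code by auto
    note dx = K.koszul_diff_term[OF x(1)]
    have "res_diff i f = \<zero>\<^bsub>res_term i\<^esub>"
      unfolding x(2) res_diff_code[OF dx] K.koszul_diff_koszul_diff[OF x(1)]
        res_term_ops(3)[OF K.koszul_term_zero K.koszul_term_zero closed(1)] ..
    with dx x(2) show "f \<in> module_kernel (res_term (Suc i)) (res_term i) (res_diff i)"
      by (simp add: module_kernel_def res_term_carrier)
  next
    fix f assume "f \<in> module_kernel (res_term (Suc i)) (res_term i) (res_diff i)"
    then obtain x where x: "x \<in> K.koszul_term n (Suc i)" "f = code x" "res_diff i f = \<zero>\<^bsub>res_term i\<^esub>"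
      by (auto simp: module_kernel_def res_term_carrier)
    have "code (K.koszul_diff n x) = code (\<lambda>S. 0)"
      using x(3) unfolding x(2) res_diff_code[OF x(1)]
        res_term_ops(3)[OF K.koszul_term_zero K.koszul_term_zero closed(1)] .
    from code_inj[OF K.koszul_diff_term[OF x(1)] K.koszul_term_zero this]
    have "x \<in> K.koszul_diff n ` K.koszul_term n (Suc (Suc i))"
      by (intro K.koszul_exact[OF phi_regular x(1)])
    then obtain x' where x': "x' \<in> K.koszul_term n (Suc (Suc i))" "x = K.koszul_diff n x'" by blast
    have "f = res_diff (Suc i) (code x')" unfolding res_diff_code[OF x'(1)] x(2) x'(2) ..
    with x'(1) show "f \<in> res_diff (Suc i) ` carrier (res_term (Suc (Suc i)))"
      unfolding res_term_carrier by blast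
  qed
qed

lemma res_term_vanishes: "n < i \<Longrightarrow> carrier (res_term i) = {\<zero>\<^bsub>res_term i\<^esub>}"
proof -
  assume i: "n < i"
  have "card S \<le> n" if "S \<subseteq> {..<n}" for S using card_mono[OF finite_lessThan that] by simp
  then have "card S \<noteq> i" if "S \<subseteq> {..<n}" for S using that i leD by blast
  then have "{S. S \<subseteq> {..<n} \<and> card S = i} = {}" by blast
  then have ci: "code_index i = {}" by (simp add: code_index_def)
  have "f \<in> carrier (res_term i) \<longleftrightarrow> f = (\<lambda>i. 0)" for f :: "'c \<times> 'a \<times> nat \<Rightarrow> 'a"
  proof
    assume "f \<in> carrier (res_term i)"
    then have "{i. f i \<noteq> 0} \<subseteq> {}" unfolding res_term_def ci free_module_sel zero_eq by blast
    then show "f = (\<lambda>i. 0)" by blast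
  next
    assume "f = (\<lambda>i. 0)"
    then show "f \<in> carrier (res_term i)" by (simp add: res_term_def)
  qed
  then show ?thesis by (auto simp: res_term_def)
qed

end

theorem projective_dimension_le:
  assumes "inj_on (enc :: 'b \<Rightarrow> 'a) B"
  shows "projective_dimension R (quotient_module R J) \<le> enat n"
  unfolding projective_dimension_def
proof (rule INF_lower, rule CollectI, intro exI conjI allI impI)
  \<comment> \<open>Elements of R/J have type \<open>'a set\<close>, so the constant first entry of
    the codes must be such a set; \<open>{}\<close> is an arbitrary choice.\<close>
  show "projective_resolution R (quotient_module R J)
      (res_term enc ({} :: 'a set)) (res_diff enc {}) (res_aug enc {})"
    by (rule res_resolution[OF assms])
  show "carrier (res_term enc ({} :: 'a set) i) = {\<zero>\<^bsub>res_term enc {} i\<^esub>}" if "n < i" for i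
    by (rule res_term_vanishes[OF assms that])
qed

end

section \<open>Regular sequences on quotient modules\<close>

context typeclass_ring
begin

primrec ext_ideal :: "'a set \<Rightarrow> (nat \<Rightarrow> 'a) \<Rightarrow> nat \<Rightarrow> 'a set" where
  "ext_ideal J f 0 = J"
| "ext_ideal J f (Suc j) = {u + f j * r | u r. u \<in> ext_ideal J f j \<and> r \<in> carrier R}"

lemma ext_ideal_ideal:
  assumes J: "ideal J R" and f: "\<And>i. i < j \<Longrightarrow> f i \<in> carrier R"
  shows "ideal (ext_ideal J f j) R"
  using f
proof (induction j)
  case 0
  show ?case using J by simp
next
  case (Suc j)
  then have I: "ideal (ext_ideal J f j) R" and fj: "f j \<in> carrier R" by simp_all
  show ?case
  proof (rule idealI')
    show "ext_ideal J f (Suc j) \<subseteq> carrier R" using ideal_carrier[OF I] fj by auto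
    show "0 \<in> ext_ideal J f (Suc j)" using ideal_zero[OF I] by (auto intro!: exI[of _ 0])
    fix x y assume "x \<in> ext_ideal J f (Suc j)" "y \<in> ext_ideal J f (Suc j)"
    then obtain u r u' r' where *: "x = u + f j * r" "u \<in> ext_ideal J f j" "r \<in> carrier R"
      "y = u' + f j * r'" "u' \<in> ext_ideal J f j" "r' \<in> carrier R" by auto
    then have "x + y = (u + u') + f j * (r + r')" by (simp add: algebra_simps)
    then show "x + y \<in> ext_ideal J f (Suc j)" using * ideal_add[OF I] closed(3) unfolding ext_ideal.simps by blast
  next
    fix s x assume s: "s \<in> carrier R" and "x \<in> ext_ideal J f (Suc j)"
    then obtain u r where *: "x = u + f j * r" "u \<in> ext_ideal J f j" "r \<in> carrier R" by auto
    then have "s * x = s * u + f j * (s * r)" by (simp add: algebra_simps)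
    then show "s * x \<in> ext_ideal J f (Suc j)" using * s ideal_mult[OF I] closed(4) unfolding ext_ideal.simps by blast
  qed
qed

lemma ext_ideal_mono:
  assumes "i \<le> j" shows "ext_ideal J f i \<subseteq> ext_ideal J f j"
  using assms
proof (induction j rule: dec_induct)
  case (step j)
  have "x \<in> ext_ideal J f (Suc j)" if "x \<in> ext_ideal J f j" for x
  proof -
    have "x = x + f j * 0" by simp
    then show ?thesis unfolding ext_ideal.simps using that closed(1) by blast
  qed
  with step show ?case by blast
qed simp

lemma ext_ideal_generator:
  assumes J: "ideal J R" and f: "\<And>i. i < j \<Longrightarrow> f i \<in> carrier R" and i: "i < j"
  shows "f i \<in> ext_ideal J f j"
proof -
  have "ideal (ext_ideal J f i) R" using f i by (intro ext_ideal_ideal[OF J]) simp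
  then have "0 + f i * 1 \<in> ext_ideal J f (Suc i)"
    unfolding ext_ideal.simps using ideal_zero closed(2) by blast
  with ext_ideal_mono[of "Suc i" j J f] i show ?thesis by auto
qed

lemma genideal_eq_ext_ideal:
  assumes J: "ideal J R" and f: "\<And>i. i < j \<Longrightarrow> f i \<in> carrier R"
  shows "Idl (f ` {..<j} \<union> J) = ext_ideal J f j"
proof
  have c: "f ` {..<j} \<union> J \<subseteq> carrier R" using f ideal_carrier[OF J] by auto
  have "f ` {..<j} \<union> J \<subseteq> ext_ideal J f j"
    using ext_ideal_generator[OF J f] ext_ideal_mono[of 0 j J f] by auto
  then show "Idl (f ` {..<j} \<union> J) \<subseteq> ext_ideal J f j"
    using f by (intro genideal_minimal ext_ideal_ideal[OF J])
  have I: "ideal (Idl (f ` {..<j} \<union> J)) R" by (rule genideal_ideal[OF c])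
  have sub: "f ` {..<j} \<union> J \<subseteq> Idl (f ` {..<j} \<union> J)" by (rule genideal_self[OF c])
  have "i \<le> j \<Longrightarrow> ext_ideal J f i \<subseteq> Idl (f ` {..<j} \<union> J)" for i
  proof (induction i)
    case (Suc i)
    then have "f i \<in> Idl (f ` {..<j} \<union> J)" using sub by auto
    then have "f i * r \<in> Idl (f ` {..<j} \<union> J)" if "r \<in> carrier R" for r
      using ideal_mult[OF I that, of "f i"] by (simp add: mult.commute)
    with Suc show ?case using ideal_add[OF I] by auto
  qed (use sub in auto)
  then show "ext_ideal J f j \<subseteq> Idl (f ` {..<j} \<union> J)" by simp
qed

text \<open>Depth and regular sequences are defined by submodules of R/J. This and the next lemmas
  return to ideals of R containing J, where all later computations take place.\<close>

lemma set_smult_quotient: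
  assumes J: "ideal J R" and S: "S \<subseteq> carrier R"
  shows "set_smult R S (quotient_module R J) = (\<lambda>r. J +> r) ` (Idl (S \<union> J))"
proof -
  let ?M = "quotient_module R J"
  let ?I = "Idl (S \<union> J)"
  note qm = quotient_module_simps[OF J]
  interpret M: Module.module R ?M by (rule quotient_module_module[OF is_cring J])
  have c: "S \<union> J \<subseteq> carrier R" using S ideal_carrier[OF J] by auto
  have I: "ideal ?I R" by (rule genideal_ideal[OF c])
  have sub: "S \<union> J \<subseteq> ?I" by (rule genideal_self[OF c])
  note Ic = ideal_carrier[OF I]
  show ?thesis
  proof (intro equalityI subsetI)
    fix q assume q: "q \<in> set_smult R S ?M"
    have "submodule ((\<lambda>r. J +> r) ` ?I) R ?M"
    proof (rule M.submoduleI)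
      show "(\<lambda>r. J +> r) ` ?I \<subseteq> carrier ?M" unfolding qm(1) using Ic by blast
      show "\<zero>\<^bsub>?M\<^esub> \<in> (\<lambda>r. J +> r) ` ?I" unfolding qm(3) using ideal_zero[OF I] by blast
      fix x assume "x \<in> (\<lambda>r. J +> r) ` ?I"
      then obtain r where r: "r \<in> ?I" "x = J +> r" by blast
      have xM: "x \<in> carrier ?M" using r Ic unfolding qm(1) by blast
      have "\<ominus>\<^bsub>?M\<^esub> x = (\<ominus> \<one>) \<odot>\<^bsub>?M\<^esub> x"
        unfolding M.smult_l_minus[OF one_closed xM] M.smult_one[OF xM] ..
      also have "\<dots> = J +> ((- 1) * r)" unfolding r(2) using r Ic by (subst a_inv_eq) (auto simp: qm(5))
      finally show "\<ominus>\<^bsub>?M\<^esub> x \<in> (\<lambda>r. J +> r) ` ?I" using ideal_uminus[OF I r(1)] by auto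
    next
      fix x y assume "x \<in> (\<lambda>r. J +> r) ` ?I" "y \<in> (\<lambda>r. J +> r) ` ?I"
      then obtain r s where r: "r \<in> ?I" "x = J +> r" "s \<in> ?I" "y = J +> s" by blast
      then have "x \<oplus>\<^bsub>?M\<^esub> y = J +> (r + s)" using Ic by (simp add: qm(4))
      then show "x \<oplus>\<^bsub>?M\<^esub> y \<in> (\<lambda>r. J +> r) ` ?I" using ideal_add[OF I r(1,3)] by blast
    next
      fix a x assume a: "a \<in> carrier R" and "x \<in> (\<lambda>r. J +> r) ` ?I"
      then obtain r where r: "r \<in> ?I" "x = J +> r" by blast
      then have "a \<odot>\<^bsub>?M\<^esub> x = J +> (a * r)" using Ic a by (simp add: qm(5))
      then show "a \<odot>\<^bsub>?M\<^esub> x \<in> (\<lambda>r. J +> r) ` ?I" using ideal_mult[OF I a r(1)] by blast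
    qed
    moreover have "a \<odot>\<^bsub>?M\<^esub> x \<in> (\<lambda>r. J +> r) ` ?I" if "a \<in> S" "x \<in> carrier ?M" for a x
    proof -
      from that(2) obtain r where r: "r \<in> carrier R" "x = J +> r" unfolding qm(1) by blast
      have "a \<in> ?I" using sub that(1) by blast
      then have "r * a \<in> ?I" by (rule ideal_mult[OF I r(1)])
      moreover have "a \<odot>\<^bsub>?M\<^esub> x = J +> (r * a)"
        unfolding r(2) qm(5)[OF subsetD[OF S that(1)] r(1)] by (simp only: mult.commute)
      ultimately show ?thesis by (metis imageI)
    qed
    ultimately show "q \<in> (\<lambda>r. J +> r) ` ?I" using q unfolding set_smult_def by blast
  next
    fix q assume "q \<in> (\<lambda>r. J +> r) ` ?I"
    then obtain r where r: "r \<in> ?I" "q = J +> r" by blast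
    show "q \<in> set_smult R S ?M"
      unfolding set_smult_def
    proof (rule InterI, clarsimp)
      fix H assume H: "submodule H R ?M" "\<forall>a\<in>S. \<forall>x\<in>carrier ?M. a \<odot>\<^bsub>?M\<^esub> x \<in> H"
      interpret H: submodule H R ?M by fact
      have H0: "\<zero>\<^bsub>?M\<^esub> \<in> H" using H.one_closed by simp
      have Ha: "x \<in> H \<Longrightarrow> y \<in> H \<Longrightarrow> x \<oplus>\<^bsub>?M\<^esub> y \<in> H" for x y using H.m_closed[of x y] by simp
      have "ideal {r \<in> carrier R. J +> r \<in> H} R"
      proof (rule idealI')
        show "0 \<in> {r \<in> carrier R. J +> r \<in> H}" using H0 by (simp add: qm(3))
        show "x + y \<in> {r \<in> carrier R. J +> r \<in> H}"
          if "x \<in> {r \<in> carrier R. J +> r \<in> H}" "y \<in> {r \<in> carrier R. J +> r \<in> H}" for x y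
          using that Ha[of "J +> x" "J +> y"] by (simp add: qm(4))
        show "a * x \<in> {r \<in> carrier R. J +> r \<in> H}"
          if "a \<in> carrier R" "x \<in> {r \<in> carrier R. J +> r \<in> H}" for a x
          using that H.smult_closed[of a "J +> x"] by (simp add: qm(5))
      qed auto
      moreover have "S \<union> J \<subseteq> {r \<in> carrier R. J +> r \<in> H}"
      proof
        fix x assume x: "x \<in> S \<union> J"
        then have xc: "x \<in> carrier R" using c by blast
        have "J +> x \<in> H"
        proof (cases "x \<in> S")
          case True
          have "J +> 1 \<in> carrier ?M" unfolding qm(1) by blast
          then have "x \<odot>\<^bsub>?M\<^esub> (J +> 1) \<in> H" using H(2) True by blast
          then show ?thesis using xc by (simp add: qm(5))
        next
          case False
          then have "J +> x = J +> 0" using qm(2)[OF xc closed(1)] x by simp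
          then show ?thesis using H0 by (simp add: qm(3))
        qed
        with xc show "x \<in> {r \<in> carrier R. J +> r \<in> H}" by blast
      qed
      ultimately have "?I \<subseteq> {r \<in> carrier R. J +> r \<in> H}" by (rule genideal_minimal)
      with r show "q \<in> H" by blast
    qed
  qed
qed

lemma coset_mem_set_smult:
  assumes J: "ideal J R" and S: "S \<subseteq> carrier R" and r: "r \<in> carrier R"
  shows "J +> r \<in> set_smult R S (quotient_module R J) \<longleftrightarrow> r \<in> Idl (S \<union> J)"
proof -
  have c: "S \<union> J \<subseteq> carrier R" using S ideal_carrier[OF J] by auto
  have I: "ideal (Idl (S \<union> J)) R" by (rule genideal_ideal[OF c])
  have "r \<in> Idl (S \<union> J)" if "r' \<in> Idl (S \<union> J)" "J +> r = J +> r'" for r'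
  proof -
    have "r - r' \<in> J" using that coset_eq_iff[OF J r, of r'] ideal_carrier[OF I] by blast
    then have "r - r' \<in> Idl (S \<union> J)" using genideal_self[OF c] by blast
    from ideal_add[OF I this that(1)] show ?thesis by simp
  qed
  then show ?thesis unfolding set_smult_quotient[OF J S] by blast
qed

lemma set_smult_eq_carrier:
  assumes J: "ideal J R" and S: "S \<subseteq> carrier R"
  shows "set_smult R S (quotient_module R J) = carrier (quotient_module R J) \<longleftrightarrow> 1 \<in> Idl (S \<union> J)"
proof -
  have c: "S \<union> J \<subseteq> carrier R" using S ideal_carrier[OF J] by auto
  have I: "ideal (Idl (S \<union> J)) R" by (rule genideal_ideal[OF c])
  show ?thesis
  proof
    assume "set_smult R S (quotient_module R J) = carrier (quotient_module R J)"
    then have "J +> 1 \<in> set_smult R S (quotient_module R J)"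
      unfolding carrier_quotient_module[OF J] by auto
    then show "1 \<in> Idl (S \<union> J)" using coset_mem_set_smult[OF J S closed(2)] by simp
  next
    assume "1 \<in> Idl (S \<union> J)"
    then have "Idl (S \<union> J) = carrier R" using ideal.one_imp_carrier[OF I] by simp
    then show "set_smult R S (quotient_module R J) = carrier (quotient_module R J)"
      unfolding set_smult_quotient[OF J S] carrier_quotient_module[OF J] by simp
  qed
qed

lemma regular_sequence_quotient:
  assumes J: "ideal J R" and fs: "set fs \<subseteq> carrier R"
  shows "regular_sequence R (quotient_module R J) fs \<longleftrightarrow>
    (\<forall>i < length fs. \<forall>x \<in> carrier R. fs ! i * x \<in> ext_ideal J ((!) fs) i \<longrightarrow> x \<in> ext_ideal J ((!) fs) i) \<and>
    1 \<notin> ext_ideal J ((!) fs) (length fs)"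
proof -
  have e: "Idl (set (take i fs) \<union> J) = ext_ideal J ((!) fs) i" if "i \<le> length fs" for i
  proof -
    have "set (take i fs) = (!) fs ` {..<i}"
      using that by (auto simp: set_conv_nth image_iff) (metis length_take min.absorb2 nth_take)+
    moreover have "fs ! k \<in> carrier R" if "k < i" for k using that \<open>i \<le> length fs\<close> fs nth_mem[of k fs] by auto
    ultimately show ?thesis using genideal_eq_ext_ideal[OF J, of i "(!) fs"] by simp
  qed
  have t: "set (take i fs) \<subseteq> carrier R" for i using fs set_take_subset[of i fs] by blast
  have "(\<forall>x \<in> carrier (quotient_module R J).
        (fs ! i) \<odot>\<^bsub>quotient_module R J\<^esub> x \<in> set_smult R (set (take i fs)) (quotient_module R J)
          \<longrightarrow> x \<in> set_smult R (set (take i fs)) (quotient_module R J)) \<longleftrightarrow>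
      (\<forall>x \<in> carrier R. fs ! i * x \<in> ext_ideal J ((!) fs) i \<longrightarrow> x \<in> ext_ideal J ((!) fs) i)"
    if i: "i < length fs" for i
  proof -
    have fi: "fs ! i \<in> carrier R" using fs i nth_mem[of i fs] by auto
    show ?thesis
      unfolding carrier_quotient_module[OF J] ball_simps(9)
      by (rule ball_cong[OF refl])
        (simp add: fi smult_quotient_module[OF J] coset_mem_set_smult[OF J t] e[OF less_imp_le[OF i]])
  qed
  moreover have "set_smult R (set fs) (quotient_module R J) \<noteq> carrier (quotient_module R J) \<longleftrightarrow>
      1 \<notin> ext_ideal J ((!) fs) (length fs)"
    unfolding set_smult_eq_carrier[OF J fs] using e[of "length fs"] by simp
  ultimately show ?thesis unfolding regular_sequence_def using fs by simp
qed

section \<open>Forms, powers of an ideal and quasi-regularity\<close>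

definition multiindices :: "nat \<Rightarrow> nat \<Rightarrow> (nat \<Rightarrow> nat) set" where
  "multiindices j t = {\<alpha>. (\<forall>i\<ge>j. \<alpha> i = 0) \<and> (\<Sum>i<j. \<alpha> i) = t}"

definition form :: "(nat \<Rightarrow> 'a) \<Rightarrow> nat \<Rightarrow> nat \<Rightarrow> ((nat \<Rightarrow> nat) \<Rightarrow> 'a) \<Rightarrow> 'a" where
  "form f j t g = (\<Sum>\<alpha>\<in>multiindices j t. (\<Prod>i<j. f i ^ \<alpha> i) * g \<alpha>)"

lemma finite_multiindices: "finite (multiindices j t)"
proof (rule finite_subset)
  show "multiindices j t \<subseteq> {\<alpha>. \<forall>i. (i \<in> {..<j} \<longrightarrow> \<alpha> i \<in> {..t}) \<and> (i \<notin> {..<j} \<longrightarrow> \<alpha> i = 0)}"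
    by (auto simp: multiindices_def intro: member_le_sum)
qed (rule finite_set_of_finite_funs; simp)

lemma multiindices_0: "multiindices j 0 = {\<lambda>_. 0}"
  by (auto simp: multiindices_def fun_eq_iff) (metis lessThan_iff not_le)

lemma sum_fun_upd_Suc: "i < (j::nat) \<Longrightarrow> (\<Sum>k<j. (\<alpha>(i := Suc (\<alpha> i))) k) = Suc (\<Sum>k<j. \<alpha> k)"
proof -
  assume i: "i < j"
  have "(\<Sum>k\<in>{..<j} - {i}. (\<alpha>(i := Suc (\<alpha> i))) k) = (\<Sum>k\<in>{..<j} - {i}. \<alpha> k)"
    by (intro sum.cong) auto
  then show ?thesis
    using i sum.remove[of "{..<j}" i \<alpha>] sum.remove[of "{..<j}" i "\<alpha>(i := Suc (\<alpha> i))"] by simp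
qed

lemma prod_fun_upd_Suc: "i < (j::nat) \<Longrightarrow> (\<Prod>k<j. f k ^ (\<alpha>(i := Suc (\<alpha> i))) k) = f i * (\<Prod>k<j. (f k :: 'a) ^ \<alpha> k)"
proof -
  assume i: "i < j"
  have "(\<Prod>k\<in>{..<j} - {i}. f k ^ (\<alpha>(i := Suc (\<alpha> i))) k) = (\<Prod>k\<in>{..<j} - {i}. f k ^ \<alpha> k)"
    by (intro prod.cong) auto
  then show ?thesis
    using i prod.remove[of "{..<j}" i "\<lambda>k. f k ^ \<alpha> k"]
      prod.remove[of "{..<j}" i "\<lambda>k. f k ^ (\<alpha>(i := Suc (\<alpha> i))) k"] by (simp add: mult.assoc)
qed

lemma multiindices_upd_Suc: "i < j \<Longrightarrow> \<alpha> \<in> multiindices j t \<Longrightarrow> \<alpha>(i := Suc (\<alpha> i)) \<in> multiindices j (Suc t)"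
  using sum_fun_upd_Suc[of i j \<alpha>] by (auto simp: multiindices_def)

lemma multiindices_upd_pred:
  assumes "\<beta> \<in> multiindices j (Suc t)" "\<beta> i \<noteq> 0"
  shows "\<beta>(i := \<beta> i - 1) \<in> multiindices j t" "i < j"
proof -
  show i: "i < j" using assms by (auto simp: multiindices_def intro: ccontr)
  let ?\<alpha> = "\<beta>(i := \<beta> i - 1)"
  have "?\<alpha>(i := Suc (?\<alpha> i)) = \<beta>" using assms(2) by auto
  then show "?\<alpha> \<in> multiindices j t" using sum_fun_upd_Suc[OF i, of ?\<alpha>] assms(1) by (auto simp: multiindices_def)
qed

lemma form_add: "form f j t (\<lambda>\<alpha>. g \<alpha> + h \<alpha>) = form f j t g + form f j t h"
  and form_diff: "form f j t (\<lambda>\<alpha>. g \<alpha> - h \<alpha>) = form f j t g - form f j t h"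
  and form_scale: "form f j t (\<lambda>\<alpha>. r * g \<alpha>) = r * form f j t g"
  by (simp_all add: form_def algebra_simps sum.distrib sum_subtractf sum_distrib_left)

lemma form_cong: "(\<And>\<alpha>. \<alpha> \<in> multiindices j t \<Longrightarrow> g \<alpha> = h \<alpha>) \<Longrightarrow> form f j t g = form f j t h"
  unfolding form_def by (intro sum.cong) auto

lemma form_0: "form f j 0 g = g (\<lambda>_. 0)"
  by (simp add: form_def multiindices_0)

lemma form_mult:
  assumes i: "i < j"
  shows "f i * form f j t g = form f j (Suc t) (\<lambda>\<beta>. if \<beta> i \<noteq> 0 then g (\<beta>(i := \<beta> i - 1)) else 0)"
proof -
  let ?u = "\<lambda>\<alpha>::nat \<Rightarrow> nat. \<alpha>(i := Suc (\<alpha> i))"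
  let ?h = "\<lambda>\<beta>. if \<beta> i \<noteq> 0 then g (\<beta>(i := \<beta> i - 1)) else 0"
  have "form f j (Suc t) ?h = (\<Sum>\<beta>\<in>?u ` multiindices j t. (\<Prod>k<j. f k ^ \<beta> k) * ?h \<beta>)"
    unfolding form_def
  proof (rule sum.mono_neutral_right[OF finite_multiindices])
    show "?u ` multiindices j t \<subseteq> multiindices j (Suc t)" using multiindices_upd_Suc[OF i] by auto
    have "\<beta> \<in> ?u ` multiindices j t" if "\<beta> \<in> multiindices j (Suc t)" "\<beta> i \<noteq> 0" for \<beta>
      using multiindices_upd_pred[OF that] that(2) by (intro image_eqI[of _ _ "\<beta>(i := \<beta> i - 1)"]) auto
    then show "\<forall>\<beta>\<in>multiindices j (Suc t) - ?u ` multiindices j t. (\<Prod>k<j. f k ^ \<beta> k) * ?h \<beta> = 0" by auto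
  qed
  also have "\<dots> = (\<Sum>\<alpha>\<in>multiindices j t. (\<Prod>k<j. f k ^ ?u \<alpha> k) * ?h (?u \<alpha>))"
  proof (rule sum.reindex_cong[of ?u])
    show "inj_on ?u (multiindices j t)"
      by (rule inj_onI) (metis fun_upd_same fun_upd_triv fun_upd_upd nat.inject)
  qed auto
  also have "\<dots> = (\<Sum>\<alpha>\<in>multiindices j t. f i * ((\<Prod>k<j. f k ^ \<alpha> k) * g \<alpha>))"
    using prod_fun_upd_Suc[OF i] by (intro sum.cong) (simp_all add: mult.assoc del: fun_upd_apply, simp)
  finally show ?thesis by (simp add: form_def sum_distrib_left)
qed

lemma form_Suc:
  "form f (Suc j) (Suc t) g = form f j (Suc t) g + f j * form f (Suc j) t (\<lambda>\<alpha>. g (\<alpha>(j := Suc (\<alpha> j))))"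
proof -
  have "form f (Suc j) (Suc t) g = form f (Suc j) (Suc t) (\<lambda>\<beta>. if \<beta> j \<noteq> 0 then g \<beta> else 0) +
      form f (Suc j) (Suc t) (\<lambda>\<beta>. if \<beta> j = 0 then g \<beta> else 0)"
    unfolding form_add[symmetric] by (rule form_cong) simp
  also have "form f (Suc j) (Suc t) (\<lambda>\<beta>. if \<beta> j \<noteq> 0 then g \<beta> else 0) =
      f j * form f (Suc j) t (\<lambda>\<alpha>. g (\<alpha>(j := Suc (\<alpha> j))))"
    by (subst form_mult) (auto intro!: form_cong)
  also have "form f (Suc j) (Suc t) (\<lambda>\<beta>. if \<beta> j = 0 then g \<beta> else 0) = form f j (Suc t) g"
  proof -
    have s: "multiindices j (Suc t) \<subseteq> multiindices (Suc j) (Suc t)" by (auto simp: multiindices_def)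
    have z: "\<beta> \<in> multiindices j (Suc t)" if "\<beta> \<in> multiindices (Suc j) (Suc t)" "\<beta> j = 0" for \<beta>
      using that by (auto simp: multiindices_def) (metis Suc_leI le_neq_implies_less)
    have z': "\<beta> j = 0" if "\<beta> \<in> multiindices j (Suc t)" for \<beta> using that by (simp add: multiindices_def)
    show ?thesis unfolding form_def
      by (rule sum.mono_neutral_cong_right[OF finite_multiindices s]) (use z in \<open>auto simp: z'\<close>)
  qed
  finally show ?thesis by (simp only: add.commute)
qed

lemma form_embed:
  "form f j (Suc t) g = form f (Suc j) (Suc t) (\<lambda>\<alpha>. if \<alpha> j = 0 then g \<alpha> else 0)"
  unfolding form_Suc[of f j t "\<lambda>\<alpha>. if \<alpha> j = 0 then g \<alpha> else 0"]
proof -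
  have "form f (Suc j) t (\<lambda>\<alpha>. if (\<alpha>(j := Suc (\<alpha> j))) j = 0 then g (\<alpha>(j := Suc (\<alpha> j))) else 0) = 0"
    by (simp add: form_def)
  moreover have "form f j (Suc t) g = form f j (Suc t) (\<lambda>\<alpha>. if \<alpha> j = 0 then g \<alpha> else 0)"
    by (rule form_cong) (simp add: multiindices_def)
  ultimately show "form f j (Suc t) g = form f j (Suc t) (\<lambda>\<alpha>. if \<alpha> j = 0 then g \<alpha> else 0) +
    f j * form f (Suc j) t (\<lambda>\<alpha>. if (\<alpha>(j := Suc (\<alpha> j))) j = 0 then g (\<alpha>(j := Suc (\<alpha> j))) else 0)" by simp
qed

end

context typeclass_ring
begin

lemma multiindices_choice:
  assumes "\<beta> \<in> multiindices j (Suc t)"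
  shows "\<exists>i. \<beta> i \<noteq> 0"
proof (rule ccontr)
  assume "\<nexists>i. \<beta> i \<noteq> 0"
  then have "(\<Sum>i<j. \<beta> i) = 0" by simp
  with assms show False by (simp add: multiindices_def)
qed

text \<open>From each monomial of degree t + 1 one factor f_i is broken off and moved into the
  coefficient; the choice \<open>c\<close> fixes which one, and the coefficients arriving at the
  same monomial of degree t are added up.\<close>

lemma form_lower:
  assumes J: "ideal J R" and f: "\<And>i. i < j \<Longrightarrow> f i \<in> carrier R" and h: "\<And>\<alpha>. h \<alpha> \<in> carrier R"
  shows "\<exists>h'. (\<forall>\<alpha>. h' \<alpha> \<in> ext_ideal J f j) \<and> form f j (Suc t) h = form f j t h'"
proof -
  define c where "c \<beta> = (SOME i. \<beta> i \<noteq> 0)" for \<beta> :: "nat \<Rightarrow> nat"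
  define p where "p \<beta> = \<beta>(c \<beta> := \<beta> (c \<beta>) - 1)" for \<beta>
  have c: "\<beta> (c \<beta>) \<noteq> 0" if "\<beta> \<in> multiindices j (Suc t)" for \<beta>
    unfolding c_def by (rule someI_ex) (rule multiindices_choice[OF that])
  have p: "p \<beta> \<in> multiindices j t" "c \<beta> < j" if "\<beta> \<in> multiindices j (Suc t)" for \<beta>
    using multiindices_upd_pred[OF that c[OF that]] by (auto simp: p_def)
  define h' where "h' \<alpha> = (\<Sum>\<beta>\<in>{\<beta> \<in> multiindices j (Suc t). p \<beta> = \<alpha>}. f (c \<beta>) * h \<beta>)" for \<alpha>
  have I: "ideal (ext_ideal J f j) R" by (rule ext_ideal_ideal[OF J f])
  have "h' \<alpha> \<in> ext_ideal J f j" for \<alpha>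
    unfolding h'_def
  proof (rule ideal_sum[OF I])
    fix \<beta> assume "\<beta> \<in> {\<beta> \<in> multiindices j (Suc t). p \<beta> = \<alpha>}"
    then have "f (c \<beta>) \<in> ext_ideal J f j" using p(2) by (intro ext_ideal_generator[OF J f]) auto
    from ideal_mult[OF I h this] show "f (c \<beta>) * h \<beta> \<in> ext_ideal J f j" by (simp add: mult.commute)
  qed
  moreover have "form f j (Suc t) h = form f j t h'"
  proof -
    have m: "(\<Prod>k<j. f k ^ \<beta> k) = (\<Prod>k<j. f k ^ p \<beta> k) * f (c \<beta>)" if "\<beta> \<in> multiindices j (Suc t)" for \<beta>
    proof -
      have "(p \<beta>)(c \<beta> := Suc (p \<beta> (c \<beta>))) = \<beta>" using c[OF that] by (auto simp: p_def)
      then show ?thesis using prod_fun_upd_Suc[OF p(2)[OF that], of f "p \<beta>"] by (simp add: mult.commute)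
    qed
    have "form f j t h' = (\<Sum>\<alpha>\<in>multiindices j t. \<Sum>\<beta>\<in>{\<beta> \<in> multiindices j (Suc t). p \<beta> = \<alpha>}.
        (\<Prod>k<j. f k ^ \<beta> k) * h \<beta>)"
      unfolding form_def h'_def sum_distrib_left
      by (intro sum.cong refl) (auto simp: m mult.assoc)
    also have "\<dots> = form f j (Suc t) h"
      unfolding form_def by (rule sum.group[OF finite_multiindices finite_multiindices]) (use p in auto)
    finally show ?thesis ..
  qed
  ultimately show ?thesis by blast
qed

text \<open>The ideal J + (f_0, ..., f_(j-1))^t. The power is presented by forms with coefficients
  in R, since quasi-regularity is a statement about these coefficients.\<close>

definition power_ideal :: "'a set \<Rightarrow> (nat \<Rightarrow> 'a) \<Rightarrow> nat \<Rightarrow> nat \<Rightarrow> 'a set" where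
  "power_ideal J f j t = {h. \<exists>g. (\<forall>\<alpha>. g \<alpha> \<in> carrier R) \<and> h - form f j t g \<in> J}"

lemma power_idealI:
  "h - form f j t g \<in> J \<Longrightarrow> (\<And>\<alpha>. g \<alpha> \<in> carrier R) \<Longrightarrow> h \<in> power_ideal J f j t"
  unfolding power_ideal_def by blast

lemma power_ideal_add:
  assumes J: "ideal J R" and "x \<in> power_ideal J f j t" "y \<in> power_ideal J f j t"
  shows "x + y \<in> power_ideal J f j t"
proof -
  obtain g h where gh: "\<forall>\<alpha>. g \<alpha> \<in> carrier R" "x - form f j t g \<in> J" "\<forall>\<alpha>. h \<alpha> \<in> carrier R" "y - form f j t h \<in> J"
    using assms unfolding power_ideal_def by blast
  have "x + y - form f j t (\<lambda>\<alpha>. g \<alpha> + h \<alpha>) \<in> J"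
    using ideal_add[OF J gh(2,4)] by (simp add: form_add algebra_simps)
  then show ?thesis by (rule power_idealI) (use gh(1,3) in simp)
qed

lemma power_ideal_mult:
  assumes J: "ideal J R" and r: "r \<in> carrier R" and "x \<in> power_ideal J f j t"
  shows "r * x \<in> power_ideal J f j t"
proof -
  obtain g where g: "\<forall>\<alpha>. g \<alpha> \<in> carrier R" "x - form f j t g \<in> J"
    using assms unfolding power_ideal_def by blast
  have "r * x - form f j t (\<lambda>\<alpha>. r * g \<alpha>) \<in> J"
    using ideal_mult[OF J r g(2)] by (simp add: form_scale algebra_simps)
  then show ?thesis by (rule power_idealI) (use g(1) r in simp)
qed

lemma power_ideal_J:
  assumes J: "ideal J R" and "x \<in> J"
  shows "x \<in> power_ideal J f j t"
  by (rule power_idealI[of _ _ _ _ "\<lambda>_. 0"]) (use assms in \<open>simp_all add: form_def\<close>)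

lemma power_ideal_sum:
  assumes J: "ideal J R" and "\<And>i. i \<in> A \<Longrightarrow> g i \<in> power_ideal J f j t"
  shows "sum g A \<in> power_ideal J f j t"
  using assms(2)
  by (induction A rule: infinite_finite_induct)
    (auto intro: power_ideal_add[OF J] power_ideal_J[OF J] ideal_zero[OF J])

lemma power_ideal_generator:
  assumes J: "ideal J R" and i: "i < j" and f: "f i \<in> carrier R" and x: "x \<in> power_ideal J f j t"
  shows "f i * x \<in> power_ideal J f j (Suc t)"
proof -
  obtain g where g: "\<forall>\<alpha>. g \<alpha> \<in> carrier R" "x - form f j t g \<in> J"
    using x unfolding power_ideal_def by blast
  let ?h = "\<lambda>\<beta>. if \<beta> i \<noteq> 0 then g (\<beta>(i := \<beta> i - 1)) else 0"
  have "f i * x - form f j (Suc t) ?h \<in> J"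
    using ideal_mult[OF J f g(2)] unfolding form_mult[OF i, symmetric] by (simp add: algebra_simps)
  then show ?thesis by (rule power_idealI) (use g(1) in simp)
qed

lemma form_ext_ideal:
  assumes J: "ideal J R" and f: "\<And>i. i < j \<Longrightarrow> f i \<in> carrier R" and k: "k \<le> j"
    and g: "\<And>\<alpha>. \<alpha> \<in> multiindices j t \<Longrightarrow> g \<alpha> \<in> ext_ideal J f k"
  shows "form f j t g \<in> power_ideal J f j (Suc t)"
  using k g
proof (induction k arbitrary: g)
  case 0
  have "form f j t g \<in> J"
    unfolding form_def by (rule ideal_sum[OF J], rule ideal_mult[OF J prod_closed]) (use 0 f in auto)
  then show ?case by (rule power_ideal_J[OF J])
next
  case (Suc k)
  have "\<exists>u r. u \<in> ext_ideal J f k \<and> r \<in> carrier R \<and> (\<alpha> \<in> multiindices j t \<longrightarrow> g \<alpha> = u + f k * r)" for \<alpha>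
  proof (cases "\<alpha> \<in> multiindices j t")
    case True
    with Suc.prems(2)[of \<alpha>] show ?thesis by auto
  next
    case False
    have "ideal (ext_ideal J f k) R" using Suc.prems by (intro ext_ideal_ideal[OF J f]) simp
    with False show ?thesis using ideal_zero closed(1) by blast
  qed
  then obtain u r where ur: "\<And>\<alpha>. u \<alpha> \<in> ext_ideal J f k" "\<And>\<alpha>. r \<alpha> \<in> carrier R"
    "\<And>\<alpha>. \<alpha> \<in> multiindices j t \<Longrightarrow> g \<alpha> = u \<alpha> + f k * r \<alpha>" by metis
  have "form f j t g = form f j t u + f k * form f j t r"
    using ur(3) unfolding form_scale[symmetric] form_add[symmetric] by (rule form_cong)
  moreover have "form f j t u \<in> power_ideal J f j (Suc t)"
    using Suc.prems ur(1) by (intro Suc.IH) auto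
  moreover have "f k * form f j t r \<in> power_ideal J f j (Suc t)"
  proof (rule power_ideal_generator[OF J])
    show "k < j" "f k \<in> carrier R" using Suc.prems f by auto
    show "form f j t r \<in> power_ideal J f j t"
      by (rule power_idealI[of _ _ _ _ r]) (use ur(2) ideal_zero[OF J] in simp_all)
  qed
  ultimately show ?case using power_ideal_add[OF J] by simp
qed

lemma power_ideal_lower:
  assumes J: "ideal J R" and f: "\<And>i. i < j \<Longrightarrow> f i \<in> carrier R" and x: "x \<in> power_ideal J f j (Suc t)"
  obtains h where "\<forall>\<alpha>. h \<alpha> \<in> ext_ideal J f j" "x - form f j t h \<in> J"
proof -
  obtain g where g: "\<forall>\<alpha>. g \<alpha> \<in> carrier R" "x - form f j (Suc t) g \<in> J"
    using x unfolding power_ideal_def by blast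
  have "\<exists>h'. (\<forall>\<alpha>. h' \<alpha> \<in> ext_ideal J f j) \<and> form f j (Suc t) g = form f j t h'"
    by (rule form_lower[OF J f]) (use g(1) in auto)
  with g(2) that show ?thesis by metis
qed

text \<open>A regular sequence is quasi-regular (Rees): a form of degree \<open>t\<close> with a zero at \<open>f\<close> modulo \<open>J\<close>
  has all its coefficients in \<open>(f) + J\<close>.\<close>

lemma quasi_regular:
  assumes J: "ideal J R" and f: "\<And>i. i < s \<Longrightarrow> f i \<in> carrier R"
    and reg: "\<And>i x. i < s \<Longrightarrow> x \<in> carrier R \<Longrightarrow> f i * x \<in> ext_ideal J f i \<Longrightarrow> x \<in> ext_ideal J f i"
    and j: "j \<le> s" and g: "\<And>\<alpha>. g \<alpha> \<in> carrier R" and zero: "form f j t g \<in> J"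
    and \<alpha>: "\<alpha> \<in> multiindices j t"
  shows "g \<alpha> \<in> ext_ideal J f j"
  using j g zero \<alpha>
proof (induction j arbitrary: g t \<alpha>)
  case 0
  then have "t = 0" by (auto simp: multiindices_def)
  with 0 show ?case by (simp add: form_0 multiindices_0)
next
  case (Suc j)
  note IHj = Suc.IH and js = Suc.prems(1)
  have fj: "\<And>i. i < j \<Longrightarrow> f i \<in> carrier R" "\<And>i. i < Suc j \<Longrightarrow> f i \<in> carrier R" "f j \<in> carrier R"
    using f Suc.prems by auto
  have I: "ideal (ext_ideal J f (Suc j)) R" by (rule ext_ideal_ideal[OF J fj(2)])
  have Ij: "ideal (ext_ideal J f j) R" by (rule ext_ideal_ideal[OF J fj(1)])
  \<comment> \<open>The element f j is a non-zero-divisor modulo every J + (f_0, ..., f_(j-1))^t, by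
    induction on t. If x is a form of degree t with coefficients g, the hypothesis for j puts every
    f j * g \<alpha> into the ideal of the first j elements; cancelling f j there gains one power
    for x.\<close>
  have nonzero_div: "x \<in> power_ideal J f j t" if "x \<in> carrier R" "f j * x \<in> power_ideal J f j t" for x t
    using that(2)
  proof (induction t)
    case 0
    show ?case
      by (rule power_idealI[of _ _ _ _ "\<lambda>_. x"]) (use that(1) ideal_zero[OF J] in \<open>simp_all add: form_0\<close>)
  next
    case (Suc t)
    obtain h where h: "\<forall>\<alpha>. h \<alpha> \<in> ext_ideal J f j" "f j * x - form f j t h \<in> J"
      using power_ideal_lower[OF J fj(1) Suc.prems] by blast
    then have hR: "\<forall>\<alpha>. h \<alpha> \<in> carrier R" using ideal_carrier[OF Ij] by blast
    from h(2) have "f j * x \<in> power_ideal J f j t" by (rule power_idealI) (use hR in blast)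
    from Suc.IH[OF this] obtain g where g: "\<forall>\<alpha>. g \<alpha> \<in> carrier R" "x - form f j t g \<in> J"
      unfolding power_ideal_def by blast
    have "form f j t (\<lambda>\<alpha>. f j * g \<alpha> - h \<alpha>) = (f j * x - form f j t h) - f j * (x - form f j t g)"
      by (simp add: form_diff form_scale algebra_simps)
    also have "\<dots> \<in> J" by (rule ideal_diff[OF J h(2) ideal_mult[OF J fj(3) g(2)]])
    finally have z: "form f j t (\<lambda>\<alpha>. f j * g \<alpha> - h \<alpha>) \<in> J" .
    have "g \<alpha> \<in> ext_ideal J f j" if \<alpha>: "\<alpha> \<in> multiindices j t" for \<alpha>
    proof -
      have "f j * g \<alpha> - h \<alpha> \<in> ext_ideal J f j"
        using js g(1) hR fj(3) by (intro IHj[OF _ _ z \<alpha>]) auto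
      from ideal_add[OF Ij this] h(1) have "f j * g \<alpha> \<in> ext_ideal J f j" by (metis diff_add_cancel)
      then show ?thesis using reg[of j "g \<alpha>"] js g(1) by simp
    qed
    then have "form f j t g \<in> power_ideal J f j (Suc t)"
      by (intro form_ext_ideal[OF J fj(1) order_refl]) auto
    from power_ideal_add[OF J this power_ideal_J[OF J g(2)]] show ?case by simp
  qed
  show ?case using Suc.prems(2-)
  proof (induction t arbitrary: g \<alpha>)
    case 0
    then have "g \<alpha> \<in> J" by (simp add: form_0 multiindices_0)
    then show ?case using ext_ideal_mono[of 0 "Suc j" J f] by auto
  next
    case (Suc t)
    let ?g = "\<lambda>\<alpha>. g (\<alpha>(j := Suc (\<alpha> j)))"
    let ?X = "form f (Suc j) t ?g"
    have XR: "?X \<in> carrier R"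
      unfolding form_def by (intro sum_closed closed(4) prod_closed power_closed fj(2) Suc.prems(1)) auto
    \<comment> \<open>The monomials are sorted by whether they contain f j. The relation puts f j *
      ?X into the power t + 1 of the first j elements, so ?X is there too, and rewriting it as a
      form of degree t with coefficients in the ideal opens the way for the hypothesis on t.\<close>
    have zero: "form f j (Suc t) g + f j * ?X \<in> J" using Suc.prems(2) unfolding form_Suc .
    have "f j * ?X - form f j (Suc t) (\<lambda>\<alpha>. 0 - g \<alpha>) \<in> J"
      using zero unfolding form_diff by (simp add: form_def algebra_simps)
    then have "f j * ?X \<in> power_ideal J f j (Suc t)"
      by (rule power_idealI) (use Suc.prems(1) in auto)
    from nonzero_div[OF XR this] obtain h where h: "\<forall>\<alpha>. h \<alpha> \<in> carrier R" "?X - form f j (Suc t) h \<in> J"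
      unfolding power_ideal_def by blast
    have "\<exists>h'. (\<forall>\<alpha>. h' \<alpha> \<in> ext_ideal J f (Suc j)) \<and> form f j (Suc t) h = form f (Suc j) t h'"
      unfolding form_embed[of f j t h] by (rule form_lower[OF J fj(2)]) (use h(1) in auto)
    then obtain h' where h': "\<forall>\<alpha>. h' \<alpha> \<in> ext_ideal J f (Suc j)" "form f j (Suc t) h = form f (Suc j) t h'" by blast
    have h'R: "\<forall>\<alpha>. h' \<alpha> \<in> carrier R" using h'(1) ideal_carrier[OF I] by blast
    have z: "form f (Suc j) t (\<lambda>\<alpha>. ?g \<alpha> - h' \<alpha>) \<in> J" using h(2) unfolding form_diff h'(2) .
    have up: "?g \<alpha> \<in> ext_ideal J f (Suc j)" if \<alpha>: "\<alpha> \<in> multiindices (Suc j) t" for \<alpha>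
    proof -
      have "?g \<alpha> - h' \<alpha> \<in> ext_ideal J f (Suc j)"
        using Suc.prems(1) h'R by (intro Suc.IH[OF _ z \<alpha>] closed(6)) auto
      from ideal_add[OF I this] h'(1) show ?thesis by (metis diff_add_cancel)
    qed
    show ?case
    proof (cases "\<alpha> j = 0")
      case False
      from up[OF multiindices_upd_pred(1)[OF Suc.prems(3) False]] False show ?thesis by simp
    next
      case True
      then have \<alpha>: "\<alpha> \<in> multiindices j (Suc t)"
        using Suc.prems(3) by (auto simp: multiindices_def) (metis Suc_leI le_neq_implies_less)
      \<comment> \<open>Replacing ?X by the form of h leaves a relation among the first j elements
        only, to which the hypothesis for j applies. The correction f j * h \<alpha> is harmless in
        the ideal of the first j + 1 elements.\<close>
      have "form f j (Suc t) (\<lambda>\<alpha>. g \<alpha> + f j * h \<alpha>) = (form f j (Suc t) g + f j * ?X) - f j * (?X - form f j (Suc t) h)"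
        by (simp add: form_add form_scale algebra_simps)
      also have "\<dots> \<in> J" by (rule ideal_diff[OF J zero ideal_mult[OF J fj(3) h(2)]])
      finally have "g \<alpha> + f j * h \<alpha> \<in> ext_ideal J f j"
        using js Suc.prems(1) h(1) fj(3)
        by (intro IHj[OF _ _ _ \<alpha>]) auto
      then have "(g \<alpha> + f j * h \<alpha>) + f j * (- h \<alpha>) \<in> ext_ideal J f (Suc j)"
        unfolding ext_ideal.simps using h(1) closed(5) by blast
      then show ?thesis by simp
    qed
  qed
qed

section \<open>Independence of regular sequences\<close>

lemma power_ideal_0: "ideal J R \<Longrightarrow> x \<in> carrier R \<Longrightarrow> x \<in> power_ideal J f j 0"
  by (rule power_idealI[of _ _ _ _ "\<lambda>_. x"]) (simp_all add: form_0 ideal_zero)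

lemma power_ideal_Suc_subset:
  assumes J: "ideal J R" and f: "\<And>i. i < j \<Longrightarrow> f i \<in> carrier R" and x: "x \<in> power_ideal J f j (Suc t)"
  shows "x \<in> power_ideal J f j t"
proof -
  obtain h where h: "\<forall>\<alpha>. h \<alpha> \<in> ext_ideal J f j" "x - form f j t h \<in> J"
    by (rule power_ideal_lower[OF J f x])
  have I: "ideal (ext_ideal J f j) R" by (rule ext_ideal_ideal[OF J f])
  show ?thesis by (rule power_idealI[OF h(2)]) (use h(1) ideal_carrier[OF I] in blast)
qed

lemma power_ideal_antimono:
  assumes J: "ideal J R" and f: "\<And>i. i < j \<Longrightarrow> f i \<in> carrier R" and "t \<le> t'" and x: "x \<in> power_ideal J f j t'"
  shows "x \<in> power_ideal J f j t"
  using assms(3) x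
proof (induction t' rule: dec_induct)
  case (step n)
  have "x \<in> power_ideal J f j n" by (rule power_ideal_Suc_subset[OF J f step.prems])
  then show ?case by (rule step.IH)
qed

lemma power_ideal_monomial:
  assumes J: "ideal J R" and f: "\<And>i. i < j \<Longrightarrow> f i \<in> carrier R"
    and \<alpha>: "\<alpha> \<in> multiindices j k" and x: "x \<in> power_ideal J f j t"
  shows "(\<Prod>i<j. f i ^ \<alpha> i) * x \<in> power_ideal J f j (k + t)"
  using \<alpha>
proof (induction k arbitrary: \<alpha>)
  case 0
  then show ?case using x by (simp add: multiindices_0)
next
  case (Suc k)
  obtain i where i: "\<alpha> i \<noteq> 0" using multiindices_choice[OF Suc.prems] by blast
  let ?\<beta> = "\<alpha>(i := \<alpha> i - 1)"
  note \<beta> = multiindices_upd_pred[OF Suc.prems i]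
  have "?\<beta>(i := Suc (?\<beta> i)) = \<alpha>" using i by auto
  then have "(\<Prod>i<j. f i ^ \<alpha> i) * x = f i * ((\<Prod>i<j. f i ^ ?\<beta> i) * x)"
    using prod_fun_upd_Suc[OF \<beta>(2), of f ?\<beta>] by (simp add: mult.assoc)
  also have "\<dots> \<in> power_ideal J f j (Suc (k + t))"
    by (rule power_ideal_generator[OF J \<beta>(2) f[OF \<beta>(2)] Suc.IH[OF \<beta>(1)]])
  finally show ?case by simp
qed

lemma base_expansion_inj:
  fixes \<alpha> \<beta> :: "nat \<Rightarrow> nat"
  assumes "\<And>i. i < j \<Longrightarrow> \<alpha> i < b" "\<And>i. i < j \<Longrightarrow> \<beta> i < b"
    and "(\<Sum>i<j. \<alpha> i * b ^ i) = (\<Sum>i<j. \<beta> i * b ^ i)" and "i < j"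
  shows "\<alpha> i = \<beta> i"
  using assms
proof (induction j arbitrary: \<alpha> \<beta> i)
  case (Suc j)
  have e: "(\<Sum>i<Suc j. \<gamma> i * b ^ i) = \<gamma> 0 + b * (\<Sum>i<j. \<gamma> (Suc i) * b ^ i)" for \<gamma> :: "nat \<Rightarrow> nat"
    by (subst sum.lessThan_Suc_shift) (simp add: sum_distrib_left mult_ac)
  have "\<alpha> 0 < b" "\<beta> 0 < b" using Suc.prems(1,2) by auto
  moreover have eq: "\<alpha> 0 + b * (\<Sum>i<j. \<alpha> (Suc i) * b ^ i) = \<beta> 0 + b * (\<Sum>i<j. \<beta> (Suc i) * b ^ i)"
    using Suc.prems(3) unfolding e .
  ultimately have z: "\<alpha> 0 = \<beta> 0" by (metis mod_less mod_mult_self2)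
  with eq \<open>\<alpha> 0 < b\<close> have "(\<Sum>i<j. \<alpha> (Suc i) * b ^ i) = (\<Sum>i<j. \<beta> (Suc i) * b ^ i)" by simp
  with Suc.IH[of "\<lambda>i. \<alpha> (Suc i)" "\<lambda>i. \<beta> (Suc i)"] Suc.prems(1,2)
  have "\<alpha> (Suc i) = \<beta> (Suc i)" if "i < j" for i using that by simp
  with z Suc.prems(4) show ?case by (cases i) auto
qed simp

lemma multiindices_add:
  "\<alpha> \<in> multiindices j k \<Longrightarrow> \<beta> \<in> multiindices j t \<Longrightarrow> (\<lambda>i. \<alpha> i + \<beta> i) \<in> multiindices j (k + t)"
  by (auto simp: multiindices_def sum.distrib)

lemma multiindices_le: "\<alpha> \<in> multiindices j k \<Longrightarrow> \<alpha> i \<le> k"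
  unfolding multiindices_def by (cases "i < j") (auto intro: member_le_sum[of i "{..<j}"])

text \<open>The associated graded module of \<open>R / J\<close> along a regular sequence is a polynomial module over
  \<open>R / ((f) + J)\<close>, hence has no torsion over the polynomials with unit coefficients. The two
  extremal exponents below are taken with respect to the monomial order that compares base-\<open>b\<close>
  expansions.\<close>

lemma regular_sequence_independent:
  assumes J: "ideal J R" and f: "\<And>i. i < s \<Longrightarrow> f i \<in> carrier R"
    and reg: "\<And>i x. i < s \<Longrightarrow> x \<in> carrier R \<Longrightarrow> f i * x \<in> ext_ideal J f i \<Longrightarrow> x \<in> ext_ideal J f i"
    and u: "u \<in> carrier R" "u \<notin> power_ideal J f s t0"
    and P: "finite P" "P \<noteq> {}" "\<And>\<alpha> i. \<alpha> \<in> P \<Longrightarrow> s \<le> i \<Longrightarrow> \<alpha> i = 0"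
    and c: "\<And>\<alpha>. c \<alpha> \<in> carrier R" "\<And>\<alpha>. \<alpha> \<in> P \<Longrightarrow> \<exists>d \<in> carrier R. d * c \<alpha> = 1"
    and zero: "(\<Sum>\<alpha>\<in>P. c \<alpha> * (\<Prod>i<s. f i ^ \<alpha> i)) * u \<in> J"
  shows False
proof -
  define deg where "deg \<alpha> = (\<Sum>i<s. \<alpha> i)" for \<alpha> :: "nat \<Rightarrow> nat"
  have Pm: "\<alpha> \<in> multiindices s (deg \<alpha>)" if "\<alpha> \<in> P" for \<alpha>
    using P(3)[OF that] by (simp add: multiindices_def deg_def)
  define k where "k = Min (deg ` P)"
  have k: "k \<in> deg ` P" "\<And>\<alpha>. \<alpha> \<in> P \<Longrightarrow> k \<le> deg \<alpha>"
    using P by (auto simp: k_def)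
  \<comment> \<open>The support of the initial form of the relation: its monomials of least total
    degree k.\<close>
  define Q where "Q = {\<alpha> \<in> P. deg \<alpha> = k}"
  have Q: "finite Q" "Q \<noteq> {}" "Q \<subseteq> P" using P k by (auto simp: Q_def)
  have Qm: "\<alpha> \<in> multiindices s k" if "\<alpha> \<in> Q" for \<alpha> using that Pm[of \<alpha>] by (auto simp: Q_def)
  have I: "ideal (ext_ideal J f s) R" by (rule ext_ideal_ideal[OF J f])
  \<comment> \<open>The order of u in the filtration by powers is exactly t = t1 - 1: u is a form of
    degree t modulo J, and some of its coefficients lie outside the ideal. \<open>T\<close> collects
    the exponents of those coefficients.\<close>
  define t1 where "t1 = (LEAST t. u \<notin> power_ideal J f s t)"
  have t1: "u \<notin> power_ideal J f s t1" unfolding t1_def by (rule LeastI) (rule u(2))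
  have "t1 \<noteq> 0" using t1 power_ideal_0[OF J u(1)] by metis
  then obtain t where t: "t1 = Suc t" by (cases t1) auto
  have ut: "u \<in> power_ideal J f s t" using not_less_Least[of t "\<lambda>t. u \<notin> power_ideal J f s t"] t unfolding t1_def by auto
  then obtain g where g: "\<forall>\<alpha>. g \<alpha> \<in> carrier R" "u - form f s t g \<in> J" unfolding power_ideal_def by blast
  define T where "T = {\<beta> \<in> multiindices s t. g \<beta> \<notin> ext_ideal J f s}"
  have T: "finite T" using finite_multiindices by (auto simp: T_def)
  have "T \<noteq> {}"
  proof
    assume "T = {}"
    then have "form f s t g \<in> power_ideal J f s (Suc t)"
      by (intro form_ext_ideal[OF J f order_refl]) (auto simp: T_def)
    from power_ideal_add[OF J this power_ideal_J[OF J g(2)]] t1 t show False by simp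
  qed
  \<comment> \<open>The coefficients of the product of the initial forms of the relation and of
    u.\<close>
  define G where "G \<gamma> = (\<Sum>(\<alpha>, \<beta>)\<in>{(\<alpha>, \<beta>) \<in> Q \<times> multiindices s t. (\<lambda>i. \<alpha> i + \<beta> i) = \<gamma>}. c \<alpha> * g \<beta>)" for \<gamma>
  have GR: "G \<gamma> \<in> carrier R" for \<gamma> unfolding G_def by (rule sum_closed) (use g c in auto)
  have form_G: "form f s (k + t) G = (\<Sum>\<alpha>\<in>Q. c \<alpha> * (\<Prod>i<s. f i ^ \<alpha> i)) * form f s t g"
  proof -
    have "form f s (k + t) G = (\<Sum>\<gamma>\<in>multiindices s (k + t).
        \<Sum>x\<in>{x \<in> Q \<times> multiindices s t. (\<lambda>i. fst x i + snd x i) = \<gamma>}.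
          (c (fst x) * (\<Prod>i<s. f i ^ fst x i)) * ((\<Prod>i<s. f i ^ snd x i) * g (snd x)))"
      unfolding form_def G_def sum_distrib_left
      by (intro sum.cong refl) (auto simp: power_add prod.distrib mult_ac case_prod_beta)
    also have "\<dots> = (\<Sum>x\<in>Q \<times> multiindices s t.
          (c (fst x) * (\<Prod>i<s. f i ^ fst x i)) * ((\<Prod>i<s. f i ^ snd x i) * g (snd x)))"
      by (rule sum.group) (use Q finite_multiindices Qm in \<open>auto intro: multiindices_add\<close>)
    also have "\<dots> = (\<Sum>\<alpha>\<in>Q. c \<alpha> * (\<Prod>i<s. f i ^ \<alpha> i)) * form f s t g"
      unfolding form_def sum_product sum.cartesian_product by (simp add: case_prod_beta)
    finally show ?thesis .
  qed
  have mono_c: "(\<Prod>i<s. f i ^ \<alpha> i) \<in> carrier R" for \<alpha> by (intro prod_closed power_closed f) auto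
  \<comment> \<open>In the relation the monomials of degree above k contribute only order above k +
    t, and so does replacing u by its form. Hence the product of the two initial forms also has
    order above k + t, and quasi-regularity puts all coefficients G into the ideal.\<close>
  have FG: "form f s (k + t) G \<in> power_ideal J f s (Suc (k + t))"
  proof -
    have 1: "(\<Sum>\<alpha>\<in>P - Q. c \<alpha> * (\<Prod>i<s. f i ^ \<alpha> i)) * u \<in> power_ideal J f s (Suc (k + t))"
      unfolding sum_distrib_right
    proof (rule power_ideal_sum[OF J])
      fix \<alpha> assume \<alpha>: "\<alpha> \<in> P - Q"
      then have "Suc k \<le> deg \<alpha>" using k(2)[of \<alpha>] by (auto simp: Q_def)
      moreover have "(\<Prod>i<s. f i ^ \<alpha> i) * u \<in> power_ideal J f s (deg \<alpha> + t)"
        by (rule power_ideal_monomial[OF J f Pm ut]) (use \<alpha> in auto)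
      ultimately have "(\<Prod>i<s. f i ^ \<alpha> i) * u \<in> power_ideal J f s (Suc (k + t))"
        by (intro power_ideal_antimono[OF J f, where t = "Suc (k + t)" and t' = "deg \<alpha> + t"]) auto
      from power_ideal_mult[OF J c(1) this] show "c \<alpha> * (\<Prod>i<s. f i ^ \<alpha> i) * u \<in> power_ideal J f s (Suc (k + t))"
        by (simp add: mult.assoc)
    qed
    let ?p = "\<Sum>\<alpha>\<in>Q. c \<alpha> * (\<Prod>i<s. f i ^ \<alpha> i)"
    let ?q = "\<Sum>\<alpha>\<in>P - Q. c \<alpha> * (\<Prod>i<s. f i ^ \<alpha> i)"
    have pR: "?p \<in> carrier R" by (intro sum_closed closed(4) c mono_c)
    have pq: "(\<Sum>\<alpha>\<in>P. c \<alpha> * (\<Prod>i<s. f i ^ \<alpha> i)) = ?p + ?q"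
      using sum.subset_diff[OF Q(3) P(1)] by (simp add: add.commute)
    have "?p * form f s t g = (?p + ?q) * u - ?p * (u - form f s t g) + (- 1) * (?q * u)"
      by (simp add: algebra_simps)
    also have "\<dots> \<in> power_ideal J f s (Suc (k + t))"
      by (intro power_ideal_add[OF J] power_ideal_mult[OF J _ 1] power_ideal_J[OF J] ideal_diff[OF J]
          ideal_mult[OF J pR g(2)] zero[unfolded pq] closed)
    finally show ?thesis unfolding form_G .
  qed
  obtain h where h: "\<forall>\<alpha>. h \<alpha> \<in> ext_ideal J f s" "form f s (k + t) G - form f s (k + t) h \<in> J"
    by (rule power_ideal_lower[OF J f FG])
  have Gext: "G \<gamma> \<in> ext_ideal J f s" if "\<gamma> \<in> multiindices s (k + t)" for \<gamma>
  proof -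
    have "form f s (k + t) (\<lambda>\<gamma>. G \<gamma> - h \<gamma>) \<in> J" using h(2) by (simp add: form_diff)
    moreover have "G \<gamma> - h \<gamma> \<in> carrier R" for \<gamma> using GR h(1) ideal_carrier[OF I] by blast
    ultimately have "G \<gamma> - h \<gamma> \<in> ext_ideal J f s"
      by (intro quasi_regular[OF J f reg order_refl _ _ that]) auto
    from ideal_add[OF I this] h(1) show ?thesis by (metis diff_add_cancel)
  qed
  \<comment> \<open>All exponents in degree at most k + t stay below this base, so the weight
    \<open>w\<close> separates multiindices of the same degree. Being additive as well, it serves as
    a monomial order.\<close>
  define b where "b = Suc (k + t)"
  define w where "w \<alpha> = (\<Sum>i<s. \<alpha> i * b ^ i)" for \<alpha> :: "nat \<Rightarrow> nat"
  obtain \<alpha>0 where \<alpha>0: "\<alpha>0 \<in> Q" "\<And>\<alpha>. \<alpha> \<in> Q \<Longrightarrow> w \<alpha>0 \<le> w \<alpha>"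
    using ex_min_if_finite[of "w ` Q"] Q by (metis (mono_tags, opaque_lifting) arg_min_if_finite(1) arg_min_least)
  obtain \<beta>0 where \<beta>0: "\<beta>0 \<in> T" "\<And>\<beta>. \<beta> \<in> T \<Longrightarrow> w \<beta>0 \<le> w \<beta>"
    using T \<open>T \<noteq> {}\<close> by (metis (mono_tags, opaque_lifting) arg_min_if_finite(1) arg_min_least)
  have \<beta>0m: "\<beta>0 \<in> multiindices s t" using \<beta>0(1) by (simp add: T_def)
  have w_inj: "\<alpha> = \<beta>" if "\<alpha> \<in> multiindices s l" "\<beta> \<in> multiindices s l" "l \<le> k + t" "w \<alpha> = w \<beta>" for \<alpha> \<beta> l
  proof
    fix i
    have lt: "\<alpha> i < b" "\<beta> i < b" for i
      using multiindices_le[OF that(1), of i] multiindices_le[OF that(2), of i] that(3) by (auto simp: b_def)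
    show "\<alpha> i = \<beta> i"
    proof (cases "i < s")
      case True
      show ?thesis by (rule base_expansion_inj[OF lt that(4)[unfolded w_def] True])
    next
      case False
      then show ?thesis using that(1,2) by (simp add: multiindices_def)
    qed
  qed
  let ?\<gamma> = "\<lambda>i. \<alpha>0 i + \<beta>0 i"
  let ?X = "{(\<alpha>, \<beta>) \<in> Q \<times> multiindices s t. (\<lambda>i. \<alpha> i + \<beta> i) = ?\<gamma>}"
  have fX: "finite ?X" by (rule finite_subset[of _ "Q \<times> multiindices s t"]) (use Q finite_multiindices in auto)
  have X0: "(\<alpha>0, \<beta>0) \<in> ?X" using \<alpha>0 \<beta>0m by simp
  \<comment> \<open>Both \<alpha>0 and \<beta>0 have least weight. A different pair with the same
    sum would, if \<beta> were in \<open>T\<close>, have the same weights and therefore be the same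
    pair. So modulo the ideal the coefficient of \<alpha>0 + \<beta>0 is c \<alpha>0 * g \<beta>0
    alone.\<close>
  have "c \<alpha> * g \<beta> \<in> ext_ideal J f s" if "(\<alpha>, \<beta>) \<in> ?X - {(\<alpha>0, \<beta>0)}" for \<alpha> \<beta>
  proof (rule ccontr)
    assume n: "c \<alpha> * g \<beta> \<notin> ext_ideal J f s"
    have ab: "\<alpha> \<in> Q" "\<beta> \<in> multiindices s t" "(\<lambda>i. \<alpha> i + \<beta> i) = ?\<gamma>" "(\<alpha>, \<beta>) \<noteq> (\<alpha>0, \<beta>0)" using that by auto
    have "\<beta> \<in> T" using n ab(2) ideal_mult[OF I c(1)] by (auto simp: T_def)
    moreover have "w \<alpha> + w \<beta> = w \<alpha>0 + w \<beta>0"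
      unfolding w_def sum.distrib[symmetric] distrib_right[symmetric] using ab(3) by (metis (no_types))
    ultimately have "w \<alpha> = w \<alpha>0" "w \<beta> = w \<beta>0" using \<alpha>0(2)[OF ab(1)] \<beta>0(2)[of \<beta>] by auto
    then have "\<alpha> = \<alpha>0" "\<beta> = \<beta>0"
      using w_inj[OF Qm[OF ab(1)] Qm[OF \<alpha>0(1)]] w_inj[OF ab(2) \<beta>0m] by auto
    with ab(4) show False by simp
  qed
  then have rest: "(\<Sum>(\<alpha>, \<beta>)\<in>?X - {(\<alpha>0, \<beta>0)}. c \<alpha> * g \<beta>) \<in> ext_ideal J f s"
    by (intro ideal_sum[OF I]) auto
  have "G ?\<gamma> = c \<alpha>0 * g \<beta>0 + (\<Sum>(\<alpha>, \<beta>)\<in>?X - {(\<alpha>0, \<beta>0)}. c \<alpha> * g \<beta>)"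
    unfolding G_def by (subst sum.remove[OF fX X0]) simp
  then have "c \<alpha>0 * g \<beta>0 = G ?\<gamma> - (\<Sum>(\<alpha>, \<beta>)\<in>?X - {(\<alpha>0, \<beta>0)}. c \<alpha> * g \<beta>)"
    by (simp only: add_diff_cancel_right')
  also have "\<dots> \<in> ext_ideal J f s"
    by (rule ideal_diff[OF I Gext[OF multiindices_add[OF Qm[OF \<alpha>0(1)] \<beta>0m]] rest])
  finally have "c \<alpha>0 * g \<beta>0 \<in> ext_ideal J f s" .
  moreover obtain d where "d \<in> carrier R" "d * c \<alpha>0 = 1" using c(2)[of \<alpha>0] \<alpha>0(1) Q(3) by blast
  ultimately have "g \<beta>0 \<in> ext_ideal J f s"
    using ideal_mult[OF I, of d "c \<alpha>0 * g \<beta>0"] by (simp add: mult.assoc[symmetric])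
  with \<beta>0(1) show False by (simp add: T_def)
qed

end

section \<open>Polynomials and substitution\<close>

abbreviation monom :: "('x \<Rightarrow>\<^sub>0 nat) \<Rightarrow> ('x, 'k::comm_ring_1) mpoly" where
  "monom m \<equiv> Poly_Mapping.single m 1"

abbreviation const_poly :: "'k \<Rightarrow> ('x, 'k::comm_ring_1) mpoly" where
  "const_poly c \<equiv> Poly_Mapping.single 0 c"

abbreviation polys :: "'x set \<Rightarrow> ('x, 'k::comm_ring_1) mpoly set" where
  "polys X \<equiv> carrier (mpoly_ring X)"

lemma mem_polys: "p \<in> polys X \<longleftrightarrow> (\<forall>m \<in> Poly_Mapping.keys p. Poly_Mapping.keys m \<subseteq> X)"
  by (simp add: mpoly_ring_def)

lemma monom_expansion: "p = (\<Sum>m\<in>Poly_Mapping.keys p. Poly_Mapping.single m (Poly_Mapping.lookup p m))"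
proof (rule poly_mapping_eqI)
  fix k
  have "(\<Sum>m\<in>Poly_Mapping.keys p. Poly_Mapping.lookup p m when m = k) = Poly_Mapping.lookup p k"
    by (simp add: when_def in_keys_iff)
  then show "Poly_Mapping.lookup p k =
      Poly_Mapping.lookup (\<Sum>m\<in>Poly_Mapping.keys p. Poly_Mapping.single m (Poly_Mapping.lookup p m)) k"
    by (simp add: lookup_sum lookup_single)
qed

lemma single_eq_const_mult: "Poly_Mapping.single m (c::'k::comm_ring_1) = const_poly c * monom m"
  by (simp add: mult_single)

definition subst :: "('x \<Rightarrow> ('y, 'k) mpoly) \<Rightarrow> ('x, 'k::comm_ring_1) mpoly \<Rightarrow> ('y, 'k) mpoly" where
  "subst h p = (\<Sum>m\<in>Poly_Mapping.keys p. const_poly (Poly_Mapping.lookup p m) *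
     (\<Prod>v\<in>Poly_Mapping.keys m. h v ^ Poly_Mapping.lookup m v))"

lemma subst_superset:
  assumes "finite U" "Poly_Mapping.keys p \<subseteq> U"
  shows "subst h p = (\<Sum>m\<in>U. const_poly (Poly_Mapping.lookup p m) *
     (\<Prod>v\<in>Poly_Mapping.keys m. h v ^ Poly_Mapping.lookup m v))"
  unfolding subst_def using assms by (intro sum.mono_neutral_left) (auto simp: in_keys_iff)

lemma subst_add: "subst h (p + q) = subst h p + subst h q"
proof -
  let ?U = "Poly_Mapping.keys p \<union> Poly_Mapping.keys q"
  have "Poly_Mapping.keys (p + q) \<subseteq> ?U" using Poly_Mapping.keys_add[of p q] by simp
  then show ?thesis
    using subst_superset[of ?U p h] subst_superset[of ?U q h] subst_superset[of ?U "p + q" h]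
    by (simp add: lookup_add single_add distrib_right sum.distrib)
qed

lemma subst_0 [simp]: "subst h 0 = 0"
  by (simp add: subst_def)

lemma subst_uminus: "subst h (- p) = - subst h p"
  using subst_add[of h p "- p"] by (simp add: eq_neg_iff_add_eq_0 add.commute)

lemma subst_diff: "subst h (p - q) = subst h p - subst h q"
  using subst_add[of h p "- q"] by (simp add: subst_uminus)

lemma subst_sum: "subst h (sum f A) = (\<Sum>i\<in>A. subst h (f i))"
  by (induction A rule: infinite_finite_induct) (simp_all add: subst_add)

lemma subst_single: "subst h (Poly_Mapping.single m c) =
    const_poly c * (\<Prod>v\<in>Poly_Mapping.keys m. h v ^ Poly_Mapping.lookup m v)"
  using subst_superset[of "{m}" "Poly_Mapping.single m c" h] by simp

lemma prod_keys_superset: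
  assumes "finite U" "Poly_Mapping.keys m \<subseteq> U"
  shows "(\<Prod>v\<in>Poly_Mapping.keys m. h v ^ Poly_Mapping.lookup m v) = (\<Prod>v\<in>U. (h v :: 'a::comm_monoid_mult) ^ Poly_Mapping.lookup m v)"
  using assms by (intro prod.mono_neutral_left) (auto simp: in_keys_iff)

lemma prod_keys_add:
  "(\<Prod>v\<in>Poly_Mapping.keys (m + m'). (h v :: 'a::comm_monoid_mult) ^ Poly_Mapping.lookup (m + m') v) =
   (\<Prod>v\<in>Poly_Mapping.keys m. h v ^ Poly_Mapping.lookup m v) * (\<Prod>v\<in>Poly_Mapping.keys m'. h v ^ Poly_Mapping.lookup m' v)"
proof -
  let ?U = "Poly_Mapping.keys m \<union> Poly_Mapping.keys m'"
  have "Poly_Mapping.keys (m + m') \<subseteq> ?U" using Poly_Mapping.keys_add[of m m'] by simp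
  then show ?thesis
    using prod_keys_superset[of ?U m h] prod_keys_superset[of ?U m' h] prod_keys_superset[of ?U "m + m'" h]
    by (simp add: lookup_add power_add prod.distrib)
qed

lemma subst_mult:
  fixes h :: "'x \<Rightarrow> ('y, 'k::comm_ring_1) mpoly"
  shows "subst h (p * q) = subst h p * subst h q"
proof -
  have single: "subst h (Poly_Mapping.single m c * Poly_Mapping.single m' c') =
      subst h (Poly_Mapping.single m c) * subst h (Poly_Mapping.single m' c')" for m m' c c'
  proof -
    have cc: "(const_poly (c * c') :: ('y, 'k) mpoly) = const_poly c * const_poly c'" by (simp add: mult_single)
    show ?thesis unfolding mult_single[of m c m' c'] subst_single prod_keys_add cc by (simp only: mult_ac)
  qed
  have "subst h (p * q) = subst h ((\<Sum>m\<in>Poly_Mapping.keys p. Poly_Mapping.single m (Poly_Mapping.lookup p m)) *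
      (\<Sum>m\<in>Poly_Mapping.keys q. Poly_Mapping.single m (Poly_Mapping.lookup q m)))"
    by (simp only: monom_expansion[symmetric])
  also have "\<dots> = subst h (\<Sum>m\<in>Poly_Mapping.keys p. Poly_Mapping.single m (Poly_Mapping.lookup p m)) *
      subst h (\<Sum>m\<in>Poly_Mapping.keys q. Poly_Mapping.single m (Poly_Mapping.lookup q m))"
    by (simp only: sum_product subst_sum single)
  also have "\<dots> = subst h p * subst h q" by (simp only: monom_expansion[symmetric])
  finally show ?thesis .
qed

lemma subst_const [simp]: "subst h (const_poly c) = const_poly c"
  by (simp add: subst_single)

lemma subst_1 [simp]: "subst h 1 = 1"
  using subst_const[of h 1] by (simp only: single_one)

lemma subst_mvar [simp]: "subst h (mvar v) = h v"
  by (simp add: mvar_def subst_single)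

lemma subst_power: "subst h (p ^ k) = subst h p ^ k"
  by (induction k) (simp_all add: subst_mult)

lemma subst_prod: "subst h (prod f A) = (\<Prod>i\<in>A. subst h (f i))"
  by (induction A rule: infinite_finite_induct) (simp_all add: subst_mult)

lemma monom_eq_prod: "monom m = (\<Prod>v\<in>Poly_Mapping.keys m. mvar v ^ Poly_Mapping.lookup m v)"
proof -
  have pow: "mvar v ^ k = (monom (Poly_Mapping.single v k) :: ('x, 'k::comm_ring_1) mpoly)" for v :: 'x and k
    by (induction k) (simp_all add: mvar_def mult_single single_add[symmetric])
  have prod: "(\<Prod>v\<in>A. (monom (Poly_Mapping.single v (f v)) :: ('x, 'k::comm_ring_1) mpoly)) =
      monom (\<Sum>v\<in>A. Poly_Mapping.single v (f v))" for A :: "'x set" and f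
    by (induction A rule: infinite_finite_induct) (simp_all add: mult_single)
  show ?thesis by (simp only: pow prod monom_expansion[of m, symmetric])
qed

lemma subst_subst: "subst h (subst g p) = subst (\<lambda>v. subst h (g v)) p"
  unfolding subst_def[of g p] subst_def[of "\<lambda>v. subst h (g v)" p]
  by (simp add: subst_sum subst_mult subst_prod subst_power)

lemma subst_mvar_id: "subst mvar p = p"
  unfolding subst_def monom_eq_prod[symmetric] single_eq_const_mult[symmetric]
  by (rule monom_expansion[symmetric])

lemma subst_cong:
  assumes "p \<in> polys X" "\<And>v. v \<in> X \<Longrightarrow> h v = h' v"
  shows "subst h p = subst h' p"
  unfolding subst_def
  by (intro sum.cong prod.cong arg_cong2[where f = "(*)"] refl arg_cong2[where f = "(^)"])
     (use assms in \<open>auto simp: mem_polys\<close>)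

lemma polys_closed [intro, simp]:
  fixes p q :: "('x, 'k::comm_ring_1) mpoly"
  shows "(0 :: ('x, 'k) mpoly) \<in> polys X" "(1 :: ('x, 'k) mpoly) \<in> polys X"
  "(const_poly c :: ('x, 'k) mpoly) \<in> polys X"
  "p \<in> polys X \<Longrightarrow> q \<in> polys X \<Longrightarrow> p + q \<in> polys X"
  "p \<in> polys X \<Longrightarrow> q \<in> polys X \<Longrightarrow> p * q \<in> polys X"
  "p \<in> polys X \<Longrightarrow> - p \<in> polys X"
  "p \<in> polys X \<Longrightarrow> q \<in> polys X \<Longrightarrow> p - q \<in> polys X"
  "v \<in> X \<Longrightarrow> (mvar v :: ('x, 'k) mpoly) \<in> polys X"
  "Poly_Mapping.keys m \<subseteq> X \<Longrightarrow> (Poly_Mapping.single m c :: ('x, 'k) mpoly) \<in> polys X"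
proof -
  interpret cring "mpoly_ring X :: ('x, 'k) mpoly ring" by (rule mpoly_ring_cring)
  show "(0 :: ('x, 'k) mpoly) \<in> polys X" "(1 :: ('x, 'k) mpoly) \<in> polys X"
    "(const_poly c :: ('x, 'k) mpoly) \<in> polys X" "v \<in> X \<Longrightarrow> (mvar v :: ('x, 'k) mpoly) \<in> polys X"
    "Poly_Mapping.keys m \<subseteq> X \<Longrightarrow> (Poly_Mapping.single m c :: ('x, 'k) mpoly) \<in> polys X"
    by (simp_all add: mem_polys mvar_def)
  show a: "p \<in> polys X \<Longrightarrow> q \<in> polys X \<Longrightarrow> p + q \<in> polys X" for p q :: "('x, 'k) mpoly"
    using a_closed[of p q] by (simp add: mpoly_ring_def)
  show "p \<in> polys X \<Longrightarrow> q \<in> polys X \<Longrightarrow> p * q \<in> polys X"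
    using m_closed[of p q] by (simp add: mpoly_ring_def)
  show n: "p \<in> polys X \<Longrightarrow> - p \<in> polys X" for p :: "('x, 'k) mpoly"
    by (auto simp: mem_polys in_keys_iff)
  show "p \<in> polys X \<Longrightarrow> q \<in> polys X \<Longrightarrow> p - q \<in> polys X"
    using a[of p "- q"] n[of q] by simp
qed

lemma polys_power: "p \<in> polys X \<Longrightarrow> p ^ k \<in> polys X"
  by (induction k) auto

lemma polys_sum: "(\<And>i. i \<in> A \<Longrightarrow> f i \<in> polys X) \<Longrightarrow> sum f A \<in> polys X"
  by (induction A rule: infinite_finite_induct) auto

lemma polys_prod: "(\<And>i. i \<in> A \<Longrightarrow> f i \<in> polys X) \<Longrightarrow> prod f A \<in> polys X"
  by (induction A rule: infinite_finite_induct) auto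

lemma polys_mono: "X \<subseteq> Y \<Longrightarrow> p \<in> polys X \<Longrightarrow> p \<in> polys Y"
  by (auto simp: mem_polys)

lemma subst_closed:
  assumes "p \<in> polys X" "\<And>v. v \<in> X \<Longrightarrow> h v \<in> polys Y"
  shows "subst h p \<in> polys Y"
  unfolding subst_def
  by (intro polys_sum polys_closed(3,5) polys_prod polys_power assms(2)) (use assms(1) in \<open>auto simp: mem_polys\<close>)

lemma polys_induct [consumes 1, case_names const var add mult]:
  assumes p: "p \<in> polys X"
    and const: "\<And>c. Q (const_poly c)" and var: "\<And>v. v \<in> X \<Longrightarrow> Q (mvar v)"
    and add: "\<And>p q. p \<in> polys X \<Longrightarrow> q \<in> polys X \<Longrightarrow> Q p \<Longrightarrow> Q q \<Longrightarrow> Q (p + q)"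
    and mult: "\<And>p q. p \<in> polys X \<Longrightarrow> q \<in> polys X \<Longrightarrow> Q p \<Longrightarrow> Q q \<Longrightarrow> Q (p * q)"
  shows "Q p"
proof -
  have Q0: "Q 0" and Q1: "Q 1" using const[of 0] const[of 1] by simp_all
  have pow: "Q (mvar v ^ k)" if "v \<in> X" for v k
  proof (induction k)
    case (Suc k)
    have "mvar v \<in> polys X" using that by simp
    then show ?case unfolding power_Suc by (intro mult var that polys_power Suc.IH)
  qed (simp add: Q1)
  have prod: "Q (prod f A)" if "\<And>i. i \<in> A \<Longrightarrow> f i \<in> polys X \<and> Q (f i)" for f and A :: "'a set"
    using that by (induction A rule: infinite_finite_induct) (auto intro!: Q1 mult polys_prod)
  have mon: "Q (monom m)" if "Poly_Mapping.keys m \<subseteq> X" for m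
    unfolding monom_eq_prod by (rule prod) (use that pow in \<open>auto intro!: polys_power\<close>)
  have sum: "Q (sum f A)" if "\<And>i. i \<in> A \<Longrightarrow> f i \<in> polys X \<and> Q (f i)" for f and A :: "('a \<Rightarrow>\<^sub>0 nat) set"
    using that by (induction A rule: infinite_finite_induct) (auto intro!: Q0 add polys_sum)
  have "Q (\<Sum>m\<in>Poly_Mapping.keys p. Poly_Mapping.single m (Poly_Mapping.lookup p m))"
  proof (rule sum)
    fix m assume "m \<in> Poly_Mapping.keys p"
    then have m: "Poly_Mapping.keys m \<subseteq> X" using p by (simp add: mem_polys)
    have "Q (const_poly (Poly_Mapping.lookup p m) * monom m)"
      by (intro mult const mon polys_closed m)
    then show "Poly_Mapping.single m (Poly_Mapping.lookup p m) \<in> polys X \<and>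
        Q (Poly_Mapping.single m (Poly_Mapping.lookup p m))"
      using m by (simp only: single_eq_const_mult[symmetric]) simp
  qed
  then show ?thesis by (simp only: monom_expansion[symmetric])
qed

lemma keys_single_mult:
  "Poly_Mapping.keys (monom m * p) = (+) m ` Poly_Mapping.keys (p :: ('x, 'k::comm_ring_1) mpoly)"
  and lookup_single_mult: "Poly_Mapping.lookup (monom m * p) (m + k) = Poly_Mapping.lookup p k"
proof -
  have e: "monom m * p = (\<Sum>k\<in>Poly_Mapping.keys p. Poly_Mapping.single (m + k) (Poly_Mapping.lookup p k))"
    by (subst monom_expansion[of p]) (simp only: sum_distrib_left mult_single mult_1)
  have l: "Poly_Mapping.lookup (monom m * p) (m + k) = Poly_Mapping.lookup p k" for k
    unfolding e lookup_sum lookup_single by (simp add: when_def in_keys_iff)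
  then show "Poly_Mapping.lookup (monom m * p) (m + k) = Poly_Mapping.lookup p k" .
  have "l \<in> (+) m ` Poly_Mapping.keys p" if "l \<in> Poly_Mapping.keys (monom m * p)" for l
    using keys_mult[of "monom m" p] that by auto
  then show "Poly_Mapping.keys (monom m * p) = (+) m ` Poly_Mapping.keys p"
    using l by (auto simp: in_keys_iff)
qed

section \<open>Order and exponent bounds\<close>

definition mdeg :: "('x \<Rightarrow>\<^sub>0 nat) \<Rightarrow> nat" where
  "mdeg m = (\<Sum>v\<in>Poly_Mapping.keys m. Poly_Mapping.lookup m v)"

lemma mdeg_superset: "finite U \<Longrightarrow> Poly_Mapping.keys m \<subseteq> U \<Longrightarrow> mdeg m = (\<Sum>v\<in>U. Poly_Mapping.lookup m v)"
  unfolding mdeg_def by (intro sum.mono_neutral_left) (auto simp: in_keys_iff)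

lemma mdeg_add: "mdeg (m + m') = mdeg m + mdeg m'"
proof -
  let ?U = "Poly_Mapping.keys m \<union> Poly_Mapping.keys m'"
  have "Poly_Mapping.keys (m + m') \<subseteq> ?U" using Poly_Mapping.keys_add[of m m'] by simp
  then show ?thesis
    using mdeg_superset[of ?U m] mdeg_superset[of ?U m'] mdeg_superset[of ?U "m + m'"]
    by (simp add: lookup_add sum.distrib)
qed

lemma mdeg_single [simp]: "mdeg (Poly_Mapping.single v k) = k"
  using mdeg_superset[of "{v}" "Poly_Mapping.single v k"] by simp

definition order_ge :: "nat \<Rightarrow> ('x, 'k::comm_ring_1) mpoly set" where
  "order_ge t = {p. \<forall>m\<in>Poly_Mapping.keys p. t \<le> mdeg m}"

lemma order_ge_0 [simp]: "p \<in> order_ge 0" and order_ge_zero [simp]: "0 \<in> order_ge t"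
  by (simp_all add: order_ge_def)

lemma order_ge_add: "p \<in> order_ge t \<Longrightarrow> q \<in> order_ge t \<Longrightarrow> p + q \<in> order_ge t"
  using Poly_Mapping.keys_add[of p q] by (auto simp: order_ge_def)

lemma order_ge_mult: "p \<in> order_ge s \<Longrightarrow> q \<in> order_ge t \<Longrightarrow> p * q \<in> order_ge (s + t)"
  using keys_mult[of p q] by (fastforce simp: order_ge_def mdeg_add intro: add_mono)

lemma order_ge_mult1: "p \<in> order_ge t \<Longrightarrow> q * p \<in> order_ge t"
  using order_ge_mult[of q 0 p t] by simp

lemma order_ge_sum: "(\<And>i. i \<in> A \<Longrightarrow> f i \<in> order_ge t) \<Longrightarrow> sum f A \<in> order_ge t"
  by (induction A rule: infinite_finite_induct) (auto intro: order_ge_add)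

lemma order_ge_power: "p \<in> order_ge 1 \<Longrightarrow> p ^ k \<in> order_ge k"
  by (induction k) (use order_ge_mult[of p 1] in auto)

lemma order_ge_prod: "(\<And>i. i \<in> A \<Longrightarrow> f i \<in> order_ge (k i)) \<Longrightarrow> prod f A \<in> order_ge (\<Sum>i\<in>A. k i)"
  by (induction A rule: infinite_finite_induct) (auto intro: order_ge_mult)

definition bounded_exps :: "nat \<Rightarrow> ('x, 'k::comm_ring_1) mpoly set" where
  "bounded_exps d = {p. \<forall>m\<in>Poly_Mapping.keys p. \<forall>v. Poly_Mapping.lookup m v \<le> d}"

lemma bounded_exps_mult: "p \<in> bounded_exps a \<Longrightarrow> q \<in> bounded_exps b \<Longrightarrow> p * q \<in> bounded_exps (a + b)"
  using keys_mult[of p q] by (fastforce simp: bounded_exps_def lookup_add intro: add_mono)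

lemma bounded_exps_1: "1 \<in> bounded_exps a"
  by (simp add: bounded_exps_def)

lemma bounded_exps_power: "p \<in> bounded_exps a \<Longrightarrow> p ^ k \<in> bounded_exps (k * a)"
  by (induction k) (auto intro: bounded_exps_mult bounded_exps_1)

lemma bounded_exps_prod: "(\<And>i. i \<in> A \<Longrightarrow> f i \<in> bounded_exps (a i)) \<Longrightarrow> prod f A \<in> bounded_exps (\<Sum>i\<in>A. a i)"
  by (induction A rule: infinite_finite_induct) (auto intro: bounded_exps_mult bounded_exps_1)

lemma bounded_exps_mono: "a \<le> b \<Longrightarrow> p \<in> bounded_exps a \<Longrightarrow> p \<in> bounded_exps b"
  by (auto simp: bounded_exps_def intro: order_trans)

lemma bounded_exps_exists: "\<exists>d. p \<in> bounded_exps d"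
proof -
  let ?S = "\<Union>m\<in>Poly_Mapping.keys p. Poly_Mapping.lookup m ` Poly_Mapping.keys m"
  have "finite ?S" by simp
  then have "p \<in> bounded_exps (Max (insert 0 ?S))"
    unfolding bounded_exps_def
    by (auto intro!: Max_ge simp del: Max_insert) (metis in_keys_iff UN_I finite.insertI Max_ge image_eqI insertI1 insertI2)
  then show ?thesis by blast
qed

section \<open>Dimension counts\<close>

definition box :: "'x set \<Rightarrow> nat \<Rightarrow> ('x \<Rightarrow>\<^sub>0 nat) set" where
  "box Y u = {m. Poly_Mapping.keys m \<subseteq> Y \<and> (\<forall>v\<in>Y. Poly_Mapping.lookup m v < u)}"

lemma card_box:
  assumes "finite Y"
  shows "finite (box Y u)" and "card (box Y u) = u ^ card Y"
proof -
  let ?g = "\<lambda>m. restrict (Poly_Mapping.lookup m) Y"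
  have b: "bij_betw ?g (box Y u) (Y \<rightarrow>\<^sub>E {..<u})"
  proof (rule bij_betw_imageI)
    show "inj_on ?g (box Y u)"
    proof (rule inj_onI, rule poly_mapping_eqI)
      fix m m' k assume "m \<in> box Y u" "m' \<in> box Y u" "?g m = ?g m'"
      then have "Poly_Mapping.keys m \<subseteq> Y" "Poly_Mapping.keys m' \<subseteq> Y" "?g m k = ?g m' k"
        by (simp_all add: box_def)
      then show "Poly_Mapping.lookup m k = Poly_Mapping.lookup m' k"
        by (cases "k \<in> Y") (simp, metis in_keys_iff subsetD)
    qed
    show "?g ` box Y u = Y \<rightarrow>\<^sub>E {..<u}"
    proof (intro equalityI subsetI)
      fix f assume "f \<in> Y \<rightarrow>\<^sub>E {..<u}"
      moreover define m where "m = Abs_poly_mapping (\<lambda>v. if v \<in> Y then f v else 0)"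
      have "finite {v. (if v \<in> Y then f v else 0) \<noteq> 0}" using assms by (rule rev_finite_subset) auto
      then have l: "Poly_Mapping.lookup m = (\<lambda>v. if v \<in> Y then f v else 0)" by (simp add: m_def)
      ultimately have "m \<in> box Y u" "?g m = f"
        by (auto simp: box_def l in_keys_iff fun_eq_iff PiE_iff extensional_def restrict_def split: if_splits)
      then show "f \<in> ?g ` box Y u" by blast
    qed (auto simp: box_def)
  qed
  show "finite (box Y u)" using bij_betw_finite[OF b] assms by (simp add: finite_PiE)
  show "card (box Y u) = u ^ card Y" using bij_betw_same_card[OF b] card_PiE[OF assms, of "\<lambda>_. {..<u}"] by simp
qed

text \<open>Gaussian elimination: a pivot vector clears one coordinate and is removed from the
  family. Coordinates form an arbitrary finite set, so that they can be monomials or pairs of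
  exponents.\<close>

lemma linear_dependence:
  fixes V :: "'i \<Rightarrow> 't \<Rightarrow> 'k::field"
  assumes "finite T" "finite I" "card T < card I"
  shows "\<exists>c. (\<exists>i\<in>I. c i \<noteq> 0) \<and> (\<forall>t\<in>T. (\<Sum>i\<in>I. c i * V i t) = 0)"
  using assms
proof (induction T arbitrary: I V rule: finite_induct)
  case empty
  then obtain i where "i \<in> I" by fastforce
  then show ?case by (intro exI[of _ "\<lambda>_. 1"]) auto
next
  case (insert t T)
  show ?case
  proof (cases "\<exists>i\<in>I. V i t \<noteq> 0")
    case False
    from insert.IH[of I V] insert.prems insert.hyps
    obtain c where "\<exists>i\<in>I. c i \<noteq> 0" "\<forall>t\<in>T. (\<Sum>i\<in>I. c i * V i t) = 0" by auto
    moreover from False have "(\<Sum>i\<in>I. c i * V i t) = 0" by simp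
    ultimately show ?thesis by blast
  next
    case True
    then obtain j where j: "j \<in> I" "V j t \<noteq> 0" by blast
    define V' where "V' i s = V i s - V i t / V j t * V j s" for i s
    have "card T < card (I - {j})" using insert.prems insert.hyps j by simp
    with insert.IH[of "I - {j}" V'] insert.prems
    obtain c where c: "\<exists>i\<in>I - {j}. c i \<noteq> 0" "\<forall>s\<in>T. (\<Sum>i\<in>I - {j}. c i * V' i s) = 0" by auto
    define c' where "c' i = (if i = j then - (\<Sum>i\<in>I - {j}. c i * V i t) / V j t else c i)" for i
    have "(\<Sum>i\<in>I. c' i * V i s) = (\<Sum>i\<in>I - {j}. c i * V' i s)" for s
    proof -
      have "(\<Sum>i\<in>I. c' i * V i s) = c' j * V j s + (\<Sum>i\<in>I - {j}. c' i * V i s)"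
        using insert.prems j by (subst sum.remove[of I j]) auto
      also have "(\<Sum>i\<in>I - {j}. c' i * V i s) = (\<Sum>i\<in>I - {j}. c i * V i s)"
        by (intro sum.cong) (auto simp: c'_def)
      also have "c' j * V j s = - (\<Sum>i\<in>I - {j}. c i * (V i t / V j t * V j s))"
        by (simp add: c'_def sum_distrib_right sum_divide_distrib mult.assoc)
      finally show ?thesis by (simp add: V'_def right_diff_distrib sum_subtractf)
    qed
    note e = this
    have "(\<Sum>i\<in>I - {j}. c i * V' i t) = 0" using j(2) by (intro sum.neutral) (simp add: V'_def)
    with c(2) e have "\<forall>s\<in>insert t T. (\<Sum>i\<in>I. c' i * V i s) = 0" by simp
    moreover have "\<exists>i\<in>I. c' i \<noteq> 0" using c(1) by (auto simp: c'_def)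
    ultimately show ?thesis by blast
  qed
qed

lemma growth:
  fixes K d s :: nat
  assumes "d < s"
  shows "\<exists>u>0. K * u ^ d < u ^ s"
proof -
  let ?u = "Suc K"
  have "K * ?u ^ d < ?u * ?u ^ d" by (rule mult_strict_right_mono) simp_all
  also have "\<dots> = ?u ^ Suc d" by simp
  also have "\<dots> \<le> ?u ^ s" using assms by (intro power_increasing) auto
  finally show ?thesis by blast
qed

lemma lookup_const_mult:
  "Poly_Mapping.lookup (const_poly c * p) m = (c::'k::comm_ring_1) * Poly_Mapping.lookup p m"
proof -
  have "const_poly c * p = (\<Sum>k\<in>Poly_Mapping.keys p. Poly_Mapping.single k (c * Poly_Mapping.lookup p k))"
    by (subst monom_expansion[of p]) (simp only: sum_distrib_left mult_single add_0_left)
  then show ?thesis by (simp add: lookup_sum lookup_single when_def in_keys_iff)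
qed

text \<open>If the exponents of all g_i are at most d, the u^s products with exponents below u only
  involve monomials with exponents up to s u d. There are at most ((s d + 1) u)^(card Y) of these,
  fewer than u^s for large u, so the products are linearly dependent.\<close>

lemma algebraic_dependence:
  fixes g :: "nat \<Rightarrow> ('x, 'k::field) mpoly"
  assumes Y: "finite Y" "card Y < s" and g: "\<And>i. i < s \<Longrightarrow> g i \<in> polys Y"
  obtains P c where "finite P" "P \<noteq> {}" "\<And>\<alpha> i. \<alpha> \<in> P \<Longrightarrow> s \<le> i \<Longrightarrow> \<alpha> i = 0" "\<And>\<alpha>. \<alpha> \<in> P \<Longrightarrow> c \<alpha> \<noteq> (0::'k)"
    "(\<Sum>\<alpha>\<in>P. const_poly (c \<alpha>) * (\<Prod>i<s. g i ^ \<alpha> i)) = 0"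
proof -
  have "\<exists>d. \<forall>i<s. g i \<in> bounded_exps d"
  proof -
    have "\<forall>i. \<exists>d. g i \<in> bounded_exps d" using bounded_exps_exists by blast
    then obtain d where d: "\<And>i. g i \<in> bounded_exps (d i)" by metis
    have "g i \<in> bounded_exps (\<Sum>i<s. d i)" if "i < s" for i
    proof (rule bounded_exps_mono[OF _ d])
      show "d i \<le> (\<Sum>i<s. d i)" using that by (intro member_le_sum) auto
    qed
    then show ?thesis by (intro exI[of _ "\<Sum>i<s. d i"]) simp
  qed
  then obtain d where d: "\<And>i. i < s \<Longrightarrow> g i \<in> bounded_exps d" by blast
  obtain u where u: "u > 0" "(s * d + 1) ^ card Y * u ^ card Y < u ^ s"
    using growth[OF Y(2), of "(s * d + 1) ^ card Y"] by auto
  define I where "I = {..<s} \<rightarrow>\<^sub>E {..<u}"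
  have I: "finite I" "card I = u ^ s" using card_PiE[of "{..<s}" "\<lambda>_. {..<u}"] by (auto simp: I_def finite_PiE)
  define T where "T = box Y (s * (u * d) + 1)"
  have T: "finite T" unfolding T_def by (rule card_box(1)[OF Y(1)])
  have "s * (u * d) + 1 \<le> (s * d + 1) * u" using u(1) by (simp add: algebra_simps)
  then have "card T \<le> ((s * d + 1) * u) ^ card Y"
    unfolding T_def card_box(2)[OF Y(1)] by (intro power_mono) auto
  also have "\<dots> < card I" using u(2) unfolding I(2) power_mult_distrib .
  finally have "card T < card I" .
  from linear_dependence[OF T I(1) this, of "\<lambda>\<alpha>. Poly_Mapping.lookup (\<Prod>i<s. g i ^ \<alpha> i)"]
  obtain c where c: "\<exists>\<alpha>\<in>I. c \<alpha> \<noteq> 0"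
    "\<And>m. m \<in> T \<Longrightarrow> (\<Sum>\<alpha>\<in>I. c \<alpha> * Poly_Mapping.lookup (\<Prod>i<s. g i ^ \<alpha> i) m) = 0" by blast
  have outside: "Poly_Mapping.lookup (\<Prod>i<s. g i ^ \<alpha> i) m = 0" if "\<alpha> \<in> I" "m \<notin> T" for \<alpha> m
  proof (rule ccontr)
    assume "Poly_Mapping.lookup (\<Prod>i<s. g i ^ \<alpha> i) m \<noteq> 0"
    then have m: "m \<in> Poly_Mapping.keys (\<Prod>i<s. g i ^ \<alpha> i)" by (simp add: in_keys_iff)
    have "(\<Prod>i<s. g i ^ \<alpha> i) \<in> polys Y" by (intro polys_prod polys_power g) auto
    then have "Poly_Mapping.keys m \<subseteq> Y" using m by (auto simp: mem_polys)
    moreover have "(\<Prod>i<s. g i ^ \<alpha> i) \<in> bounded_exps (\<Sum>i<s. \<alpha> i * d)"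
      by (intro bounded_exps_prod bounded_exps_power d) auto
    moreover have "(\<Sum>i<s. \<alpha> i * d) \<le> s * (u * d)"
      using that(1) sum_bounded_above[of "{..<s}" "\<lambda>i. \<alpha> i * d" "u * d"]
      by (force simp: I_def PiE_iff intro!: mult_right_mono)
    ultimately have "Poly_Mapping.lookup m v \<le> s * (u * d)" for v
      using m unfolding bounded_exps_def by (blast intro: order_trans)
    with \<open>Poly_Mapping.keys m \<subseteq> Y\<close> have "m \<in> T" by (simp add: T_def box_def le_imp_less_Suc)
    with that(2) show False by simp
  qed
  define P where "P = {\<alpha> \<in> I. c \<alpha> \<noteq> 0}"
  have "(\<Sum>\<alpha>\<in>P. const_poly (c \<alpha>) * (\<Prod>i<s. g i ^ \<alpha> i)) = (\<Sum>\<alpha>\<in>I. const_poly (c \<alpha>) * (\<Prod>i<s. g i ^ \<alpha> i))"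
    using I by (intro sum.mono_neutral_left) (auto simp: P_def)
  also have "\<dots> = 0"
  proof (rule poly_mapping_eqI)
    fix m show "Poly_Mapping.lookup (\<Sum>\<alpha>\<in>I. const_poly (c \<alpha>) * (\<Prod>i<s. g i ^ \<alpha> i)) m = Poly_Mapping.lookup 0 m"
      using c(2)[of m] outside[of _ m] by (cases "m \<in> T") (simp_all add: lookup_sum lookup_const_mult)
  qed
  finally have z: "(\<Sum>\<alpha>\<in>P. const_poly (c \<alpha>) * (\<Prod>i<s. g i ^ \<alpha> i)) = 0" .
  \<comment> \<open>The exponents in \<open>I\<close> are extensional functions, undefined from s
    on; the statement wants zeros there.\<close>
  define ext where "ext \<alpha> = (\<lambda>i. if i < s then \<alpha> i else 0)" for \<alpha> :: "nat \<Rightarrow> nat"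
  have r: "restrict (ext \<alpha>) {..<s} = \<alpha>" if "\<alpha> \<in> P" for \<alpha>
    using that by (auto simp: P_def I_def ext_def PiE_iff extensional_def fun_eq_iff)
  have inj: "inj_on ext P" by (rule inj_on_inverseI) (rule r)
  have "(\<Sum>\<alpha>\<in>ext ` P. const_poly (c (restrict \<alpha> {..<s})) * (\<Prod>i<s. g i ^ \<alpha> i)) =
      (\<Sum>\<alpha>\<in>P. const_poly (c \<alpha>) * (\<Prod>i<s. g i ^ \<alpha> i))"
    unfolding sum.reindex[OF inj] o_def
    by (intro sum.cong refl arg_cong2[where f = "(*)"] prod.cong) (auto simp: r, simp add: ext_def)
  with z have z': "(\<Sum>\<alpha>\<in>ext ` P. const_poly (c (restrict \<alpha> {..<s})) * (\<Prod>i<s. g i ^ \<alpha> i)) = 0" by simp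
  show ?thesis
  proof (rule that[OF _ _ _ _ z'])
    show "finite (ext ` P)" "ext ` P \<noteq> {}" using I c(1) by (auto simp: P_def)
    show "\<alpha> i = 0" if "\<alpha> \<in> ext ` P" "s \<le> i" for \<alpha> i using that by (auto simp: ext_def)
    show "c (restrict \<alpha> {..<s}) \<noteq> 0" if "\<alpha> \<in> ext ` P" for \<alpha> using that r by (auto simp: P_def)
  qed
qed

text \<open>Elements \<open>g\<close> of the maximal ideal generate an ideal of finite colength only if there are at
  least as many of them as variables: the span of the products of a box monomial with a product
  of the \<open>g i\<close> of exponents below \<open>t\<close> fills everything modulo order \<open>t\<close>, and comparing dimensions
  as \<open>t\<close> grows gives the claim.\<close>

lemma finite_colength_generators:
  fixes g :: "nat \<Rightarrow> ('x, 'k::field) mpoly"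
  assumes Y: "finite Y" and g: "\<And>i. i < s \<Longrightarrow> g i \<in> order_ge 1"
    and vars: "\<And>v. v \<in> Y \<Longrightarrow> \<exists>h. (\<forall>i. h i \<in> polys Y) \<and> mvar v ^ k = (\<Sum>i<s. h i * g i)"
  shows "card Y \<le> s"
proof (rule ccontr)
  assume "\<not> card Y \<le> s"
  then have less: "s < card Y" by simp
  define A where "A t = {..<s} \<rightarrow>\<^sub>E {..<t}" for t :: nat
  define S where "S t = {p. \<exists>c. p - (\<Sum>(\<beta>, \<alpha>)\<in>box Y k \<times> A t. const_poly (c (\<beta>, \<alpha>)) * (monom \<beta> * (\<Prod>i<s. g i ^ \<alpha> i))) \<in> order_ge t}" for t
  have fA: "finite (A t)" "card (A t) = t ^ s" for t
    using card_PiE[of "{..<s}" "\<lambda>_. {..<t}"] by (auto simp: A_def finite_PiE)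
  note fB = card_box[OF Y, of k]
  have fT: "finite (box Y k \<times> A t)" for t using fA fB by simp
  have S_add: "p + q \<in> S t" if p: "p \<in> S t" and q: "q \<in> S t" for p q t
  proof -
    obtain c c' where *: "p - (\<Sum>(\<beta>, \<alpha>)\<in>box Y k \<times> A t. const_poly (c (\<beta>, \<alpha>)) * (monom \<beta> * (\<Prod>i<s. g i ^ \<alpha> i))) \<in> order_ge t"
      "q - (\<Sum>(\<beta>, \<alpha>)\<in>box Y k \<times> A t. const_poly (c' (\<beta>, \<alpha>)) * (monom \<beta> * (\<Prod>i<s. g i ^ \<alpha> i))) \<in> order_ge t"
      using p q by (auto simp: S_def)
    have "p + q - (\<Sum>(\<beta>, \<alpha>)\<in>box Y k \<times> A t. const_poly (c (\<beta>, \<alpha>) + c' (\<beta>, \<alpha>)) * (monom \<beta> * (\<Prod>i<s. g i ^ \<alpha> i))) \<in> order_ge t"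
      using order_ge_add[OF *] by (simp add: single_add distrib_right sum.distrib case_prod_beta algebra_simps)
    then show ?thesis unfolding S_def by (intro CollectI exI[of _ "\<lambda>x. c x + c' x"]) simp
  qed
  have S_order: "p \<in> S t" if "p \<in> order_ge t" for p t
    unfolding S_def using that by (intro CollectI exI[of _ "\<lambda>_. 0"]) simp
  have S_sum: "sum f U \<in> S t" if "\<And>i. i \<in> U \<Longrightarrow> f i \<in> S t" for f t and U :: "'z set"
    using that by (induction U rule: infinite_finite_induct) (auto intro: S_add S_order)
  have S_gen: "const_poly c * (monom \<beta> * (\<Prod>i<s. g i ^ \<alpha> i)) \<in> S t" if "\<beta> \<in> box Y k" "\<alpha> \<in> A t" for c \<beta> \<alpha> t
  proof -
    let ?c = "\<lambda>x. if x = (\<beta>, \<alpha>) then c else 0"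
    have "(\<Sum>(\<beta>', \<alpha>')\<in>box Y k \<times> A t. const_poly (?c (\<beta>', \<alpha>')) * (monom \<beta>' * (\<Prod>i<s. g i ^ \<alpha>' i))) =
      (\<Sum>x\<in>{(\<beta>, \<alpha>)}. const_poly (?c x) * (monom (fst x) * (\<Prod>i<s. g i ^ snd x i)))"
      using that fT by (intro sum.mono_neutral_cong_right) (auto split: if_splits)
    then show ?thesis unfolding S_def by (intro CollectI exI[of _ ?c]) simp
  qed
  \<comment> \<open>A factor g i raises the order of the error term by one, and the largest exponent
    of a product by at most one, so both bounds may be advanced together from t to t + 1.\<close>
  have S_mult: "q * g i \<in> S (Suc t)" if q: "q \<in> S t" and i: "i < s" for q i t
  proof -
    obtain c where c: "q - (\<Sum>(\<beta>, \<alpha>)\<in>box Y k \<times> A t. const_poly (c (\<beta>, \<alpha>)) * (monom \<beta> * (\<Prod>i<s. g i ^ \<alpha> i))) \<in> order_ge t" (is "q - ?s \<in> _")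
      using q by (auto simp: S_def)
    have "(q - ?s) * g i \<in> S (Suc t)" using order_ge_mult[OF c g[OF i]] by (intro S_order) simp
    moreover have "?s * g i \<in> S (Suc t)"
      unfolding sum_distrib_right
    proof (rule S_sum)
      fix x assume "x \<in> box Y k \<times> A t"
      then obtain \<beta> \<alpha> where x: "x = (\<beta>, \<alpha>)" "\<beta> \<in> box Y k" "\<alpha> \<in> A t" by auto
      let ?\<alpha> = "\<alpha>(i := Suc (\<alpha> i))"
      have "(\<Prod>j\<in>{..<s} - {i}. g j ^ ?\<alpha> j) = (\<Prod>j\<in>{..<s} - {i}. g j ^ \<alpha> j)" by (intro prod.cong) auto
      then have "(\<Prod>j<s. g j ^ ?\<alpha> j) = (\<Prod>j<s. g j ^ \<alpha> j) * g i"
        using i prod.remove[of "{..<s}" i "\<lambda>j. g j ^ \<alpha> j"] prod.remove[of "{..<s}" i "\<lambda>j. g j ^ ?\<alpha> j"]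
        by (simp add: mult_ac)
      moreover have "?\<alpha> \<in> A (Suc t)" using x(3) i by (force simp: A_def PiE_iff extensional_def)
      ultimately show "(case x of (\<beta>, \<alpha>) \<Rightarrow> const_poly (c (\<beta>, \<alpha>)) * (monom \<beta> * (\<Prod>i<s. g i ^ \<alpha> i))) * g i \<in> S (Suc t)"
        using S_gen[OF x(2), of ?\<alpha> "Suc t" "c (\<beta>, \<alpha>)"] by (simp add: x(1) mult.assoc)
    qed
    ultimately have "(q - ?s) * g i + ?s * g i \<in> S (Suc t)" by (rule S_add)
    then show ?thesis by (simp add: algebra_simps)
  qed
  have S_all: "p \<in> polys Y \<Longrightarrow> p \<in> S t" for p t
  proof (induction t arbitrary: p)
    case 0
    show ?case by (rule S_order) simp
  next
    case (Suc t)
    have "Poly_Mapping.single m c \<in> S (Suc t)" if m: "Poly_Mapping.keys m \<subseteq> Y" for m c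
    proof (cases "m \<in> box Y k")
      case True
      have "(\<lambda>i\<in>{..<s}. 0) \<in> A (Suc t)" by (auto simp: A_def)
      from S_gen[OF True this, of c] show ?thesis by (simp add: mult_single)
    next
      case False
      \<comment> \<open>A monomial outside the box contains the k-th power of some variable, which
        is a combination of the g_i. After this replacement each cofactor only has to be known
        modulo order t.\<close>
      then obtain v where v: "v \<in> Y" "k \<le> Poly_Mapping.lookup m v" using m by (auto simp: box_def)
      define m' where "m' = m - Poly_Mapping.single v k"
      have mm': "m = Poly_Mapping.single v k + m'"
        using v(2) by (intro poly_mapping_eqI) (auto simp: m'_def lookup_add lookup_minus lookup_single when_def)
      then have m'Y: "Poly_Mapping.keys m' \<subseteq> Y"
        using m by (auto simp: in_keys_iff lookup_add subset_iff)
      obtain h where h: "\<forall>i. h i \<in> polys Y" "mvar v ^ k = (\<Sum>i<s. h i * g i)" using vars[OF v(1)] by blast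
      have vk: "(mvar v :: ('x, 'k) mpoly) ^ k = monom (Poly_Mapping.single v k)"
        by (induction k) (simp_all add: mvar_def mult_single single_add[symmetric])
      have "Poly_Mapping.single m c = mvar v ^ k * Poly_Mapping.single m' c"
        unfolding vk by (simp add: mult_single mm')
      also have "\<dots> = (\<Sum>i<s. (h i * Poly_Mapping.single m' c) * g i)"
        unfolding h(2) sum_distrib_right by (intro sum.cong refl) (simp add: mult_ac)
      also have "\<dots> \<in> S (Suc t)"
        by (intro S_sum S_mult Suc.IH) (use h(1) m'Y in auto)
      finally show ?thesis .
    qed
    then have "(\<Sum>m\<in>Poly_Mapping.keys p. Poly_Mapping.single m (Poly_Mapping.lookup p m)) \<in> S (Suc t)"
      using Suc.prems by (intro S_sum) (auto simp: mem_polys)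
    then show ?case by (simp only: monom_expansion[symmetric])
  qed
  \<comment> \<open>With t = card Y * u every monomial of the box of side u has degree below t, so
    these u^(card Y) monomials stay independent modulo order t. They would have to lie in a span of
    at most k^(card Y) * t^s elements, and u is chosen so large that this is too few.\<close>
  obtain u where u: "u > 0" "(k ^ card Y * card Y ^ s) * u ^ s < u ^ card Y"
    using growth[OF less, of "k ^ card Y * card Y ^ s"] by auto
  define t where "t = card Y * u"
  have "\<exists>c. monom m - (\<Sum>(\<beta>, \<alpha>)\<in>box Y k \<times> A t. const_poly (c (\<beta>, \<alpha>)) * (monom \<beta> * (\<Prod>i<s. g i ^ \<alpha> i))) \<in> order_ge t"
    if "m \<in> box Y u" for m
  proof -
    have "monom m \<in> S t" using that by (intro S_all) (simp add: box_def)
    then show ?thesis unfolding S_def by (rule CollectD)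
  qed
  then have "\<forall>m\<in>box Y u. \<exists>c. monom m - (\<Sum>(\<beta>, \<alpha>)\<in>box Y k \<times> A t. const_poly (c (\<beta>, \<alpha>)) * (monom \<beta> * (\<Prod>i<s. g i ^ \<alpha> i))) \<in> order_ge t"
    by (rule ballI)
  from bchoice[OF this] obtain c where c: "\<And>m. m \<in> box Y u \<Longrightarrow>
      monom m - (\<Sum>(\<beta>, \<alpha>)\<in>box Y k \<times> A t. const_poly (c m (\<beta>, \<alpha>)) * (monom \<beta> * (\<Prod>i<s. g i ^ \<alpha> i))) \<in> order_ge t"
    by blast
  have "card (box Y k \<times> A t) < card (box Y u)"
    using u(2) unfolding card_cartesian_product fA(2) fB(2) card_box(2)[OF Y] t_def power_mult_distrib
    by (simp only: mult.assoc)
  from linear_dependence[OF fT card_box(1)[OF Y] this, of c] obtain e where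
    e: "\<exists>m\<in>box Y u. e m \<noteq> 0" "\<And>x. x \<in> box Y k \<times> A t \<Longrightarrow> (\<Sum>m\<in>box Y u. e m * c m x) = 0" by blast
  define G where "G x = monom (fst x) * (\<Prod>i<s. g i ^ snd x i)" for x :: "('x \<Rightarrow>\<^sub>0 nat) \<times> (nat \<Rightarrow> nat)"
  have "(\<Sum>m\<in>box Y u. const_poly (e m) * (monom m - (\<Sum>x\<in>box Y k \<times> A t. const_poly (c m x) * G x))) \<in> order_ge t"
    by (intro order_ge_sum order_ge_mult1) (use c in \<open>simp add: G_def case_prod_beta\<close>)
  also have "(\<Sum>m\<in>box Y u. const_poly (e m) * (monom m - (\<Sum>x\<in>box Y k \<times> A t. const_poly (c m x) * G x))) =
      (\<Sum>m\<in>box Y u. const_poly (e m) * monom m) - (\<Sum>x\<in>box Y k \<times> A t. const_poly (\<Sum>m\<in>box Y u. e m * c m x) * G x)"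
  proof -
    have cs: "const_poly (sum f U) = (\<Sum>i\<in>U. const_poly (f i :: 'k) :: ('x, 'k) mpoly)" for f and U :: "('x \<Rightarrow>\<^sub>0 nat) set"
      by (induction U rule: infinite_finite_induct) (simp_all add: single_add)
    have "(\<Sum>x\<in>box Y k \<times> A t. const_poly (\<Sum>m\<in>box Y u. e m * c m x) * G x) =
        (\<Sum>x\<in>box Y k \<times> A t. \<Sum>m\<in>box Y u. const_poly (e m) * (const_poly (c m x) * G x))"
      unfolding cs sum_distrib_right by (intro sum.cong refl) (simp add: mult.assoc[symmetric] mult_single)
    also have "\<dots> = (\<Sum>m\<in>box Y u. const_poly (e m) * (\<Sum>x\<in>box Y k \<times> A t. const_poly (c m x) * G x))"
      unfolding sum_distrib_left by (rule sum.swap)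
    finally show ?thesis by (simp add: right_diff_distrib sum_subtractf)
  qed
  also have "\<dots> = (\<Sum>m\<in>box Y u. const_poly (e m) * monom m)" using e(2) by simp
  finally have o: "(\<Sum>m\<in>box Y u. const_poly (e m) * monom m) \<in> order_ge t" .
  obtain m where m: "m \<in> box Y u" "e m \<noteq> 0" using e(1) by blast
  have "Poly_Mapping.lookup (\<Sum>m\<in>box Y u. const_poly (e m) * monom m) m = e m"
    using m(1) card_box(1)[OF Y] by (simp add: lookup_sum mult_single lookup_single when_def)
  then have "t \<le> mdeg m" using o m(2) by (auto simp: order_ge_def in_keys_iff)
  also have "mdeg m = (\<Sum>v\<in>Y. Poly_Mapping.lookup m v)" using m(1) Y by (intro mdeg_superset) (auto simp: box_def)
  also have "\<dots> < t"
  proof -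
    have "(\<Sum>v\<in>Y. Poly_Mapping.lookup m v) < (\<Sum>v\<in>Y. u)"
      using m(1) less Y by (intro sum_strict_mono) (auto simp: box_def)
    then show ?thesis by (simp add: t_def)
  qed
  finally show False by simp
qed

section \<open>Ideals generated by variables\<close>

lemma typeclass_ring_mpoly: "typeclass_ring (mpoly_ring X :: ('x, 'k::comm_ring_1) mpoly ring)"
  by (rule typeclass_ring.intro[OF mpoly_ring_cring], unfold_locales) (simp_all add: mpoly_ring_def)

text \<open>Membership in the ideal generated by the variables in \<open>U\<close>, read off
  monomial by monomial; \<open>involving_ideal\<close> makes the connection with ideals of a given
  polynomial ring.\<close>

definition involving :: "'x set \<Rightarrow> ('x, 'k::comm_ring_1) mpoly set" where
  "involving U = {p. \<forall>m\<in>Poly_Mapping.keys p. \<exists>v\<in>U. Poly_Mapping.lookup m v \<noteq> 0}"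

lemma involving_0: "0 \<in> involving U"
  by (simp add: involving_def)

lemma involving_add: "p \<in> involving U \<Longrightarrow> q \<in> involving U \<Longrightarrow> p + q \<in> involving U"
  using Poly_Mapping.keys_add[of p q] by (auto simp: involving_def)

lemma involving_mult: "p \<in> involving U \<Longrightarrow> q * p \<in> involving U"
proof -
  assume p: "p \<in> involving U"
  show ?thesis unfolding involving_def
  proof (intro CollectI ballI)
    fix m assume "m \<in> Poly_Mapping.keys (q * p)"
    then obtain a b where ab: "m = a + b" "b \<in> Poly_Mapping.keys p" using keys_mult[of q p] by blast
    then obtain v where "v \<in> U" "Poly_Mapping.lookup b v \<noteq> 0" using p unfolding involving_def by blast
    then show "\<exists>v\<in>U. Poly_Mapping.lookup m v \<noteq> 0" by (intro bexI[of _ v]) (simp_all add: ab(1) lookup_add)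
  qed
qed

lemma involving_mono: "U \<subseteq> U' \<Longrightarrow> p \<in> involving U \<Longrightarrow> p \<in> involving U'"
  unfolding involving_def by blast

lemma keys_mvar_mult:
  "m \<in> Poly_Mapping.keys p \<Longrightarrow> Poly_Mapping.single v 1 + m \<in> Poly_Mapping.keys (mvar v * p)"
  unfolding mvar_def keys_single_mult by (rule imageI)

lemma involving_mvar: "v \<in> U \<Longrightarrow> mvar v \<in> involving U"
  by (auto simp: involving_def mvar_def intro!: bexI[of _ v])

lemma involving_cancel: "mvar v * p \<in> involving U \<Longrightarrow> v \<notin> U \<Longrightarrow> p \<in> involving U"
  unfolding involving_def
proof (intro CollectI ballI)
  fix m assume *: "mvar v * p \<in> {p. \<forall>m\<in>Poly_Mapping.keys p. \<exists>v\<in>U. Poly_Mapping.lookup m v \<noteq> 0}"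
    "v \<notin> U" "m \<in> Poly_Mapping.keys p"
  then obtain u where "u \<in> U" "Poly_Mapping.lookup (Poly_Mapping.single v 1 + m) u \<noteq> 0"
    using keys_mvar_mult[OF *(3)] by blast
  moreover from this *(2) have "Poly_Mapping.lookup (Poly_Mapping.single v 1 + m) u = Poly_Mapping.lookup m u"
    by (auto simp: lookup_add lookup_single when_def)
  ultimately show "\<exists>v\<in>U. Poly_Mapping.lookup m v \<noteq> 0" by auto
qed

lemma involving_ideal:
  fixes p :: "('x, 'k::comm_ring_1) mpoly"
  assumes I: "ideal I (mpoly_ring X :: ('x, 'k) mpoly ring)" and U: "mvar ` U \<subseteq> I"
    and p: "p \<in> polys X" "p \<in> involving U"
  shows "p \<in> I"
proof -
  interpret typeclass_ring "mpoly_ring X :: ('x, 'k) mpoly ring" by (rule typeclass_ring_mpoly)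
  have "(\<Sum>m\<in>Poly_Mapping.keys p. Poly_Mapping.single m (Poly_Mapping.lookup p m)) \<in> I"
  proof (rule ideal_sum[OF I])
    fix m assume m: "m \<in> Poly_Mapping.keys p"
    then obtain v where v: "v \<in> U" "Poly_Mapping.lookup m v \<noteq> 0" using p(2) by (auto simp: involving_def)
    define m' where "m' = m - Poly_Mapping.single v 1"
    have mm': "m = m' + Poly_Mapping.single v 1"
      using v(2) by (intro poly_mapping_eqI) (auto simp: m'_def lookup_add lookup_minus lookup_single when_def)
    have "Poly_Mapping.keys m \<subseteq> X" using p(1) m by (simp add: mem_polys)
    then have "Poly_Mapping.keys m' \<subseteq> X" unfolding mm' by (auto simp: in_keys_iff lookup_add subset_iff)
    then have "Poly_Mapping.single m' (Poly_Mapping.lookup p m) * mvar v \<in> I"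
      using U v(1) by (intro ideal_mult[OF I]) auto
    then show "Poly_Mapping.single m (Poly_Mapping.lookup p m) \<in> I"
      unfolding mvar_def mult_single mult_1_right mm'[symmetric] .
  qed
  then show ?thesis by (simp only: monom_expansion[symmetric])
qed

text \<open>Multiplying a monomial by a variable outside \<open>U\<close> does not change whether it
  involves a variable of \<open>U\<close>. Distinctness of the variables is what keeps w r outside
  the earlier ones.\<close>

lemma variables_weakly_regular:
  fixes w :: "nat \<Rightarrow> 'x"
  assumes w: "inj_on w {..<n}" "w ` {..<n} \<subseteq> X" and r: "r < n"
    and x: "x \<in> polys X" "mvar (w r) * x \<in> ideal_upto (mpoly_ring X) (\<lambda>i. mvar (w i)) r"
  shows "x \<in> ideal_upto (mpoly_ring X :: ('x, 'k::comm_ring_1) mpoly ring) (\<lambda>i. mvar (w i)) r"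
proof -
  interpret typeclass_ring "mpoly_ring X :: ('x, 'k) mpoly ring" by (rule typeclass_ring_mpoly)
  have e: "ideal_upto (mpoly_ring X :: ('x, 'k) mpoly ring) f j = ext_ideal {0} f j" for f j
    by (induction j) simp_all
  have Z: "ideal {0} (mpoly_ring X :: ('x, 'k) mpoly ring)" by (rule idealI') auto
  have "p \<in> involving (w ` {..<j})" if "p \<in> ext_ideal {0} (\<lambda>i. mvar (w i)) j" for p :: "('x, 'k) mpoly" and j
    using that
  proof (induction j arbitrary: p)
    case (Suc j)
    then obtain u q where uq: "p = u + mvar (w j) * q" "u \<in> ext_ideal {0} (\<lambda>i. mvar (w i)) j" by auto
    have "u \<in> involving (w ` {..<Suc j})" using Suc.IH[OF uq(2)] by (rule involving_mono[rotated]) auto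
    moreover have "q * mvar (w j) \<in> involving (w ` {..<Suc j})" by (intro involving_mult involving_mvar) simp
    ultimately show ?case unfolding uq(1) by (simp add: involving_add mult.commute)
  qed (simp add: involving_0)
  from this[OF x(2)[unfolded e]] have "x \<in> involving (w ` {..<r})"
  proof (rule involving_cancel)
    show "w r \<notin> w ` {..<r}"
    proof
      assume "w r \<in> w ` {..<r}"
      then obtain i where i: "i < r" "w r = w i" by blast
      then have "r = i" using inj_onD[OF w(1) i(2)] r by simp
      with i(1) show False by simp
    qed
  qed
  moreover have f: "mvar (w i) \<in> carrier (mpoly_ring X)" if "i < r" for i
    by (rule polys_closed(8)) (use w(2) r that in \<open>simp add: image_subset_iff\<close>)
  have "mvar ` w ` {..<r} \<subseteq> ext_ideal {0} (\<lambda>i. (mvar (w i) :: ('x, 'k) mpoly)) r"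
    using ext_ideal_generator[OF Z f] by auto
  ultimately show ?thesis
    unfolding e by (intro involving_ideal[OF ext_ideal_ideal[OF Z f]] x(1)) auto
qed

text \<open>Division with remainder by a variable, with control of the degree of the quotient; this
  provides the splitting axiom of an iterated polynomial ring.\<close>

lemma split_off_variable:
  fixes p :: "('x, 'k::comm_ring_1) mpoly"
  assumes "\<And>m. m \<in> Poly_Mapping.keys p \<Longrightarrow> Poly_Mapping.lookup m v \<le> Suc k" and "p \<in> polys Z"
  shows "\<exists>q r. p = mvar v * q + r \<and> q \<in> polys Z \<and> r \<in> polys Z \<and>
    (\<forall>m\<in>Poly_Mapping.keys q. Poly_Mapping.lookup m v \<le> k) \<and> (\<forall>m\<in>Poly_Mapping.keys r. Poly_Mapping.lookup m v = 0)"
proof -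
  let ?K = "{m \<in> Poly_Mapping.keys p. Poly_Mapping.lookup m v \<noteq> 0}"
  define q where "q = (\<Sum>m\<in>?K. Poly_Mapping.single (m - Poly_Mapping.single v 1) (Poly_Mapping.lookup p m))"
  define r where "r = (\<Sum>m\<in>Poly_Mapping.keys p - ?K. Poly_Mapping.single m (Poly_Mapping.lookup p m))"
  have sub: "\<exists>m\<in>U. k \<in> Poly_Mapping.keys (f m)" if "k \<in> Poly_Mapping.keys (sum f U)" "finite U"
    for k and f :: "('x \<Rightarrow>\<^sub>0 nat) \<Rightarrow> ('x, 'k) mpoly" and U
    using that by (auto simp: in_keys_iff lookup_sum dest: sum.not_neutral_contains_not_neutral)
  have "mvar v * q = (\<Sum>m\<in>?K. Poly_Mapping.single m (Poly_Mapping.lookup p m))"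
    unfolding q_def sum_distrib_left
  proof (intro sum.cong refl)
    fix m assume "m \<in> ?K"
    then have "Poly_Mapping.single v 1 + (m - Poly_Mapping.single v 1) = m"
      by (intro poly_mapping_eqI) (auto simp: lookup_add lookup_minus lookup_single when_def)
    then show "mvar v * Poly_Mapping.single (m - Poly_Mapping.single v 1) (Poly_Mapping.lookup p m) =
        Poly_Mapping.single m (Poly_Mapping.lookup p m)" by (simp add: mvar_def mult_single)
  qed
  then have "p = mvar v * q + r"
    using sum.subset_diff[of ?K "Poly_Mapping.keys p" "\<lambda>m. Poly_Mapping.single m (Poly_Mapping.lookup p m)"]
      monom_expansion[of p] by (simp add: r_def add.commute)
  moreover have "q \<in> polys Z" unfolding q_def
  proof (rule polys_sum, rule polys_closed(9))
    fix m assume "m \<in> ?K"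
    then have "Poly_Mapping.keys m \<subseteq> Z" using assms(2) by (auto simp: mem_polys)
    then show "Poly_Mapping.keys (m - Poly_Mapping.single v 1) \<subseteq> Z"
      by (auto simp: in_keys_iff lookup_minus subset_iff)
  qed
  moreover have "r \<in> polys Z" unfolding r_def
    by (intro polys_sum polys_closed(9)) (use assms(2) in \<open>auto simp: mem_polys\<close>)
  moreover have "Poly_Mapping.lookup m v \<le> k" if m: "m \<in> Poly_Mapping.keys q" for m
  proof -
    obtain m' where "m' \<in> ?K" "m \<in> Poly_Mapping.keys (Poly_Mapping.single (m' - Poly_Mapping.single v 1) (Poly_Mapping.lookup p m'))"
      using sub[OF m[unfolded q_def] finite_subset[OF Collect_subset finite_keys]] by blast
    then have "m' \<in> Poly_Mapping.keys p" "m = m' - Poly_Mapping.single v 1" by (auto split: if_splits)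
    with assms(1)[of m'] show ?thesis by (simp add: lookup_minus)
  qed
  moreover have "Poly_Mapping.lookup m v = 0" if m: "m \<in> Poly_Mapping.keys r" for m
  proof -
    obtain m' where "m' \<in> Poly_Mapping.keys p - ?K" "m \<in> Poly_Mapping.keys (Poly_Mapping.single m' (Poly_Mapping.lookup p m'))"
      using sub[OF m[unfolded r_def] finite_Diff[OF finite_keys]] by blast
    then show ?thesis by (auto split: if_splits)
  qed
  ultimately show ?thesis by blast
qed

section \<open>Radicals\<close>

context typeclass_ring
begin

lemma of_nat_closed: "of_nat k \<in> carrier R"
  by (induction k) auto

lemma radical_iff: "a \<in> radical R I \<longleftrightarrow> a \<in> carrier R \<and> (\<exists>k. a ^ k \<in> I)"
  by (simp add: radical_def nat_pow_eq)

lemma radical_ideal: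
  assumes I: "ideal I R"
  shows "ideal (radical R I) R"
proof (rule idealI')
  show "radical R I \<subseteq> carrier R" by (auto simp: radical_iff)
  show "0 \<in> radical R I" using ideal_zero[OF I] by (auto simp: radical_iff intro!: exI[of _ 1])
next
  fix x y assume "x \<in> radical R I" "y \<in> radical R I"
  then obtain k l where x: "x \<in> carrier R" "x ^ k \<in> I" and y: "y \<in> carrier R" "y ^ l \<in> I" by (auto simp: radical_iff)
  have "(x + y) ^ (k + l) = (\<Sum>i\<le>k + l. of_nat ((k + l) choose i) * x ^ i * y ^ (k + l - i))" by (rule binomial_ring)
  also have "\<dots> \<in> I"
  proof (rule ideal_sum[OF I])
    fix i assume "i \<in> {..k + l}"
    show "of_nat ((k + l) choose i) * x ^ i * y ^ (k + l - i) \<in> I"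
    proof (cases "k \<le> i")
      case True
      then have "x ^ i = x ^ (i - k) * x ^ k" by (simp flip: power_add)
      then have "of_nat ((k + l) choose i) * x ^ i * y ^ (k + l - i) =
          (of_nat ((k + l) choose i) * x ^ (i - k) * y ^ (k + l - i)) * x ^ k" by (simp add: mult_ac)
      then show ?thesis using x y by (simp only:) (intro ideal_mult[OF I] closed power_closed of_nat_closed)
    next
      case False
      then have "y ^ (k + l - i) = y ^ (k - i) * y ^ l" by (simp flip: power_add)
      then have "of_nat ((k + l) choose i) * x ^ i * y ^ (k + l - i) =
          (of_nat ((k + l) choose i) * x ^ i * y ^ (k - i)) * y ^ l" by (simp add: mult_ac)
      then show ?thesis using x y by (simp only:) (intro ideal_mult[OF I] closed power_closed of_nat_closed)
    qed
  qed
  finally show "x + y \<in> radical R I" using x y by (auto simp: radical_iff)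
next
  fix r x assume "r \<in> carrier R" "x \<in> radical R I"
  then obtain k where "x \<in> carrier R" "x ^ k \<in> I" by (auto simp: radical_iff)
  with \<open>r \<in> carrier R\<close> show "r * x \<in> radical R I"
    by (auto simp: radical_iff power_mult_distrib intro!: exI[of _ k] ideal_mult[OF I])
qed

lemma radical_power: "x \<in> carrier R \<Longrightarrow> x ^ k \<in> radical R I \<Longrightarrow> x \<in> radical R I"
  by (auto simp: radical_iff simp flip: power_mult)

lemma radical_superset: "I \<subseteq> carrier R \<Longrightarrow> I \<subseteq> radical R I"
  by (auto simp: radical_iff intro!: exI[of _ 1])

text \<open>Any two 2-minors \<open>[k, l]\<close> and \<open>[k', l']\<close> with \<open>k + l = k' + l'\<close> are nested, and by the Plucker
  relation their product lies in the ideal of the minors with smaller index sum. So modulo the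
  minors of smaller index sum, a minor is nilpotent as soon as the sum over its antidiagonal
  vanishes.\<close>

lemma minors_in_radical:
  fixes a b :: "nat \<Rightarrow> 'a"
  defines "M \<equiv> \<lambda>i j. a i * b j - a j * b i"
  assumes ab: "\<And>i. a i \<in> carrier R" "\<And>i. b i \<in> carrier R" and I: "ideal I R"
    and S: "\<And>r. finite (S r)" "\<And>r k. k \<in> S r \<longleftrightarrow> 1 \<le> k \<and> k < r - k \<and> r - k \<le> N"
    and sums: "\<And>r. 3 \<le> r \<Longrightarrow> r \<le> t \<Longrightarrow> (\<Sum>k\<in>S r. M k (r - k)) \<in> I"
    and kl: "1 \<le> k" "k < l" "l \<le> N" "k + l \<le> t"
  shows "M k l \<in> radical R I"
  using kl
proof (induction "k + l" arbitrary: k l rule: less_induct)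
  case less
  let ?Rad = "radical R I"
  let ?r = "k + l"
  have Rad: "ideal ?Rad R" by (rule radical_ideal[OF I])
  have MR: "M i j \<in> carrier R" for i j using ab by (simp add: M_def)
  have nested: "M i j * M i' j' \<in> ?Rad"
    if "1 \<le> i" "i < i'" "i' < j'" "j' < j" "j \<le> N" "i' + j' = ?r" "i + j = ?r" for i j i' j'
  proof -
    \<comment> \<open>Since i' < j' < j, both index sums i + j' and i + i' are below i + j, so the
      induction hypothesis covers both minors.\<close>
    have "M i j' \<in> ?Rad" "M i i' \<in> ?Rad" using that less.prems by (auto intro!: less.hyps)
    then have "M i' j * M i j' - M j' j * M i i' \<in> ?Rad"
      by (intro ideal_diff[OF Rad] ideal_mult[OF Rad] MR)
    moreover have "M i j * M i' j' = - (M j' j * M i i') + M i' j * M i j'"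
      by (simp add: M_def algebra_simps)
    ultimately show ?thesis by simp
  qed
  have kS: "k \<in> S ?r" using less.prems by (simp add: S)
  \<comment> \<open>Multiplying the antidiagonal sum by one of its minors isolates the square of
    that minor; all other terms are products of two nested minors.\<close>
  have "M k l * (\<Sum>k'\<in>S ?r. M k' (?r - k')) = M k l ^ 2 + (\<Sum>k'\<in>S ?r - {k}. M k l * M k' (?r - k'))"
    by (subst sum.remove[OF S(1) kS]) (simp add: distrib_left sum_distrib_left power2_eq_square)
  then have "M k l ^ 2 = M k l * (\<Sum>k'\<in>S ?r. M k' (?r - k')) - (\<Sum>k'\<in>S ?r - {k}. M k l * M k' (?r - k'))" by simp
  also have "\<dots> \<in> ?Rad"
  proof (rule ideal_diff[OF Rad])
    have "(\<Sum>k'\<in>S ?r. M k' (?r - k')) \<in> I" using less.prems by (intro sums) auto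
    then have "(\<Sum>k'\<in>S ?r. M k' (?r - k')) \<in> ?Rad" using radical_superset ideal_carrier[OF I] by blast
    then show "M k l * (\<Sum>k'\<in>S ?r. M k' (?r - k')) \<in> ?Rad" by (rule ideal_mult[OF Rad MR])
    show "(\<Sum>k'\<in>S ?r - {k}. M k l * M k' (?r - k')) \<in> ?Rad"
    proof (rule ideal_sum[OF Rad])
      fix k' assume "k' \<in> S ?r - {k}"
      then have k': "1 \<le> k'" "k' < ?r - k'" "?r - k' \<le> N" "k' \<noteq> k" by (auto simp: S)
      show "M k l * M k' (?r - k') \<in> ?Rad"
      proof (cases "k < k'")
        case True
        with k' less.prems show ?thesis by (intro nested) auto
      next
        case False
        with k' less.prems have "M k' (?r - k') * M k l \<in> ?Rad" by (intro nested) auto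
        then show ?thesis by (simp add: mult.commute)
      qed
    qed
  qed
  finally show ?case by (rule radical_power[OF MR])
qed

lemma ext_ideal_combination:
  "x \<in> ext_ideal {0} f j \<Longrightarrow> \<exists>h. (\<forall>i. h i \<in> carrier R) \<and> x = (\<Sum>i<j. h i * f i)"
proof (induction j arbitrary: x)
  case 0
  then show ?case by (intro exI[of _ "\<lambda>_. 0"]) simp
next
  case (Suc j)
  then obtain u r where ur: "x = u + f j * r" "u \<in> ext_ideal {0} f j" "r \<in> carrier R" by auto
  then obtain h where h: "\<forall>i. h i \<in> carrier R" "u = (\<Sum>i<j. h i * f i)" using Suc.IH by blast
  show ?case using ur h by (intro exI[of _ "h(j := r)"]) (auto simp: mult.commute)
qed

lemma genideal_set_combination:
  assumes fs: "set fs \<subseteq> carrier R" and x: "x \<in> Idl (set fs)"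
  shows "\<exists>h. (\<forall>i. h i \<in> carrier R) \<and> x = (\<Sum>i<length fs. h i * fs ! i)"
proof (rule ext_ideal_combination)
  have Z: "ideal {0} R" by (rule idealI') auto
  have f: "\<And>i. i < length fs \<Longrightarrow> fs ! i \<in> carrier R" using fs by auto
  have "set fs \<subseteq> ext_ideal {0} ((!) fs) (length fs)"
    using ext_ideal_generator[OF Z f] by (auto simp: in_set_conv_nth)
  from genideal_minimal[OF ext_ideal_ideal[OF Z f] this] x show "x \<in> ext_ideal {0} ((!) fs) (length fs)" by auto
qed

end

lemma subst_order_ge:
  assumes h: "\<And>v. h v \<in> order_ge 1" and p: "p \<in> order_ge t"
  shows "subst h p \<in> order_ge t"
  unfolding subst_def
proof (intro order_ge_sum order_ge_mult1)
  fix m assume "m \<in> Poly_Mapping.keys p"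
  then have "t \<le> mdeg m" using p by (simp add: order_ge_def)
  moreover have "(\<Prod>v\<in>Poly_Mapping.keys m. h v ^ Poly_Mapping.lookup m v) \<in> order_ge (mdeg m)"
    unfolding mdeg_def by (intro order_ge_prod order_ge_power h)
  ultimately show "(\<Prod>v\<in>Poly_Mapping.keys m. h v ^ Poly_Mapping.lookup m v) \<in> order_ge t"
    by (auto simp: order_ge_def)
qed

section \<open>Quotients that are free over a ring of parameters\<close>

text \<open>\<tau> and \<tau>' describe mutually inverse coordinate changes of the polynomial ring.
  The image of \<open>polys XA\<close> under \<open>subst \<tau>\<close> is thus a polynomial ring
  on the parameters \<open>\<tau> x\<close> for x in \<open>XA\<close>, and R/J is free over it with
  basis \<open>v\<close>.\<close>

locale free_over_parameters =
  fixes X XA :: "'x set" and \<tau> \<tau>' :: "'x \<Rightarrow> ('x, 'k::comm_ring_1) mpoly" and J :: "('x, 'k) mpoly set"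
    and B :: "'b set" and v :: "'b \<Rightarrow> ('x, 'k) mpoly"
  assumes X: "finite X" "XA \<subseteq> X"
    and \<tau>: "\<And>x. x \<in> X \<Longrightarrow> \<tau> x \<in> polys X" "\<And>x. x \<in> X \<Longrightarrow> \<tau>' x \<in> polys X"
    and inverse: "\<And>x. x \<in> X \<Longrightarrow> subst \<tau> (\<tau>' x) = mvar x" "\<And>x. x \<in> X \<Longrightarrow> subst \<tau>' (\<tau> x) = mvar x"
    and J: "ideal J (mpoly_ring X)" and v: "\<And>b. b \<in> B \<Longrightarrow> v b \<in> polys X"
    and basis_span: "\<And>r. r \<in> polys X \<Longrightarrow> \<exists>a \<in> pm_over B (subst \<tau> ` polys XA). r - eval_comb v a \<in> J"
    and basis_indep: "\<And>a. a \<in> pm_over B (subst \<tau> ` polys XA) \<Longrightarrow> eval_comb v a \<in> J \<Longrightarrow> a = 0"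
begin

sublocale R: typeclass_ring "mpoly_ring X :: ('x, 'k) mpoly ring"
  by (rule typeclass_ring_mpoly)

lemma subst_left_inverse: "p \<in> polys X \<Longrightarrow> subst \<tau>' (subst \<tau> p) = p"
  unfolding subst_subst using subst_cong[of p X "\<lambda>v. subst \<tau>' (\<tau> v)" mvar] inverse(2) by (simp add: subst_mvar_id)

lemma subst_right_inverse: "p \<in> polys X \<Longrightarrow> subst \<tau> (subst \<tau>' p) = p"
  unfolding subst_subst using subst_cong[of p X "\<lambda>v. subst \<tau> (\<tau>' v)" mvar] inverse(1) by (simp add: subst_mvar_id)

lemma subst_inj: "p \<in> polys X \<Longrightarrow> q \<in> polys X \<Longrightarrow> subst \<tau> p = subst \<tau> q \<Longrightarrow> p = q"
  using subst_left_inverse by metis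

text \<open>The chain drops the coordinates outside \<open>XA\<close> one after the other. Degrees
  in the dropped coordinate are measured before substitution, where they can be read off from
  exponents.\<close>

lemma exists_relative_polynomial_ring:
  "\<exists>y C D. relative_polynomial_ring (mpoly_ring X) (card (X - XA)) y C D J B v"
proof -
  let ?n = "card (X - XA)"
  obtain z where z: "bij_betw z {0..<?n} (X - XA)"
    using ex_bij_betw_nat_finite[of "X - XA"] X by auto
  have zX: "z j \<in> X" "z j \<notin> XA" if "j < ?n" for j using bij_betwE[OF z] that by auto
  have zinj: "z i = z j \<Longrightarrow> i = j" if "i < ?n" "j < ?n" for i j
    using bij_betw_imp_inj_on[OF z] that by (auto simp: inj_on_def)
  define V where "V j = XA \<union> z ` {j..<?n}" for j
  \<comment> \<open>The value 0 past the last coordinate makes \<open>y\<close> a total sequence in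
    the ring, as the locale demands.\<close>
  define y where "y j = (if j < ?n then subst \<tau> (mvar (z j)) else 0)" for j
  define E where "E j k = {p :: ('x, 'k) mpoly. p \<in> polys (V j) \<and> (\<forall>m\<in>Poly_Mapping.keys p. Poly_Mapping.lookup m (z j) \<le> k)}" for j k
  define C where "C j = subst \<tau> ` polys (V j)" for j
  define D where "D j k = subst \<tau> ` E j k" for j k
  have VX: "V j \<subseteq> X" for j using zX X by (auto simp: V_def)
  have V0: "V 0 = X" using bij_betw_imp_surj_on[OF z] X by (auto simp: V_def)
  have Vn: "V ?n = XA" by (simp add: V_def)
  have VS: "V j = insert (z j) (V (Suc j))" "z j \<notin> V (Suc j)" if jn: "j < ?n" for j
  proof -
    have "{j..<?n} = insert j {Suc j..<?n}" using that by auto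
    then show "V j = insert (z j) (V (Suc j))" by (simp add: V_def)
    show "z j \<notin> V (Suc j)"
    proof
      assume "z j \<in> V (Suc j)"
      then obtain i where i: "Suc j \<le> i" "i < ?n" "z j = z i" using zX(2)[OF jn] unfolding V_def by auto
      from zinj[OF jn i(2,3)] i(1) show False by simp
    qed
  qed
  have EV: "E j k \<subseteq> polys (V j)" for j k by (auto simp: E_def)
  have Vp: "p \<in> polys X" if "p \<in> polys (V j)" for p :: "('x, 'k) mpoly" and j using polys_mono[OF VX that] .
  have E0: "E j 0 = polys (V (Suc j))" if "j < ?n" for j
  proof (intro equalityI subsetI)
    fix p assume p: "p \<in> E j 0"
    show "p \<in> polys (V (Suc j))"
      unfolding mem_polys
    proof
      fix m assume m: "m \<in> Poly_Mapping.keys p"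
      have "Poly_Mapping.keys m \<subseteq> V j" "Poly_Mapping.lookup m (z j) = 0"
        using p m by (simp_all add: E_def mem_polys)
      moreover from this(2) have "z j \<notin> Poly_Mapping.keys m" by (simp add: in_keys_iff)
      ultimately show "Poly_Mapping.keys m \<subseteq> V (Suc j)" unfolding VS(1)[OF that] by blast
    qed
  next
    fix p :: "('x, 'k) mpoly" assume p: "p \<in> polys (V (Suc j))"
    then have "p \<in> polys (V j)" using polys_mono[of "V (Suc j)" "V j" p] VS(1)[OF that] by blast
    moreover have "Poly_Mapping.lookup m (z j) = 0" if m: "m \<in> Poly_Mapping.keys p" for m
    proof -
      have "z j \<notin> Poly_Mapping.keys m" using p m VS(2)[OF \<open>j < ?n\<close>] unfolding mem_polys by blast
      then show ?thesis by (simp add: in_keys_iff)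
    qed
    ultimately show "p \<in> E j 0" by (simp add: E_def)
  qed
  have Ediff: "p - q \<in> E j k" if "p \<in> E j k" "q \<in> E j k" for p q j k
  proof -
    have "Poly_Mapping.keys (p - q) \<subseteq> Poly_Mapping.keys p \<union> Poly_Mapping.keys q" by (auto simp: in_keys_iff lookup_minus)
    then show ?thesis using that by (auto simp: E_def)
  qed
  have keys_y: "Poly_Mapping.lookup m (z j) \<le> k" if "m \<in> Poly_Mapping.keys p" "mvar (z j) * p \<in> E j (Suc k)" for m p j k
  proof -
    have "Poly_Mapping.single (z j) 1 + m \<in> Poly_Mapping.keys (mvar (z j) * p)"
      by (rule keys_mvar_mult[OF that(1)])
    then have "Poly_Mapping.lookup (Poly_Mapping.single (z j) 1 + m) (z j) \<le> Suc k" using that(2) by (auto simp: E_def)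
    then show ?thesis by (simp add: lookup_add)
  qed
  have keys_y0: "p = 0" if "mvar (z j) * p \<in> E j 0" for p j
  proof (rule ccontr)
    assume "p \<noteq> 0"
    then obtain m where "m \<in> Poly_Mapping.keys p" by (metis all_not_in_conv keys_eq_empty)
    then have "Poly_Mapping.single (z j) 1 + m \<in> Poly_Mapping.keys (mvar (z j) * p)"
      by (rule keys_mvar_mult)
    then have "Poly_Mapping.lookup (Poly_Mapping.single (z j) 1 + m) (z j) \<le> 0" using that by (auto simp: E_def)
    then show False by (simp add: lookup_add)
  qed
  have ya: "\<exists>p \<in> polys (V j). a = subst \<tau> p \<and> mvar (z j) * p \<in> E j k"
    if j: "j < ?n" and a: "a \<in> C j" "y j * a \<in> D j k" for a j k
  proof -
    obtain p q where pq: "p \<in> polys (V j)" "a = subst \<tau> p" "q \<in> E j k" "y j * a = subst \<tau> q"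
      using a by (auto simp: C_def D_def)
    have 1: "subst \<tau> (mvar (z j) * p) = subst \<tau> q" using pq(4) j unfolding pq(2) y_def by (simp add: subst_mult)
    have 2: "mvar (z j) * p \<in> polys X" by (intro polys_closed(5,8) Vp[OF pq(1)] zX(1)[OF j])
    have 3: "q \<in> polys X" using pq(3) EV Vp by blast
    from subst_inj[OF 2 3 1] pq show ?thesis by (intro bexI[of _ p]) simp_all
  qed
  have "relative_polynomial_ring (mpoly_ring X) ?n y C D J B v"
  proof (rule relative_polynomial_ring.intro[OF typeclass_ring_mpoly relative_polynomial_ring_axioms.intro])
    show "y j \<in> polys X" for j
    proof (cases "j < ?n")
      case True
      then have "y j = \<tau> (z j)" by (simp add: y_def)
      then show ?thesis using \<tau>(1)[OF zX(1)[OF True]] by simp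
    qed (simp add: y_def)
    show "C 0 = polys X"
    proof (intro equalityI subsetI)
      fix p assume "p \<in> C 0" then show "p \<in> polys X" unfolding C_def V0 using \<tau> by (auto intro: subst_closed)
    next
      fix p :: "('x, 'k) mpoly" assume p: "p \<in> polys X"
      have "subst \<tau>' p \<in> polys X" using p \<tau> by (auto intro: subst_closed)
      then show "p \<in> C 0" unfolding C_def V0 using subst_right_inverse[OF p] by (metis imageI)
    qed
    show "C (Suc j) \<subseteq> C j" if "j < ?n" for j
      unfolding C_def using polys_mono[of "V (Suc j)" "V j"] VS(1)[OF that] by blast
    show "0 \<in> C j" for j unfolding C_def by (rule image_eqI[of _ _ 0]) auto
    show "a - b \<in> C j" if "a \<in> C j" "b \<in> C j" for a b j
      using that unfolding C_def by (auto simp: subst_diff[symmetric])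
    show "a * b \<in> C j" if "a \<in> C j" "b \<in> C j" for a b j
      using that unfolding C_def by (auto simp: subst_mult[symmetric])
    show "1 \<in> C ?n" unfolding C_def by (rule image_eqI[of _ _ 1]) auto
    show "y j * a \<in> C j" if "j < ?n" "a \<in> C j" for j a
    proof -
      obtain p where p: "p \<in> polys (V j)" "a = subst \<tau> p" using \<open>a \<in> C j\<close> by (auto simp: C_def)
      have "y j * a = subst \<tau> (mvar (z j) * p)" using \<open>j < ?n\<close> by (simp add: y_def p(2) subst_mult)
      moreover have "mvar (z j) * p \<in> polys (V j)" using p(1) VS(1)[OF \<open>j < ?n\<close>] by auto
      ultimately show ?thesis unfolding C_def by blast
    qed
    show "D j 0 = C (Suc j)" if "j < ?n" for j unfolding D_def C_def E0[OF that] ..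
    show "D j k \<subseteq> D j (Suc k)" for j k unfolding D_def by (rule image_mono) (auto simp: E_def)
    show "D j k \<subseteq> C j" for j k unfolding D_def C_def by (rule image_mono) (auto simp: E_def)
    show "\<exists>k. a \<in> D j k" if a: "a \<in> C j" for a j
    proof -
      obtain p where p: "p \<in> polys (V j)" "a = subst \<tau> p" using a by (auto simp: C_def)
      obtain k where "p \<in> bounded_exps k" using bounded_exps_exists by blast
      with p have "p \<in> E j k" by (auto simp: E_def bounded_exps_def)
      with p(2) show ?thesis by (auto simp: D_def)
    qed
    show "a - b \<in> D j k" if "a \<in> D j k" "b \<in> D j k" for a b j k
      using that Ediff unfolding D_def by (auto simp: subst_diff[symmetric])
    show "a * b \<in> D j k" if ab: "j < ?n" "a \<in> C ?n" "b \<in> D j k" for a b j k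
    proof -
      obtain p q where p: "p \<in> polys XA" "a = subst \<tau> p" and q: "q \<in> E j k" "b = subst \<tau> q"
        using ab unfolding C_def Vn D_def by auto
      have pz: "Poly_Mapping.lookup m (z j) = 0" if m: "m \<in> Poly_Mapping.keys p" for m
      proof -
        have "z j \<notin> Poly_Mapping.keys m" using p(1) m zX(2)[OF \<open>j < ?n\<close>] unfolding mem_polys by blast
        then show ?thesis by (simp add: in_keys_iff)
      qed
      have "p \<in> polys (V j)" using p(1) by (rule polys_mono[rotated]) (auto simp: V_def)
      then have "p * q \<in> polys (V j)" using q(1) EV by blast
      moreover have "Poly_Mapping.lookup m (z j) \<le> k" if "m \<in> Poly_Mapping.keys (p * q)" for m
        using that keys_mult[of p q] pz q(1) by (auto simp: E_def lookup_add)
      ultimately have "p * q \<in> E j k" by (simp add: E_def)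
      then show ?thesis unfolding D_def p(2) q(2) subst_mult[symmetric] by blast
    qed
    show "\<exists>b\<in>D j k. \<exists>c\<in>C (Suc j). a = y j * b + c" if j: "j < ?n" and a: "a \<in> D j (Suc k)" for a j k
    proof -
      obtain p where p: "p \<in> E j (Suc k)" "a = subst \<tau> p" using a unfolding D_def by auto
      then obtain q r where qr: "p = mvar (z j) * q + r" "q \<in> polys (V j)" "r \<in> polys (V j)"
        "\<forall>m\<in>Poly_Mapping.keys q. Poly_Mapping.lookup m (z j) \<le> k" "\<forall>m\<in>Poly_Mapping.keys r. Poly_Mapping.lookup m (z j) = 0"
        using split_off_variable[of p "z j" k "V j"] by (auto simp: E_def)
      have "subst \<tau> q \<in> D j k" unfolding D_def E_def using qr by blast
      moreover have "r \<in> E j 0" using qr(3,5) by (simp add: E_def)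
      then have "subst \<tau> r \<in> C (Suc j)" unfolding C_def E0[OF j] by blast
      moreover have "a = y j * subst \<tau> q + subst \<tau> r" unfolding p(2) qr(1) y_def using j by (simp add: subst_add subst_mult)
      ultimately show ?thesis by blast
    qed
    show "a \<in> D j k" if a: "j < ?n" "a \<in> C j" "y j * a \<in> D j (Suc k)" for a j k
    proof -
      obtain p where p: "p \<in> polys (V j)" "a = subst \<tau> p" "mvar (z j) * p \<in> E j (Suc k)" using ya[OF a] by blast
      then have "p \<in> E j k" using keys_y unfolding E_def by blast
      with p(2) show ?thesis unfolding D_def by blast
    qed
    show "a = 0" if "j < ?n" "a \<in> C j" "y j * a \<in> D j 0" for a j
    proof -
      obtain p where p: "a = subst \<tau> p" "mvar (z j) * p \<in> E j 0" using ya[OF \<open>j < ?n\<close> \<open>a \<in> C j\<close> \<open>y j * a \<in> D j 0\<close>] by blast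
      from keys_y0[OF p(2)] show ?thesis by (simp add: p(1))
    qed
    show "ideal J (mpoly_ring X)" by (rule J)
    show "v \<beta> \<in> polys X" if "\<beta> \<in> B" for \<beta> by (rule v[OF that])
    show "\<exists>\<alpha>\<in>pm_over B (C ?n). r - eval_comb v \<alpha> \<in> J" if "r \<in> polys X" for r
      using basis_span[OF that] unfolding C_def Vn .
    show "\<alpha> = 0" if "\<alpha> \<in> pm_over B (C ?n)" "eval_comb v \<alpha> \<in> J" for \<alpha>
      using basis_indep that unfolding C_def Vn by blast
  qed
  then show ?thesis by blast
qed

lemma projective_dimension_le:
  assumes "inj_on (enc :: 'b \<Rightarrow> ('x, 'k) mpoly) B"
  shows "projective_dimension (mpoly_ring X) (quotient_module (mpoly_ring X) J) \<le> enat (card (X - XA))"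
proof -
  obtain y C D where "relative_polynomial_ring (mpoly_ring X) (card (X - XA)) y C D J B v"
    using exists_relative_polynomial_ring by blast
  from relative_polynomial_ring.projective_dimension_le[OF this assms] show ?thesis .
qed

text \<open>The variables of a polynomial ring are regular on any free module over it, by comparing
  coordinates. Modulo J, an element of the ideal of J and the first j parameters has coordinates in
  \<open>W j\<close>, the ideal of those parameters in the parameter ring itself; there, cancelling
  a further variable is a matter of monomials.\<close>

lemma parameters_regular:
  assumes l: "distinct l" "set l \<subseteq> XA" and i: "i < length l"
    and x: "x \<in> polys X" "subst \<tau> (mvar (l ! i)) * x \<in> R.ext_ideal J (\<lambda>i. subst \<tau> (mvar (l ! i))) i"
  shows "x \<in> R.ext_ideal J (\<lambda>i. subst \<tau> (mvar (l ! i))) i"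
proof -
  let ?A = "subst \<tau> ` polys XA"
  let ?f = "\<lambda>i. subst \<tau> (mvar (l ! i))"
  define W where "W j = subst \<tau> ` (polys XA \<inter> involving ((!) l ` {..<j}))" for j
  have lA: "l ! j \<in> XA" if "j < length l" for j using l(2) nth_mem[OF that] by blast
  have f: "?f j \<in> polys X" if "j < length l" for j using lA[OF that] X \<tau> by auto
  have W_zero: "0 \<in> W j" for j unfolding W_def by (rule image_eqI[of _ _ 0]) (auto simp: involving_0)
  have W_add: "a + b \<in> W j" if "a \<in> W j" "b \<in> W j" for a b j
    using that unfolding W_def by (auto simp: subst_add[symmetric] intro!: imageI involving_add)
  have AX: "subst \<tau> p \<in> polys X" if "p \<in> polys XA" for p
    using that X \<tau> by (auto intro!: subst_closed)
  have A_diff: "a - b \<in> ?A" if "a \<in> ?A" "b \<in> ?A" for a b using that by (auto simp: subst_diff[symmetric])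
  have A_mult: "a * b \<in> ?A" if "a \<in> ?A" "b \<in> ?A" for a b using that by (auto simp: subst_mult[symmetric])
  have fA: "?f j \<in> ?A" if "j < length l" for j using lA[OF that] by (auto intro!: image_eqI[of _ _ "mvar (l ! j)"])
  have WA: "W j \<subseteq> ?A" for j unfolding W_def by blast
  have diff_pm: "a - b \<in> pm_over B ?A" if "a \<in> pm_over B ?A" "b \<in> pm_over B ?A" for a b
  proof -
    have "Poly_Mapping.keys (a - b) \<subseteq> Poly_Mapping.keys a \<union> Poly_Mapping.keys b" by (auto simp: in_keys_iff lookup_minus)
    with that show ?thesis using A_diff by (auto simp: pm_over_def lookup_minus)
  qed
  have scale_pm: "scale (?f j) a \<in> pm_over B ?A" if "a \<in> pm_over B ?A" "j < length l" for a j
  proof -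
    have "?f j * Poly_Mapping.lookup a c \<in> ?A" for c
      using that(1) by (intro A_mult[OF fA[OF that(2)]]) (simp add: pm_over_def)
    moreover have "Poly_Mapping.keys (scale (?f j) a) \<subseteq> B" using that(1) keys_scale[of "?f j" a] by (auto simp: pm_over_def)
    ultimately show ?thesis by (simp add: pm_over_def)
  qed
  have ext: "\<exists>a \<in> pm_over B (W j). x - eval_comb v a \<in> J" if "x \<in> R.ext_ideal J ?f j" "j \<le> length l" for x j
    using that
  proof (induction j arbitrary: x)
    case 0
    have "0 \<in> pm_over B (W 0)" using W_zero by (simp add: pm_over_def)
    with 0 show ?case by (intro bexI[of _ 0]) simp_all
  next
    case (Suc j)
    then obtain u r where ur: "x = u + ?f j * r" "u \<in> R.ext_ideal J ?f j" "r \<in> polys X" by auto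
    obtain a where a: "a \<in> pm_over B (W j)" "u - eval_comb v a \<in> J" using Suc ur by auto
    obtain b where b: "b \<in> pm_over B ?A" "r - eval_comb v b \<in> J" using basis_span[OF ur(3)] by blast
    have j: "j < length l" using Suc.prems by simp
    have "Poly_Mapping.lookup (a + scale (?f j) b) c \<in> W (Suc j)" for c
    proof -
      have "(!) l ` {..<j} \<subseteq> (!) l ` {..<Suc j}" by auto
      from involving_mono[OF this] have "W j \<subseteq> W (Suc j)" unfolding W_def by blast
      then have "Poly_Mapping.lookup a c \<in> W (Suc j)" using a(1) by (auto simp: pm_over_def)
      moreover have "?f j * Poly_Mapping.lookup b c \<in> W (Suc j)"
      proof -
        obtain p where p: "p \<in> polys XA" "Poly_Mapping.lookup b c = subst \<tau> p" using b(1) by (auto simp: pm_over_def)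
        have "p * mvar (l ! j) \<in> polys XA \<inter> involving ((!) l ` {..<Suc j})"
          using p(1) lA[OF j] by (auto intro!: involving_mult involving_mvar)
        then have "subst \<tau> (p * mvar (l ! j)) \<in> W (Suc j)" unfolding W_def by (rule imageI)
        then show ?thesis unfolding p(2) by (simp add: subst_mult mult.commute)
      qed
      ultimately show ?thesis by (simp add: lookup_add W_add)
    qed
    moreover have "Poly_Mapping.keys (a + scale (?f j) b) \<subseteq> B"
    proof -
      have "Poly_Mapping.keys a \<subseteq> B" "Poly_Mapping.keys b \<subseteq> B" using a(1) b(1) by (simp_all add: pm_over_def)
      then show ?thesis using Poly_Mapping.keys_add[of a "scale (?f j) b"] keys_scale[of "?f j" b] by blast
    qed
    ultimately have "a + scale (?f j) b \<in> pm_over B (W (Suc j))" by (simp add: pm_over_def)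
    moreover have "x - eval_comb v (a + scale (?f j) b) = (u - eval_comb v a) + ?f j * (r - eval_comb v b)"
      unfolding ur(1) eval_comb_add eval_comb_scale by (simp add: algebra_simps)
    moreover have "\<dots> \<in> J" using a(2) b(2) f[OF j] by (intro R.ideal_add[OF J] R.ideal_mult[OF J])
    ultimately show ?case by (metis (no_types, lifting))
  qed
  obtain a where a: "a \<in> pm_over B ?A" "x - eval_comb v a \<in> J" using basis_span[OF x(1)] by blast
  obtain b where b: "b \<in> pm_over B (W i)" "?f i * x - eval_comb v b \<in> J" using ext[OF x(2)] i by auto
  have bA: "b \<in> pm_over B ?A" using b(1) WA[of i] by (auto simp: pm_over_def)
  have "eval_comb v (scale (?f i) a - b) = (?f i * x - eval_comb v b) - ?f i * (x - eval_comb v a)"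
    unfolding eval_comb_diff eval_comb_scale by (simp add: algebra_simps)
  also have "\<dots> \<in> J" by (rule R.ideal_diff[OF J b(2) R.ideal_mult[OF J f[OF i] a(2)]])
  finally have "scale (?f i) a - b = 0" using basis_indep diff_pm[OF scale_pm[OF a(1) i] bA] by blast
  then have ab: "scale (?f i) a = b" by simp
  have fi: "\<And>j. j < i \<Longrightarrow> ?f j \<in> polys X" using f i by simp
  have I: "ideal (R.ext_ideal J ?f i) (mpoly_ring X)" by (rule R.ext_ideal_ideal[OF J fi])
  have "Poly_Mapping.lookup a c \<in> R.ext_ideal J ?f i" for c
  proof -
    obtain p where p: "p \<in> polys XA" "Poly_Mapping.lookup a c = subst \<tau> p" using a(1) by (auto simp: pm_over_def)
    have "?f i * subst \<tau> p \<in> W i" using b(1) unfolding ab[symmetric] pm_over_def by (simp add: p(2)[symmetric])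
    then obtain q where q: "q \<in> polys XA" "q \<in> involving ((!) l ` {..<i})" "subst \<tau> (mvar (l ! i) * p) = subst \<tau> q"
      by (auto simp: W_def subst_mult)
    have "mvar (l ! i) * p = q"
    proof (rule subst_inj[OF _ _ q(3)])
      show "mvar (l ! i) * p \<in> polys X" by (rule polys_mono[OF X(2)]) (use lA[OF i] p(1) in auto)
      show "q \<in> polys X" by (rule polys_mono[OF X(2) q(1)])
    qed
    then have pi: "p \<in> involving ((!) l ` {..<i})"
      using q(2) l(1) i by (intro involving_cancel[of "l ! i" p]) (auto simp: nth_eq_iff_index_eq)
    let ?I = "{p \<in> polys X. subst \<tau> p \<in> R.ext_ideal J ?f i}"
    have st: "subst \<tau> r \<in> polys X" if r: "r \<in> polys X" for r by (rule subst_closed[OF r]) (rule \<tau>(1))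
    have idl: "ideal ?I (mpoly_ring X)"
    proof (rule R.idealI')
      fix r s :: "('x, 'k) mpoly" assume rs: "r \<in> ?I" "s \<in> polys X"
      show "s * r \<in> ?I" using rs R.ideal_mult[OF I st[OF rs(2)]] by (simp add: subst_mult)
    next
      fix r s :: "('x, 'k) mpoly" assume rs: "r \<in> ?I" "s \<in> ?I"
      then show "r + s \<in> ?I" using R.ideal_add[OF I, of "subst \<tau> r" "subst \<tau> s"] by (simp add: subst_add)
    next
      show "0 \<in> ?I" using R.ideal_zero[OF I] by simp
    qed blast
    have mv: "mvar ` (!) l ` {..<i} \<subseteq> ?I"
    proof clarify
      fix j assume j: "j < i"
      have "l ! j \<in> X" using lA[of j] i j X by auto
      then show "mvar (l ! j) \<in> polys X \<and> ?f j \<in> R.ext_ideal J ?f i"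
        using R.ext_ideal_generator[where f = "?f", OF J fi j] by blast
    qed
    have "p \<in> ?I" by (rule involving_ideal[OF idl mv polys_mono[OF X(2) p(1)] pi])
    then show ?thesis by (simp add: p(2))
  qed
  then have lc: "Poly_Mapping.lookup a c * v c \<in> R.ext_ideal J ?f i" if "c \<in> Poly_Mapping.keys a" for c
    using R.ideal_mult[OF I] v a(1) that unfolding pm_over_def mult.commute[of _ "v c"] by blast
  have ev: "eval_comb v a \<in> R.ext_ideal J ?f i"
    unfolding eval_comb_def by (rule R.ideal_sum[OF I]) (rule lc)
  have "x - eval_comb v a \<in> R.ext_ideal J ?f i" using R.ext_ideal_mono[of 0 i J ?f] a(2) by auto
  from R.ideal_add[OF I this ev] have "x - eval_comb v a + eval_comb v a \<in> R.ext_ideal J ?f i" .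
  then show ?thesis by simp
qed

end

section \<open>A complete graph without one edge\<close>

text \<open>The type argument carries the coefficient field, because the number N alone does not
  determine it.\<close>

locale near_complete =
  fixes N :: nat and K :: "'k::field itself"
  assumes N: "3 \<le> N"
begin

abbreviation "X \<equiv> edge_vars N"
abbreviation R :: "(nat \<times> nat, 'k) mpoly ring" where "R \<equiv> mpoly_ring X"
abbreviation z :: "nat \<Rightarrow> (nat \<times> nat, 'k) mpoly" where "z i \<equiv> mvar (1, i)"
abbreviation t :: "nat \<Rightarrow> (nat \<times> nat, 'k) mpoly" where "t i \<equiv> mvar (2, i)"

sublocale R: typeclass_ring R by (rule typeclass_ring_mpoly)

definition minor :: "nat \<Rightarrow> nat \<Rightarrow> (nat \<times> nat, 'k) mpoly" where
  "minor i j = z i * t j - z j * t i"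

definition E :: "nat set set" where
  "E = {{i, j} | i j. i \<in> {1..N} \<and> j \<in> {1..N} \<and> i \<noteq> j} - {{1, N}}"

definition J :: "(nat \<times> nat, 'k) mpoly set" where
  "J = binomial_edge_ideal N E"

abbreviation \<Delta> :: "(nat \<times> nat, 'k) mpoly" where "\<Delta> \<equiv> minor 1 N"

definition W :: "(nat \<times> nat) set" where
  "W = {1, 2} \<times> {2..N - 1}"

lemma simple_graph_E: "simple_graph N E"
  by (auto simp: simple_graph_def E_def)

lemma edge_iff: "i < j \<Longrightarrow> {i, j} \<in> E \<longleftrightarrow> 1 \<le> i \<and> j \<le> N \<and> (i, j) \<noteq> (1, N)"
proof -
  assume ij: "i < j"
  have "{i, j} \<in> {{i, j} | i j. i \<in> {1..N} \<and> j \<in> {1..N} \<and> i \<noteq> j} \<longleftrightarrow> 1 \<le> i \<and> j \<le> N"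
  proof
    assume "1 \<le> i \<and> j \<le> N"
    with ij show "{i, j} \<in> {{i, j} | i j. i \<in> {1..N} \<and> j \<in> {1..N} \<and> i \<noteq> j}"
      by (intro CollectI exI[of _ i] exI[of _ j]) auto
  qed (auto simp: doubleton_eq_iff)
  moreover have "{i, j} = {1, N} \<longleftrightarrow> (i, j) = (1, N)" using ij N by (auto simp: doubleton_eq_iff)
  ultimately show ?thesis unfolding E_def by blast
qed

lemma J_def': "J = Idl\<^bsub>R\<^esub> {minor i j | i j. i < j \<and> 1 \<le> i \<and> j \<le> N \<and> (i, j) \<noteq> (1, N)}"
  unfolding J_def binomial_edge_ideal_def minor_def
  by (rule arg_cong[where f = "genideal R"]) (use edge_iff in blast)

lemma minor_closed: "i \<in> {1..N} \<Longrightarrow> j \<in> {1..N} \<Longrightarrow> minor i j \<in> polys X"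
  unfolding minor_def by (intro polys_closed) (auto simp: edge_vars_def)

lemma gens_closed: "{minor i j | i j. i < j \<and> 1 \<le> i \<and> j \<le> N \<and> (i, j) \<noteq> (1, N)} \<subseteq> polys X"
  using minor_closed by auto

lemma J_ideal: "ideal J R"
  unfolding J_def' by (rule R.genideal_ideal[OF gens_closed])

lemma J_least:
  assumes "ideal I R" "\<And>i j. i < j \<Longrightarrow> 1 \<le> i \<Longrightarrow> j \<le> N \<Longrightarrow> (i, j) \<noteq> (1, N) \<Longrightarrow> minor i j \<in> I"
  shows "J \<subseteq> I"
  unfolding J_def' by (rule R.genideal_minimal[OF assms(1)]) (use assms(2) in blast)

lemma minor_swap: "minor i j = - minor j i"
  by (simp add: minor_def)

lemma minor_self: "minor i i = 0"
  by (simp add: minor_def mult.commute)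

lemma minor_in_J:
  assumes "i \<in> {1..N}" "j \<in> {1..N}" "{i, j} \<noteq> {1, N}"
  shows "minor i j \<in> J"
proof -
  have g: "minor i j \<in> J" if "i < j" "1 \<le> i" "j \<le> N" "(i, j) \<noteq> (1, N)" for i j
    unfolding J_def' using R.genideal_self[OF gens_closed] that by blast
  consider "i < j" | "i = j" | "j < i" by linarith
  then show ?thesis
  proof cases
    case 1
    then show ?thesis using assms by (intro g) auto
  next
    case 2
    then show ?thesis using R.ideal_zero[OF J_ideal] by (simp add: minor_self)
  next
    case 3
    then have "minor j i \<in> J" using assms by (intro g) auto
    then show ?thesis using R.ideal_uminus[OF J_ideal] minor_swap[of i j] by simp
  qed
qed

section \<open>The missing minor and its annihilator\<close>

lemma W_subset: "W \<subseteq> X"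
  by (auto simp: W_def edge_vars_def)

lemma card_W: "card W = 2 * N - 4" and finite_W: "finite W"
  using N by (auto simp: W_def card_cartesian_product)

text \<open>A 3 by 3 determinant with a repeated row vanishes. Expanding it for the columns 1, i, N
  expresses each entry of column i times \<Delta> by the minors of the two edges {1, i} and {i,
  N}.\<close>

lemma W_annihilates: "v \<in> W \<Longrightarrow> mvar v * \<Delta> \<in> J"
proof -
  assume "v \<in> W"
  then obtain i where i: "i \<in> {2..N - 1}" "v = (1, i) \<or> v = (2, i)" by (auto simp: W_def)
  have m: "minor i N \<in> J" "minor 1 i \<in> J" using i N by (auto intro!: minor_in_J simp: doubleton_eq_iff)
  have "z i * \<Delta> = z 1 * minor i N + z N * minor 1 i" "t i * \<Delta> = t 1 * minor i N + t N * minor 1 i"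
    by (simp_all add: minor_def algebra_simps)
  moreover have "z 1 \<in> polys X" "z N \<in> polys X" "t 1 \<in> polys X" "t N \<in> polys X"
    using N by (auto simp: edge_vars_def)
  ultimately show ?thesis
    using i(2) m R.ideal_add[OF J_ideal] R.ideal_mult[OF J_ideal] by metis
qed

text \<open>The projection onto R/(W), realised as a retraction of R onto the polynomials in the
  four entries of columns 1 and N.\<close>

definition \<omega> :: "nat \<times> nat \<Rightarrow> (nat \<times> nat, 'k) mpoly" where
  "\<omega> v = (if v \<in> W then 0 else mvar v)"

lemma \<omega>_closed: "v \<in> X \<Longrightarrow> \<omega> v \<in> polys (X - W)"
  by (auto simp: \<omega>_def)

lemma \<omega>_\<Delta>: "subst \<omega> \<Delta> = \<Delta>"
  using N by (auto simp: minor_def subst_diff subst_mult \<omega>_def W_def)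

text \<open>Every edge has an end in 2, ..., N - 1, where \<omega> makes the whole column zero; the
  minor of the missing edge is the only one that survives.\<close>

lemma \<omega>_J: "p \<in> J \<Longrightarrow> subst \<omega> p = 0"
proof -
  have "J \<subseteq> {p \<in> polys X. subst \<omega> p = 0}"
  proof (rule J_least)
    show "ideal {p \<in> polys X. subst \<omega> p = 0} R"
      by (rule R.idealI') (auto simp: subst_add subst_mult)
    fix i j :: nat assume ij: "i < j" "1 \<le> i" "j \<le> N" "(i, j) \<noteq> (1, N)"
    then have "i \<in> {2..N - 1} \<or> j \<in> {2..N - 1}" by auto
    then show "minor i j \<in> {p \<in> polys X. subst \<omega> p = 0}"
      using ij minor_closed[of i j] by (auto simp: minor_def subst_diff subst_mult \<omega>_def W_def)
  qed
  then show "p \<in> J \<Longrightarrow> subst \<omega> p = 0" by blast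
qed

text \<open>\<Delta> is quadratic, so it lies outside the cube of the maximal ideal. This is the
  origin of the exponent 3 in the upper bound for the depth.\<close>

lemma \<Delta>_order: "\<Delta> \<notin> order_ge 3"
proof
  let ?m = "Poly_Mapping.single (1, 1) 1 + Poly_Mapping.single (2, N) 1 :: nat \<times> nat \<Rightarrow>\<^sub>0 nat"
  let ?m' = "Poly_Mapping.single (1, N) 1 + Poly_Mapping.single (2, 1) 1 :: nat \<times> nat \<Rightarrow>\<^sub>0 nat"
  assume o: "\<Delta> \<in> order_ge 3"
  have "Poly_Mapping.lookup ?m (1, 1) \<noteq> Poly_Mapping.lookup ?m' (1, 1)"
    using N by (simp add: lookup_add lookup_single when_def)
  then have "?m \<noteq> ?m'" by metis
  moreover have "\<Delta> = monom ?m - monom ?m'" by (simp add: minor_def mvar_def mult_single)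
  ultimately have "Poly_Mapping.lookup \<Delta> ?m = 1" by (simp add: lookup_minus lookup_single when_def)
  then have "3 \<le> mdeg ?m" using o by (auto simp: order_ge_def in_keys_iff)
  then show False by (simp add: mdeg_add)
qed

lemma \<Delta>_closed: "\<Delta> \<in> polys X"
  using N by (intro minor_closed) auto

lemma \<Delta>_notin_J: "\<Delta> \<notin> J"
  using \<omega>_J[of \<Delta>] \<omega>_\<Delta> \<Delta>_order by auto

text \<open>The difference p - \<open>subst \<omega>\<close> p lies in the ideal generated by
  \<open>W\<close>, by induction on p, and that ideal annihilates \<Delta> modulo J.\<close>

lemma \<omega>_kernel: "p \<in> polys X \<Longrightarrow> subst \<omega> p = 0 \<Longrightarrow> p * \<Delta> \<in> J"
proof -
  assume p: "p \<in> polys X" "subst \<omega> p = 0"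
  have "p - subst \<omega> p \<in> involving W"
    using p(1)
  proof (induction p rule: polys_induct)
    case (var v)
    then show ?case by (auto simp: \<omega>_def involving_0 involving_mvar)
  next
    case (add p q)
    have "p + q - subst \<omega> (p + q) = (p - subst \<omega> p) + (q - subst \<omega> q)" by (simp add: subst_add)
    then show ?case using involving_add add by metis
  next
    case (mult p q)
    have "p * q - subst \<omega> (p * q) = p * (q - subst \<omega> q) + subst \<omega> q * (p - subst \<omega> p)"
      by (simp add: subst_mult algebra_simps)
    then show ?case using involving_add involving_mult mult by metis
  qed (simp add: involving_0)
  then have pW: "p \<in> involving W" using p(2) by simp
  have idl: "ideal {p \<in> polys X. p * \<Delta> \<in> J} R"
    by (rule R.idealI')
      (auto simp: distrib_right mult.assoc R.ideal_zero[OF J_ideal] intro: R.ideal_add[OF J_ideal] R.ideal_mult[OF J_ideal])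
  have mv: "mvar ` W \<subseteq> {p \<in> polys X. p * \<Delta> \<in> J}" using W_annihilates W_subset by auto
  have "p \<in> {p \<in> polys X. p * \<Delta> \<in> J}" by (rule involving_ideal[OF idl mv p(1) pW])
  then show ?thesis by simp
qed

section \<open>Projective dimension from below and depth from above\<close>

lemma J_order: "J \<subseteq> order_ge 1" and max_order: "homogeneous_maximal_ideal X \<subseteq> polys X \<inter> (order_ge 1 :: (nat \<times> nat, 'k) mpoly set)"
proof -
  have I: "ideal (polys X \<inter> order_ge 1) R"
    by (rule R.idealI') (auto intro: order_ge_add order_ge_mult1)
  have v: "mvar v \<in> (order_ge 1 :: (nat \<times> nat, 'k) mpoly set)" for v by (simp add: order_ge_def mvar_def)
  have "minor i j \<in> order_ge 1" for i j
    unfolding minor_def diff_conv_add_uminus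
    using order_ge_add[OF order_ge_mult1[OF v] order_ge_mult1[OF v], of "z i" "(2,j)" "- z j" "(2,i)"] by simp
  then have "J \<subseteq> polys X \<inter> order_ge 1" using minor_closed by (intro J_least[OF I]) auto
  then show "J \<subseteq> order_ge 1" by blast
  show "homogeneous_maximal_ideal X \<subseteq> polys X \<inter> (order_ge 1 :: (nat \<times> nat, 'k) mpoly set)"
    unfolding homogeneous_maximal_ideal_def by (rule R.genideal_minimal[OF I]) (use v in auto)
qed

lemma one_notin_order_ge: "1 \<notin> (order_ge 1 :: (nat \<times> nat, 'k) mpoly set)"
  by (simp add: order_ge_def mdeg_def)

lemma projective_dimension_lower: "enat (2 * N - 4) \<le> projective_dimension R (quotient_module R J)"
proof -
  obtain w where w: "bij_betw w {0..<card W} W" using ex_bij_betw_nat_finite[OF finite_W] by blast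
  have ww: "inj_on w {..<card W}" "w ` {..<card W} \<subseteq> X"
    using bij_betw_imp_inj_on[OF w] bij_betw_imp_surj_on[OF w] W_subset by (auto simp: atLeast0LessThan)
  have wW: "w i \<in> W" if "i < card W" for i using bij_betwE[OF w] that by auto
  note qm = R.quotient_module_simps[OF J_ideal]
  have "enat (card W) \<le> projective_dimension R (quotient_module R J)"
  proof (rule projective_dimension_ge[where w = "\<lambda>i. mvar (w i)" and u = "J +>\<^bsub>R\<^esub> \<Delta>"])
    show "cring R" by (rule mpoly_ring_cring)
    show "Module.module R (quotient_module R J)" by (rule quotient_module_module[OF mpoly_ring_cring J_ideal])
    show c: "mvar (w i) \<in> polys X" if "i < card W" for i using wW[OF that] W_subset by auto
    show "x \<in> ideal_upto R (\<lambda>i. mvar (w i)) r"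
      if "r < card W" "x \<in> polys X" "mvar (w r) \<otimes>\<^bsub>R\<^esub> x \<in> ideal_upto R (\<lambda>i. mvar (w i)) r" for r x
      using variables_weakly_regular[OF ww that(1,2)] that(3) by simp
    show "J +>\<^bsub>R\<^esub> \<Delta> \<in> carrier (quotient_module R J)" unfolding qm(1) using \<Delta>_closed by blast
    show "J +>\<^bsub>R\<^esub> \<Delta> \<noteq> \<zero>\<^bsub>quotient_module R J\<^esub>" unfolding qm(3) using qm(2)[OF \<Delta>_closed R.closed(1)] \<Delta>_notin_J by simp
    show "mvar (w i) \<odot>\<^bsub>quotient_module R J\<^esub> (J +>\<^bsub>R\<^esub> \<Delta>) = \<zero>\<^bsub>quotient_module R J\<^esub>" if "i < card W" for i
      unfolding qm(3) qm(5)[OF c[OF that] \<Delta>_closed]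
      using qm(2)[OF R.closed(4)[OF c[OF that] \<Delta>_closed] R.closed(1)] W_annihilates[OF wW[OF that]] by simp
  qed
  then show ?thesis by (simp add: card_W)
qed

lemma card_X: "card X = 2 * N" and finite_X: "finite X"
  by (auto simp: edge_vars_def card_cartesian_product)

text \<open>Under \<omega> five elements land in a polynomial ring in four variables and satisfy a
  polynomial relation. The same relation evaluated at the original elements lies in the kernel of
  \<omega>, so it annihilates \<Delta> modulo J, which is impossible for a regular sequence.\<close>

lemma depth_upper:
  assumes fs: "set fs \<subseteq> homogeneous_maximal_ideal X" and reg: "regular_sequence R (quotient_module R J) fs"
  shows "length fs \<le> 4"
proof (rule ccontr)
  assume "\<not> length fs \<le> 4"
  then have len: "5 \<le> length fs" by simp
  have fsc: "set fs \<subseteq> polys X" and fso: "set fs \<subseteq> order_ge 1" using fs max_order by auto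
  have f: "\<And>i. i < 5 \<Longrightarrow> fs ! i \<in> polys X" "\<And>i. i < 5 \<Longrightarrow> fs ! i \<in> order_ge 1" using fsc fso len by auto
  have reg': "x \<in> R.ext_ideal J ((!) fs) i" if "i < 5" "x \<in> polys X" "fs ! i * x \<in> R.ext_ideal J ((!) fs) i" for i x
    using reg len that unfolding R.regular_sequence_quotient[OF J_ideal fsc] by auto
  have "card (X - W) < 5" using card_X card_W W_subset finite_W N by (simp add: card_Diff_subset)
  moreover have "subst \<omega> (fs ! i) \<in> polys (X - W)" if "i < 5" for i
    using f(1)[OF that] \<omega>_closed by (rule subst_closed)
  ultimately obtain P c where P: "finite P" "P \<noteq> {}" "\<And>\<alpha> i. \<alpha> \<in> P \<Longrightarrow> 5 \<le> i \<Longrightarrow> \<alpha> i = 0"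
    and c: "\<And>\<alpha>. \<alpha> \<in> P \<Longrightarrow> c \<alpha> \<noteq> (0 :: 'k)"
    and zero: "(\<Sum>\<alpha>\<in>P. const_poly (c \<alpha>) * (\<Prod>i<5. subst \<omega> (fs ! i) ^ \<alpha> i)) = 0"
    using finite_X by (rule_tac algebraic_dependence[of "X - W" 5 "\<lambda>i. subst \<omega> (fs ! i)"]) auto
  let ?p = "\<Sum>\<alpha>\<in>P. const_poly (c \<alpha>) * (\<Prod>i<5. (fs ! i) ^ \<alpha> i)"
  have "subst \<omega> ?p = 0" using zero by (simp add: subst_sum subst_mult subst_prod subst_power)
  moreover have "?p \<in> polys X" by (intro polys_sum polys_closed(3,5) polys_prod polys_power f) simp
  ultimately have pJ: "?p * \<Delta> \<in> J" by (intro \<omega>_kernel)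
  \<comment> \<open>Otherwise \<Delta> would be, modulo J, a cubic form in elements without constant
    term. Applying \<omega>, which fixes \<Delta> and kills J, would then give \<Delta> order at
    least three.\<close>
  have "\<Delta> \<notin> R.power_ideal J ((!) fs) 5 3"
  proof
    assume "\<Delta> \<in> R.power_ideal J ((!) fs) 5 3"
    then obtain g where g: "\<Delta> - R.form ((!) fs) 5 3 g \<in> J" unfolding R.power_ideal_def by blast
    have "R.form ((!) fs) 5 3 g \<in> order_ge 3"
      unfolding R.form_def
    proof (rule order_ge_sum)
      fix \<alpha> assume "\<alpha> \<in> R.multiindices 5 3"
      then have "(\<Sum>i<5. \<alpha> i) = 3" by (simp add: R.multiindices_def)
      moreover have "(\<Prod>i<5. (fs ! i) ^ \<alpha> i) \<in> order_ge (\<Sum>i<5. \<alpha> i)"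
        by (intro order_ge_prod order_ge_power f) simp
      ultimately show "(\<Prod>i<5. (fs ! i) ^ \<alpha> i) * g \<alpha> \<in> order_ge 3"
        using order_ge_mult1[of _ 3 "g \<alpha>"] by (metis mult.commute)
    qed
    moreover have "\<omega> v \<in> order_ge 1" for v by (simp add: \<omega>_def order_ge_def mvar_def)
    ultimately have "subst \<omega> (R.form ((!) fs) 5 3 g) \<in> order_ge 3" by (intro subst_order_ge)
    moreover have "subst \<omega> (R.form ((!) fs) 5 3 g) = \<Delta>" using \<omega>_J[OF g] unfolding subst_diff \<omega>_\<Delta> by (metis eq_iff_diff_eq_0)
    ultimately show False using \<Delta>_order by simp
  qed
  then have not_power: "\<Delta> \<notin> R.power_ideal J ((!) fs) 5 3" .
  have unit: "\<exists>d \<in> polys X. d * const_poly (c \<alpha>) = 1" if "\<alpha> \<in> P" for \<alpha>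
  proof
    show "const_poly (inverse (c \<alpha>)) * const_poly (c \<alpha>) = 1"
      unfolding mult_single using c[OF that] by simp
  qed (rule polys_closed(3))
  show False
    by (rule R.regular_sequence_independent[where s = 5 and f = "(!) fs" and u = \<Delta> and ?t0.0 = 3 and P = P
          and c = "\<lambda>\<alpha>. const_poly (c \<alpha>)"],
        fact J_ideal, erule f(1), erule (2) reg', fact \<Delta>_closed, fact not_power, fact P(1), fact P(2), erule (1) P(3),
        rule polys_closed(3), erule unit, fact pJ)
qed

end

lemma mvar_power: "(mvar v :: ('x, 'k::comm_ring_1) mpoly) ^ k = monom (Poly_Mapping.single v k)"
  by (induction k) (simp_all add: mvar_def mult_single single_add[symmetric])

lemma monom_split:
  fixes m :: "'x \<Rightarrow>\<^sub>0 nat"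
  shows "\<exists>a b. m = a + b \<and> Poly_Mapping.keys a \<subseteq> S \<and> Poly_Mapping.keys b \<subseteq> Poly_Mapping.keys m - S \<and>
    (\<forall>y. Poly_Mapping.lookup b y \<le> Poly_Mapping.lookup m y)"
proof -
  define r where "r T = (\<Sum>x\<in>T. Poly_Mapping.single x (Poly_Mapping.lookup m x))" for T
  have l: "Poly_Mapping.lookup (r T) y = (if y \<in> T then Poly_Mapping.lookup m y else 0)" if "finite T" for T y
    using that by (simp add: r_def lookup_sum lookup_single when_def)
  have f: "finite (Poly_Mapping.keys m \<inter> S)" "finite (Poly_Mapping.keys m - S)" by simp_all
  have "m = r (Poly_Mapping.keys m \<inter> S) + r (Poly_Mapping.keys m - S)"
    by (rule poly_mapping_eqI) (auto simp: lookup_add l[OF f(1)] l[OF f(2)] in_keys_iff)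
  moreover have "Poly_Mapping.keys (r (Poly_Mapping.keys m \<inter> S)) \<subseteq> S"
    by (auto simp: in_keys_iff l[OF f(1)] split: if_splits)
  moreover have "Poly_Mapping.keys (r (Poly_Mapping.keys m - S)) \<subseteq> Poly_Mapping.keys m - S"
    by (auto simp: in_keys_iff l[OF f(2)] split: if_splits)
  moreover have "Poly_Mapping.lookup (r (Poly_Mapping.keys m - S)) y \<le> Poly_Mapping.lookup m y" for y
    by (simp add: l[OF f(2)])
  ultimately show ?thesis by blast
qed

section \<open>The basis over four parameters: generation\<close>

context near_complete
begin

definition XA :: "(nat \<times> nat) set" where
  "XA = {(1, 1), (2, 1), (2, N - 1), (2, N)}"

text \<open>In the coordinates given by \<open>\<tau>\<close>, the columns of the generic matrix are
  \<open>(z i, t i + z (i + 1))\<close>.\<close>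

definition \<tau> :: "nat \<times> nat \<Rightarrow> (nat \<times> nat, 'k) mpoly" where
  "\<tau> v = (if fst v = 2 \<and> snd v < N then mvar v - z (Suc (snd v)) else mvar v)"

definition \<tau>' :: "nat \<times> nat \<Rightarrow> (nat \<times> nat, 'k) mpoly" where
  "\<tau>' v = (if fst v = 2 \<and> snd v < N then mvar v + z (Suc (snd v)) else mvar v)"

definition Zs :: "(nat \<times> nat) set" where
  "Zs = {1} \<times> {2..N}"

definition zdeg :: "(nat \<times> nat \<Rightarrow>\<^sub>0 nat) \<Rightarrow> nat" where
  "zdeg m = (\<Sum>i=2..N. Poly_Mapping.lookup m (1, i))"

definition U :: "(nat \<times> nat, 'k) mpoly set" where
  "U = {q \<in> polys X. \<forall>m\<in>Poly_Mapping.keys q. zdeg m \<le> 1}"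

text \<open>\<open>None\<close> indexes \<Delta>. The coordinates outside \<open>XA\<close> are z_2,
  ..., z_N, in which the monomials are at most linear together, and t_2, ..., t_(N-2), which may
  occur to any power.\<close>

definition B :: "(nat \<times> nat \<Rightarrow>\<^sub>0 nat) option set" where
  "B = insert None (Some ` {\<mu>. Poly_Mapping.keys \<mu> \<subseteq> X - XA \<and> zdeg \<mu> \<le> 1})"

definition v :: "(nat \<times> nat \<Rightarrow>\<^sub>0 nat) option \<Rightarrow> (nat \<times> nat, 'k) mpoly" where
  "v b = (case b of None \<Rightarrow> \<Delta> | Some \<mu> \<Rightarrow> subst \<tau> (monom \<mu>))"

lemma \<tau>_closed: "x \<in> X \<Longrightarrow> \<tau> x \<in> polys X" and \<tau>'_closed: "x \<in> X \<Longrightarrow> \<tau>' x \<in> polys X"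
proof -
  have "z (Suc j) \<in> polys X" if "1 \<le> j" "j < N" for j using that by (intro polys_closed(8)) (auto simp: edge_vars_def)
  then show "x \<in> X \<Longrightarrow> \<tau> x \<in> polys X" "x \<in> X \<Longrightarrow> \<tau>' x \<in> polys X"
    by (auto simp: \<tau>_def \<tau>'_def edge_vars_def)
qed

lemma \<tau>_inverse: "subst \<tau> (\<tau>' x) = mvar x" "subst \<tau>' (\<tau> x) = mvar x"
  by (auto simp: \<tau>_def \<tau>'_def subst_add subst_diff)

lemma XA_subset: "XA \<subseteq> X" and card_XA: "card XA = 4" and XA_Zs: "XA \<inter> Zs = {}"
  using N by (auto simp: XA_def edge_vars_def Zs_def card_insert_if)

lemma subst_\<tau>_closed: "p \<in> polys X \<Longrightarrow> subst \<tau> p \<in> polys X"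
  by (erule subst_closed) (rule \<tau>_closed)

lemma subst_\<tau>_\<tau>': "subst \<tau> (subst \<tau>' p) = p" "subst \<tau>' (subst \<tau> p) = p"
  by (simp_all add: subst_subst \<tau>_inverse subst_mvar_id)

lemma zdeg_add: "zdeg (m + m') = zdeg m + zdeg m'"
  by (simp add: zdeg_def lookup_add sum.distrib)

lemma zdeg_0: "Poly_Mapping.keys m \<inter> Zs = {} \<Longrightarrow> zdeg m = 0"
  unfolding zdeg_def by (rule sum.neutral) (auto simp: Zs_def in_keys_iff)

lemma U_mult: "p \<in> polys (X - Zs) \<Longrightarrow> q \<in> U \<Longrightarrow> p * q \<in> U"
proof -
  assume p: "p \<in> polys (X - Zs)" and q: "q \<in> U"
  have pX: "p \<in> polys X" by (rule polys_mono[OF _ p]) auto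
  have "zdeg m \<le> 1" if m: "m \<in> Poly_Mapping.keys (p * q)" for m
  proof -
    obtain a b where ab: "m = a + b" "a \<in> Poly_Mapping.keys p" "b \<in> Poly_Mapping.keys q"
      using m keys_mult[of p q] by blast
    have "Poly_Mapping.keys a \<subseteq> X - Zs" using p ab(2) by (simp add: mem_polys)
    then have "zdeg a = 0" by (intro zdeg_0) blast
    with ab q show ?thesis by (simp add: U_def zdeg_add)
  qed
  then show ?thesis using pX q by (simp add: U_def)
qed

lemma U_add: "p \<in> U \<Longrightarrow> q \<in> U \<Longrightarrow> p + q \<in> U"
  using Poly_Mapping.keys_add[of p q] unfolding U_def by auto

lemma U_sum: "(\<And>i. i \<in> S \<Longrightarrow> f i \<in> U) \<Longrightarrow> sum f S \<in> U"
proof -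
  have "0 \<in> U" by (simp add: U_def)
  then show "(\<And>i. i \<in> S \<Longrightarrow> f i \<in> U) \<Longrightarrow> sum f S \<in> U"
    by (induction S rule: infinite_finite_induct) (auto intro: U_add)
qed

lemma U_single: "Poly_Mapping.keys m \<subseteq> X \<Longrightarrow> zdeg m \<le> 1 \<Longrightarrow> Poly_Mapping.single m c \<in> U"
  by (simp add: U_def)

definition V :: "(nat \<times> nat, 'k) mpoly set" where
  "V = {r \<in> polys X. \<exists>a \<in> pm_over B (subst \<tau> ` polys XA). r - eval_comb v a \<in> J}"

lemma A_add: "x \<in> subst \<tau> ` polys XA \<Longrightarrow> y \<in> subst \<tau> ` polys XA \<Longrightarrow> x + y \<in> subst \<tau> ` polys XA"
  by (auto simp: subst_add[symmetric] intro!: imageI)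

lemma A_zero: "0 \<in> subst \<tau> ` polys XA"
  by (rule image_eqI[of _ _ 0]) auto

lemma V_add:
  assumes "x \<in> V" "y \<in> V"
  shows "x + y \<in> V"
proof -
  obtain a b where ab: "a \<in> pm_over B (subst \<tau> ` polys XA)" "x - eval_comb v a \<in> J"
    "b \<in> pm_over B (subst \<tau> ` polys XA)" "y - eval_comb v b \<in> J" using assms unfolding V_def by blast
  have "Poly_Mapping.keys a \<subseteq> B" "Poly_Mapping.keys b \<subseteq> B" using ab(1,3) unfolding pm_over_def by blast+
  then have "Poly_Mapping.keys (a + b) \<subseteq> B" using Poly_Mapping.keys_add[of a b] by blast
  moreover have "Poly_Mapping.lookup a c \<in> subst \<tau> ` polys XA" "Poly_Mapping.lookup b c \<in> subst \<tau> ` polys XA" for c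
    using ab(1,3) unfolding pm_over_def by blast+
  then have "Poly_Mapping.lookup (a + b) c \<in> subst \<tau> ` polys XA" for c unfolding lookup_add by (rule A_add)
  ultimately have "a + b \<in> pm_over B (subst \<tau> ` polys XA)" unfolding pm_over_def by blast
  moreover have eq: "x + y - eval_comb v (a + b) = (x - eval_comb v a) + (y - eval_comb v b)" by (simp add: eval_comb_add)
  have "x + y - eval_comb v (a + b) \<in> J" unfolding eq by (rule R.ideal_add[OF J_ideal ab(2,4)])
  moreover have "x + y \<in> polys X" using assms unfolding V_def by blast
  ultimately show ?thesis unfolding V_def by blast
qed

lemma V_J: "x \<in> J \<Longrightarrow> x \<in> V"
proof -
  assume x: "x \<in> J"
  have "0 \<in> pm_over B (subst \<tau> ` polys XA)" unfolding pm_over_def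
    by (intro CollectI conjI allI, simp, simp only: lookup_zero, rule A_zero)
  moreover have "x - eval_comb v 0 \<in> J" using x by simp
  ultimately show ?thesis unfolding V_def using R.ideal_carrier[OF J_ideal x] by blast
qed

lemma V_sum: "(\<And>i. i \<in> S \<Longrightarrow> f i \<in> V) \<Longrightarrow> sum f S \<in> V"
  by (induction S rule: infinite_finite_induct) (auto intro: V_add V_J R.ideal_zero[OF J_ideal])

lemma v_closed: "b \<in> B \<Longrightarrow> v b \<in> polys X"
  using \<Delta>_closed by (auto simp: B_def v_def intro!: subst_\<tau>_closed polys_closed(9))

lemma V_gen:
  assumes "p \<in> polys XA" "b \<in> B"
  shows "subst \<tau> p * v b \<in> V"
proof -
  have "Poly_Mapping.single b (subst \<tau> p) \<in> pm_over B (subst \<tau> ` polys XA)"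
    using assms A_zero by (auto simp: pm_over_def lookup_single when_def)
  moreover have "subst \<tau> p * v b - eval_comb v (Poly_Mapping.single b (subst \<tau> p)) \<in> J"
    using R.ideal_zero[OF J_ideal] by simp
  moreover have "subst \<tau> p * v b \<in> polys X"
    using v_closed[OF assms(2)] subst_\<tau>_closed[OF polys_mono[OF XA_subset assms(1)]] by auto
  ultimately show ?thesis unfolding V_def by blast
qed

lemma V_U: "q \<in> U \<Longrightarrow> subst \<tau> q \<in> V"
proof -
  assume q: "q \<in> U"
  have "subst \<tau> (\<Sum>m\<in>Poly_Mapping.keys q. Poly_Mapping.single m (Poly_Mapping.lookup q m)) \<in> V"
    unfolding subst_sum
  proof (rule V_sum)
    fix m assume "m \<in> Poly_Mapping.keys q"
    then have m: "Poly_Mapping.keys m \<subseteq> X" "zdeg m \<le> 1" using q by (auto simp: U_def mem_polys)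
    obtain a b where ab: "m = a + b" "Poly_Mapping.keys a \<subseteq> XA" "Poly_Mapping.keys b \<subseteq> Poly_Mapping.keys m - XA"
      "\<forall>y. Poly_Mapping.lookup b y \<le> Poly_Mapping.lookup m y" using monom_split[of m XA] by blast
    have "zdeg b \<le> zdeg m" unfolding zdeg_def using ab(4) by (intro sum_mono) simp
    then have "zdeg b \<le> 1" "Poly_Mapping.keys b \<subseteq> X - XA" using ab(3) m by auto
    then have "Some b \<in> B" unfolding B_def by blast
    moreover have "Poly_Mapping.single a (Poly_Mapping.lookup q m) \<in> polys XA" using ab(2) by auto
    ultimately have "subst \<tau> (Poly_Mapping.single a (Poly_Mapping.lookup q m)) * v (Some b) \<in> V" by (intro V_gen)
    moreover have "Poly_Mapping.single m (Poly_Mapping.lookup q m) = Poly_Mapping.single a (Poly_Mapping.lookup q m) * monom b"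
      unfolding mult_single mult_1_right ab(1)[symmetric] ..
    ultimately show "subst \<tau> (Poly_Mapping.single m (Poly_Mapping.lookup q m)) \<in> V"
      by (simp only: subst_mult v_def option.case)
  qed
  then show ?thesis by (simp only: monom_expansion[symmetric])
qed

text \<open>A multiple r * \<Delta> modulo J depends only on r modulo \<open>W\<close>. The
  parameter ring maps onto R/(W), so r can be replaced by an element of it.\<close>

lemma V_\<Delta>: "r \<in> polys X \<Longrightarrow> \<Delta> * r \<in> V"
proof -
  assume r: "r \<in> polys X"
  have "\<exists>p \<in> polys XA. subst \<omega> r = subst \<omega> (subst \<tau> p)"
    using r
  proof (induction r rule: polys_induct)
    case (const c)
    show ?case by (rule bexI[of _ "const_poly c"]) simp_all
  next
    case (var x)
    have zi: "z i \<in> polys XA" if "i = 1" for i using that by (intro polys_closed(8)) (simp add: XA_def)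
    have \<omega>W: "\<omega> x = 0" if "x \<in> W" for x using that by (simp add: \<omega>_def)
    have notW: "\<omega> (i, 1) = mvar (i, 1)" "\<omega> (i, N) = mvar (i, N)" for i
    proof -
      have "(i, 1) \<notin> W" "(i, N) \<notin> W" using N unfolding W_def mem_Times_iff by auto
      then show "\<omega> (i, 1) = mvar (i, 1)" "\<omega> (i, N) = mvar (i, N)" by (simp_all add: \<omega>_def)
    qed
    consider "x \<in> W" | "x = (1, 1)" | "x = (2, 1)" | "x = (1, N)" | "x = (2, N)"
      using var N by (fastforce simp: W_def edge_vars_def)
    then show ?case
    proof cases
      case 1
      then show ?thesis by (intro bexI[of _ 0]) (simp_all add: \<omega>W)
    next
      case 2
      then show ?thesis by (intro bexI[of _ "z 1"] zi) (simp_all add: \<tau>_def)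
    next
      case 3
      have "(1, Suc 1) \<in> W" using N by (simp add: W_def)
      then have "subst \<omega> (subst \<tau> (t 1)) = subst \<omega> (mvar x)"
        using N unfolding 3 by (simp add: \<tau>_def subst_diff \<omega>W[of "(1, 2)", simplified] \<omega>_def numeral_2_eq_2)
      then show ?thesis by (intro bexI[of _ "t 1"]) (simp, simp add: XA_def)
    next
      case 4
      \<comment> \<open>The parameter t_(N-1) - z_N becomes - z_N, since t_(N-1) belongs to
        \<open>W\<close>; this explains the sign of the witness.\<close>
      have "(2, N - 1) \<in> W" "N - 1 < N" "Suc (N - 1) = N" using N by (auto simp: W_def)
      then have "subst \<omega> (subst \<tau> (- t (N - 1))) = subst \<omega> (mvar x)"
        unfolding 4 by (simp add: \<tau>_def subst_diff subst_uminus \<omega>W notW)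
      then show ?thesis by (intro bexI[of _ "- t (N - 1)"]) (simp, simp add: XA_def)
    next
      case 5
      then show ?thesis by (intro bexI[of _ "t N"]) (simp_all add: \<tau>_def XA_def)
    qed
  next
    case (add p q)
    then obtain p' q' where "p' \<in> polys XA" "subst \<omega> p = subst \<omega> (subst \<tau> p')"
      "q' \<in> polys XA" "subst \<omega> q = subst \<omega> (subst \<tau> q')" by blast
    then show ?case by (intro bexI[of _ "p' + q'"]) (simp_all add: subst_add)
  next
    case (mult p q)
    then obtain p' q' where "p' \<in> polys XA" "subst \<omega> p = subst \<omega> (subst \<tau> p')"
      "q' \<in> polys XA" "subst \<omega> q = subst \<omega> (subst \<tau> q')" by blast
    then show ?case by (intro bexI[of _ "p' * q'"]) (simp_all add: subst_mult)
  qed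
  then obtain p where p: "p \<in> polys XA" "subst \<omega> r = subst \<omega> (subst \<tau> p)" by blast
  have "r - subst \<tau> p \<in> polys X" using r subst_\<tau>_closed[OF polys_mono[OF XA_subset p(1)]] by auto
  then have "(r - subst \<tau> p) * \<Delta> \<in> J" by (rule \<omega>_kernel) (simp add: subst_diff p(2))
  then have "(r - subst \<tau> p) * \<Delta> + subst \<tau> p * v None \<in> V"
    using p(1) by (intro V_add V_J V_gen) (simp_all add: B_def)
  then show ?thesis by (simp add: v_def algebra_simps)
qed

text \<open>The ideal J + (\<Delta>) of all 2-minors, which defines the matrices of rank at most
  one.\<close>

definition IK :: "(nat \<times> nat, 'k) mpoly set" where
  "IK = R.ext_ideal J (\<lambda>_. \<Delta>) 1"

lemma IK_ideal: "ideal IK R"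
  unfolding IK_def by (rule R.ext_ideal_ideal[OF J_ideal \<Delta>_closed])

lemma IK_V: "x \<in> IK \<Longrightarrow> x \<in> V"
proof -
  assume "x \<in> IK"
  then obtain u r where ur: "x = u + \<Delta> * r" "u \<in> J" "r \<in> polys X" unfolding IK_def by auto
  show ?thesis unfolding ur(1) by (rule V_add[OF V_J[OF ur(2)] V_\<Delta>[OF ur(3)]])
qed

lemma minor_IK: "i \<in> {1..N} \<Longrightarrow> j \<in> {1..N} \<Longrightarrow> minor i j \<in> IK"
proof -
  assume ij: "i \<in> {1..N}" "j \<in> {1..N}"
  have "\<Delta> \<in> IK" unfolding IK_def by (rule R.ext_ideal_generator[OF J_ideal \<Delta>_closed]) simp
  moreover have "J \<subseteq> IK" unfolding IK_def using R.ext_ideal_mono[of 0 1 J "\<lambda>_. \<Delta>"] by simp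
  moreover have "minor i j = \<Delta> \<or> minor i j = - \<Delta>" if "{i, j} = {1, N}"
    using that minor_swap[of N 1] by (auto simp: doubleton_eq_iff)
  ultimately show ?thesis using ij minor_in_J R.ideal_uminus[OF IK_ideal] by (cases "{i, j} = {1, N}") auto
qed

definition V' :: "(nat \<times> nat, 'k) mpoly set" where
  "V' = {x. \<exists>q\<in>U. x - subst \<tau> q \<in> IK}"

lemma V'_U: "q \<in> U \<Longrightarrow> subst \<tau> q \<in> V'"
  unfolding V'_def using R.ideal_zero[OF IK_ideal] by force

lemma V'_IK: "x \<in> IK \<Longrightarrow> x \<in> V'"
  unfolding V'_def by (auto intro!: bexI[of _ 0] simp: U_def)

lemma V'_add: "x \<in> V' \<Longrightarrow> y \<in> V' \<Longrightarrow> x + y \<in> V'"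
proof -
  assume "x \<in> V'" "y \<in> V'"
  then obtain p q where pq: "p \<in> U" "x - subst \<tau> p \<in> IK" "q \<in> U" "y - subst \<tau> q \<in> IK" unfolding V'_def by blast
  have eq: "x + y - subst \<tau> (p + q) = (x - subst \<tau> p) + (y - subst \<tau> q)" by (simp add: subst_add)
  have "x + y - subst \<tau> (p + q) \<in> IK" unfolding eq by (rule R.ideal_add[OF IK_ideal pq(2,4)])
  then show ?thesis unfolding V'_def using U_add[OF pq(1,3)] by blast
qed

lemma V'_sum: "(\<And>i. i \<in> S \<Longrightarrow> f i \<in> V') \<Longrightarrow> sum f S \<in> V'"
  by (induction S rule: infinite_finite_induct) (auto intro: V'_add V'_IK R.ideal_zero[OF IK_ideal])

lemma V'_mult_parameters:
  assumes p: "p \<in> polys (X - Zs)" and x: "x \<in> V'"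
  shows "subst \<tau> p * x \<in> V'"
proof -
  obtain q where q: "q \<in> U" "x - subst \<tau> q \<in> IK" using x unfolding V'_def by blast
  have "subst \<tau> p \<in> polys X" by (rule subst_\<tau>_closed[OF polys_mono[OF _ p]]) auto
  then have "subst \<tau> p * (x - subst \<tau> q) \<in> IK" using q(2) by (rule R.ideal_mult[OF IK_ideal])
  then have "subst \<tau> p * x - subst \<tau> (p * q) \<in> IK" by (simp add: subst_mult algebra_simps)
  then show ?thesis unfolding V'_def using U_mult[OF p q(1)] by blast
qed

text \<open>With t_k = D_k + z_(k+1), the minor of columns i and j gives z_(i+1) z_j = z_i z_(j+1) +
  z_i D_j - z_j D_i modulo all minors. The two indices move apart until one factor is the parameter
  z_1 or the other is z_(N+1), which is read as 0; this is why j may reach N + 1.\<close>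

lemma V'_quadratic:
  "1 \<le> i \<Longrightarrow> i \<le> j \<Longrightarrow> j \<le> Suc N \<Longrightarrow> (if i \<le> N then z i else 0) * (if j \<le> N then z j else 0) \<in> V'"
proof (induction i arbitrary: j rule: dec_induct)
  case base
  show ?case
  proof (cases "j \<le> N")
    case True
    have z1: "z 1 \<in> polys (X - Zs)" using N by (intro polys_closed(8)) (auto simp: edge_vars_def Zs_def)
    have "z j \<in> V'"
    proof -
      have "z j \<in> U" unfolding mvar_def
        using True base by (intro U_single) (auto simp: edge_vars_def zdeg_def lookup_single when_def)
      from V'_U[OF this] show ?thesis by (simp add: \<tau>_def)
    qed
    from V'_mult_parameters[OF z1 this] show ?thesis using True N by (simp add: \<tau>_def)
  next
    case False
    then show ?thesis using V'_IK[OF R.ideal_zero[OF IK_ideal]] by simp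
  qed
next
  case (step i)
  show ?case
  proof (cases "j \<le> N")
    case True
    with step have i: "Suc i \<le> N" "1 \<le> i" by auto
    define D where "D k = subst \<tau> (t k)" for k
    have tk: "t k = D k + (if Suc k \<le> N then z (Suc k) else 0)" if "k \<le> N" for k
      using that by (auto simp: D_def \<tau>_def)
    have lin: "z k * D l \<in> V'" if "k \<in> {1..N}" "l \<in> {1..N}" for k l
    proof -
      have "z k \<in> U" unfolding mvar_def
        using that by (intro U_single) (auto simp: edge_vars_def zdeg_def lookup_single when_def)
      then have "subst \<tau> (z k) \<in> V'" by (rule V'_U)
      moreover have "t l \<in> polys (X - Zs)" using that by (intro polys_closed(8)) (auto simp: edge_vars_def Zs_def)
      ultimately have "subst \<tau> (t l) * subst \<tau> (z k) \<in> V'" by (rule V'_mult_parameters[rotated])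
      moreover have "subst \<tau> (z k) = z k" by (simp add: \<tau>_def)
      ultimately show ?thesis by (simp only: D_def mult.commute)
    qed
    have neg: "- x \<in> V'" if "x \<in> V'" for x
      using V'_mult_parameters[OF polys_closed(3)[of "- 1"] that] by (simp add: single_uminus subst_uminus)
    have "z (Suc i) * z j = z i * (if Suc j \<le> N then z (Suc j) else 0) + z i * D j + (- (z j * D i)) + (- minor i j)"
      using tk[of i] tk[of j] i True by (simp add: minor_def algebra_simps)
    also have "\<dots> \<in> V'"
    proof -
      have "z i * (if Suc j \<le> N then z (Suc j) else 0) \<in> V'"
        using step.IH[of "Suc j"] step.prems i True by auto
      moreover have "z i * D j \<in> V'" by (rule lin) (use i True step.prems in auto)
      moreover have "- (z j * D i) \<in> V'" by (rule neg[OF lin]) (use i True step.prems in auto)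
      moreover have "minor i j \<in> IK" using i True step.prems by (intro minor_IK) auto
      then have "- minor i j \<in> V'" by (rule neg[OF V'_IK])
      ultimately show ?thesis using V'_add by blast
    qed
    finally show ?thesis using i True by simp
  next
    case False
    then show ?thesis using V'_IK[OF R.ideal_zero[OF IK_ideal]] by simp
  qed
qed

text \<open>Multiplication by z_i either keeps a monomial at most linear in z_2, ..., z_N or
  produces a product z_i z_j, which the quadratic relations make linear again.\<close>

lemma V'_mult_z:
  assumes i: "i \<in> {2..N}" and x: "x \<in> V'"
  shows "z i * x \<in> V'"
proof -
  obtain q where q: "q \<in> U" "x - subst \<tau> q \<in> IK" using x unfolding V'_def by blast
  have zX: "z j \<in> polys X" if "j \<in> {2..N}" for j using that by (intro polys_closed(8)) (auto simp: edge_vars_def)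
  have "z i * subst \<tau> (\<Sum>m\<in>Poly_Mapping.keys q. Poly_Mapping.single m (Poly_Mapping.lookup q m)) \<in> V'"
    unfolding subst_sum sum_distrib_left
  proof (rule V'_sum)
    fix m assume "m \<in> Poly_Mapping.keys q"
    then have m: "Poly_Mapping.keys m \<subseteq> X" "zdeg m \<le> 1" using q by (auto simp: U_def mem_polys)
    let ?c = "Poly_Mapping.lookup q m"
    show "z i * subst \<tau> (Poly_Mapping.single m ?c) \<in> V'"
    proof (cases "zdeg m = 0")
      case True
      have "zdeg (Poly_Mapping.single (1, i) 1) = 1" using i by (simp add: zdeg_def lookup_single when_def)
      moreover have "Poly_Mapping.keys (Poly_Mapping.single (1, i) 1 + m) \<subseteq> X"
        using m(1) i Poly_Mapping.keys_add[of "Poly_Mapping.single (1, i) 1" m] by (auto simp: edge_vars_def)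
      ultimately have "Poly_Mapping.single (Poly_Mapping.single (1, i) 1 + m) ?c \<in> U"
        using True by (intro U_single) (simp_all add: zdeg_add)
      then have "z i * Poly_Mapping.single m ?c \<in> U" unfolding mvar_def mult_single mult_1_left .
      from V'_U[OF this] show ?thesis by (simp add: subst_mult \<tau>_def)
    next
      case False
      then obtain j where j: "j \<in> {2..N}" "Poly_Mapping.lookup m (1, j) \<noteq> 0"
        unfolding zdeg_def by (meson sum.neutral)
      define m' where "m' = m - Poly_Mapping.single (1, j) 1"
      have mm': "m = m' + Poly_Mapping.single (1, j) 1"
        using j(2) by (intro poly_mapping_eqI) (auto simp: m'_def lookup_add lookup_minus lookup_single when_def)
      have "zdeg (Poly_Mapping.single (1, j) 1) = 1" using j by (simp add: zdeg_def lookup_single when_def)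
      then have "zdeg m' = 0" using m(2) unfolding mm' zdeg_add by simp
      then have "Poly_Mapping.keys m' \<inter> Zs = {}" by (auto simp: zdeg_def Zs_def in_keys_iff)
      moreover have "Poly_Mapping.keys m' \<subseteq> X" using m(1) unfolding mm' by (auto simp: in_keys_iff lookup_add subset_iff)
      ultimately have p: "Poly_Mapping.single m' ?c \<in> polys (X - Zs)" by (intro polys_closed(9)) blast
      have "z i * z j \<in> V'"
      proof (cases "i \<le> j")
        case True
        then show ?thesis using V'_quadratic[of i j] i j by simp
      next
        case False
        then show ?thesis using V'_quadratic[of j i] i j by (simp add: mult.commute)
      qed
      from V'_mult_parameters[OF p this] have "subst \<tau> (Poly_Mapping.single m' ?c) * (z i * z j) \<in> V'" .
      moreover have "Poly_Mapping.single m ?c = Poly_Mapping.single m' ?c * z j"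
        unfolding mvar_def mult_single mult_1_right mm'[symmetric] ..
      ultimately show ?thesis by (simp add: subst_mult \<tau>_def mult_ac)
    qed
  qed
  then have "z i * subst \<tau> q \<in> V'" by (simp only: monom_expansion[symmetric])
  from V'_add[OF this V'_IK[OF R.ideal_mult[OF IK_ideal zX[OF i] q(2)]]]
  have "z i * subst \<tau> q + z i * (x - subst \<tau> q) \<in> V'" .
  then show ?thesis by (simp add: algebra_simps)
qed

text \<open>\<open>V'\<close> contains 1 and is stable under multiplication by every coordinate, so
  it is everything. The remaining error in J + (\<Delta>) is absorbed by the basis element
  \<Delta>.\<close>

lemma basis_span: "r \<in> polys X \<Longrightarrow> \<exists>a \<in> pm_over B (subst \<tau> ` polys XA). r - eval_comb v a \<in> J"
proof -
  assume r: "r \<in> polys X"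
  have "\<forall>x\<in>V'. subst \<tau> p * x \<in> V'" if "p \<in> polys X" for p
    using that
  proof (induction p rule: polys_induct)
    case (const c)
    show ?case using V'_mult_parameters[OF polys_closed(3)] by blast
  next
    case (var y)
    show ?case
    proof (cases "y \<in> Zs")
      case True
      then obtain i where "y = (1, i)" "i \<in> {2..N}" by (auto simp: Zs_def)
      then show ?thesis using V'_mult_z by (simp add: \<tau>_def)
    next
      case False
      then have "mvar y \<in> polys (X - Zs)" using var by (intro polys_closed(8)) simp
      then show ?thesis using V'_mult_parameters by blast
    qed
  next
    case (add p q)
    then show ?case by (auto simp: subst_add distrib_right intro: V'_add)
  next
    case (mult p q)
    then show ?case by (auto simp: subst_mult mult.assoc)
  qed
  moreover have "subst \<tau>' r \<in> polys X" using r \<tau>'_closed by (rule subst_closed)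
  moreover have "1 \<in> V'" using V'_U[of 1] by (simp add: U_def zdeg_def)
  ultimately have "subst \<tau> (subst \<tau>' r) * 1 \<in> V'" by blast
  then have "r \<in> V'" by (simp add: subst_\<tau>_\<tau>')
  then obtain q where "q \<in> U" "r - subst \<tau> q \<in> IK" unfolding V'_def by blast
  then have "subst \<tau> q + (r - subst \<tau> q) \<in> V" by (intro V_add V_U IK_V)
  then have "r \<in> V" by simp
  then show ?thesis unfolding V_def by blast
qed

end

text \<open>Substitutions under which the images of distinct monomials have distinct leading terms
  with respect to the degree in one variable \<open>\<rho>\<close> are injective.\<close>

definition leads :: "'x \<Rightarrow> ('x, 'k::comm_ring_1) mpoly \<Rightarrow> ('x \<Rightarrow>\<^sub>0 nat) \<Rightarrow> bool" where
  "leads \<rho> p m \<longleftrightarrow> (\<forall>k\<in>Poly_Mapping.keys (p - monom m). Poly_Mapping.lookup k \<rho> < Poly_Mapping.lookup m \<rho>)"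

lemma leads_0: "leads \<rho> 1 0"
  by (simp add: leads_def)

lemma leads_mult:
  assumes "leads \<rho> p m" "leads \<rho> q n"
  shows "leads \<rho> (p * q) (m + n)"
  unfolding leads_def
proof
  fix k assume k: "k \<in> Poly_Mapping.keys (p * q - monom (m + n))"
  have mm: "monom (m + n) = monom m * monom n" by (simp add: mult_single)
  define A where "A = (p - monom m) * (q - monom n)"
  define C where "C = (p - monom m) * monom n"
  define D where "D = monom m * (q - monom n)"
  have "p * q - monom (m + n) = A + (C + D)" unfolding mm A_def C_def D_def by (simp add: algebra_simps)
  then have "k \<in> Poly_Mapping.keys (A + (C + D))" using k by (simp only:)
  then consider "k \<in> Poly_Mapping.keys A" | "k \<in> Poly_Mapping.keys C" | "k \<in> Poly_Mapping.keys D"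
    using Poly_Mapping.keys_add[of A "C + D"] Poly_Mapping.keys_add[of C D] by blast
  then consider a b where "k = a + b" "a \<in> Poly_Mapping.keys (p - monom m)" "b \<in> Poly_Mapping.keys (q - monom n)"
    | a where "k = a + n" "a \<in> Poly_Mapping.keys (p - monom m)"
    | b where "k = m + b" "b \<in> Poly_Mapping.keys (q - monom n)"
  proof cases
    case 1
    then show ?thesis unfolding A_def using keys_mult[of "p - monom m" "q - monom n"] that(1) by blast
  next
    case 2
    then have "k \<in> Poly_Mapping.keys (monom n * (p - monom m))" by (simp add: C_def mult.commute)
    then show ?thesis unfolding keys_single_mult using that(2) by (metis add.commute imageE)
  next
    case 3
    then show ?thesis unfolding D_def keys_single_mult using that(3) by blast
  qed
  then show "Poly_Mapping.lookup k \<rho> < Poly_Mapping.lookup (m + n) \<rho>"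
  proof cases
    case 1
    then have "Poly_Mapping.lookup a \<rho> < Poly_Mapping.lookup m \<rho>" "Poly_Mapping.lookup b \<rho> < Poly_Mapping.lookup n \<rho>"
      using assms by (simp_all add: leads_def)
    then show ?thesis by (simp add: 1 lookup_add)
  next
    case 2
    then have "Poly_Mapping.lookup a \<rho> < Poly_Mapping.lookup m \<rho>" using assms by (simp add: leads_def)
    then show ?thesis by (simp add: 2 lookup_add)
  next
    case 3
    then have "Poly_Mapping.lookup b \<rho> < Poly_Mapping.lookup n \<rho>" using assms by (simp add: leads_def)
    then show ?thesis by (simp add: 3 lookup_add)
  qed
qed

lemma leads_power: "leads \<rho> p m \<Longrightarrow> leads \<rho> (p ^ k) (\<Sum>j<k. m)"
proof (induction k)
  case 0
  show ?case using leads_0 by simp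
next
  case (Suc k)
  have "leads \<rho> (p * p ^ k) (m + (\<Sum>j<k. m))" by (rule leads_mult[OF Suc.prems Suc.IH[OF Suc.prems]])
  then show ?case by (simp only: power_Suc sum.lessThan_Suc add.commute)
qed

lemma leads_prod: "finite S \<Longrightarrow> (\<And>i. i \<in> S \<Longrightarrow> leads \<rho> (f i) (m i)) \<Longrightarrow> leads \<rho> (prod f S) (sum m S)"
  by (induction S rule: finite_induct) (simp_all add: leads_0 leads_mult)

lemma lookup_sum_const: "Poly_Mapping.lookup (\<Sum>j<(k::nat). m :: 'x \<Rightarrow>\<^sub>0 nat) y = k * Poly_Mapping.lookup m y"
  by (simp add: lookup_sum)

text \<open>Choose a monomial of q whose image has the highest leading exponent at \<rho>. Its
  leading monomial cannot be cancelled: the other leading monomials differ from it, and all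
  remainders have smaller degree in \<rho>.\<close>

lemma subst_leading_inj:
  fixes q :: "('x, 'k::comm_ring_1) mpoly" and h :: "'x \<Rightarrow> ('y, 'k) mpoly"
  assumes lead: "\<And>m y. m \<in> Poly_Mapping.keys q \<Longrightarrow> y \<in> Poly_Mapping.keys m \<Longrightarrow> leads \<rho> (h y) (l y)"
    and inj: "inj_on (\<lambda>m. \<Sum>y\<in>Poly_Mapping.keys m. \<Sum>j<Poly_Mapping.lookup m y. l y) (Poly_Mapping.keys q)"
    and zero: "subst h q = 0"
  shows "q = 0"
proof (rule ccontr)
  let ?L = "\<lambda>m. \<Sum>y\<in>Poly_Mapping.keys m. \<Sum>j<Poly_Mapping.lookup m y. l y"
  let ?h = "\<lambda>m. \<Prod>y\<in>Poly_Mapping.keys m. h y ^ Poly_Mapping.lookup m y"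
  assume "q \<noteq> 0"
  then have ne: "Poly_Mapping.keys q \<noteq> {}" by simp
  define d where "d = Max ((\<lambda>m. Poly_Mapping.lookup (?L m) \<rho>) ` Poly_Mapping.keys q)"
  have "d \<in> (\<lambda>m. Poly_Mapping.lookup (?L m) \<rho>) ` Poly_Mapping.keys q" unfolding d_def using ne by (intro Max_in) auto
  then obtain \<mu> where \<mu>: "\<mu> \<in> Poly_Mapping.keys q" "d = Poly_Mapping.lookup (?L \<mu>) \<rho>" by blast
  have max: "Poly_Mapping.lookup (?L m) \<rho> \<le> d" if "m \<in> Poly_Mapping.keys q" for m
    unfolding d_def using that by (intro Max_ge) auto
  have top: "leads \<rho> (?h m) (?L m)" if "m \<in> Poly_Mapping.keys q" for m
    by (intro leads_prod leads_power lead[OF that]) simp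
  have coeff: "Poly_Mapping.lookup (?h m) (?L \<mu>) = (if m = \<mu> then 1 else 0)" if m: "m \<in> Poly_Mapping.keys q" for m
  proof -
    have "?L \<mu> \<notin> Poly_Mapping.keys (?h m - monom (?L m))" using top[OF m] max[OF m] \<mu>(2) unfolding leads_def by auto
    then have "Poly_Mapping.lookup (?h m) (?L \<mu>) = Poly_Mapping.lookup (monom (?L m) :: ('y, 'k) mpoly) (?L \<mu>)"
      by (simp add: in_keys_iff lookup_minus)
    moreover have "?L m = ?L \<mu> \<longleftrightarrow> m = \<mu>" using inj_on_eq_iff[OF inj m \<mu>(1)] .
    ultimately show ?thesis by (simp only: lookup_single when_def)
  qed
  have "Poly_Mapping.lookup (subst h q) (?L \<mu>) = (\<Sum>m\<in>Poly_Mapping.keys q. Poly_Mapping.lookup q m * Poly_Mapping.lookup (?h m) (?L \<mu>))"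
    unfolding subst_def lookup_sum lookup_const_mult ..
  also have "\<dots> = (\<Sum>m\<in>Poly_Mapping.keys q. if m = \<mu> then Poly_Mapping.lookup q m else 0)"
    by (rule sum.cong[OF refl]) (simp only: coeff, simp)
  also have "\<dots> = Poly_Mapping.lookup q \<mu>" using \<mu>(1) by simp
  finally show False using \<mu>(1) by (simp add: zero in_keys_iff)
qed

section \<open>The basis over four parameters: independence\<close>

context near_complete
begin

text \<open>The solution of Q_i = t_i + z_1 Q_(i+1) with Q_N = t_N. Making the rows z_1 Q_i and Q_i
  proportional gives rank one, and the recursion is chosen so that the coordinates t_i - z_(i+1) are
  sent to plain variables t_i.\<close>

definition Q :: "nat \<Rightarrow> (nat \<times> nat, 'k) mpoly" where
  "Q i = (\<Sum>k=i..N. z 1 ^ (k - i) * t k)"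

text \<open>\<open>\<psi>\<close> parametrises the matrices of rank one; \<open>\<chi>\<close> is its composition with \<open>\<tau>\<close>, on \<open>X\<close>.\<close>

definition \<psi> :: "nat \<times> nat \<Rightarrow> (nat \<times> nat, 'k) mpoly" where
  "\<psi> w = (if fst w = 1 then z 1 * Q (snd w) else Q (snd w))"

definition \<chi> :: "nat \<times> nat \<Rightarrow> (nat \<times> nat, 'k) mpoly" where
  "\<chi> w = (if fst w = 1 then z 1 * Q (snd w) else mvar w)"

text \<open>For z_i this is z_1^(N+1-i) * t_N, the term of z_1 Q_i with the highest power of
  z_1.\<close>

definition lead :: "nat \<times> nat \<Rightarrow> (nat \<times> nat \<Rightarrow>\<^sub>0 nat)" where
  "lead w = (if fst w = 1 then Poly_Mapping.single (1, 1) (N + 1 - snd w) + Poly_Mapping.single (2, N) 1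
     else Poly_Mapping.single w 1)"

lemma Q_step: "j < N \<Longrightarrow> Q j = t j + z 1 * Q (Suc j)"
proof -
  assume j: "j < N"
  have "Q j = t j + (\<Sum>k=Suc j..N. z 1 ^ (k - j) * t k)" unfolding Q_def using j by (subst sum.atLeast_Suc_atMost) simp_all
  also have "(\<Sum>k=Suc j..N. z 1 ^ (k - j) * t k) = z 1 * Q (Suc j)"
    unfolding Q_def sum_distrib_left
  proof (rule sum.cong[OF refl])
    fix k assume "k \<in> {Suc j..N}"
    then have "k - j = Suc (k - Suc j)" by auto
    then show "z 1 ^ (k - j) * t k = z 1 * (z 1 ^ (k - Suc j) * t k)" by (simp add: mult.assoc)
  qed
  finally show ?thesis .
qed

lemma \<psi>_minor: "subst \<psi> (minor i j) = 0"
  by (simp add: minor_def subst_diff subst_mult \<psi>_def)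

lemma \<psi>_J: "p \<in> J \<Longrightarrow> subst \<psi> p = 0"
proof -
  have "J \<subseteq> {p \<in> polys X. subst \<psi> p = 0}"
  proof (rule J_least)
    show "ideal {p \<in> polys X. subst \<psi> p = 0} R"
      by (rule R.idealI') (auto simp: subst_add subst_mult)
  qed (auto simp: \<psi>_minor intro: minor_closed)
  then show "p \<in> J \<Longrightarrow> subst \<psi> p = 0" by blast
qed

lemma \<psi>_\<tau>: "w \<in> X \<Longrightarrow> subst \<psi> (\<tau> w) = \<chi> w"
proof -
  assume "w \<in> X"
  then obtain i where i: "w = (1, i) \<or> w = (2, i)" "1 \<le> i" "i \<le> N" by (auto simp: edge_vars_def)
  have QN: "Q N = t N" by (simp add: Q_def)
  show ?thesis
  proof (cases "w = (2, i) \<and> i < N")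
    case True
    then show ?thesis using Q_step[of i] by (simp add: \<tau>_def \<chi>_def subst_diff \<psi>_def)
  next
    case False
    then have "w = (1, i) \<or> w = (2, N)" using i by auto
    then show ?thesis using QN by (auto simp: \<tau>_def \<chi>_def \<psi>_def)
  qed
qed

lemma \<chi>_leads: "w \<in> X \<Longrightarrow> leads (1, 1) (\<chi> w) (lead w)"
proof -
  assume "w \<in> X"
  then consider i where "w = (1, i)" "1 \<le> i" "i \<le> N" | i where "w = (2, i)" by (auto simp: edge_vars_def)
  then show ?thesis
  proof cases
    case 1
    let ?e = "\<lambda>k. Poly_Mapping.single (1, 1) (Suc (k - i)) + Poly_Mapping.single (2, k) 1 :: nat \<times> nat \<Rightarrow>\<^sub>0 nat"
    have e: "z 1 * (z 1 ^ (k - i) * t k) = monom (?e k)" for k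
    proof -
      have "z 1 * (z 1 ^ (k - i) * t k) = z 1 ^ Suc (k - i) * t k" by (simp add: mult.assoc)
      then show ?thesis unfolding mvar_power by (simp add: mvar_def mult_single)
    qed
    have "{i..N} = insert N {i..<N}" using 1 by auto
    moreover have "\<chi> w = (\<Sum>k=i..N. monom (?e k))"
      unfolding \<chi>_def 1 Q_def fst_conv snd_conv if_P[OF refl] sum_distrib_left e ..
    ultimately have "\<chi> w = (\<Sum>k\<in>insert N {i..<N}. monom (?e k))" by (simp only:)
    also have "\<dots> = monom (?e N) + (\<Sum>k=i..<N. monom (?e k))" by (rule sum.insert) simp_all
    finally have "\<chi> w = monom (?e N) + (\<Sum>k=i..<N. monom (?e k))" .
    moreover have "lead w = ?e N" using 1 by (simp add: lead_def Suc_diff_le)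
    ultimately have eq: "\<chi> w - monom (lead w) = (\<Sum>k=i..<N. monom (?e k))" by simp
    show ?thesis
      unfolding leads_def eq
    proof
      fix m assume "m \<in> Poly_Mapping.keys (\<Sum>k=i..<N. monom (?e k) :: (nat \<times> nat, 'k) mpoly)"
      then obtain k where k: "k \<in> {i..<N}" "m = ?e k"
        using Poly_Mapping.keys_sum[of "\<lambda>k. monom (?e k) :: (nat \<times> nat, 'k) mpoly" "{i..<N}"] by auto
      then show "Poly_Mapping.lookup m (1, 1) < Poly_Mapping.lookup (lead w) (1, 1)"
        unfolding \<open>lead w = ?e N\<close> using 1 diff_less_mono[of k N i] by (simp add: lookup_add lookup_single when_def)
    qed
  next
    case 2
    then show ?thesis by (simp add: leads_def \<chi>_def lead_def mvar_def)
  qed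
qed

definition lead_monom :: "(nat \<times> nat \<Rightarrow>\<^sub>0 nat) \<Rightarrow> (nat \<times> nat \<Rightarrow>\<^sub>0 nat)" where
  "lead_monom m = (\<Sum>w\<in>Poly_Mapping.keys m. \<Sum>j<Poly_Mapping.lookup m w. lead w)"

lemma lookup_lead_monom:
  assumes m: "Poly_Mapping.keys m \<subseteq> X"
  shows "Poly_Mapping.lookup (lead_monom m) (1, 1) = (\<Sum>i=1..N. Poly_Mapping.lookup m (1, i) * (N + 1 - i))"
    and "Poly_Mapping.lookup (lead_monom m) (2, N) = (\<Sum>i=1..N. Poly_Mapping.lookup m (1, i)) + Poly_Mapping.lookup m (2, N)"
    and "1 \<le> k \<Longrightarrow> k < N \<Longrightarrow> Poly_Mapping.lookup (lead_monom m) (2, k) = Poly_Mapping.lookup m (2, k)"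
proof -
  have gen: "Poly_Mapping.lookup (lead_monom m) y = (\<Sum>i=1..N. Poly_Mapping.lookup m (1, i) * Poly_Mapping.lookup (lead (1, i)) y)
      + (\<Sum>i=1..N. Poly_Mapping.lookup m (2, i) * Poly_Mapping.lookup (lead (2, i)) y)" for y
  proof -
    have "Poly_Mapping.lookup (lead_monom m) y = (\<Sum>w\<in>Poly_Mapping.keys m. Poly_Mapping.lookup m w * Poly_Mapping.lookup (lead w) y)"
      unfolding lead_monom_def lookup_sum[of _ "Poly_Mapping.keys m"] lookup_sum_const ..
    also have "\<dots> = (\<Sum>w\<in>X. Poly_Mapping.lookup m w * Poly_Mapping.lookup (lead w) y)"
      using m finite_X by (intro sum.mono_neutral_left) (auto simp: in_keys_iff)
    also have "\<dots> = (\<Sum>a\<in>{1,2}. \<Sum>i=1..N. Poly_Mapping.lookup m (a, i) * Poly_Mapping.lookup (lead (a, i)) y)"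
      unfolding edge_vars_def sum.cartesian_product by (simp add: case_prod_beta')
    finally show ?thesis by simp
  qed
  show "Poly_Mapping.lookup (lead_monom m) (1, 1) = (\<Sum>i=1..N. Poly_Mapping.lookup m (1, i) * (N + 1 - i))"
    unfolding gen by (simp add: lead_def lookup_add lookup_single when_def)
  show "Poly_Mapping.lookup (lead_monom m) (2, N) = (\<Sum>i=1..N. Poly_Mapping.lookup m (1, i)) + Poly_Mapping.lookup m (2, N)"
    unfolding gen using N by (simp add: lead_def lookup_add lookup_single when_def if_distrib cong: if_cong)
  show "Poly_Mapping.lookup (lead_monom m) (2, k) = Poly_Mapping.lookup m (2, k)" if "1 \<le> k" "k < N"
    unfolding gen using that by (simp add: lead_def lookup_add lookup_single when_def if_distrib cong: if_cong)
qed

text \<open>The value i = N + 1 encodes that none of z_2, ..., z_N occurs, so both cases obey the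
  same formula.\<close>

lemma zdeg_le_1:
  assumes "zdeg m \<le> 1"
  obtains i where "2 \<le> i" "i \<le> N + 1" "\<And>j. j \<in> {2..N} \<Longrightarrow> Poly_Mapping.lookup m (1, j) = (if j = i then 1 else 0)"
proof (cases "zdeg m = 0")
  case True
  show ?thesis
  proof (rule that[of "N + 1"])
    show "Poly_Mapping.lookup m (1, j) = (if j = N + 1 then 1 else 0)" if "j \<in> {2..N}" for j
      using True that unfolding zdeg_def by auto
  qed (use N in auto)
next
  case False
  then have "zdeg m = Suc 0" using assms by simp
  then obtain i where "i \<in> {2..N}" "Poly_Mapping.lookup m (1, i) = Suc 0"
    "\<forall>j\<in>{2..N}. i \<noteq> j \<longrightarrow> Poly_Mapping.lookup m (1, j) = 0"
    unfolding zdeg_def sum_eq_Suc0_iff[OF finite_atLeastAtMost] by blast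
  then show ?thesis by (intro that[of i]) auto
qed

text \<open>If the monomial contains z_1 to the power e and the further factor z_i, its leading
  monomial has exponent (N + 1 - i) + N e at z_1. As 2 \<le> i \<le> N + 1, the first summand is
  below N, so division by N recovers i and e. Linearity in z_2, ..., z_N is essential here. The
  exponent of t_N follows by subtraction.\<close>

lemma lead_monom_inj:
  assumes m: "Poly_Mapping.keys m \<subseteq> X" "zdeg m \<le> 1" and m': "Poly_Mapping.keys m' \<subseteq> X" "zdeg m' \<le> 1"
    and eq: "lead_monom m = lead_monom m'"
  shows "m = m'"
proof -
  obtain i where i: "2 \<le> i" "i \<le> N + 1" "\<And>j. j \<in> {2..N} \<Longrightarrow> Poly_Mapping.lookup m (1, j) = (if j = i then 1 else 0)"
    using zdeg_le_1[OF m(2)] by metis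
  obtain i' where i': "2 \<le> i'" "i' \<le> N + 1" "\<And>j. j \<in> {2..N} \<Longrightarrow> Poly_Mapping.lookup m' (1, j) = (if j = i' then 1 else 0)"
    using zdeg_le_1[OF m'(2)] by metis
  have deg: "(\<Sum>j=1..N. Poly_Mapping.lookup k (1, j) * (N + 1 - j)) = (N + 1 - l) + N * Poly_Mapping.lookup k (1, 1)"
    if kl: "2 \<le> l" "l \<le> N + 1" "\<And>j. j \<in> {2..N} \<Longrightarrow> Poly_Mapping.lookup k (1, j) = (if j = l then 1 else 0)" for k l
  proof -
    have "(\<Sum>j=1..N. Poly_Mapping.lookup k (1, j) * (N + 1 - j))
        = Poly_Mapping.lookup k (1, 1) * N + (\<Sum>j=2..N. Poly_Mapping.lookup k (1, j) * (N + 1 - j))"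
      using N by (subst sum.atLeast_Suc_atMost) (simp_all add: numeral_2_eq_2)
    also have "(\<Sum>j=2..N. Poly_Mapping.lookup k (1, j) * (N + 1 - j)) = (\<Sum>j=2..N. if j = l then N + 1 - j else 0)"
      by (rule sum.cong) (simp_all add: kl(3))
    also have "\<dots> = N + 1 - l" using kl(1,2) by auto
    finally show ?thesis by (simp add: mult.commute)
  qed
  have e: "(N + 1 - i) + N * Poly_Mapping.lookup m (1, 1) = (N + 1 - i') + N * Poly_Mapping.lookup m' (1, 1)"
    using lookup_lead_monom(1)[OF m(1)] lookup_lead_monom(1)[OF m'(1)] deg[OF i] deg[OF i'] eq by metis
  have lt: "N + 1 - i < N" "N + 1 - i' < N" using i(1) i'(1) N by auto
  have "N + 1 - i = ((N + 1 - i) + N * Poly_Mapping.lookup m (1, 1)) mod N" using lt by simp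
  also have "\<dots> = N + 1 - i'" unfolding e using lt by simp
  finally have ii: "N + 1 - i = N + 1 - i'" .
  then have "i = i'" using i(2) i'(2) by simp
  moreover have "Poly_Mapping.lookup m (1, 1) = Poly_Mapping.lookup m' (1, 1)" using e ii N by simp
  ultimately have one: "Poly_Mapping.lookup m (1, j) = Poly_Mapping.lookup m' (1, j)" if "j \<in> {1..N}" for j
    using i(3)[of j] i'(3)[of j] that by (cases "j = 1") auto
  have two: "Poly_Mapping.lookup m (2, j) = Poly_Mapping.lookup m' (2, j)" if j: "j \<in> {1..N}" for j
  proof (cases "j = N")
    case True
    have "(\<Sum>j=1..N. Poly_Mapping.lookup m (1, j)) = (\<Sum>j=1..N. Poly_Mapping.lookup m' (1, j))"
      by (rule sum.cong[OF refl one])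
    then show ?thesis using lookup_lead_monom(2)[OF m(1)] lookup_lead_monom(2)[OF m'(1)] eq True by simp
  next
    case False
    then show ?thesis using lookup_lead_monom(3)[OF m(1), of j] lookup_lead_monom(3)[OF m'(1), of j] eq j by simp
  qed
  show ?thesis
  proof (rule poly_mapping_eqI)
    fix w show "Poly_Mapping.lookup m w = Poly_Mapping.lookup m' w"
    proof (cases "w \<in> X")
      case True
      then show ?thesis using one two by (auto simp: edge_vars_def)
    next
      case False
      then have "w \<notin> Poly_Mapping.keys m" "w \<notin> Poly_Mapping.keys m'" using m(1) m'(1) by auto
      then show ?thesis by (simp add: in_keys_iff)
    qed
  qed
qed

lemma \<chi>_inj: "q \<in> U \<Longrightarrow> subst \<chi> q = 0 \<Longrightarrow> q = 0"
proof -
  assume q: "q \<in> U" and zero: "subst \<chi> q = 0"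
  have k: "Poly_Mapping.keys m \<subseteq> X" "zdeg m \<le> 1" if "m \<in> Poly_Mapping.keys q" for m
    using q that by (auto simp: U_def mem_polys)
  have "inj_on lead_monom (Poly_Mapping.keys q)" using lead_monom_inj k by (intro inj_onI) blast
  then show ?thesis
    unfolding lead_monom_def using subst_leading_inj[of q "(1, 1)" \<chi> lead, OF \<chi>_leads _ zero] k by blast
qed

text \<open>Only the term z_1 t_N of \<Delta> contains z_1. Times a monomial of p of highest degree
  in z_1 it gives a monomial that the other term cannot produce.\<close>

lemma \<Delta>_cancel: "p * \<Delta> = 0 \<Longrightarrow> p = 0"
proof (rule ccontr)
  let ?m = "Poly_Mapping.single (1, 1) 1 + Poly_Mapping.single (2, N) 1 :: nat \<times> nat \<Rightarrow>\<^sub>0 nat"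
  let ?m' = "Poly_Mapping.single (1, N) 1 + Poly_Mapping.single (2, 1) 1 :: nat \<times> nat \<Rightarrow>\<^sub>0 nat"
  assume zero: "p * \<Delta> = 0" and "p \<noteq> 0"
  then have ne: "Poly_Mapping.keys p \<noteq> {}" by simp
  let ?d = "Max ((\<lambda>m. Poly_Mapping.lookup m (1, 1)) ` Poly_Mapping.keys p)"
  have "?d \<in> (\<lambda>m. Poly_Mapping.lookup m (1, 1)) ` Poly_Mapping.keys p" using ne by (intro Max_in) auto
  then obtain \<mu> where \<mu>: "\<mu> \<in> Poly_Mapping.keys p" "?d = Poly_Mapping.lookup \<mu> (1, 1)" by blast
  have D: "\<Delta> = monom ?m - monom ?m'" by (simp add: minor_def mvar_def mult_single)
  have "monom ?m * p - monom ?m' * p = 0" using zero unfolding D right_diff_distrib mult.commute[of p] .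
  moreover have "?m + \<mu> \<notin> Poly_Mapping.keys (monom ?m' * p)"
  proof
    assume "?m + \<mu> \<in> Poly_Mapping.keys (monom ?m' * p)"
    then obtain k where k: "k \<in> Poly_Mapping.keys p" "?m + \<mu> = ?m' + k" unfolding keys_single_mult by blast
    have "Poly_Mapping.lookup k (1, 1) \<le> ?d" using k(1) by (intro Max_ge) auto
    moreover have "Poly_Mapping.lookup (?m + \<mu>) (1, 1) = Poly_Mapping.lookup (?m' + k) (1, 1)" using k(2) by (rule arg_cong)
    ultimately show False using \<mu>(2) N by (simp add: lookup_add lookup_single when_def)
  qed
  ultimately have "Poly_Mapping.lookup (monom ?m * p) (?m + \<mu>) = 0" by (simp add: in_keys_iff)
  then show False using \<mu>(1) unfolding lookup_single_mult by (simp add: in_keys_iff)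
qed

text \<open>On the parameters, \<omega> after \<tau> gives z_1, t_1, - z_N and t_N. The map \<eta>
  undoes this by sending z_N to - t_(N-1).\<close>

lemma \<omega>_\<tau>_inj: "p \<in> polys XA \<Longrightarrow> subst \<omega> (subst \<tau> p) = 0 \<Longrightarrow> p = 0"
proof -
  assume p: "p \<in> polys XA" and zero: "subst \<omega> (subst \<tau> p) = 0"
  define \<eta> :: "nat \<times> nat \<Rightarrow> (nat \<times> nat, 'k) mpoly" where "\<eta> w = (if w = (1, N) then - t (N - 1) else mvar w)" for w
  have "subst \<eta> (subst \<omega> (\<tau> w)) = mvar w" if w: "w \<in> XA" for w
  proof -
    consider "w = (1, 1)" | "w = (2, 1)" | "w = (2, N - 1)" | "w = (2, N)" using w unfolding XA_def by blast
    then show ?thesis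
    proof cases
      case 3
      have "(2, N - 1) \<in> W" "(1, N) \<notin> W" "N - 1 < N" "Suc (N - 1) = N" using N by (auto simp: W_def)
      then show ?thesis unfolding 3 by (simp add: \<tau>_def \<omega>_def \<eta>_def subst_diff subst_uminus)
    next
      case 2
      have "(1, Suc 1) \<in> W" "(2, 1) \<notin> W" using N by (auto simp: W_def)
      then show ?thesis using N unfolding 2 by (simp add: \<tau>_def \<omega>_def \<eta>_def subst_diff)
    qed (use N in \<open>auto simp: \<tau>_def \<omega>_def \<eta>_def W_def\<close>)
  qed
  then have "subst \<eta> (subst \<omega> (subst \<tau> p)) = subst mvar p" unfolding subst_subst by (intro subst_cong[OF p])
  then show ?thesis by (simp add: zero subst_mvar_id)
qed

text \<open>The rank-one parametrisation kills both J and \<Delta>, so it isolates the monomial part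
  of the relation and forces it to vanish. What is left is a parameter multiple of \<Delta> in J,
  and \<omega> detects that, since it kills J and fixes \<Delta>.\<close>

lemma basis_indep:
  assumes a: "a \<in> pm_over B (subst \<tau> ` polys XA)" and J: "eval_comb v a \<in> J"
  shows "a = 0"
proof -
  define p where "p b = subst \<tau>' (Poly_Mapping.lookup a b)" for b
  have p: "p b \<in> polys XA" "Poly_Mapping.lookup a b = subst \<tau> (p b)" for b
  proof -
    obtain r where "r \<in> polys XA" "Poly_Mapping.lookup a b = subst \<tau> r" using a unfolding pm_over_def by blast
    then show "p b \<in> polys XA" by (simp add: p_def subst_\<tau>_\<tau>')
  qed (simp add: p_def subst_\<tau>_\<tau>')
  define M where "M = Some -` Poly_Mapping.keys a"
  have fM: "finite M" unfolding M_def by (intro finite_vimageI) simp_all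
  have MB: "Poly_Mapping.keys \<mu> \<subseteq> X - XA" "zdeg \<mu> \<le> 1" if "\<mu> \<in> M" for \<mu>
    using a that by (auto simp: M_def pm_over_def B_def)
  define q where "q = (\<Sum>\<mu>\<in>M. p (Some \<mu>) * monom \<mu>)"
  have eval: "eval_comb v a = Poly_Mapping.lookup a None * \<Delta> + subst \<tau> q"
  proof -
    have sub: "Poly_Mapping.keys a \<subseteq> insert None (Some ` M)"
    proof
      fix b assume "b \<in> Poly_Mapping.keys a"
      then show "b \<in> insert None (Some ` M)" by (cases b) (auto simp: M_def)
    qed
    have "eval_comb v a = (\<Sum>b\<in>insert None (Some ` M). Poly_Mapping.lookup a b * v b)"
      by (rule eval_comb_superset[OF _ sub]) (simp add: fM)
    also have "\<dots> = Poly_Mapping.lookup a None * v None + (\<Sum>\<mu>\<in>M. Poly_Mapping.lookup a (Some \<mu>) * v (Some \<mu>))"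
      using fM by (subst sum.insert) (auto simp: sum.reindex)
    also have "(\<Sum>\<mu>\<in>M. Poly_Mapping.lookup a (Some \<mu>) * v (Some \<mu>)) = subst \<tau> q"
      unfolding q_def subst_sum subst_mult by (simp only: p(2) v_def option.case)
    also have "v None = \<Delta>" by (simp add: v_def)
    finally show ?thesis .
  qed
  have "q \<in> U" unfolding q_def
  proof (rule U_sum)
    fix \<mu> assume "\<mu> \<in> M"
    have "p (Some \<mu>) \<in> polys (X - Zs)" using XA_subset XA_Zs by (intro polys_mono[OF _ p(1)]) auto
    then show "p (Some \<mu>) * monom \<mu> \<in> U" using MB[OF \<open>\<mu> \<in> M\<close>] by (intro U_mult U_single) auto
  qed
  then have qX: "q \<in> polys X" by (simp add: U_def)
  have "subst \<psi> (eval_comb v a) = subst \<psi> (subst \<tau> q)" by (simp add: eval subst_add subst_mult \<psi>_minor)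
  then have "subst (\<lambda>w. subst \<psi> (\<tau> w)) q = 0" using \<psi>_J[OF J] by (simp add: subst_subst)
  then have "subst \<chi> q = 0" using subst_cong[OF qX \<psi>_\<tau>] by simp
  with \<open>q \<in> U\<close> have q0: "q = 0" by (rule \<chi>_inj)
  have "M = {}"
  proof (rule ccontr)
    assume "M \<noteq> {}"
    then obtain \<mu> where \<mu>: "\<mu> \<in> M" by blast
    have "Poly_Mapping.lookup a (Some \<mu>) \<noteq> 0" using \<mu> by (simp add: M_def in_keys_iff)
    then have "p (Some \<mu>) \<noteq> 0" using p(2)[of "Some \<mu>"] by auto
    then obtain \<alpha> where \<alpha>: "\<alpha> \<in> Poly_Mapping.keys (p (Some \<mu>))" by (metis all_not_in_conv keys_eq_empty)
    \<comment> \<open>Basis monomials avoid the variables in \<open>XA\<close> and coefficients use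
      only those, so a product determines both factors. Hence products belonging to different basis
      monomials share no monomial.\<close>
    have other: "Poly_Mapping.lookup (p (Some \<nu>) * monom \<nu>) (\<mu> + \<alpha>) = 0" if \<nu>: "\<nu> \<in> M - {\<mu>}" for \<nu>
    proof (rule ccontr)
      assume "Poly_Mapping.lookup (p (Some \<nu>) * monom \<nu>) (\<mu> + \<alpha>) \<noteq> 0"
      then have "\<mu> + \<alpha> \<in> Poly_Mapping.keys (monom \<nu> * p (Some \<nu>))" by (simp add: in_keys_iff mult.commute)
      then obtain \<beta> where \<beta>: "\<beta> \<in> Poly_Mapping.keys (p (Some \<nu>))" "\<mu> + \<alpha> = \<nu> + \<beta>" unfolding keys_single_mult by blast
      have sub: "Poly_Mapping.keys \<alpha> \<subseteq> XA" "Poly_Mapping.keys \<beta> \<subseteq> XA" using p(1) \<alpha> \<beta>(1) unfolding mem_polys by blast+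
      have disj: "Poly_Mapping.keys \<mu> \<inter> XA = {}" "Poly_Mapping.keys \<nu> \<inter> XA = {}" using MB \<mu> \<nu> by blast+
      have eq: "Poly_Mapping.lookup \<mu> y + Poly_Mapping.lookup \<alpha> y = Poly_Mapping.lookup \<nu> y + Poly_Mapping.lookup \<beta> y" for y
        unfolding lookup_add[symmetric] \<beta>(2) ..
      have "Poly_Mapping.lookup \<mu> y = Poly_Mapping.lookup \<nu> y" for y
      proof (cases "y \<in> XA")
        case True
        then have "y \<notin> Poly_Mapping.keys \<mu>" "y \<notin> Poly_Mapping.keys \<nu>" using disj by blast+
        then show ?thesis by (simp add: in_keys_iff)
      next
        case False
        then have "y \<notin> Poly_Mapping.keys \<alpha>" "y \<notin> Poly_Mapping.keys \<beta>" using sub by blast+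
        then show ?thesis using eq[of y] by (simp add: in_keys_iff)
      qed
      then have "\<mu> = \<nu>" by (rule poly_mapping_eqI)
      with \<nu> show False by simp
    qed
    have "Poly_Mapping.lookup q (\<mu> + \<alpha>) = Poly_Mapping.lookup (p (Some \<mu>) * monom \<mu>) (\<mu> + \<alpha>)"
      unfolding q_def lookup_sum using sum.remove[OF fM \<mu>, of "\<lambda>\<nu>. Poly_Mapping.lookup (p (Some \<nu>) * monom \<nu>) (\<mu> + \<alpha>)"] other
      by simp
    also have "\<dots> = Poly_Mapping.lookup (p (Some \<mu>)) \<alpha>" unfolding mult.commute[of "p (Some \<mu>)"] by (rule lookup_single_mult)
    finally show False using \<alpha> q0 by (simp add: in_keys_iff)
  qed
  have "subst \<tau> (p None) * \<Delta> \<in> J" using J unfolding eval q0 p(2) by simp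
  from \<omega>_J[OF this] have "subst \<omega> (subst \<tau> (p None)) * \<Delta> = 0" unfolding subst_mult \<omega>_\<Delta> .
  then have "p None = 0" by (rule \<omega>_\<tau>_inj[OF p(1) \<Delta>_cancel])
  show ?thesis
  proof (rule poly_mapping_eqI)
    fix b show "Poly_Mapping.lookup a b = Poly_Mapping.lookup 0 b"
    proof (cases b)
      case None
      then show ?thesis using p(2)[of None] \<open>p None = 0\<close> by simp
    next
      case (Some \<mu>)
      then have "b \<notin> Poly_Mapping.keys a" using \<open>M = {}\<close> by (auto simp: M_def)
      then show ?thesis by (simp add: in_keys_iff)
    qed
  qed
qed

lemma free_over_parameters: "free_over_parameters X XA \<tau> \<tau>' J B v"
proof (rule free_over_parameters.intro)
  show "finite X" by (rule finite_X)
  show "XA \<subseteq> X" by (rule XA_subset)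
  show "\<tau> x \<in> polys X" "\<tau>' x \<in> polys X" if "x \<in> X" for x using \<tau>_closed[OF that] \<tau>'_closed[OF that] by blast+
  show "subst \<tau> (\<tau>' x) = mvar x" "subst \<tau>' (\<tau> x) = mvar x" for x by (rule \<tau>_inverse)+
  show "ideal J R" by (rule J_ideal)
  show "v b \<in> polys X" if "b \<in> B" for b by (rule v_closed[OF that])
  show "\<exists>a\<in>pm_over B (subst \<tau> ` polys XA). r - eval_comb v a \<in> J" if "r \<in> polys X" for r by (rule basis_span[OF that])
  show "a = 0" if "a \<in> pm_over B (subst \<tau> ` polys XA)" "eval_comb v a \<in> J" for a by (rule basis_indep[OF that])
qed

lemma projective_dimension: "projective_dimension R (quotient_module R J) = enat (2 * N - 4)"
proof (rule antisym[OF _ projective_dimension_lower])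
  \<comment> \<open>An injection of the basis into the ring: monomials stand for themselves, and 0
    is free to code \<Delta> because no monomial is zero.\<close>
  let ?enc = "\<lambda>b. case b of None \<Rightarrow> 0 :: (nat \<times> nat, 'k) mpoly | Some \<mu> \<Rightarrow> monom \<mu>"
  have "monom \<mu> = (monom \<nu> :: (nat \<times> nat, 'k) mpoly) \<Longrightarrow> \<mu> = \<nu>" for \<mu> \<nu>
    by (metis lookup_single_eq lookup_single_not_eq zero_neq_one)
  moreover have "monom \<mu> \<noteq> (0 :: (nat \<times> nat, 'k) mpoly)" for \<mu> by (metis lookup_single_eq lookup_zero zero_neq_one)
  ultimately have "inj_on ?enc B" by (auto simp: inj_on_def B_def split: option.splits)
  moreover have "card (X - XA) = 2 * N - 4"
    using card_X card_XA XA_subset finite_X by (simp add: card_Diff_subset finite_subset)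
  ultimately show "projective_dimension R (quotient_module R J) \<le> enat (2 * N - 4)"
    using free_over_parameters.projective_dimension_le[OF free_over_parameters, of ?enc] by simp
qed

end

section \<open>The value of the depth\<close>

context typeclass_ring
begin

lemma ext_ideal_cong: "(\<And>i. i < j \<Longrightarrow> f i = g i) \<Longrightarrow> ext_ideal J f j = ext_ideal J g j"
  by (induction j) simp_all

lemma ext_ideal_least:
  assumes "ideal I R" "J \<subseteq> I" "\<And>i. i < j \<Longrightarrow> f i \<in> I"
  shows "ext_ideal J f j \<subseteq> I"
  using assms(3)
proof (induction j)
  case (Suc j)
  then have "ext_ideal J f j \<subseteq> I" "f j \<in> I" by auto
  then show ?case
    unfolding ext_ideal.simps using ideal_add[OF assms(1)] ideal_mult[OF assms(1)] by (auto simp: mult.commute)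
qed (use assms(2) in simp)

end

context near_complete
begin

lemma positive_order_ideal: "ideal (polys X \<inter> order_ge 1) R"
  by (rule R.idealI') (auto intro: order_ge_add order_ge_mult1)

lemma mvar_maximal: "w \<in> X \<Longrightarrow> (mvar w :: (nat \<times> nat, 'k) mpoly) \<in> homogeneous_maximal_ideal X"
proof -
  have "mvar ` X \<subseteq> polys X" by auto
  from R.genideal_self[OF this] show "w \<in> X \<Longrightarrow> (mvar w :: (nat \<times> nat, 'k) mpoly) \<in> homogeneous_maximal_ideal X"
    unfolding homogeneous_maximal_ideal_def by blast
qed

lemma \<tau>_maximal: "w \<in> X \<Longrightarrow> \<tau> w \<in> homogeneous_maximal_ideal X"
proof -
  assume w: "w \<in> X"
  have I: "ideal (homogeneous_maximal_ideal X) R"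
    unfolding homogeneous_maximal_ideal_def by (rule R.genideal_ideal) auto
  show ?thesis
  proof (cases "fst w = 2 \<and> snd w < N")
    case True
    then have "(1, Suc (snd w)) \<in> X" by (auto simp: edge_vars_def)
    then have "mvar w - z (Suc (snd w)) \<in> homogeneous_maximal_ideal X"
      by (intro R.ideal_diff[OF I] mvar_maximal w)
    with True show ?thesis by (simp add: \<tau>_def)
  next
    case False
    then have "\<tau> w = mvar w" by (auto simp: \<tau>_def)
    with mvar_maximal[OF w] show ?thesis by simp
  qed
qed

lemma regular_parameters:
  obtains fs where "set fs \<subseteq> homogeneous_maximal_ideal X" "regular_sequence R (quotient_module R J) fs" "length fs = 4"
proof -
  define l :: "(nat \<times> nat) list" where "l = [(1, 1), (2, 1), (2, N - 1), (2, N)]"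
  define fs where "fs = map (\<lambda>w. subst \<tau> (mvar w)) l"
  have l: "distinct l" "set l \<subseteq> XA" "length l = 4" using N by (auto simp: l_def XA_def)
  have fs: "set fs \<subseteq> homogeneous_maximal_ideal X" using \<tau>_maximal l(2) XA_subset by (auto simp: fs_def)
  have max: "set fs \<subseteq> polys X \<inter> order_ge 1" using fs max_order by blast
  then have fsX: "set fs \<subseteq> polys X" by blast
  interpret P: free_over_parameters X XA \<tau> \<tau>' J B v by (rule free_over_parameters)
  have ext: "R.ext_ideal J ((!) fs) i = R.ext_ideal J (\<lambda>i. subst \<tau> (mvar (l ! i))) i" if "i \<le> length l" for i
    using that by (intro R.ext_ideal_cong) (simp add: fs_def)
  have "R.ext_ideal J ((!) fs) (length fs) \<subseteq> polys X \<inter> order_ge 1"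
  proof (rule R.ext_ideal_least[OF positive_order_ideal])
    show "J \<subseteq> polys X \<inter> order_ge 1" using J_order R.ideal_carrier[OF J_ideal] by blast
  qed (use max nth_mem in blast)
  then have one: "1 \<notin> R.ext_ideal J ((!) fs) (length fs)" using one_notin_order_ge by blast
  have "x \<in> R.ext_ideal J ((!) fs) i" if i: "i < length fs" and x: "x \<in> polys X" "fs ! i * x \<in> R.ext_ideal J ((!) fs) i" for i x
  proof -
    have il: "i < length l" using i by (simp add: fs_def)
    then have e: "R.ext_ideal J ((!) fs) i = R.ext_ideal J (\<lambda>i. subst \<tau> (mvar (l ! i))) i" by (intro ext) simp
    have "fs ! i = subst \<tau> (mvar (l ! i))" using il by (simp add: fs_def)
    then show ?thesis using P.parameters_regular[OF l(1,2) il x(1)] x(2) unfolding e by simp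
  qed
  then have "regular_sequence R (quotient_module R J) fs"
    unfolding R.regular_sequence_quotient[OF J_ideal fsX] using one by blast
  with fs show ?thesis using l(3) by (intro that[of fs]) (simp_all add: fs_def)
qed

lemma depth: "depth R (homogeneous_maximal_ideal X) (quotient_module R J) = 4"
proof -
  let ?m = "homogeneous_maximal_ideal X :: (nat \<times> nat, 'k) mpoly set"
  have m: "?m \<subseteq> polys X" using max_order by blast
  have "Idl\<^bsub>R\<^esub> (?m \<union> J) \<subseteq> polys X \<inter> order_ge 1"
  proof (rule R.genideal_minimal[OF positive_order_ideal])
    show "?m \<union> J \<subseteq> polys X \<inter> order_ge 1" using J_order R.ideal_carrier[OF J_ideal] max_order by blast
  qed
  then have "1 \<notin> Idl\<^bsub>R\<^esub> (?m \<union> J)" using one_notin_order_ge by blast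
  then have ne: "set_smult R ?m (quotient_module R J) \<noteq> carrier (quotient_module R J)"
    using R.set_smult_eq_carrier[OF J_ideal m] by simp
  let ?S = "{fs. set fs \<subseteq> ?m \<and> regular_sequence R (quotient_module R J) fs}"
  have "(SUP fs \<in> ?S. enat (length fs)) = enat 4"
  proof (rule antisym)
    show "(SUP fs \<in> ?S. enat (length fs)) \<le> enat 4" 
    proof (rule SUP_least)
      fix fs assume "fs \<in> ?S"
      then have "length fs \<le> 4" using depth_upper by blast
      then show "enat (length fs) \<le> enat 4" by simp
    qed
    obtain fs where fs: "set fs \<subseteq> ?m" "regular_sequence R (quotient_module R J) fs" "length fs = 4"
      by (rule regular_parameters)
    then have "fs \<in> ?S" by blast
    then show "enat 4 \<le> (SUP fs \<in> ?S. enat (length fs))" by (rule SUP_upper2) (simp only: fs(3) order_refl)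
  qed
  then show ?thesis using ne by (simp add: depth_def numeral_eq_enat)
qed

section \<open>Arithmetical rank\<close>

text \<open>The columns in the order 2, ..., N - 1, 1, N. The value 1 outside the positions 1, ...,
  N is a default that keeps \<open>column_range\<close> unconditional.\<close>

definition column :: "nat \<Rightarrow> nat" where
  "column k = (if 1 \<le> k \<and> k < N - 1 then k + 1 else if k = N then N else 1)"

lemma column_range: "column k \<in> {1..N}"
  using N by (auto simp: column_def)

lemma column_N: "column N = N" and column_pred: "column (N - 1) = 1"
proof -
  have "\<not> (1 \<le> N \<and> N < N - 1)" by linarith
  then show "column N = N" unfolding column_def by (simp only: if_False simp_thms if_True)
  have n: "\<not> (1 \<le> N - 1 \<and> N - 1 < N - 1)" "N - 1 \<noteq> N" using N by linarith+
  show "column (N - 1) = 1" unfolding column_def if_not_P[OF n(1)] if_not_P[OF n(2)] ..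
qed

lemma column_eq: "column k = 1 \<Longrightarrow> column l = N \<Longrightarrow> 1 \<le> k \<Longrightarrow> k \<le> N \<Longrightarrow> k = N - 1 \<and> l = N"
proof -
  assume a: "column k = 1" "column l = N" "1 \<le> k" "k \<le> N"
  have "\<not> k < N - 1"
  proof
    assume "k < N - 1"
    then have "column k = k + 1" using a(3) by (simp add: column_def)
    then show False using a(1,3) by simp
  qed
  moreover have "k \<noteq> N" using a(1) column_N N by auto
  moreover have "l = N"
  proof (rule ccontr)
    assume "l \<noteq> N"
    then have "column l = (if 1 \<le> l \<and> l < N - 1 then l + 1 else 1)" by (simp add: column_def)
    then show False using a(2) N by (simp split: if_splits)
  qed
  ultimately show "k = N - 1 \<and> l = N" using a(4) by linarith
qed

lemma column_surj: "i \<in> {1..N} \<Longrightarrow> \<exists>k\<in>{1..N}. column k = i"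
proof -
  assume i: "i \<in> {1..N}"
  consider "i = 1" | "i = N" | "2 \<le> i" "i \<le> N - 1" using i by fastforce
  then show ?thesis
  proof cases
    case 1
    then show ?thesis using N by (intro bexI[of _ "N - 1"]) (auto simp: column_def)
  next
    case 2
    then show ?thesis using N by (intro bexI[of _ N]) (auto simp: column_def)
  next
    case 3
    then show ?thesis using N by (intro bexI[of _ "i - 1"]) (auto simp: column_def)
  qed
qed

text \<open>The \<open>2 N - 4\<close> sums of the minors of columns \<open>k\<close> and \<open>r - k\<close>, in an order of the columns in
  which the missing edge joins the last two of them and thus contributes only to \<open>r = 2 N - 1\<close>.\<close>

lemma arithmetical_rank_le: "arithmetical_rank R J \<le> enat (2 * N - 4)"
proof -
  define S where "S r = {k. 1 \<le> k \<and> k < r - k \<and> r - k \<le> N}" for r :: nat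
  define f where "f r = (\<Sum>k\<in>S r. minor (column k) (column (r - k)))" for r
  \<comment> \<open>The smallest sum of two positions is 1 + 2, and 2 N - 1 = (N - 1) + N is reached
    only by the missing edge. This leaves 3, ..., 2 N - 2, that is 2 N - 4 values.\<close>
  define fs where "fs = map f [3..<2 * N - 1]"
  have S: "finite (S r)" for r by (rule finite_subset[of _ "{..r}"]) (auto simp: S_def)
  have fJ: "f r \<in> J" if r: "r \<le> 2 * N - 2" for r
    unfolding f_def
  proof (rule R.ideal_sum[OF J_ideal])
    fix k assume k: "k \<in> S r"
    have "{column k, column (r - k)} \<noteq> {1, N}"
    proof
      assume "{column k, column (r - k)} = {1, N}"
      then consider "column k = 1" "column (r - k) = N" | "column (r - k) = 1" "column k = N"
        by (auto simp: doubleton_eq_iff)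
      then show False
      proof cases
        case 1
        have "k = N - 1 \<and> r - k = N" by (rule column_eq[OF 1]) (use k in \<open>auto simp: S_def\<close>)
        then show False using r N by linarith
      next
        case 2
        have "r - k = N - 1 \<and> k = N" by (rule column_eq[OF 2]) (use k in \<open>auto simp: S_def\<close>)
        then show False using k N by (auto simp: S_def)
      qed
    qed
    then show "minor (column k) (column (r - k)) \<in> J" by (intro minor_in_J column_range)
  qed
  have fs: "set fs \<subseteq> J" using fJ by (auto simp: fs_def)
  then have fsX: "set fs \<subseteq> polys X" using R.ideal_carrier[OF J_ideal] by blast
  let ?I = "Idl\<^bsub>R\<^esub> (set fs)"
  have I: "ideal ?I R" by (rule R.genideal_ideal[OF fsX])
  have IJ: "?I \<subseteq> J" by (rule R.genideal_minimal[OF J_ideal fs])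
  have in_rad: "minor (column k) (column l) \<in> radical R ?I" if kl: "1 \<le> k" "k < l" "l \<le> N" "k + l \<le> 2 * N - 2" for k l
    unfolding minor_def
  proof (rule R.minors_in_radical[where S = S and N = N and t = "2 * N - 2" and a = "\<lambda>k. z (column k)" and b = "\<lambda>k. t (column k)", OF _ _ I S _ _ kl])
    show "z (column i) \<in> polys X" "t (column i) \<in> polys X" for i
      using column_range[of i] by (auto simp: edge_vars_def)
    show "k \<in> S r \<longleftrightarrow> 1 \<le> k \<and> k < r - k \<and> r - k \<le> N" for r k by (simp add: S_def)
    fix r assume "3 \<le> r" "r \<le> 2 * N - 2"
    then have "f r \<in> set fs" using N by (auto simp: fs_def)
    then have "f r \<in> ?I" using R.genideal_self[OF fsX] by blast
    then show "(\<Sum>k\<in>S r. z (column k) * t (column (r - k)) - z (column (r - k)) * t (column k)) \<in> ?I"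
      by (simp add: f_def minor_def)
  qed
  have Jrad: "J \<subseteq> radical R ?I"
  proof (rule J_least[OF R.radical_ideal[OF I]])
    fix i j :: nat assume ij: "i < j" "1 \<le> i" "j \<le> N" "(i, j) \<noteq> (1, N)"
    obtain k where k: "k \<in> {1..N}" "column k = i" using column_surj[of i] ij by auto
    obtain l where l: "l \<in> {1..N}" "column l = j" using column_surj[of j] ij by auto
    have kl: "k \<noteq> l" using k l ij by auto
    have sum: "k + l \<le> 2 * N - 2"
    proof (rule ccontr)
      assume "\<not> k + l \<le> 2 * N - 2"
      then have "(k = N - 1 \<and> l = N) \<or> (k = N \<and> l = N - 1)" using k l kl by auto
      then have "(i = 1 \<and> j = N) \<or> (i = N \<and> j = 1)" using k(2) l(2) column_N column_pred by metis
      then show False using ij N by auto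
    qed
    show "minor i j \<in> radical R ?I"
    proof (cases "k < l")
      case True
      then show ?thesis using in_rad[of k l] k l sum by simp
    next
      case False
      then have "minor j i \<in> radical R ?I" using in_rad[of l k] k l sum kl by (simp add: add.commute)
      then show ?thesis using R.ideal_uminus[OF R.radical_ideal[OF I]] minor_swap[of i j] by simp
    qed
  qed
  have "radical R J = radical R ?I"
  proof
    show "radical R J \<subseteq> radical R ?I"
    proof
      fix x assume "x \<in> radical R J"
      then obtain k where "x \<in> polys X" "x ^ k \<in> J" unfolding R.radical_iff by blast
      with Jrad show "x \<in> radical R ?I" using R.radical_power by blast
    qed
    show "radical R ?I \<subseteq> radical R J" using IJ unfolding R.radical_iff subset_iff by blast
  qed
  then have "arithmetical_rank R J \<le> enat (length fs)"
    unfolding arithmetical_rank_def using fs by (intro INF_lower) simp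
  then show ?thesis by (simp add: fs_def)
qed

text \<open>Setting the first and last columns to the unit vectors turns \<open>\<Delta>\<close> into \<open>1\<close>, so that
  generators of \<open>J\<close> up to radical become generators of an ideal containing powers of all
  remaining variables.\<close>

lemma arithmetical_rank_ge: "enat (2 * N - 4) \<le> arithmetical_rank R J"
  unfolding arithmetical_rank_def
proof (rule INF_greatest)
  fix fs assume "fs \<in> {fs. set fs \<subseteq> J \<and> radical R J = radical R (Idl\<^bsub>R\<^esub> (set fs))}"
  then have fs: "set fs \<subseteq> J" and rad: "radical R J = radical R (Idl\<^bsub>R\<^esub> (set fs))" by auto
  have fsX: "set fs \<subseteq> polys X" using fs R.ideal_carrier[OF J_ideal] by blast
  let ?I = "Idl\<^bsub>R\<^esub> (set fs)"
  have I: "ideal ?I R" by (rule R.genideal_ideal[OF fsX])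
  define \<sigma> :: "nat \<times> nat \<Rightarrow> (nat \<times> nat, 'k) mpoly"
    where "\<sigma> w = (if w \<in> W then mvar w else if w = (1, 1) \<or> w = (2, N) then 1 else 0)" for w
  have \<sigma>W: "\<sigma> w \<in> polys W" for w by (simp add: \<sigma>_def)
  have \<sigma>\<Delta>: "subst \<sigma> \<Delta> = 1"
  proof -
    have "(i, 1) \<notin> W" "(i, N) \<notin> W" for i using N unfolding W_def mem_Times_iff by auto
    then show ?thesis using N by (simp add: minor_def subst_diff subst_mult \<sigma>_def)
  qed
  \<comment> \<open>Every edge meets one of the columns 2, ..., N - 1, whose variables \<sigma>
    keeps, so each term of a specialised generator contains such a variable.\<close>
  have J\<sigma>: "J \<subseteq> {p \<in> polys X. subst \<sigma> p \<in> order_ge 1}"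
  proof (rule J_least)
    show "ideal {p \<in> polys X. subst \<sigma> p \<in> order_ge 1} R"
      by (rule R.idealI') (auto simp: subst_add subst_mult intro: order_ge_add order_ge_mult1)
    fix i j :: nat assume ij: "i < j" "1 \<le> i" "j \<le> N" "(i, j) \<noteq> (1, N)"
    have "\<exists>k\<in>{i, j}. k \<in> {2..N - 1}" using ij by auto
    moreover have o: "\<sigma> (a, k) \<in> order_ge 1" if "k \<in> {2..N - 1}" "a = 1 \<or> a = 2" for a k
      using that by (auto simp: \<sigma>_def W_def order_ge_def mvar_def)
    moreover have "x - y \<in> order_ge 1" if "x \<in> order_ge 1" "y \<in> order_ge 1" for x y :: "(nat \<times> nat, 'k) mpoly"
      using order_ge_add[OF that(1) order_ge_mult1[OF that(2), of "- 1"]] by simp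
    ultimately have "\<sigma> (1, i) * \<sigma> (2, j) - \<sigma> (1, j) * \<sigma> (2, i) \<in> order_ge 1"
      by (metis (no_types, lifting) insert_iff mult.commute order_ge_mult1 singletonD)
    then show "minor i j \<in> {p \<in> polys X. subst \<sigma> p \<in> order_ge 1}"
      using ij minor_closed[of i j] by (simp add: minor_def subst_diff subst_mult)
  qed
  have "\<exists>k. (mvar w * \<Delta>) ^ k \<in> ?I" if "w \<in> W" for w
  proof -
    have "mvar w * \<Delta> \<in> radical R J" using W_annihilates[OF that] R.radical_superset R.ideal_carrier[OF J_ideal] by blast
    then show ?thesis unfolding rad R.radical_iff by blast
  qed
  then obtain k where k: "\<And>w. w \<in> W \<Longrightarrow> (mvar w * \<Delta>) ^ k w \<in> ?I" by metis
  \<comment> \<open>One exponent that works for all variables of \<open>W\<close>; the colength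
    argument asks for a common one. Specialisation then turns the power M of w * \<Delta> into that
    of w, because \<sigma> sends \<Delta> to 1.\<close>
  define M where "M = Max (insert 0 (k ` W))"
  have comb: "\<exists>h. (\<forall>i. h i \<in> polys W) \<and> mvar w ^ M = (\<Sum>i<length fs. h i * subst \<sigma> (fs ! i))" if w: "w \<in> W" for w
  proof -
    have "k w \<le> M" unfolding M_def using finite_W w by (intro Max_ge) auto
    then have "(mvar w * \<Delta>) ^ M = (mvar w * \<Delta>) ^ (M - k w) * (mvar w * \<Delta>) ^ k w" by (simp add: power_add[symmetric])
    moreover have "(mvar w * \<Delta>) ^ (M - k w) \<in> polys X" using w W_subset \<Delta>_closed by (intro polys_power polys_closed(5)) auto
    ultimately have "(mvar w * \<Delta>) ^ M \<in> ?I" using R.ideal_mult[OF I _ k[OF w]] by metis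
    then obtain h where h: "\<And>i. h i \<in> polys X" "(mvar w * \<Delta>) ^ M = (\<Sum>i<length fs. h i * fs ! i)"
      using R.genideal_set_combination[OF fsX] by blast
    have "mvar w ^ M = subst \<sigma> ((mvar w * \<Delta>) ^ M)" unfolding subst_power subst_mult \<sigma>\<Delta> subst_mvar using w by (simp add: \<sigma>_def)
    also have "\<dots> = (\<Sum>i<length fs. subst \<sigma> (h i) * subst \<sigma> (fs ! i))" unfolding h(2) by (simp add: subst_sum subst_mult)
    finally have power: "mvar w ^ M = (\<Sum>i<length fs. subst \<sigma> (h i) * subst \<sigma> (fs ! i))" .
    have "subst \<sigma> (h i) \<in> polys W" for i by (rule subst_closed[OF h(1) \<sigma>W])
    then show ?thesis using power by (intro exI[of _ "\<lambda>i. subst \<sigma> (h i)"]) blast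
  qed
  have "card W \<le> length fs"
  proof (rule finite_colength_generators[OF finite_W _ comb])
    show "subst \<sigma> (fs ! i) \<in> order_ge 1" if "i < length fs" for i
      using J\<sigma> fs nth_mem[OF that] by blast
  qed
  then show "enat (2 * N - 4) \<le> enat (length fs)" by (simp add: card_W)
qed

end

theorem theorem3p16:
  fixes n :: nat
  assumes "even n" and "0 < n"
  shows "\<exists>N E. simple_graph N E \<and>
    (let X = edge_vars N;
         R = (mpoly_ring X :: (nat \<times> nat, 'k::field) mpoly ring);
         J = binomial_edge_ideal N E
     in depth R (homogeneous_maximal_ideal X) (quotient_module R J) = 4 \<and>
        arithmetical_rank R J = enat n \<and>
        projective_dimension R (quotient_module R J) = enat n)"
proof -
  \<comment> \<open>Solves 2 N - 4 = n. Evenness makes the halving exact, and n > 0 gives N \<ge>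
    3.\<close>
  define N where "N = n div 2 + 2"
  have N: "3 \<le> N" "2 * N - 4 = n" using assms by (auto simp: N_def)
  interpret G: near_complete N "TYPE('k)" by unfold_locales (rule N)
  have "arithmetical_rank G.R G.J = enat n"
    using antisym[OF G.arithmetical_rank_le G.arithmetical_rank_ge] unfolding N(2) .
  then show ?thesis
    unfolding Let_def using G.simple_graph_E G.depth G.projective_dimension unfolding N(2) G.J_def by blast
qed

end
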